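(* Let $R$ be a unital commutative associative ring with $2\in R^\times$, let $n\ge1$, let $S=R[t_0,\dots,t_n]=\bigoplus_{k\ge0}S_k$ with its canonical grading, and let $X={\rm Proj}\,S=\mathbb{P}^n_R$. Let $l,m$ be positive integers, choose an isomorphism $\alpha:\det(\mathcal{O}_X(l)\oplus\mathcal{O}_X(m)\oplus\mathcal{O}_X(-l-m))\to\mathcal{O}_X$, and let $\mathcal{C}_{l,m}$ be the split colour algebra ${\rm Col}(\mathcal{O}_X(l)\oplus\mathcal{O}_X(m)\oplus\mathcal{O}_X(-l-m),\alpha)$ over $X$. Then the $R$-algebra of global sections $$C_{l,m}=H^0(X,\mathcal{C}_{l,m})=\begin{bmatrix} R & S_l\oplus S_m\\ S_{l+m} & R\end{bmatrix}$$ (with equal diagonal entries) has multiplication $$\begin{bmatrix} a & f_l\oplus f_m\\ f_{l+m} & a\end{bmatrix}\begin{bmatrix} b & g_l\oplus g_m\\ g_{l+m} & b\end{bmatrix}=\begin{bmatrix} ab & (ag_l+bf_l)\oplus(ag_m+bf_m)\\ bf_{l+m}+ag_{l+m}+f_lg_m-f_mg_l & ab\end{bmatrix}$$ for $a,b\in R$ and homogeneous polynomials $f_i,g_i\in S_i$. It is a free $R$-module of rank $$1+\binom{l+n}{n}+\binom{m+n}{n}+\binom{(l+m)+n}{n},$$ and it is an $R$-subalgebra of the split colour algebra ${\rm Col}(S)$ over $S$; hence it is a noncommutative Jordan $R$-subalgebra of ${\rm Col}(S)$.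
   Context: For a projective $R$-module $T$ of constant rank $3$ with dual $\check T$, pairing $\langle u,\check v\rangle=\check v(u)$, and an isomorphism $\alpha:\bigwedge^3T\to R$, put $u\times v=\alpha(u\wedge v\wedge -)\in\check T$ for $u,v\in T$; let $\beta:\bigwedge^3\check T\to R$ be the isomorphism with $\alpha(u_1\wedge u_2\wedge u_3)\beta(\check u_1\wedge\check u_2\wedge\check u_3)=\det(\langle u_i,\check u_j\rangle)$, and put $\check u\times\check v=\beta(\check u\wedge\check v\wedge -)\in T$. The split colour algebra ${\rm Col}(T,\alpha)$ consists of the matrices $\begin{bmatrix} a&u\\ \check u&a\end{bmatrix}$ with $a\in R,u\in T,\check u\in\check T$ and multiplication $$\begin{bmatrix} a&u\\ \check u&a\end{bmatrix}\begin{bmatrix} b&v\\ \check v&b\end{bmatrix}=\begin{bmatrix} ab+\langle u,\check v\rangle+\langle v,\check u\rangle & av+bu-\check u\times\check v\\ b\check u+a\check v+u\times v & ab+\langle u,\check v\rangle+\langle v,\check u\rangle\end{bmatrix}.$$ The same formulas, applied to sections, define ${\rm Col}(\mathcal{T},\alpha)$ over a scheme $X$ for a locally free $\mathcal{O}_X$-module $\mathcal{T}$ of rank $3$ and an isomorphism $\alpha:\det\mathcal{T}=\bigwedge^3\mathcal{T}\to\mathcal{O}_X$. For a commutative ring $S$, ${\rm Col}(S)$ denotes ${\rm Col}(T,\alpha)$ over $S$ with $T=S^3$, $\check T=S^3$, and both vector products equal to the classical vector product on $S^3$. In the displayed formula for $C_{l,m}$, the isomorphism $\alpha$ is the canonical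 one given by multiplication $\mathcal{O}_X(l)\otimes\mathcal{O}_X(m)\otimes\mathcal{O}_X(-l-m)\cong\mathcal{O}_X$. The embedding into ${\rm Col}(S)$ sends $(a,f_l\oplus f_m,f_{l+m})$ to the matrix with diagonal entries $a$, $u=(f_l,f_m,0)$ and $\check u=(0,0,f_{l+m})$. An algebra is a noncommutative Jordan algebra if it is flexible, $(x,y,x)=0$, and satisfies the Jordan identity $(x,y,x^2)=0$ for all $x,y$, where $(x,y,z)=(xy)z-x(yz)$. *)

theory Defs
  imports
    "HOL-Algebra.Free_Abelian_Groups"
    "HOL-Algebra.Algebraic_Closure_Type"
    "HOL-Analysis.Abstract_Topology"
begin

section \<open>Nonassociative algebras\<close>

text \<open>
  The record type \<^typ>\<open>('r, 'm) module\<close> of HOL-Algebra carries a multiplication and a unit.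
  It is used both for modules, where these two fields are left \<^const>\<open>undefined\<close>, and for
  not necessarily associative algebras.  The locale of HOL-Algebra called algebra is not used,
  since it requires the multiplication to be commutative and associative.
\<close>

definition unital_algebra :: "'r ring \<Rightarrow> ('r, 'c) module \<Rightarrow> bool" where
  "unital_algebra R A \<longleftrightarrow> Module.module R A \<and>
     (\<forall>x\<in>carrier A. \<forall>y\<in>carrier A. x \<otimes>\<^bsub>A\<^esub> y \<in> carrier A) \<and>
     (\<forall>x\<in>carrier A. \<forall>y\<in>carrier A. \<forall>z\<in>carrier A.
        (x \<oplus>\<^bsub>A\<^esub> y) \<otimes>\<^bsub>A\<^esub> z = (x \<otimes>\<^bsub>A\<^esub> z) \<oplus>\<^bsub>A\<^esub> (y \<otimes>\<^bsub>A\<^esub> z) \<and>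
        z \<otimes>\<^bsub>A\<^esub> (x \<oplus>\<^bsub>A\<^esub> y) = (z \<otimes>\<^bsub>A\<^esub> x) \<oplus>\<^bsub>A\<^esub> (z \<otimes>\<^bsub>A\<^esub> y)) \<and>
     (\<forall>c\<in>carrier R. \<forall>x\<in>carrier A. \<forall>y\<in>carrier A.
        (c \<odot>\<^bsub>A\<^esub> x) \<otimes>\<^bsub>A\<^esub> y = c \<odot>\<^bsub>A\<^esub> (x \<otimes>\<^bsub>A\<^esub> y) \<and>
        x \<otimes>\<^bsub>A\<^esub> (c \<odot>\<^bsub>A\<^esub> y) = c \<odot>\<^bsub>A\<^esub> (x \<otimes>\<^bsub>A\<^esub> y)) \<and>
     \<one>\<^bsub>A\<^esub> \<in> carrier A \<and>
     (\<forall>x\<in>carrier A. \<one>\<^bsub>A\<^esub> \<otimes>\<^bsub>A\<^esub> x = x \<and> x \<otimes>\<^bsub>A\<^esub> \<one>\<^bsub>A\<^esub> = x)"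

definition linear_iso :: "'r ring \<Rightarrow> ('r, 'b) module \<Rightarrow> ('r, 'c) module \<Rightarrow> ('b \<Rightarrow> 'c) \<Rightarrow> bool" where
  "linear_iso R M N h \<longleftrightarrow> bij_betw h (carrier M) (carrier N) \<and>
     (\<forall>x\<in>carrier M. \<forall>y\<in>carrier M. h (x \<oplus>\<^bsub>M\<^esub> y) = h x \<oplus>\<^bsub>N\<^esub> h y) \<and>
     (\<forall>c\<in>carrier R. \<forall>x\<in>carrier M. h (c \<odot>\<^bsub>M\<^esub> x) = c \<odot>\<^bsub>N\<^esub> h x)"

definition algebra_hom :: "'r ring \<Rightarrow> ('r, 'b) module \<Rightarrow> ('r, 'c) module \<Rightarrow> ('b \<Rightarrow> 'c) \<Rightarrow> bool" where
  "algebra_hom R A B h \<longleftrightarrow> h \<in> carrier A \<rightarrow> carrier B \<and>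
     (\<forall>x\<in>carrier A. \<forall>y\<in>carrier A.
        h (x \<oplus>\<^bsub>A\<^esub> y) = h x \<oplus>\<^bsub>B\<^esub> h y \<and> h (x \<otimes>\<^bsub>A\<^esub> y) = h x \<otimes>\<^bsub>B\<^esub> h y) \<and>
     (\<forall>c\<in>carrier R. \<forall>x\<in>carrier A. h (c \<odot>\<^bsub>A\<^esub> x) = c \<odot>\<^bsub>B\<^esub> h x) \<and>
     h \<one>\<^bsub>A\<^esub> = \<one>\<^bsub>B\<^esub>"

definition subalgebra :: "'r ring \<Rightarrow> ('r, 'c) module \<Rightarrow> 'c set \<Rightarrow> bool" where
  "subalgebra R A B \<longleftrightarrow> submodule B R A \<and> \<one>\<^bsub>A\<^esub> \<in> B \<and> (\<forall>x\<in>B. \<forall>y\<in>B. x \<otimes>\<^bsub>A\<^esub> y \<in> B)"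

definition associator :: "('r, 'c) module \<Rightarrow> 'c \<Rightarrow> 'c \<Rightarrow> 'c \<Rightarrow> 'c" where
  "associator A x y z = ((x \<otimes>\<^bsub>A\<^esub> y) \<otimes>\<^bsub>A\<^esub> z) \<ominus>\<^bsub>A\<^esub> (x \<otimes>\<^bsub>A\<^esub> (y \<otimes>\<^bsub>A\<^esub> z))"

definition noncommutative_Jordan :: "('r, 'c) module \<Rightarrow> bool" where
  "noncommutative_Jordan A \<longleftrightarrow> (\<forall>x\<in>carrier A. \<forall>y\<in>carrier A.
     associator A x y x = \<zero>\<^bsub>A\<^esub> \<and> associator A x y (x \<otimes>\<^bsub>A\<^esub> x) = \<zero>\<^bsub>A\<^esub>)"

definition free_of_rank :: "'r ring \<Rightarrow> ('r, 'm) module \<Rightarrow> nat \<Rightarrow> bool" where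
  "free_of_rank R M N \<longleftrightarrow> Module.module R M \<and>
     (\<exists>b \<in> {..<N} \<rightarrow> carrier M. \<forall>x\<in>carrier M.
        \<exists>!c. c \<in> {..<N} \<rightarrow>\<^sub>E carrier R \<and> x = (\<Oplus>\<^bsub>M\<^esub>i\<in>{..<N}. c i \<odot>\<^bsub>M\<^esub> b i))"

definition restrict_scalars :: "('a \<Rightarrow> 'r) \<Rightarrow> ('r, 'm) module \<Rightarrow> ('a, 'm) module" where
  "restrict_scalars h M = \<lparr>carrier = carrier M, monoid.mult = monoid.mult M, one = one M,
     zero = zero M, add = add M, module.smult = (\<lambda>c x. h c \<odot>\<^bsub>M\<^esub> x)\<rparr>"


section \<open>The colour multiplication\<close>

text \<open>
  The triple \<open>(a, u, x)\<close> stands for the matrix with diagonal entries \<open>a\<close>, upper right entry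
  \<open>u\<close> in \<open>T\<close> and lower left entry \<open>x\<close> in the dual module \<open>D\<close>.
\<close>

definition colour_algebra ::
  "'r ring \<Rightarrow> ('r, 'm) module \<Rightarrow> ('r, 'd) module \<Rightarrow> ('m \<Rightarrow> 'd \<Rightarrow> 'r) \<Rightarrow>
   ('m \<Rightarrow> 'm \<Rightarrow> 'd) \<Rightarrow> ('d \<Rightarrow> 'd \<Rightarrow> 'm) \<Rightarrow> ('r, 'r \<times> 'm \<times> 'd) module" where
  "colour_algebra A T D pair cross dcross = \<lparr>
     carrier = carrier A \<times> carrier T \<times> carrier D,
     monoid.mult = (\<lambda>(a, u, x) (b, v, y).
       ((a \<otimes>\<^bsub>A\<^esub> b \<oplus>\<^bsub>A\<^esub> pair u y) \<oplus>\<^bsub>A\<^esub> pair v x,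
        (a \<odot>\<^bsub>T\<^esub> v \<oplus>\<^bsub>T\<^esub> b \<odot>\<^bsub>T\<^esub> u) \<ominus>\<^bsub>T\<^esub> dcross x y,
        (b \<odot>\<^bsub>D\<^esub> x \<oplus>\<^bsub>D\<^esub> a \<odot>\<^bsub>D\<^esub> y) \<oplus>\<^bsub>D\<^esub> cross u v)),
     one = (\<one>\<^bsub>A\<^esub>, \<zero>\<^bsub>T\<^esub>, \<zero>\<^bsub>D\<^esub>),
     zero = (\<zero>\<^bsub>A\<^esub>, \<zero>\<^bsub>T\<^esub>, \<zero>\<^bsub>D\<^esub>),
     add = (\<lambda>(a, u, x) (b, v, y). (a \<oplus>\<^bsub>A\<^esub> b, u \<oplus>\<^bsub>T\<^esub> v, x \<oplus>\<^bsub>D\<^esub> y)),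
     module.smult = (\<lambda>c (a, u, x). (c \<otimes>\<^bsub>A\<^esub> a, c \<odot>\<^bsub>T\<^esub> u, c \<odot>\<^bsub>D\<^esub> x))\<rparr>"

definition triples :: "('s::comm_ring_1, 's \<times> 's \<times> 's) module" where
  "triples = \<lparr>carrier = UNIV, monoid.mult = undefined, one = undefined, zero = (0, 0, 0),
     add = (\<lambda>(u1, u2, u3) (v1, v2, v3). (u1 + v1, u2 + v2, u3 + v3)),
     module.smult = (\<lambda>c (u1, u2, u3). (c * u1, c * u2, c * u3))\<rparr>"

fun dot_prod :: "'s::comm_ring_1 \<times> 's \<times> 's \<Rightarrow> 's \<times> 's \<times> 's \<Rightarrow> 's" where
  "dot_prod (u1, u2, u3) (v1, v2, v3) = u1 * v1 + u2 * v2 + u3 * v3"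

fun vector_prod :: "'s::comm_ring_1 \<times> 's \<times> 's \<Rightarrow> 's \<times> 's \<times> 's \<Rightarrow> 's \<times> 's \<times> 's" where
  "vector_prod (u1, u2, u3) (v1, v2, v3) =
     (u2 * v3 - u3 * v2, u3 * v1 - u1 * v3, u1 * v2 - u2 * v1)"

definition Col :: "('s::comm_ring_1, 's \<times> ('s \<times> 's \<times> 's) \<times> ('s \<times> 's \<times> 's)) module" where
  "Col = colour_algebra ring_of_type_algebra triples triples dot_prod vector_prod vector_prod"


section \<open>Third exterior powers\<close>

definition ext3_free :: "('r, 'm) module \<Rightarrow> ('m \<times> 'm \<times> 'm \<Rightarrow>\<^sub>0 int) monoid" where
  "ext3_free M = free_Abelian_group (carrier M \<times> carrier M \<times> carrier M)"

definition ext3_rels :: "'r ring \<Rightarrow> ('r, 'm) module \<Rightarrow> ('m \<times> 'm \<times> 'm \<Rightarrow>\<^sub>0 int) set" where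
  "ext3_rels A M = generate (ext3_free M)
     (\<Union>u\<in>carrier M. \<Union>v\<in>carrier M. \<Union>w\<in>carrier M.
        {frag_of (u, u, w), frag_of (u, w, w), frag_of (u, w, u)}
        \<union> (\<Union>x\<in>carrier M.
             {frag_of (u \<oplus>\<^bsub>M\<^esub> x, v, w) - frag_of (u, v, w) - frag_of (x, v, w),
              frag_of (u, v \<oplus>\<^bsub>M\<^esub> x, w) - frag_of (u, v, w) - frag_of (u, x, w),
              frag_of (u, v, w \<oplus>\<^bsub>M\<^esub> x) - frag_of (u, v, w) - frag_of (u, v, x)})
        \<union> (\<Union>c\<in>carrier A.
             {frag_of (c \<odot>\<^bsub>M\<^esub> u, v, w) - frag_of (u, c \<odot>\<^bsub>M\<^esub> v, w),
              frag_of (u, c \<odot>\<^bsub>M\<^esub> v, w) - frag_of (u, v, c \<odot>\<^bsub>M\<^esub> w)}))"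

definition ext3 :: "'r ring \<Rightarrow> ('r, 'm) module \<Rightarrow> ('m \<times> 'm \<times> 'm \<Rightarrow>\<^sub>0 int) set monoid" where
  "ext3 A M = ext3_free M Mod ext3_rels A M"

definition wedge3 ::
  "'r ring \<Rightarrow> ('r, 'm) module \<Rightarrow> 'm \<Rightarrow> 'm \<Rightarrow> 'm \<Rightarrow> ('m \<times> 'm \<times> 'm \<Rightarrow>\<^sub>0 int) set" where
  "wedge3 A M u v w = ext3_rels A M #>\<^bsub>ext3_free M\<^esub> frag_of (u, v, w)"

text \<open>The map between third exterior powers induced by \<open>r\<close>, with target the exterior power of \<open>M\<close>
  over \<open>A\<close>.\<close>

definition ext3_map ::
  "'r ring \<Rightarrow> ('r, 'm) module \<Rightarrow> ('m \<Rightarrow> 'm) \<Rightarrow>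
   ('m \<times> 'm \<times> 'm \<Rightarrow>\<^sub>0 int) set \<Rightarrow> ('m \<times> 'm \<times> 'm \<Rightarrow>\<^sub>0 int) set" where
  "ext3_map A M r \<xi> = (\<Union>z\<in>\<xi>. ext3_rels A M #>\<^bsub>ext3_free M\<^esub>
      frag_extend (\<lambda>(u, v, w). frag_of (r u, r v, r w)) z)"

definition det3 :: "'r ring \<Rightarrow> (nat \<Rightarrow> nat \<Rightarrow> 'r) \<Rightarrow> 'r" where
  "det3 A m =
     (m 0 0 \<otimes>\<^bsub>A\<^esub> (m 1 1 \<otimes>\<^bsub>A\<^esub> m 2 2 \<ominus>\<^bsub>A\<^esub> m 1 2 \<otimes>\<^bsub>A\<^esub> m 2 1)
      \<ominus>\<^bsub>A\<^esub> m 0 1 \<otimes>\<^bsub>A\<^esub> (m 1 0 \<otimes>\<^bsub>A\<^esub> m 2 2 \<ominus>\<^bsub>A\<^esub> m 1 2 \<otimes>\<^bsub>A\<^esub> m 2 0))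
      \<oplus>\<^bsub>A\<^esub> m 0 2 \<otimes>\<^bsub>A\<^esub> (m 1 0 \<otimes>\<^bsub>A\<^esub> m 2 1 \<ominus>\<^bsub>A\<^esub> m 1 1 \<otimes>\<^bsub>A\<^esub> m 2 0)"


section \<open>Sheaves of modules and the split colour algebra of a sheaf\<close>

text \<open>The restriction maps \<open>str_res V\<close> and \<open>res V\<close> take the target open set only, since the same
  function serves all larger source sets.\<close>

record ('x, 'r) ringed_space =
  space :: "'x topology"
  str :: "'x set \<Rightarrow> 'r ring"
  str_res :: "'x set \<Rightarrow> 'r \<Rightarrow> 'r"

record ('x, 'r, 'm) sheaf_module =
  sections :: "'x set \<Rightarrow> ('r, 'm) module"
  res :: "'x set \<Rightarrow> 'm \<Rightarrow> 'm"

abbreviation opens :: "('x, 'r) ringed_space \<Rightarrow> 'x set \<Rightarrow> 'x set set" where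
  "opens Y U \<equiv> {V. openin (space Y) V \<and> V \<subseteq> U}"

definition linear_forms :: "'r ring \<Rightarrow> ('r, 'm) module \<Rightarrow> ('m \<Rightarrow> 'r) set" where
  "linear_forms A M = {f \<in> carrier M \<rightarrow>\<^sub>E carrier A.
     (\<forall>x\<in>carrier M. \<forall>y\<in>carrier M. f (x \<oplus>\<^bsub>M\<^esub> y) = f x \<oplus>\<^bsub>A\<^esub> f y) \<and>
     (\<forall>c\<in>carrier A. \<forall>x\<in>carrier M. f (c \<odot>\<^bsub>M\<^esub> x) = c \<otimes>\<^bsub>A\<^esub> f x)}"

text \<open>The dual sheaf Hom(M, O): a section over \<open>U\<close> is a morphism of sheaves of modules from \<open>M\<close>
  to the structure sheaf, both restricted to \<open>U\<close>.\<close>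

definition dual_sheaf ::
  "('x, 'r) ringed_space \<Rightarrow> ('x, 'r, 'm) sheaf_module \<Rightarrow> ('x, 'r, 'x set \<Rightarrow> 'm \<Rightarrow> 'r) sheaf_module" where
  "dual_sheaf Y M = \<lparr>
     sections = (\<lambda>U. \<lparr>
       carrier = {\<phi> \<in> (\<Pi>\<^sub>E V\<in>opens Y U. linear_forms (str Y V) (sections M V)).
         \<forall>V\<in>opens Y U. \<forall>W\<in>opens Y V. \<forall>t\<in>carrier (sections M V).
           str_res Y W (\<phi> V t) = \<phi> W (res M W t)},
       monoid.mult = undefined, one = undefined,
       zero = (\<lambda>V\<in>opens Y U. \<lambda>t\<in>carrier (sections M V). \<zero>\<^bsub>str Y V\<^esub>),
       add = (\<lambda>\<phi> \<psi>. \<lambda>V\<in>opens Y U. \<lambda>t\<in>carrier (sections M V). \<phi> V t \<oplus>\<^bsub>str Y V\<^esub> \<psi> V t),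
       module.smult = (\<lambda>c \<phi>. \<lambda>V\<in>opens Y U. \<lambda>t\<in>carrier (sections M V).
         str_res Y V c \<otimes>\<^bsub>str Y V\<^esub> \<phi> V t)\<rparr>),
     res = (\<lambda>V \<phi>. \<lambda>W\<in>opens Y V. \<phi> W)\<rparr>"

definition wedge_over ::
  "('x, 'r) ringed_space \<Rightarrow> ('x, 'r, 'm) sheaf_module \<Rightarrow> 'x set \<Rightarrow>
   'm \<Rightarrow> 'm \<Rightarrow> 'm \<Rightarrow> ('m \<times> 'm \<times> 'm \<Rightarrow>\<^sub>0 int) set" where
  "wedge_over Y M U = wedge3 (str Y U) (sections M U)"

type_synonym ('x, 'r, 'm) det_form = "'x set \<Rightarrow> ('m \<times> 'm \<times> 'm \<Rightarrow>\<^sub>0 int) set \<Rightarrow> 'r"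

text \<open>
  The third exterior power of a sheaf \<open>M\<close> of modules is the sheaf associated with the presheaf
  sending \<open>U\<close> to the third exterior power of \<open>M(U)\<close>.  A morphism from it to the sheaf O is
  the same as a morphism \<open>\<alpha>\<close> from that presheaf to O, and it is an isomorphism if and only if
  \<open>\<alpha>\<close> is locally injective and locally surjective; these are the last two conjuncts.
\<close>

definition det_iso ::
  "('x, 'r) ringed_space \<Rightarrow> ('x, 'r, 'm) sheaf_module \<Rightarrow> ('x, 'r, 'm) det_form \<Rightarrow> bool" where
  "det_iso Y M \<alpha> \<longleftrightarrow> (\<forall>U. openin (space Y) U \<longrightarrow>
     \<alpha> U \<in> hom (ext3 (str Y U) (sections M U)) (add_monoid (str Y U)) \<and>
     (\<forall>c\<in>carrier (str Y U).
        \<forall>u\<in>carrier (sections M U). \<forall>v\<in>carrier (sections M U). \<forall>w\<in>carrier (sections M U).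
          \<alpha> U (wedge_over Y M U (c \<odot>\<^bsub>sections M U\<^esub> u) v w)
            = c \<otimes>\<^bsub>str Y U\<^esub> \<alpha> U (wedge_over Y M U u v w)) \<and>
     (\<forall>\<xi>\<in>carrier (ext3 (str Y U) (sections M U)). \<forall>V\<in>opens Y U.
        str_res Y V (\<alpha> U \<xi>) = \<alpha> V (ext3_map (str Y V) (sections M V) (res M V) \<xi>)) \<and>
     (\<forall>\<xi>\<in>carrier (ext3 (str Y U) (sections M U)). \<alpha> U \<xi> = \<zero>\<^bsub>str Y U\<^esub> \<longrightarrow>
        (\<forall>P\<in>U. \<exists>V\<in>opens Y U. P \<in> V \<and>
           ext3_map (str Y V) (sections M V) (res M V) \<xi> = \<one>\<^bsub>ext3 (str Y V) (sections M V)\<^esub>)) \<and>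
     (\<forall>f\<in>carrier (str Y U). \<forall>P\<in>U. \<exists>V\<in>opens Y U. P \<in> V \<and>
        str_res Y V f \<in> \<alpha> V ` carrier (ext3 (str Y V) (sections M V))))"

definition dual_det ::
  "('x, 'r) ringed_space \<Rightarrow> ('x, 'r, 'm) sheaf_module \<Rightarrow> ('x, 'r, 'm) det_form \<Rightarrow>
   ('x, 'r, 'x set \<Rightarrow> 'm \<Rightarrow> 'r) det_form" where
  "dual_det Y M \<alpha> = (SOME \<beta>. det_iso Y (dual_sheaf Y M) \<beta> \<and>
     (\<forall>U. openin (space Y) U \<longrightarrow>
       (\<forall>u1\<in>carrier (sections M U). \<forall>u2\<in>carrier (sections M U). \<forall>u3\<in>carrier (sections M U).
        \<forall>x1\<in>carrier (sections (dual_sheaf Y M) U). \<forall>x2\<in>carrier (sections (dual_sheaf Y M) U).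
        \<forall>x3\<in>carrier (sections (dual_sheaf Y M) U).
          \<alpha> U (wedge_over Y M U u1 u2 u3) \<otimes>\<^bsub>str Y U\<^esub> \<beta> U (wedge_over Y (dual_sheaf Y M) U x1 x2 x3)
            = det3 (str Y U) (\<lambda>i j. ([x1, x2, x3] ! j) U ([u1, u2, u3] ! i)))))"

definition sheaf_cross ::
  "('x, 'r) ringed_space \<Rightarrow> ('x, 'r, 'm) sheaf_module \<Rightarrow> ('x, 'r, 'm) det_form \<Rightarrow>
   'x set \<Rightarrow> 'm \<Rightarrow> 'm \<Rightarrow> ('x set \<Rightarrow> 'm \<Rightarrow> 'r)" where
  "sheaf_cross Y M \<alpha> U u v =
     (\<lambda>V\<in>opens Y U. \<lambda>w\<in>carrier (sections M V). \<alpha> V (wedge_over Y M V (res M V u) (res M V v) w))"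

text \<open>The form \<open>\<beta>(x \<and> y \<and> -)\<close> on the dual of \<open>M\<close>, viewed as a section of \<open>M\<close> by biduality.\<close>

definition sheaf_dual_cross ::
  "('x, 'r) ringed_space \<Rightarrow> ('x, 'r, 'm) sheaf_module \<Rightarrow> ('x, 'r, 'm) det_form \<Rightarrow>
   'x set \<Rightarrow> ('x set \<Rightarrow> 'm \<Rightarrow> 'r) \<Rightarrow> ('x set \<Rightarrow> 'm \<Rightarrow> 'r) \<Rightarrow> 'm" where
  "sheaf_dual_cross Y M \<alpha> U x y = (THE w. w \<in> carrier (sections M U) \<and>
     (\<forall>V\<in>opens Y U. \<forall>z\<in>carrier (sections (dual_sheaf Y M) V).
        z V (res M V w) = dual_det Y M \<alpha> V (wedge_over Y (dual_sheaf Y M) V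
          (res (dual_sheaf Y M) V x) (res (dual_sheaf Y M) V y) z)))"

definition sheaf_Col ::
  "('x, 'r) ringed_space \<Rightarrow> ('x, 'r, 'm) sheaf_module \<Rightarrow> ('x, 'r, 'm) det_form \<Rightarrow>
   'x set \<Rightarrow> ('r, 'r \<times> 'm \<times> ('x set \<Rightarrow> 'm \<Rightarrow> 'r)) module" where
  "sheaf_Col Y M \<alpha> U = colour_algebra (str Y U) (sections M U) (sections (dual_sheaf Y M) U)
     (\<lambda>u x. x U u) (sheaf_cross Y M \<alpha> U) (sheaf_dual_cross Y M \<alpha> U)"

definition sheaf_sum3 ::
  "('x, 'r, 'm) sheaf_module \<Rightarrow> ('x, 'r, 'm) sheaf_module \<Rightarrow> ('x, 'r, 'm) sheaf_module \<Rightarrow>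
   ('x, 'r, 'm \<times> 'm \<times> 'm) sheaf_module" where
  "sheaf_sum3 K M N = \<lparr>
     sections = (\<lambda>U. \<lparr>
       carrier = carrier (sections K U) \<times> carrier (sections M U) \<times> carrier (sections N U),
       monoid.mult = undefined, one = undefined,
       zero = (\<zero>\<^bsub>sections K U\<^esub>, \<zero>\<^bsub>sections M U\<^esub>, \<zero>\<^bsub>sections N U\<^esub>),
       add = (\<lambda>(u1, u2, u3) (v1, v2, v3).
         (u1 \<oplus>\<^bsub>sections K U\<^esub> v1, u2 \<oplus>\<^bsub>sections M U\<^esub> v2, u3 \<oplus>\<^bsub>sections N U\<^esub> v3)),
       module.smult = (\<lambda>c (u1, u2, u3).
         (c \<odot>\<^bsub>sections K U\<^esub> u1, c \<odot>\<^bsub>sections M U\<^esub> u2, c \<odot>\<^bsub>sections N U\<^esub> u3))\<rparr>),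
     res = (\<lambda>V (u1, u2, u3). (res K V u1, res M V u2, res N V u3))\<rparr>"


section \<open>Proj of a graded ring and the twisting sheaves\<close>

text \<open>
  Throughout, \<open>G d\<close> is the homogeneous part of degree \<open>d\<close> of a graded ring whose underlying ring
  is a type.  The sheaves are built from locally fractional functions into homogeneous
  localizations, as in Hartshorne, Section II.2 and II.5; sections are extensional functions.
\<close>

definition homogeneous_elems :: "(nat \<Rightarrow> 's set) \<Rightarrow> 's set" where
  "homogeneous_elems G = (\<Union>d. G d)"

definition Proj :: "(nat \<Rightarrow> 's::comm_ring_1 set) \<Rightarrow> 's set set" where
  "Proj G = {P. primeideal P ring_of_type_algebra \<and>
     P = Idl\<^bsub>ring_of_type_algebra\<^esub> (P \<inter> homogeneous_elems G) \<and>
     \<not> (\<Union>d\<in>{0<..}. G d) \<subseteq> P}"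

definition Proj_topology :: "(nat \<Rightarrow> 's::comm_ring_1 set) \<Rightarrow> 's set topology" where
  "Proj_topology G =
     topology (\<lambda>U. \<exists>F\<subseteq>homogeneous_elems G. U = Proj G - {P \<in> Proj G. F \<subseteq> P})"

definition fraction :: "'s::comm_ring_1 set \<Rightarrow> 's \<Rightarrow> 's \<Rightarrow> ('s \<times> 's) set" where
  "fraction T a s = {(b, t). t \<in> T \<and> (\<exists>u\<in>T. u * (a * t - b * s) = 0)}"

definition localization :: "'s::comm_ring_1 set \<Rightarrow> ('s \<times> 's) set ring" where
  "localization T = \<lparr>
     carrier = {fraction T a s | a s. s \<in> T},
     monoid.mult = (\<lambda>x y. \<Union>(a, s)\<in>x. \<Union>(b, t)\<in>y. fraction T (a * b) (s * t)),
     one = fraction T 1 1,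
     zero = fraction T 0 1,
     add = (\<lambda>x y. \<Union>(a, s)\<in>x. \<Union>(b, t)\<in>y. fraction T (a * t + b * s) (s * t))\<rparr>"

definition denoms :: "(nat \<Rightarrow> 's set) \<Rightarrow> 's set \<Rightarrow> 's set" where
  "denoms G P = homogeneous_elems G - P"

type_synonym 's sect = "'s set \<Rightarrow> ('s \<times> 's) set"

definition twisted_sections :: "(nat \<Rightarrow> 's::comm_ring_1 set) \<Rightarrow> int \<Rightarrow> 's set set \<Rightarrow> 's sect set" where
  "twisted_sections G k U = {\<sigma> \<in> extensional U. \<forall>P\<in>U. \<exists>V. openin (Proj_topology G) V \<and> P \<in> V \<and> V \<subseteq> U \<and>
     (\<exists>i j a s. a \<in> G i \<and> s \<in> G j \<and> int i = int j + k \<and>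
        (\<forall>Q\<in>V. s \<notin> Q \<and> \<sigma> Q = fraction (denoms G Q) a s))}"

text \<open>Pointwise product; it also maps O(j) x O(k) to O(j + k).\<close>

definition sec_mult :: "(nat \<Rightarrow> 's::comm_ring_1 set) \<Rightarrow> 's set set \<Rightarrow> 's sect \<Rightarrow> 's sect \<Rightarrow> 's sect" where
  "sec_mult G U \<sigma> \<tau> = (\<lambda>P\<in>U. \<sigma> P \<otimes>\<^bsub>localization (denoms G P)\<^esub> \<tau> P)"

definition sec_add :: "(nat \<Rightarrow> 's::comm_ring_1 set) \<Rightarrow> 's set set \<Rightarrow> 's sect \<Rightarrow> 's sect \<Rightarrow> 's sect" where
  "sec_add G U \<sigma> \<tau> = (\<lambda>P\<in>U. \<sigma> P \<oplus>\<^bsub>localization (denoms G P)\<^esub> \<tau> P)"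

definition sec_of :: "(nat \<Rightarrow> 's::comm_ring_1 set) \<Rightarrow> 's set set \<Rightarrow> 's \<Rightarrow> 's sect" where
  "sec_of G U f = (\<lambda>P\<in>U. fraction (denoms G P) f 1)"

definition Proj_space :: "(nat \<Rightarrow> 's::comm_ring_1 set) \<Rightarrow> ('s set, 's sect) ringed_space" where
  "Proj_space G = \<lparr>
     space = Proj_topology G,
     str = (\<lambda>U. \<lparr>carrier = twisted_sections G 0 U, monoid.mult = sec_mult G U, one = sec_of G U 1,
                 zero = sec_of G U 0, add = sec_add G U\<rparr>),
     str_res = (\<lambda>V \<sigma>. restrict \<sigma> V)\<rparr>"

definition twist :: "(nat \<Rightarrow> 's::comm_ring_1 set) \<Rightarrow> int \<Rightarrow> ('s set, 's sect, 's sect) sheaf_module" where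
  "twist G k = \<lparr>
     sections = (\<lambda>U. \<lparr>carrier = twisted_sections G k U, monoid.mult = undefined, one = undefined,
                      zero = sec_of G U 0, add = sec_add G U, module.smult = sec_mult G U\<rparr>),
     res = (\<lambda>V \<sigma>. restrict \<sigma> V)\<rparr>"


section \<open>Projective space and the algebras of global sections\<close>

type_synonym ('v, 'a) mpoly = "('v \<Rightarrow>\<^sub>0 nat) \<Rightarrow>\<^sub>0 'a"

definition homog :: "nat \<Rightarrow> ('v::finite, 'a::comm_ring_1) mpoly set" where
  "homog d = {p. \<forall>\<mu>\<in>Poly_Mapping.keys p. (\<Sum>i\<in>UNIV. Poly_Mapping.lookup \<mu> i) = d}"

definition Const :: "'a::comm_ring_1 \<Rightarrow> ('v::finite, 'a) mpoly" where
  "Const c = Poly_Mapping.single 0 c"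

definition PP :: "(('v::finite, 'a::comm_ring_1) mpoly set, ('v, 'a) mpoly sect) ringed_space" where
  "PP = Proj_space homog"

definition T_sheaf ::
  "nat \<Rightarrow> nat \<Rightarrow> (('v::finite, 'a::comm_ring_1) mpoly set, ('v, 'a) mpoly sect,
     ('v, 'a) mpoly sect \<times> ('v, 'a) mpoly sect \<times> ('v, 'a) mpoly sect) sheaf_module" where
  "T_sheaf l m = sheaf_sum3 (twist homog (int l)) (twist homog (int m)) (twist homog (- int l - int m))"

type_synonym ('v, 'a) T_form =
  "(('v, 'a) mpoly set, ('v, 'a) mpoly sect,
    ('v, 'a) mpoly sect \<times> ('v, 'a) mpoly sect \<times> ('v, 'a) mpoly sect) det_form"

text \<open>The canonical isomorphism \<open>(f,0,0) \<and> (0,g,0) \<and> (0,0,h) \<mapsto> f g h\<close>; since it is alternating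
  and trilinear, its values on these elements determine it.\<close>

definition canonical_det :: "nat \<Rightarrow> nat \<Rightarrow> ('v::finite, 'a::comm_ring_1) T_form \<Rightarrow> bool" where
  "canonical_det l m \<alpha> \<longleftrightarrow> det_iso PP (T_sheaf l m) \<alpha> \<and>
     (\<forall>U. openin (space PP) U \<longrightarrow>
       (\<forall>f\<in>twisted_sections homog (int l) U. \<forall>g\<in>twisted_sections homog (int m) U.
        \<forall>h\<in>twisted_sections homog (- int l - int m) U.
          \<alpha> U (wedge_over PP (T_sheaf l m) U
                 (f, sec_of homog U 0, sec_of homog U 0)
                 (sec_of homog U 0, g, sec_of homog U 0)
                 (sec_of homog U 0, sec_of homog U 0, h))
            = sec_mult homog U (sec_mult homog U f g) h))"

type_synonym ('v, 'a) C_elem =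
  "('v, 'a) mpoly sect \<times>
   (('v, 'a) mpoly sect \<times> ('v, 'a) mpoly sect \<times> ('v, 'a) mpoly sect) \<times>
   (('v, 'a) mpoly set set \<Rightarrow>
    ('v, 'a) mpoly sect \<times> ('v, 'a) mpoly sect \<times> ('v, 'a) mpoly sect \<Rightarrow> ('v, 'a) mpoly sect)"

definition C_alg ::
  "nat \<Rightarrow> nat \<Rightarrow> ('v::finite, 'a::comm_ring_1) T_form \<Rightarrow> ('a, ('v, 'a) C_elem) module" where
  "C_alg l m \<alpha> = restrict_scalars (\<lambda>c. sec_of homog (topspace (space PP)) (Const c))
     (sheaf_Col PP (T_sheaf l m) \<alpha> (topspace (space PP)))"

text \<open>The global section given by the matrix with diagonal entries \<open>a\<close>, upper right entry
  \<open>f \<oplus> g\<close> and lower left entry \<open>h\<close>; the last acts on the third summand by multiplication.\<close>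

definition C_matrix ::
  "nat \<Rightarrow> nat \<Rightarrow> 'a::comm_ring_1 \<times> ('v::finite, 'a) mpoly \<times> ('v, 'a) mpoly \<times> ('v, 'a) mpoly \<Rightarrow>
   ('v, 'a) C_elem" where
  "C_matrix l m = (\<lambda>(a, f, g, h).
     (sec_of homog (topspace (space PP)) (Const a),
      (sec_of homog (topspace (space PP)) f, sec_of homog (topspace (space PP)) g,
       sec_of homog (topspace (space PP)) 0),
      (\<lambda>V\<in>opens PP (topspace (space PP)). \<lambda>w\<in>carrier (sections (T_sheaf l m) V).
         sec_mult homog V (sec_of homog V h) (snd (snd w)))))"

definition matrix_space ::
  "nat \<Rightarrow> nat \<Rightarrow>
   ('a::comm_ring_1, 'a \<times> ('v::finite, 'a) mpoly \<times> ('v, 'a) mpoly \<times> ('v, 'a) mpoly) module" where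
  "matrix_space l m = \<lparr>
     carrier = UNIV \<times> homog l \<times> homog m \<times> homog (l + m),
     monoid.mult = undefined, one = undefined,
     zero = (0, 0, 0, 0),
     add = (\<lambda>(a, f, g, h) (a', f', g', h'). (a + a', f + f', g + g', h + h')),
     module.smult = (\<lambda>c (a, f, g, h). (c * a, Const c * f, Const c * g, Const c * h))\<rparr>"

definition Col_over ::
  "('a::comm_ring_1, ('v::finite, 'a) mpoly \<times>
      (('v, 'a) mpoly \<times> ('v, 'a) mpoly \<times> ('v, 'a) mpoly) \<times>
      (('v, 'a) mpoly \<times> ('v, 'a) mpoly \<times> ('v, 'a) mpoly)) module" where
  "Col_over = restrict_scalars Const Col"

text \<open>\<open>\<iota>\<close> identifies \<open>C\<close> with a noncommutative Jordan R-subalgebra of Col(S).\<close>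

definition Jordan_embedding where
  "Jordan_embedding (C :: ('a::comm_ring_1, 'c) module) \<iota> \<longleftrightarrow>
     algebra_hom ring_of_type_algebra C Col_over \<iota> \<and>
     inj_on \<iota> (carrier C) \<and>
     subalgebra ring_of_type_algebra Col_over (\<iota> ` carrier C) \<and>
     noncommutative_Jordan (Col_over\<lparr>carrier := \<iota> ` carrier C\<rparr>)"

end

theory Submission
  imports Defs
begin

text \<open>
  Let \<open>T\<close> be the sum of the three twisting sheaves, \<open>D\<close> its dual, and call an isomorphism from
  the determinant of \<open>T\<close> to the structure sheaf an orientation.

  The global sections of O(d) are the forms of degree \<open>d\<close>, and there are none for negative \<open>d\<close>
  (\<open>global_sections_nonneg\<close>, \<open>global_sections_neg\<close>).  Over an arbitrary base ring this follows
  from a homogeneous Nullstellensatz, which provides partitions of unity on each chart, and from the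
  comparison of two charts.  The dual of \<open>T\<close> is the sum of the opposite twists
  (\<open>presheaf_iso_dual\<close>).  Since \<open>l\<close> and \<open>m\<close> are positive, a global section of \<open>T\<close> is therefore a
  pair \<open>(f, g)\<close> of forms of degrees \<open>l\<close> and \<open>m\<close> with third coordinate zero, whereas a global section
  of \<open>D\<close> is a form \<open>h\<close> of degree \<open>l + m\<close> in the third coordinate (\<open>C_matrix_bij\<close>).

  The determinant of the coordinates is the canonical orientation (\<open>exists_canonical_det\<close>).  Any other
  one differs from it by a global unit of the structure sheaf, which is a unit \<open>c\<close> of the base ring
  (\<open>global_unit\<close>, \<open>det_iso_is_multiple_of_canonical\<close>).  The orientation of the dual required by the
  pairing identity is the determinant divided by \<open>c\<close>, by multiplicativity of determinants
  (\<open>exists_dual_det\<close>).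

  Hence all products can be computed.  The pairing of a section of \<open>T\<close> with a section of \<open>D\<close> vanishes,
  because they live in different coordinates.  The vector product of two sections of \<open>D\<close> vanishes,
  because both are multiples of the same local basis vector (\<open>sheaf_dual_cross_third_summand\<close>).  The vector product of
  \<open>(f, g)\<close> and \<open>(f', g')\<close> is \<open>c (f g' - g f')\<close> (\<open>sheaf_cross_first_summands\<close>).  So the algebra of
  global sections is the algebra \<open>mat_alg\<close> of triples and scalars with this bracket
  (\<open>C_matrix_iso\<close>).  The bracket takes values in a summand that annihilates all off-diagonal
  elements, so the algebra is even associative (\<open>associative_mat_alg\<close>), and associators vanish.
  Monomials form a basis (\<open>free_mat_alg\<close>), and dividing the lower left entry by \<open>c\<close> turns the bracket
  into a component of the classical vector product, which embeds the algebra into the split colour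
  algebra over the polynomial ring (\<open>col_embed_iso\<close>).
\<close>

section \<open>The grading of the polynomial ring\<close>

definition mdeg :: "('v::finite \<Rightarrow>\<^sub>0 nat) \<Rightarrow> nat" where
  "mdeg \<mu> = (\<Sum>i\<in>UNIV. Poly_Mapping.lookup \<mu> i)"

lemma homog_iff: "p \<in> homog d \<longleftrightarrow> (\<forall>\<mu>. Poly_Mapping.lookup p \<mu> \<noteq> 0 \<longrightarrow> mdeg \<mu> = d)"
  by (auto simp: homog_def mdeg_def in_keys_iff)

lemma mdeg_add: "mdeg (\<mu> + \<nu>) = mdeg \<mu> + mdeg \<nu>"
  by (simp add: mdeg_def lookup_add sum.distrib)

lemma mdeg_0 [simp]: "mdeg 0 = 0"
  by (simp add: mdeg_def)

lemma mdeg_eq_0_iff: "mdeg \<mu> = 0 \<longleftrightarrow> \<mu> = 0"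
  by (auto simp: mdeg_def intro: poly_mapping_eqI)

lemma mdeg_single [simp]: "mdeg (Poly_Mapping.single i k) = k"
  by (simp add: mdeg_def lookup_single when_def)

lemma homog_0 [simp]: "0 \<in> homog d"
  by (simp add: homog_iff)

lemma homog_add: "p \<in> homog d \<Longrightarrow> q \<in> homog d \<Longrightarrow> p + q \<in> homog d"
  unfolding homog_iff lookup_add by (metis add_0)

lemma homog_uminus: "p \<in> homog d \<Longrightarrow> - p \<in> homog d"
  by (simp add: homog_iff)

lemma homog_diff: "p \<in> homog d \<Longrightarrow> q \<in> homog d \<Longrightarrow> p - q \<in> homog d"
  using homog_add[of p d "- q"] by (simp add: homog_uminus)

lemma homog_mult:
  assumes "p \<in> homog d" "q \<in> homog e"
  shows "p * q \<in> homog (d + e)"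
proof -
  have "mdeg \<mu> = d + e" if "\<mu> \<in> Poly_Mapping.keys (p * q)" for \<mu>
    using subsetD[OF keys_mult that] assms by (auto simp: homog_iff in_keys_iff mdeg_add)
  then show ?thesis by (auto simp: homog_iff in_keys_iff)
qed

lemma homog_Const [simp]: "Const c \<in> homog 0"
  by (auto simp: homog_iff Const_def lookup_single when_def)

lemma Const_simps [simp]:
  "Const 0 = 0" "Const 1 = 1" "Const (a + b) = Const a + Const b"
  "Const (a * b) = Const a * Const b"
  by (simp_all add: Const_def single_add mult_single)

lemma Const_eq_iff [simp]: "Const a = Const b \<longleftrightarrow> a = b"
  unfolding Const_def by (metis lookup_single_eq)

lemma homog_1 [simp]: "1 \<in> homog 0"
  by (metis Const_simps(2) homog_Const)

lemma homog_zero_Const: "p \<in> homog 0 \<Longrightarrow> \<exists>c. p = Const c"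
  by (rule exI[of _ "Poly_Mapping.lookup p 0"], rule poly_mapping_eqI)
     (auto simp: Const_def lookup_single when_def homog_iff mdeg_eq_0_iff)

lemma homog_power: "p \<in> homog d \<Longrightarrow> p ^ N \<in> homog (N * d)"
  by (induction N) (simp_all add: homog_mult)

lemma homog_Const_mult: "p \<in> homog d \<Longrightarrow> Const c * p \<in> homog d"
  using homog_mult[OF homog_Const] by force

definition hcomp :: "nat \<Rightarrow> ('v::finite, 'a::comm_ring_1) mpoly \<Rightarrow> ('v, 'a) mpoly" where
  "hcomp d p = Poly_Mapping.mapp (\<lambda>\<mu> c. c when mdeg \<mu> = d) p"

lemma lookup_hcomp: "Poly_Mapping.lookup (hcomp d p) \<mu> = (Poly_Mapping.lookup p \<mu> when mdeg \<mu> = d)"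
  by (auto simp: hcomp_def lookup_mapp when_def in_keys_iff)

lemma hcomp_homog [simp]: "hcomp d p \<in> homog d"
  by (auto simp: homog_iff lookup_hcomp)

lemma hcomp_of_homog: "p \<in> homog e \<Longrightarrow> hcomp d p = (if d = e then p else 0)"
  by (rule poly_mapping_eqI) (auto simp: lookup_hcomp homog_iff when_def)

lemma hcomp_add: "hcomp d (p + q) = hcomp d p + hcomp d q"
  by (rule poly_mapping_eqI) (simp add: lookup_hcomp lookup_add when_def)

lemma hcomp_0 [simp]: "hcomp d 0 = 0"
  by (rule poly_mapping_eqI) (simp add: lookup_hcomp)

lemma hcomp_sum: "hcomp d (sum f I) = (\<Sum>i\<in>I. hcomp d (f i))"
  by (induction I rule: infinite_finite_induct) (simp_all add: hcomp_add)

lemma hcomp_sum_eq: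
  obtains N where "\<And>d. d > N \<Longrightarrow> hcomp d p = 0" "p = (\<Sum>d\<le>N. hcomp d p)"
proof
  define N where "N = Max (insert 0 (mdeg ` Poly_Mapping.keys p))"
  have N: "mdeg \<mu> \<le> N" if "Poly_Mapping.lookup p \<mu> \<noteq> 0" for \<mu>
    unfolding N_def using that by (intro Max_ge) (auto simp: in_keys_iff)
  show "hcomp d p = 0" if "d > N" for d
    by (rule poly_mapping_eqI) (use that N in \<open>force simp: lookup_hcomp when_def\<close>)
  show "p = (\<Sum>d\<le>N. hcomp d p)"
    by (rule poly_mapping_eqI) (use N in \<open>auto simp: lookup_sum lookup_hcomp when_def\<close>)
qed

lemma hcomp_mult_homog:
  assumes "s \<in> homog e"
  shows "hcomp (d + e) (p * s) = hcomp d p * s"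
    and "d < e \<Longrightarrow> hcomp d (p * s) = 0"
proof -
  obtain N where N: "\<And>d. d > N \<Longrightarrow> hcomp d p = 0" "p = (\<Sum>d\<le>N. hcomp d p)"
    by (rule hcomp_sum_eq[of p]) blast
  have *: "hcomp d' (p * s) = (\<Sum>i\<le>N. if d' = i + e then hcomp i p * s else 0)" for d'
  proof -
    have "hcomp d' (p * s) = hcomp d' ((\<Sum>d\<le>N. hcomp d p) * s)"
      using N(2) by simp
    also have "\<dots> = (\<Sum>i\<le>N. hcomp d' (hcomp i p * s))"
      by (simp only: sum_distrib_right hcomp_sum)
    also have "\<dots> = (\<Sum>i\<le>N. if d' = i + e then hcomp i p * s else 0)"
      by (intro sum.cong refl hcomp_of_homog homog_mult hcomp_homog assms)
    finally show ?thesis .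
  qed
  show "hcomp (d + e) (p * s) = hcomp d p * s"
    unfolding * using N(1)[of d] by (cases "d \<le> N") (auto simp: not_le)
  show "hcomp d (p * s) = 0" if "d < e"
    unfolding * using that by (intro sum.neutral) auto
qed

definition Xvar :: "'v::finite \<Rightarrow> ('v, 'a::comm_ring_1) mpoly" where
  "Xvar i = Poly_Mapping.single (Poly_Mapping.single i 1) 1"

lemma homog_Xvar [simp]: "Xvar i \<in> homog 1"
  by (auto simp: homog_iff Xvar_def lookup_single when_def)

lemma homog_Xvar_power [simp]: "Xvar i ^ N \<in> homog N"
  using homog_power[OF homog_Xvar, of i N] by simp

lemma Xvar_power: "Xvar i ^ N = Poly_Mapping.single (Poly_Mapping.single i N) 1"
  by (induction N) (simp_all add: Xvar_def mult_single single_add[symmetric])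

lemma lookup_mult_single:
  fixes p :: "('v::finite, 'a::comm_ring_1) mpoly"
  shows "Poly_Mapping.lookup (p * Poly_Mapping.single \<nu> 1) (\<mu> + \<nu>) = Poly_Mapping.lookup p \<mu>"
proof -
  have *: "(\<lambda>b. (Poly_Mapping.lookup (Poly_Mapping.single \<nu> (1::'a)) b when \<mu> + \<nu> = a + b))
      = (\<lambda>b. (1 when \<mu> = a) when b = \<nu>)" for a
    by (auto simp: lookup_single when_def)
  show ?thesis
    unfolding lookup_mult * Sum_any_when_equal by (simp add: mult_when)
qed

lemma keys_mult_single:
  fixes p :: "('v::finite, 'a::comm_ring_1) mpoly"
  assumes "Poly_Mapping.lookup (p * Poly_Mapping.single \<nu> 1) \<mu> \<noteq> 0"
  shows "\<exists>\<mu>'. \<mu> = \<mu>' + \<nu>"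
  using assms keys_mult[of p "Poly_Mapping.single \<nu> 1"] by (force simp: in_keys_iff[symmetric])

lemma Xvar_power_cancel: "Xvar i ^ N * p = Xvar i ^ N * q \<Longrightarrow> p = q"
  by (rule poly_mapping_eqI) (metis Xvar_power lookup_mult_single mult.commute)

lemma Xvar_power_eq_0: "Xvar i ^ N * p = 0 \<Longrightarrow> p = 0"
  using Xvar_power_cancel[of i N p 0] by simp

text \<open>Divisibility by \<open>x\<^sub>i\<^sup>M\<close> is a condition on the exponents of \<open>x\<^sub>i\<close> in the monomials, and multiplication
  by a power of another variable does not change these.  This is what rules out denominators in a
  function that is defined on two charts.\<close>

lemma Xvar_power_dvd:
  fixes f :: "('v::finite, 'a::comm_ring_1) mpoly"
  assumes "i \<noteq> j" and eq: "Xvar j ^ N * f = Xvar i ^ M * h"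
  shows "Xvar i ^ M dvd f"
proof -
  have "M \<le> Poly_Mapping.lookup \<mu> i" if "Poly_Mapping.lookup f \<mu> \<noteq> 0" for \<mu>
  proof -
    have "Poly_Mapping.lookup (h * Xvar i ^ M) (\<mu> + Poly_Mapping.single j N) \<noteq> 0"
      using that eq by (metis Xvar_power lookup_mult_single mult.commute)
    then obtain \<mu>' where "\<mu> + Poly_Mapping.single j N = \<mu>' + Poly_Mapping.single i M"
      unfolding Xvar_power using keys_mult_single by blast
    then have "Poly_Mapping.lookup (\<mu> + Poly_Mapping.single j N) i
        = Poly_Mapping.lookup (\<mu>' + Poly_Mapping.single i M) i" by simp
    then show ?thesis
      using assms(1) by (simp add: lookup_add lookup_single when_def)
  qed
  then have split: "\<mu> = (\<mu> - Poly_Mapping.single i M) + Poly_Mapping.single i M"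
    if "Poly_Mapping.lookup f \<mu> \<noteq> 0" for \<mu>
    by (intro poly_mapping_eqI) (use that in \<open>auto simp: lookup_add lookup_minus lookup_single when_def\<close>)
  have "f = (\<Sum>\<mu>\<in>Poly_Mapping.keys f. Poly_Mapping.single \<mu> (Poly_Mapping.lookup f \<mu>))"
    by (rule poly_mapping_eqI) (auto simp: lookup_sum lookup_single when_def in_keys_iff)
  also have "\<dots> = (\<Sum>\<mu>\<in>Poly_Mapping.keys f. Xvar i ^ M *
       Poly_Mapping.single (\<mu> - Poly_Mapping.single i M) (Poly_Mapping.lookup f \<mu>))"
    by (intro sum.cong refl) (use split in \<open>auto simp: Xvar_power mult_single in_keys_iff add.commute\<close>)
  finally show ?thesis
    by (simp add: sum_distrib_left[symmetric] dvd_def) blast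
qed

lemma homog_pos_Xvar_sum:
  fixes p :: "('v::finite, 'a::comm_ring_1) mpoly"
  assumes "p \<in> homog d" "d > 0"
  shows "\<exists>q. p = (\<Sum>i\<in>UNIV. q i * Xvar i)"
proof -
  have ex: "\<exists>i. Poly_Mapping.lookup \<mu> i > 0" if "\<mu> \<in> Poly_Mapping.keys p" for \<mu>
    using that assms by (metis gr0I homog_iff in_keys_iff mdeg_eq_0_iff not_less_zero poly_mapping_eqI lookup_zero)
  define c where "c \<mu> = (SOME i. Poly_Mapping.lookup \<mu> i > 0)" for \<mu> :: "'v \<Rightarrow>\<^sub>0 nat"
  have c: "Poly_Mapping.lookup \<mu> (c \<mu>) > 0" if "\<mu> \<in> Poly_Mapping.keys p" for \<mu>
    unfolding c_def using someI_ex[OF ex[OF that]] .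
  have split: "\<mu> = (\<mu> - Poly_Mapping.single (c \<mu>) 1) + Poly_Mapping.single (c \<mu>) 1"
    if "\<mu> \<in> Poly_Mapping.keys p" for \<mu>
    by (intro poly_mapping_eqI) (use c[OF that] in \<open>auto simp: lookup_add lookup_minus lookup_single when_def\<close>)
  have "p = (\<Sum>\<mu>\<in>Poly_Mapping.keys p. Poly_Mapping.single \<mu> (Poly_Mapping.lookup p \<mu>))"
    by (rule poly_mapping_eqI) (auto simp: lookup_sum lookup_single when_def in_keys_iff)
  also have "\<dots> = (\<Sum>i\<in>UNIV. \<Sum>\<mu>\<in>{\<mu>\<in>Poly_Mapping.keys p. c \<mu> = i}.
        Poly_Mapping.single \<mu> (Poly_Mapping.lookup p \<mu>))"
    by (rule sum.group[symmetric]) auto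
  also have "\<dots> = (\<Sum>i\<in>UNIV. (\<Sum>\<mu>\<in>{\<mu>\<in>Poly_Mapping.keys p. c \<mu> = i}.
        Poly_Mapping.single (\<mu> - Poly_Mapping.single i 1) (Poly_Mapping.lookup p \<mu>)) * Xvar i)"
    unfolding sum_distrib_right
    by (intro sum.cong refl) (use split in \<open>auto simp: Xvar_def mult_single\<close>)
  finally show ?thesis
    by (intro exI[of _ "\<lambda>i. \<Sum>\<mu>\<in>{\<mu>\<in>Poly_Mapping.keys p. c \<mu> = i}.
        Poly_Mapping.single (\<mu> - Poly_Mapping.single i 1) (Poly_Mapping.lookup p \<mu>)"])
qed

section \<open>Homogeneous prime ideals\<close>

definition is_ideal :: "'s::comm_ring_1 set \<Rightarrow> bool" where
  "is_ideal I \<longleftrightarrow> 0 \<in> I \<and> (\<forall>x\<in>I. \<forall>y\<in>I. x + y \<in> I) \<and> (\<forall>x\<in>I. \<forall>c. c * x \<in> I)"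

lemma is_idealD:
  assumes "is_ideal I"
  shows "0 \<in> I" "x \<in> I \<Longrightarrow> y \<in> I \<Longrightarrow> x + y \<in> I" "x \<in> I \<Longrightarrow> c * x \<in> I"
  using assms by (simp_all add: is_ideal_def)

lemma is_ideal_sum: "is_ideal I \<Longrightarrow> (\<And>i. i \<in> A \<Longrightarrow> f i \<in> I) \<Longrightarrow> sum f A \<in> I"
  by (induction A rule: infinite_finite_induct) (auto simp: is_ideal_def)

lemma is_ideal_mult_right: "is_ideal I \<Longrightarrow> x \<in> I \<Longrightarrow> x * c \<in> I"
  unfolding is_ideal_def by (metis mult.commute)

lemma is_ideal_uminus: "is_ideal I \<Longrightarrow> x \<in> I \<Longrightarrow> - x \<in> I"
  using is_ideal_mult_right[of I x "- 1"] by simp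

lemma is_ideal_diff: "is_ideal I \<Longrightarrow> x \<in> I \<Longrightarrow> y \<in> I \<Longrightarrow> x - y \<in> I"
  using is_ideal_uminus[of I y] unfolding is_ideal_def by (metis diff_conv_add_uminus)

lemma ideal_of_type_iff: "ideal I (ring_of_type_algebra :: 's::comm_ring_1 ring) \<longleftrightarrow> is_ideal I"
proof
  let ?R = "ring_of_type_algebra :: 's ring"
  assume "ideal I ?R"
  then interpret ideal I ?R .
  show "is_ideal I"
    using additive_subgroup.zero_closed[OF additive_subgroup_axioms]
      additive_subgroup.a_closed[OF additive_subgroup_axioms] I_l_closed
    by (simp add: is_ideal_def ring_of_type_algebra_def)
next
  let ?R = "ring_of_type_algebra :: 's ring"
  assume I: "is_ideal I"
  interpret cring ?R by (rule cring_from_type_algebra)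
  have inv: "\<ominus>\<^bsub>?R\<^esub> x = - x" for x
    by (rule minus_equality) (auto simp: ring_of_type_algebra_def)
  show "ideal I ?R"
  proof (rule idealI)
    show "subgroup I (add_monoid ?R)"
      using I is_ideal_uminus[OF I] inv
      by unfold_locales (auto simp: is_ideal_def ring_of_type_algebra_def a_inv_def)
    show "ring ?R" by (rule ring_from_type_algebra)
  qed (use I in \<open>auto simp: is_ideal_def ring_of_type_algebra_def mult.commute\<close>)
qed

lemma primeideal_of_type_iff:
  "primeideal P (ring_of_type_algebra :: 's::comm_ring_1 ring) \<longleftrightarrow>
     is_ideal P \<and> 1 \<notin> P \<and> (\<forall>a b. a * b \<in> P \<longrightarrow> a \<in> P \<or> b \<in> P)"
proof -
  have "(P \<noteq> UNIV) \<longleftrightarrow> 1 \<notin> P" if "is_ideal P"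
    using that unfolding is_ideal_def by (metis UNIV_I UNIV_eq_I mult.right_neutral)
  then show ?thesis
    unfolding primeideal_def primeideal_axioms_def ideal_of_type_iff
    by (auto simp: ring_of_type_algebra_def cring_from_type_algebra[unfolded ring_of_type_algebra_def])
qed

definition span_ideal :: "'s::comm_ring_1 set \<Rightarrow> 's set" where
  "span_ideal H = {\<Sum>h\<in>F. c h * h | F c. finite F \<and> F \<subseteq> H}"

lemma subset_span_ideal: "H \<subseteq> span_ideal H"
proof
  fix h assume "h \<in> H"
  then show "h \<in> span_ideal H"
    unfolding span_ideal_def by (intro CollectI exI[of _ "{h}"] exI[of _ "\<lambda>_. 1"]) auto
qed

lemma is_ideal_span_ideal: "is_ideal (span_ideal H)"
  unfolding is_ideal_def
proof (intro conjI ballI allI)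
  show "0 \<in> span_ideal H"
    unfolding span_ideal_def by (intro CollectI exI[of _ "{}"]) auto
next
  fix x c assume "x \<in> span_ideal H"
  then obtain F d where "x = (\<Sum>h\<in>F. d h * h)" "finite F" "F \<subseteq> H"
    unfolding span_ideal_def by blast
  then show "c * x \<in> span_ideal H"
    unfolding span_ideal_def
    by (intro CollectI exI[of _ F] exI[of _ "\<lambda>h. c * d h"]) (auto simp: sum_distrib_left mult.assoc)
next
  fix x y assume "x \<in> span_ideal H" "y \<in> span_ideal H"
  then obtain F d F' d' where x: "x = (\<Sum>h\<in>F. d h * h)" "finite F" "F \<subseteq> H"
    and y: "y = (\<Sum>h\<in>F'. d' h * h)" "finite F'" "F' \<subseteq> H"
    unfolding span_ideal_def by blast
  have "x = (\<Sum>h\<in>F \<union> F'. (if h \<in> F then d h else 0) * h)"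
    unfolding x(1) by (rule sum.mono_neutral_cong_left) (use x y in auto)
  moreover have "y = (\<Sum>h\<in>F \<union> F'. (if h \<in> F' then d' h else 0) * h)"
    unfolding y(1) by (rule sum.mono_neutral_cong_left) (use x y in auto)
  ultimately have "x + y = (\<Sum>h\<in>F \<union> F'. ((if h \<in> F then d h else 0) + (if h \<in> F' then d' h else 0)) * h)"
    by (simp add: sum.distrib distrib_right)
  then show "x + y \<in> span_ideal H"
    unfolding span_ideal_def using x y by (intro CollectI exI[of _ "F \<union> F'"] exI conjI) auto
qed

text \<open>Krull's argument: an ideal maximal among those that avoid the powers of \<open>g\<close> is prime.\<close>

lemma exists_prime_avoiding_powers:
  assumes J: "is_ideal J" and g: "\<And>N. g ^ N \<notin> J"
  shows "\<exists>M. is_ideal M \<and> J \<subseteq> M \<and> g \<notin> M \<and> 1 \<notin> M \<and> (\<forall>a b. a * b \<in> M \<longrightarrow> a \<in> M \<or> b \<in> M)"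
proof -
  define \<A> where "\<A> = {I. is_ideal I \<and> J \<subseteq> I \<and> (\<forall>N. g ^ N \<notin> I)}"
  have "\<exists>M\<in>\<A>. \<forall>Y\<in>\<A>. M \<subseteq> Y \<longrightarrow> Y = M"
  proof (rule subset_Zorn_nonempty)
    show "\<A> \<noteq> {}" using J g unfolding \<A>_def by blast
  next
    fix \<C> assume ne: "\<C> \<noteq> {}" and ch: "subset.chain \<A> \<C>"
    have sub: "\<C> \<subseteq> \<A>" using ch by (simp add: subset.chain_def)
    have "is_ideal (\<Union>\<C>)"
      unfolding is_ideal_def
    proof (intro conjI ballI allI)
      obtain A where "A \<in> \<C>" using ne by blast
      moreover from this have "is_ideal A" using sub by (auto simp: \<A>_def)
      ultimately show "0 \<in> \<Union>\<C>" using is_idealD(1) by blast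
    next
      fix x c assume "x \<in> \<Union>\<C>"
      then obtain A where A: "x \<in> A" "A \<in> \<C>" by blast
      then have "is_ideal A" using sub by (auto simp: \<A>_def)
      then have "c * x \<in> A" using A(1) by (simp add: is_ideal_def)
      then show "c * x \<in> \<Union>\<C>" using A(2) by blast
    next
      fix x y assume "x \<in> \<Union>\<C>" "y \<in> \<Union>\<C>"
      then obtain A B where AB: "x \<in> A" "A \<in> \<C>" "y \<in> B" "B \<in> \<C>" by blast
      then have "A \<subseteq> B \<or> B \<subseteq> A" using ch by (auto simp: subset.chain_def)
      then obtain D where "x \<in> D" "y \<in> D" "D \<in> \<C>" using AB by blast
      moreover from this have "is_ideal D" using sub by (auto simp: \<A>_def)
      ultimately have "x + y \<in> D" using is_idealD(2) by blast
      then show "x + y \<in> \<Union>\<C>" using \<open>D \<in> \<C>\<close> by blast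
    qed
    then show "\<Union>\<C> \<in> \<A>" using ne sub by (auto simp: \<A>_def)
  qed
  then obtain M where M: "M \<in> \<A>" and max: "\<And>Y. Y \<in> \<A> \<Longrightarrow> M \<subseteq> Y \<Longrightarrow> Y = M" by blast
  have idM: "is_ideal M" and JM: "J \<subseteq> M" and gM: "\<And>N. g ^ N \<notin> M" using M by (auto simp: \<A>_def)
  have pow: "\<exists>N c m. m \<in> M \<and> g ^ N = m + c * a" if "a \<notin> M" for a
  proof -
    define Y where "Y = {m + c * a | m c. m \<in> M}"
    have "is_ideal Y"
      unfolding is_ideal_def
    proof (intro conjI ballI allI)
      show "0 \<in> Y" unfolding Y_def using idM by (intro CollectI exI[of _ 0]) (auto simp: is_ideal_def)
    next
      fix x y assume "x \<in> Y" "y \<in> Y"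
      then obtain m c m' c' where "x = m + c * a" "y = m' + c' * a" "m \<in> M" "m' \<in> M"
        unfolding Y_def by blast
      then show "x + y \<in> Y" unfolding Y_def using idM
        by (intro CollectI exI[of _ "m + m'"] exI[of _ "c + c'"]) (auto simp: is_ideal_def algebra_simps)
    next
      fix x d assume "x \<in> Y"
      then obtain m c where "x = m + c * a" "m \<in> M" unfolding Y_def by blast
      then show "d * x \<in> Y" unfolding Y_def using idM
        by (intro CollectI exI[of _ "d * m"] exI[of _ "d * c"]) (auto simp: is_ideal_def algebra_simps)
    qed
    moreover have "M \<subseteq> Y" unfolding Y_def by (force intro: exI[of _ 0])
    moreover have "a \<in> Y" unfolding Y_def using idM
      by (intro CollectI exI[of _ 0] exI[of _ 1]) (auto simp: is_ideal_def)
    ultimately have "Y \<notin> \<A>" using max that by blast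
    then have "\<exists>N. g ^ N \<in> Y"
      using \<open>is_ideal Y\<close> subset_trans[OF JM \<open>M \<subseteq> Y\<close>] by (simp add: \<A>_def)
    then show ?thesis unfolding Y_def by blast
  qed
  have "a \<in> M \<or> b \<in> M" if ab: "a * b \<in> M" for a b
  proof (rule ccontr)
    assume "\<not> (a \<in> M \<or> b \<in> M)"
    then obtain N c m N' c' m' where *: "m \<in> M" "g ^ N = m + c * a" "m' \<in> M" "g ^ N' = m' + c' * b"
      using pow by metis
    have "g ^ (N + N') = (m' + c' * b) * m + (c * a) * m' + (c * c') * (a * b)"
      unfolding power_add *(2,4) by (simp add: algebra_simps)
    moreover have "\<dots> \<in> M"
      using *(1,3) ab by (simp add: is_idealD[OF idM])
    ultimately show False using gM by metis
  qed
  then show ?thesis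
    using idM JM gM[of 1] gM[of 0] by (intro exI[of _ M]) auto
qed

lemma hcomp_mult:
  assumes "p = (\<Sum>i\<le>N. hcomp i p)"
  shows "hcomp d (p * q) = (\<Sum>i\<in>{..N} \<inter> {..d}. hcomp i p * hcomp (d - i) q)"
proof -
  have 1: "hcomp d (q * hcomp i p) = (if i \<le> d then hcomp i p * hcomp (d - i) q else 0)" for i
    using hcomp_mult_homog[of "hcomp i p" i "d - i" q] hcomp_mult_homog(2)[of "hcomp i p" i d q]
    by (auto simp: mult.commute not_le)
  have "hcomp d (p * q) = hcomp d (\<Sum>i\<le>N. q * hcomp i p)"
    using assms by (metis mult.commute sum_distrib_left)
  also have "\<dots> = (\<Sum>i\<le>N. if i \<le> d then hcomp i p * hcomp (d - i) q else 0)"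
    by (simp add: hcomp_sum 1)
  also have "\<dots> = (\<Sum>i\<in>{..N} \<inter> {..d}. hcomp i p * hcomp (d - i) q)"
    by (rule sum.mono_neutral_cong_right) auto
  finally show ?thesis .
qed

lemma is_ideal_homogeneous_core:
  assumes M: "is_ideal M"
  shows "is_ideal {p. \<forall>d. hcomp d p \<in> M}" (is "is_ideal ?P")
  unfolding is_ideal_def
proof (intro conjI ballI allI)
  show "0 \<in> ?P" using M by (simp add: is_ideal_def)
  show "x + y \<in> ?P" if "x \<in> ?P" "y \<in> ?P" for x y
    using that M by (simp add: is_ideal_def hcomp_add)
  show "c * x \<in> ?P" if "x \<in> ?P" for x c
  proof -
    obtain N where "c = (\<Sum>d\<le>N. hcomp d c)" by (rule hcomp_sum_eq[of c]) blast
    then have eq: "hcomp d (c * x) = (\<Sum>i\<in>{..N} \<inter> {..d}. hcomp i c * hcomp (d - i) x)" for d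
      by (rule hcomp_mult)
    show ?thesis
      unfolding mem_Collect_eq eq
      using that M by (intro allI is_ideal_sum[OF M]) (auto simp: is_ideal_def)
  qed
qed

text \<open>The elements all of whose homogeneous components lie in a prime form a homogeneous prime:
  among the components outside, compare the ones of highest degree.\<close>

lemma homogeneous_core_prime:
  fixes M :: "('v::finite, 'a::comm_ring_1) mpoly set"
  assumes M: "is_ideal M" "1 \<notin> M" and pr: "\<And>a b. a * b \<in> M \<Longrightarrow> a \<in> M \<or> b \<in> M"
  defines "P \<equiv> {p. \<forall>d. hcomp d p \<in> M}"
  shows "is_ideal P" "1 \<notin> P" "\<And>a b. a * b \<in> P \<Longrightarrow> a \<in> P \<or> b \<in> P"
proof -
  show "is_ideal P" unfolding P_def by (rule is_ideal_homogeneous_core[OF M(1)])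
  have "hcomp 0 (1 :: ('v, 'a) mpoly) = 1" by (simp add: hcomp_of_homog[OF homog_1])
  then show "1 \<notin> P" using M by (auto simp: P_def intro!: exI[of _ 0])
  fix a b :: "('v, 'a) mpoly" assume ab: "a * b \<in> P"
  show "a \<in> P \<or> b \<in> P"
  proof (rule ccontr)
    assume "\<not> (a \<in> P \<or> b \<in> P)"
    then obtain d0 e0 where d0: "hcomp d0 a \<notin> M" and e0: "hcomp e0 b \<notin> M" by (auto simp: P_def)
    obtain N where N: "\<And>d. d > N \<Longrightarrow> hcomp d a = 0" "a = (\<Sum>d\<le>N. hcomp d a)"
      by (rule hcomp_sum_eq[of a]) blast
    obtain N' where N': "\<And>d. d > N' \<Longrightarrow> hcomp d b = 0"
      by (rule hcomp_sum_eq[of b]) blast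
    have z: "0 \<in> M" using M by (simp add: is_ideal_def)
    have "\<exists>d. hcomp d a \<notin> M \<and> (\<forall>d'. hcomp d' a \<notin> M \<longrightarrow> d' \<le> d)"
    proof (rule ex_has_greatest_nat[of "\<lambda>d. hcomp d a \<notin> M" d0 "\<lambda>d. d" "Suc N"])
      show "\<forall>d. hcomp d a \<notin> M \<longrightarrow> d < Suc N" using N(1) z not_le less_Suc_eq_le by metis
    qed (rule d0)
    then obtain d where d1: "hcomp d a \<notin> M" and dmax: "\<forall>d'. hcomp d' a \<notin> M \<longrightarrow> d' \<le> d" by blast
    have d: "hcomp d a \<notin> M" "\<And>d'. d' > d \<Longrightarrow> hcomp d' a \<in> M"
      using d1 dmax not_le by blast+
    have "\<exists>e. hcomp e b \<notin> M \<and> (\<forall>e'. hcomp e' b \<notin> M \<longrightarrow> e' \<le> e)"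
    proof (rule ex_has_greatest_nat[of "\<lambda>d. hcomp d b \<notin> M" e0 "\<lambda>d. d" "Suc N'"])
      show "\<forall>e. hcomp e b \<notin> M \<longrightarrow> e < Suc N'" using N'(1) z by (metis less_Suc_eq_le not_le)
    qed (rule e0)
    then obtain e where e1: "hcomp e b \<notin> M" and emax: "\<forall>e'. hcomp e' b \<notin> M \<longrightarrow> e' \<le> e" by blast
    have e: "hcomp e b \<notin> M" "\<And>e'. e' > e \<Longrightarrow> hcomp e' b \<in> M"
      using e1 emax not_le by blast+
    let ?I = "{..N} \<inter> {..d + e}"
    have "\<not> N < d" using N(1)[of d] d(1) z by auto
    then have dI: "d \<in> ?I" by simp
    have "hcomp (d + e) (a * b) = hcomp d a * hcomp e b + (\<Sum>i\<in>?I - {d}. hcomp i a * hcomp (d + e - i) b)"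
      unfolding hcomp_mult[OF N(2)]
      by (subst sum.remove[OF _ dI]) (rule finite_Int, simp_all only: finite_atMost simp_thms add_diff_cancel_left')
    moreover have "(\<Sum>i\<in>?I - {d}. hcomp i a * hcomp (d + e - i) b) \<in> M"
    proof (rule is_ideal_sum[OF M(1)])
      fix i assume "i \<in> ?I - {d}"
      then have "i > d \<or> d + e - i > e" by auto
      then show "hcomp i a * hcomp (d + e - i) b \<in> M"
      proof
        assume "i > d"
        then show ?thesis by (intro is_ideal_mult_right[OF M(1)] d(2))
      next
        assume "d + e - i > e"
        then show ?thesis by (intro is_idealD(3)[OF M(1)] e(2))
      qed
    qed
    moreover have "hcomp (d + e) (a * b) \<in> M" using ab by (simp add: P_def)
    ultimately have "hcomp d a * hcomp e b \<in> M"
      using is_ideal_diff[OF M(1), of "hcomp (d + e) (a * b)" "\<Sum>i\<in>?I - {d}. hcomp i a * hcomp (d + e - i) b"]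
      by simp
    then show False using pr[of "hcomp d a" "hcomp e b"] d(1) e(1) by blast
  qed
qed

text \<open>Stability under passing to homogeneous components replaces generation by homogeneous elements,
  and the irrelevant ideal is generated by the variables.\<close>

lemma in_Proj_iff:
  fixes P :: "('v::finite, 'a::comm_ring_1) mpoly set"
  shows "P \<in> Proj homog \<longleftrightarrow> is_ideal P \<and> 1 \<notin> P \<and> (\<forall>a b. a * b \<in> P \<longrightarrow> a \<in> P \<or> b \<in> P)
     \<and> (\<forall>p\<in>P. \<forall>d. hcomp d p \<in> P) \<and> (\<exists>i. Xvar i \<notin> P)"
proof -
  let ?R = "ring_of_type_algebra :: ('v, 'a) mpoly ring"
  have gen: "P = Idl\<^bsub>?R\<^esub> (P \<inter> homogeneous_elems homog) \<longleftrightarrow> (\<forall>p\<in>P. \<forall>d. hcomp d p \<in> P)"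
    if P: "is_ideal P"
  proof
    assume eq: "P = Idl\<^bsub>?R\<^esub> (P \<inter> homogeneous_elems homog)"
    let ?Q = "P \<inter> {p. \<forall>d. hcomp d p \<in> P}"
    have "is_ideal ?Q"
      using P is_ideal_homogeneous_core[OF P] unfolding is_ideal_def by blast
    moreover have "P \<inter> homogeneous_elems homog \<subseteq> ?Q"
      using P by (auto simp: homogeneous_elems_def hcomp_of_homog is_ideal_def)
    ultimately have "Idl\<^bsub>?R\<^esub> (P \<inter> homogeneous_elems homog) \<subseteq> ?Q"
      unfolding genideal_def ideal_of_type_iff by blast
    then have "P \<subseteq> ?Q" using eq by blast
    then show "\<forall>p\<in>P. \<forall>d. hcomp d p \<in> P" by blast
  next
    assume h: "\<forall>p\<in>P. \<forall>d. hcomp d p \<in> P"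
    show "P = Idl\<^bsub>?R\<^esub> (P \<inter> homogeneous_elems homog)"
    proof
      show "P \<subseteq> Idl\<^bsub>?R\<^esub> (P \<inter> homogeneous_elems homog)"
        unfolding genideal_def
      proof (intro subsetI InterI, clarify)
        fix p I assume p: "p \<in> P" and I: "ideal I ?R" "P \<inter> homogeneous_elems homog \<subseteq> I"
        obtain N where N: "p = (\<Sum>d\<le>N. hcomp d p)" by (rule hcomp_sum_eq[of p]) blast
        have "hcomp d p \<in> I" for d
          using h p I(2) hcomp_homog[of d p] unfolding homogeneous_elems_def by blast
        then show "p \<in> I" using I(1) is_ideal_sum N unfolding ideal_of_type_iff by metis
      qed
      show "Idl\<^bsub>?R\<^esub> (P \<inter> homogeneous_elems homog) \<subseteq> P"
        using P by (auto simp: genideal_def ideal_of_type_iff)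
    qed
  qed
  have irr: "\<not> (\<Union>d\<in>{0<..}. homog d) \<subseteq> P \<longleftrightarrow> (\<exists>i. Xvar i \<notin> P)" if P: "is_ideal P"
  proof
    assume "\<not> (\<Union>d\<in>{0<..}. homog d) \<subseteq> P"
    then obtain p d where p: "p \<in> homog d" "d > 0" "p \<notin> P" by auto
    obtain q where q: "p = (\<Sum>i\<in>UNIV. q i * Xvar i)" using homog_pos_Xvar_sum[OF p(1,2)] by blast
    show "\<exists>i. Xvar i \<notin> P"
    proof (rule ccontr)
      assume "\<nexists>i. Xvar i \<notin> P"
      then have "p \<in> P" unfolding q using P by (intro is_ideal_sum) (auto simp: is_ideal_def)
      then show False using p by simp
    qed
  next
    assume "\<exists>i. Xvar i \<notin> P"
    then show "\<not> (\<Union>d\<in>{0<..}. homog d) \<subseteq> P" using homog_Xvar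
      by (metis UN_I greaterThan_iff subsetD zero_less_one)
  qed
  show ?thesis
  proof (cases "is_ideal P")
    case True
    show ?thesis
      unfolding Proj_def mem_Collect_eq primeideal_of_type_iff gen[OF True] irr[OF True]
      by (rule iffI) (elim conjE, intro conjI, assumption+)+
  next
    case False
    then show ?thesis
      unfolding Proj_def mem_Collect_eq primeideal_of_type_iff by simp
  qed
qed

text \<open>The homogeneous Nullstellensatz in the form used below: if \<open>H\<close> has no common zero in the
  open set where \<open>f\<close> is invertible, then a power of each \<open>f x\<^sub>i\<close> is in the ideal generated by \<open>H\<close>.
  The factor \<open>x\<^sub>i\<close> keeps the prime that would violate this away from the irrelevant ideal.\<close>

lemma Proj_Nullstellensatz:
  fixes H :: "('v::finite, 'a::comm_ring_1) mpoly set"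
  assumes H: "H \<subseteq> homogeneous_elems homog" and f: "f \<in> homogeneous_elems homog"
    and cov: "\<And>P. P \<in> Proj homog \<Longrightarrow> f \<notin> P \<Longrightarrow> \<not> H \<subseteq> P"
  shows "\<exists>N. (f * Xvar i) ^ N \<in> span_ideal H"
proof (rule ccontr)
  assume "\<nexists>N. (f * Xvar i) ^ N \<in> span_ideal H"
  then obtain M where M: "is_ideal M" "span_ideal H \<subseteq> M" "f * Xvar i \<notin> M" "1 \<notin> M"
     "\<And>a b. a * b \<in> M \<Longrightarrow> a \<in> M \<or> b \<in> M"
    using exists_prime_avoiding_powers[OF is_ideal_span_ideal, of "f * Xvar i" H] by metis
  define P where "P = {p. \<forall>d. hcomp d p \<in> M}"
  note P = homogeneous_core_prime[OF M(1,4,5), folded P_def]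
  have hom: "p \<in> P \<longleftrightarrow> p \<in> M" if p: "p \<in> homogeneous_elems homog" for p
  proof -
    obtain e where "p \<in> homog e" using p unfolding homogeneous_elems_def by blast
    then show ?thesis using M(1) by (auto simp: P_def hcomp_of_homog is_ideal_def)
  qed
  have "f \<notin> M" "Xvar i \<notin> M"
    using M(1,3) is_ideal_mult_right unfolding is_ideal_def by blast+
  then have fP: "f \<notin> P" "Xvar i \<notin> P"
    using hom f homog_Xvar unfolding homogeneous_elems_def by blast+
  have "hcomp d p \<in> P" if "p \<in> P" for p d
    using that M(1) by (auto simp: P_def hcomp_of_homog[OF hcomp_homog] is_ideal_def)
  then have "P \<in> Proj homog"
    unfolding in_Proj_iff using P fP by blast
  moreover have "H \<subseteq> P" using hom H M(2) subset_span_ideal by blast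
  ultimately show False using cov fP by blast
qed

section \<open>Localizations\<close>

locale mult_set =
  fixes T :: "'s::comm_ring_1 set"
  assumes one_mem [simp, intro]: "1 \<in> T"
    and mult_mem [simp, intro]: "s \<in> T \<Longrightarrow> t \<in> T \<Longrightarrow> s * t \<in> T"
begin

lemma fraction_subset:
  assumes "s \<in> T" "t \<in> T" "u \<in> T" "u * (a * t - b * s) = 0"
  shows "fraction T a s \<subseteq> fraction T b t"
proof (clarsimp simp: fraction_def)
  fix c v w assume v: "v \<in> T" and w: "w \<in> T" "w * (a * v - c * s) = 0"
  have "w * u * s * (b * v - c * t) = u * t * (w * (a * v - c * s)) - w * v * (u * (a * t - b * s))"
    by (simp add: algebra_simps)
  then have "w * u * s * (b * v - c * t) = 0" using assms w by simp
  then show "\<exists>u\<in>T. u * (b * v - c * t) = 0" using w assms by (meson mult_mem)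
qed

lemma fraction_eq_iff:
  assumes "s \<in> T" "t \<in> T"
  shows "fraction T a s = fraction T b t \<longleftrightarrow> (\<exists>u\<in>T. u * (a * t - b * s) = 0)"
proof
  assume "fraction T a s = fraction T b t"
  moreover have "(b, t) \<in> fraction T b t" using assms by (auto simp: fraction_def intro!: bexI[of _ 1])
  ultimately have "(b, t) \<in> fraction T a s" by simp
  then show "\<exists>u\<in>T. u * (a * t - b * s) = 0" by (auto simp: fraction_def)
next
  assume "\<exists>u\<in>T. u * (a * t - b * s) = 0"
  then obtain u where u: "u \<in> T" "u * (a * t - b * s) = 0" by blast
  have "u * (b * s - a * t) = - (u * (a * t - b * s))" by (simp add: algebra_simps)
  then have "u * (b * s - a * t) = 0" using u by simp
  then show "fraction T a s = fraction T b t"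
    using fraction_subset[OF assms u] fraction_subset[OF assms(2,1) u(1)] by blast
qed

lemma fraction_eqI: "s \<in> T \<Longrightarrow> t \<in> T \<Longrightarrow> a * t = b * s \<Longrightarrow> fraction T a s = fraction T b t"
  by (subst fraction_eq_iff) (auto intro!: bexI[of _ 1])

lemma fraction_cancel: "s \<in> T \<Longrightarrow> r \<in> T \<Longrightarrow> fraction T (a * r) (s * r) = fraction T a s"
  by (rule fraction_eqI) (auto simp: algebra_simps)

lemma fraction_self: "s \<in> T \<Longrightarrow> (a, s) \<in> fraction T a s"
  by (auto simp: fraction_def intro!: bexI[of _ 1])

lemma fraction_mult:
  assumes "s \<in> T" "t \<in> T"
  shows "fraction T a s \<otimes>\<^bsub>localization T\<^esub> fraction T b t = fraction T (a * b) (s * t)"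
proof -
  have "fraction T (a' * b') (s' * t') = fraction T (a * b) (s * t)"
    if "(a', s') \<in> fraction T a s" "(b', t') \<in> fraction T b t" for a' s' b' t'
  proof -
    obtain u v where u: "u \<in> T" "u * (a * s' - a' * s) = 0" "s' \<in> T"
      and v: "v \<in> T" "v * (b * t' - b' * t) = 0" "t' \<in> T"
      using \<open>(a', s') \<in> fraction T a s\<close> \<open>(b', t') \<in> fraction T b t\<close> unfolding fraction_def by blast
    have "u * v * (a' * b' * (s * t) - a * b * (s' * t'))
      = - (v * (b * t') * (u * (a * s' - a' * s))) - u * a' * s * (v * (b * t' - b' * t))"
      by (simp add: algebra_simps)
    then have "u * v * (a' * b' * (s * t) - a * b * (s' * t')) = 0" using u v by simp
    then show ?thesis by (subst fraction_eq_iff) (use u v assms in auto)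
  qed
  then have "(\<Union>(a', s')\<in>fraction T a s. \<Union>(b', t')\<in>fraction T b t. fraction T (a' * b') (s' * t'))
      = (\<Union>(a', s')\<in>fraction T a s. \<Union>(b', t')\<in>fraction T b t. fraction T (a * b) (s * t))"
    by (intro SUP_cong refl) (auto split: prod.split)
  also have "\<dots> = fraction T (a * b) (s * t)"
    using fraction_self[OF assms(1), of a] fraction_self[OF assms(2), of b] by auto
  finally show ?thesis by (simp add: localization_def)
qed

lemma fraction_add:
  assumes "s \<in> T" "t \<in> T"
  shows "fraction T a s \<oplus>\<^bsub>localization T\<^esub> fraction T b t = fraction T (a * t + b * s) (s * t)"
proof -
  have "fraction T (a' * t' + b' * s') (s' * t') = fraction T (a * t + b * s) (s * t)"
    if "(a', s') \<in> fraction T a s" "(b', t') \<in> fraction T b t" for a' s' b' t'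
  proof -
    obtain u v where u: "u \<in> T" "u * (a * s' - a' * s) = 0" "s' \<in> T"
      and v: "v \<in> T" "v * (b * t' - b' * t) = 0" "t' \<in> T"
      using \<open>(a', s') \<in> fraction T a s\<close> \<open>(b', t') \<in> fraction T b t\<close> unfolding fraction_def by blast
    have "u * v * ((a' * t' + b' * s') * (s * t) - (a * t + b * s) * (s' * t'))
      = - (v * t * t' * (u * (a * s' - a' * s))) - u * s * s' * (v * (b * t' - b' * t))"
      by (simp add: algebra_simps)
    then have "u * v * ((a' * t' + b' * s') * (s * t) - (a * t + b * s) * (s' * t')) = 0"
      using u v by simp
    then show ?thesis by (subst fraction_eq_iff) (use u v assms in auto)
  qed
  then have "(\<Union>(a', s')\<in>fraction T a s. \<Union>(b', t')\<in>fraction T b t. fraction T (a' * t' + b' * s') (s' * t'))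
      = (\<Union>(a', s')\<in>fraction T a s. \<Union>(b', t')\<in>fraction T b t. fraction T (a * t + b * s) (s * t))"
    by (intro SUP_cong refl) (auto split: prod.split)
  also have "\<dots> = fraction T (a * t + b * s) (s * t)"
    using fraction_self[OF assms(1), of a] fraction_self[OF assms(2), of b] by auto
  finally show ?thesis by (simp add: localization_def)
qed

lemma fraction_closed [simp, intro]: "s \<in> T \<Longrightarrow> fraction T a s \<in> carrier (localization T)"
  by (auto simp: localization_def)

lemma localization_one: "\<one>\<^bsub>localization T\<^esub> = fraction T 1 1"
  and localization_zero: "\<zero>\<^bsub>localization T\<^esub> = fraction T 0 1"
  by (simp_all add: localization_def)

lemma fraction_zero: "s \<in> T \<Longrightarrow> fraction T 0 s = fraction T 0 1"
  by (rule fraction_eqI) auto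

lemma cring_localization: "cring (localization T)"
proof -
  let ?L = "localization T"
  have elim: "\<exists>a s. x = fraction T a s \<and> s \<in> T" if "x \<in> carrier ?L" for x
    using that by (auto simp: localization_def)
  note simps = fraction_mult fraction_add localization_one localization_zero
  show ?thesis
  proof (rule cringI)
    show "abelian_group ?L"
    proof (rule abelian_groupI)
      fix x y z assume xyz: "x \<in> carrier ?L" "y \<in> carrier ?L" "z \<in> carrier ?L"
      obtain a s where x: "x = fraction T a s" "s \<in> T" using elim[OF xyz(1)] by blast
      obtain b t where y: "y = fraction T b t" "t \<in> T" using elim[OF xyz(2)] by blast
      obtain c r where z: "z = fraction T c r" "r \<in> T" using elim[OF xyz(3)] by blast
      note * = x y z
      show "x \<oplus>\<^bsub>?L\<^esub> y \<oplus>\<^bsub>?L\<^esub> z = x \<oplus>\<^bsub>?L\<^esub> (y \<oplus>\<^bsub>?L\<^esub> z)"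
        unfolding * by (simp add: simps *(2,4,6)) (rule fraction_eqI; simp add: *(2,4,6) algebra_simps)
      show "x \<oplus>\<^bsub>?L\<^esub> y = y \<oplus>\<^bsub>?L\<^esub> x" unfolding * by (simp add: simps *(2,4,6)) (rule fraction_eqI; simp add: *(2,4,6) algebra_simps)
      show "x \<oplus>\<^bsub>?L\<^esub> y \<in> carrier ?L" using * by (simp add: simps)
      show "\<zero>\<^bsub>?L\<^esub> \<oplus>\<^bsub>?L\<^esub> x = x" using * by (simp add: simps)
      have "fraction T (- a) s \<oplus>\<^bsub>?L\<^esub> x = \<zero>\<^bsub>?L\<^esub>" using * by (simp add: simps fraction_zero[of "s * s"])
      then show "\<exists>y\<in>carrier ?L. y \<oplus>\<^bsub>?L\<^esub> x = \<zero>\<^bsub>?L\<^esub>" using * by blast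
    qed (simp add: simps)
    show "comm_monoid ?L"
    proof (rule comm_monoidI)
      fix x y z assume xyz: "x \<in> carrier ?L" "y \<in> carrier ?L" "z \<in> carrier ?L"
      obtain a s where x: "x = fraction T a s" "s \<in> T" using elim[OF xyz(1)] by blast
      obtain b t where y: "y = fraction T b t" "t \<in> T" using elim[OF xyz(2)] by blast
      obtain c r where z: "z = fraction T c r" "r \<in> T" using elim[OF xyz(3)] by blast
      note * = x y z
      show "x \<otimes>\<^bsub>?L\<^esub> y \<otimes>\<^bsub>?L\<^esub> z = x \<otimes>\<^bsub>?L\<^esub> (y \<otimes>\<^bsub>?L\<^esub> z)"
        unfolding * by (simp add: simps *(2,4,6)) (rule fraction_eqI; simp add: *(2,4,6) algebra_simps)
      show "x \<otimes>\<^bsub>?L\<^esub> y = y \<otimes>\<^bsub>?L\<^esub> x" unfolding * by (simp add: simps *(2,4,6)) (rule fraction_eqI; simp add: *(2,4,6) algebra_simps)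
      show "x \<otimes>\<^bsub>?L\<^esub> y \<in> carrier ?L" using * by (simp add: simps)
      show "\<one>\<^bsub>?L\<^esub> \<otimes>\<^bsub>?L\<^esub> x = x" using * by (simp add: simps)
    qed (simp add: simps)
  next
    fix x y z assume xyz: "x \<in> carrier ?L" "y \<in> carrier ?L" "z \<in> carrier ?L"
    obtain a s where x: "x = fraction T a s" "s \<in> T" using elim[OF xyz(1)] by blast
    obtain b t where y: "y = fraction T b t" "t \<in> T" using elim[OF xyz(2)] by blast
    obtain c r where z: "z = fraction T c r" "r \<in> T" using elim[OF xyz(3)] by blast
    note * = x y z
    show "(x \<oplus>\<^bsub>?L\<^esub> y) \<otimes>\<^bsub>?L\<^esub> z = x \<otimes>\<^bsub>?L\<^esub> z \<oplus>\<^bsub>?L\<^esub> y \<otimes>\<^bsub>?L\<^esub> z"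
      unfolding * by (simp add: simps *(2,4,6)) (rule fraction_eqI; simp add: *(2,4,6) algebra_simps)
  qed
qed

sublocale L: cring "localization T"
  by (rule cring_localization)

lemma fraction_add_same:
  "s \<in> T \<Longrightarrow> fraction T a s \<oplus>\<^bsub>localization T\<^esub> fraction T b s = fraction T (a + b) s"
  by (simp add: fraction_add distrib_right[symmetric] fraction_cancel)

lemma fraction_uminus: "s \<in> T \<Longrightarrow> \<ominus>\<^bsub>localization T\<^esub> fraction T a s = fraction T (- a) s"
  by (rule L.minus_equality) (simp_all add: fraction_add_same fraction_zero[of s] localization_zero)

end

section \<open>The twisting sheaves as sheaves of locally fractional functions\<close>

abbreviation dn :: "('v::finite, 'a::comm_ring_1) mpoly set \<Rightarrow> ('v, 'a) mpoly set" where
  "dn \<equiv> denoms homog"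

abbreviation LL :: "('v::finite, 'a::comm_ring_1) mpoly set \<Rightarrow> (('v, 'a) mpoly \<times> ('v, 'a) mpoly) set ring" where
  "LL P \<equiv> localization (dn P)"

abbreviation tw :: "int \<Rightarrow> ('v::finite, 'a::comm_ring_1) mpoly set set \<Rightarrow> ('v, 'a) mpoly sect set" where
  "tw \<equiv> twisted_sections homog"

abbreviation opn :: "('v::finite, 'a::comm_ring_1) mpoly set set \<Rightarrow> bool" where
  "opn \<equiv> openin (Proj_topology homog)"

lemma homogeneous_elemsI: "p \<in> homog d \<Longrightarrow> p \<in> homogeneous_elems homog"
  by (auto simp: homogeneous_elems_def)

lemma homogeneous_mult: "p \<in> homogeneous_elems homog \<Longrightarrow> q \<in> homogeneous_elems homog \<Longrightarrow>
    p * q \<in> homogeneous_elems homog"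
  unfolding homogeneous_elems_def using homog_mult by blast

lemma Proj_prime: "P \<in> Proj homog \<Longrightarrow> a * b \<in> P \<longleftrightarrow> a \<in> P \<or> b \<in> P"
  unfolding in_Proj_iff using is_ideal_mult_right[of P] unfolding is_ideal_def by metis

lemma Proj_one: "P \<in> Proj homog \<Longrightarrow> 1 \<notin> P"
  unfolding in_Proj_iff is_ideal_def by blast+

lemma Proj_power: "P \<in> Proj homog \<Longrightarrow> a \<notin> P \<Longrightarrow> a ^ N \<notin> P"
  by (induction N) (auto simp: Proj_one Proj_prime)

lemma in_denoms: "s \<in> homog d \<Longrightarrow> s \<notin> P \<Longrightarrow> s \<in> dn P"
  by (simp add: denoms_def homogeneous_elemsI)

lemma mult_set_denoms: "P \<in> Proj homog \<Longrightarrow> mult_set (dn P)"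
  by unfold_locales (auto simp: denoms_def Proj_one Proj_prime homogeneous_mult homogeneous_elemsI[OF homog_1])

lemma istopology_Proj:
  "istopology (\<lambda>U :: ('v::finite, 'a::comm_ring_1) mpoly set set. \<exists>F\<subseteq>homogeneous_elems homog. U = Proj homog - {P \<in> Proj homog. F \<subseteq> P})"
proof -
  define V :: "('v, 'a) mpoly set \<Rightarrow> ('v, 'a) mpoly set set" where "V F = {P \<in> Proj homog. \<not> F \<subseteq> P}" for F
  have V: "Proj homog - {P \<in> Proj homog. F \<subseteq> P} = V F" for F by (auto simp: V_def)
  show ?thesis
    unfolding istopology_def V
  proof (intro conjI allI impI)
    fix S T assume "\<exists>F\<subseteq>homogeneous_elems homog. S = V F" "\<exists>F\<subseteq>homogeneous_elems homog. T = V F"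
    then obtain F F' where F: "F \<subseteq> homogeneous_elems homog" "S = V F"
      "F' \<subseteq> homogeneous_elems homog" "T = V F'" by blast
    let ?F = "{f * g | f g. f \<in> F \<and> g \<in> F'}"
    have sub: "?F \<subseteq> homogeneous_elems homog" using F(1,3) homogeneous_mult by blast
    have "?F \<subseteq> P \<longleftrightarrow> F \<subseteq> P \<or> F' \<subseteq> P" if "P \<in> Proj homog" for P
      using Proj_prime[OF that] by blast
    then have "S \<inter> T = V ?F" unfolding F(2,4) V_def by blast
    then show "\<exists>F\<subseteq>homogeneous_elems homog. S \<inter> T = V F" using sub by blast
  next
    fix K assume K: "\<forall>S\<in>K. \<exists>F\<subseteq>homogeneous_elems homog. S = V F"
    let ?F = "\<Union>{F. F \<subseteq> homogeneous_elems homog \<and> V F \<in> K}"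
    have "\<Union>K = V ?F"
    proof
      show "\<Union>K \<subseteq> V ?F"
      proof
        fix P assume "P \<in> \<Union>K"
        then obtain S where S: "S \<in> K" "P \<in> S" by blast
        then obtain F where F: "F \<subseteq> homogeneous_elems homog" "S = V F" using K by blast
        then have "F \<subseteq> ?F" using S by blast
        then show "P \<in> V ?F" using S(2) unfolding F(2) V_def by blast
      qed
      show "V ?F \<subseteq> \<Union>K"
      proof
        fix P assume "P \<in> V ?F"
        then obtain F where "P \<in> Proj homog" "V F \<in> K" "\<not> F \<subseteq> P" unfolding V_def by blast
        then show "P \<in> \<Union>K" by (intro UnionI[of "V F"]) (auto simp: V_def)
      qed
    qed
    moreover have "?F \<subseteq> homogeneous_elems homog" by blast
    ultimately show "\<exists>F\<subseteq>homogeneous_elems homog. \<Union>K = V F" by blast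
  qed
qed

lemma op_iff: "opn U \<longleftrightarrow> (\<exists>F\<subseteq>homogeneous_elems homog. U = Proj homog - {P \<in> Proj homog. F \<subseteq> P})"
  unfolding Proj_topology_def by (simp only: topology_inverse'[OF istopology_Proj])

lemma op_subset_Proj: "opn U \<Longrightarrow> P \<in> U \<Longrightarrow> P \<in> Proj homog"
  by (auto simp: op_iff)

lemma op_Proj [simp]: "opn (Proj homog)"
  unfolding op_iff using Proj_one homogeneous_elemsI[OF homog_1]
  by (intro exI[of _ "{1}"]) auto

lemma topspace_Proj [simp]: "topspace (Proj_topology homog) = Proj homog"
  by (metis op_Proj op_subset_Proj openin_subset openin_topspace subsetI subset_antisym)

definition D :: "('v::finite, 'a::comm_ring_1) mpoly \<Rightarrow> ('v, 'a) mpoly set set" where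
  "D h = {P \<in> Proj homog. h \<notin> P}"

lemma op_D: "h \<in> homog d \<Longrightarrow> opn (D h)"
  unfolding op_iff D_def using homogeneous_elemsI by (intro exI[of _ "{h}"]) auto

lemma op_basic:
  assumes "opn U" "P \<in> U"
  obtains h d where "h \<in> homog d" "P \<in> D h" "D h \<subseteq> U"
proof -
  obtain F where F: "F \<subseteq> homogeneous_elems homog" "U = Proj homog - {P \<in> Proj homog. F \<subseteq> P}"
    using assms by (auto simp: op_iff)
  then obtain h where "h \<in> F" "h \<notin> P" using assms by auto
  moreover obtain d where "h \<in> homog d" using F calculation by (auto simp: homogeneous_elems_def)
  ultimately show ?thesis using that assms F by (auto simp: D_def)
qed

lemma Proj_cover: "P \<in> Proj homog \<Longrightarrow> \<exists>i. P \<in> D (Xvar i)"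
  by (auto simp: D_def in_Proj_iff)

text \<open>Multiplying numerator and denominator by the equation of a basic open set turns any local
  representation into one that is valid wherever its own denominator does not vanish.\<close>

lemma tw_iff:
  fixes U :: "('v::finite, 'a::comm_ring_1) mpoly set set"
  assumes U: "opn U"
  shows "\<sigma> \<in> tw k U \<longleftrightarrow> \<sigma> \<in> extensional U \<and> (\<forall>P\<in>U. \<exists>a s i j. a \<in> homog i \<and> s \<in> homog j \<and>
     int i = int j + k \<and> s \<notin> P \<and> (\<forall>Q\<in>U. s \<notin> Q \<longrightarrow> \<sigma> Q = fraction (dn Q) a s))"
proof (intro iffI)
  assume \<sigma>: "\<sigma> \<in> tw k U"
  show "\<sigma> \<in> extensional U \<and> (\<forall>P\<in>U. \<exists>a s i j. a \<in> homog i \<and> s \<in> homog j \<and>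
     int i = int j + k \<and> s \<notin> P \<and> (\<forall>Q\<in>U. s \<notin> Q \<longrightarrow> \<sigma> Q = fraction (dn Q) a s))"
  proof (intro conjI ballI)
    show "\<sigma> \<in> extensional U" using \<sigma> by (simp add: twisted_sections_def)
    fix P assume P: "P \<in> U"
    obtain V i j a s where V: "opn V" "P \<in> V" "V \<subseteq> U" "a \<in> homog i" "s \<in> homog j" "int i = int j + k"
      "\<forall>Q\<in>V. s \<notin> Q \<and> \<sigma> Q = fraction (dn Q) a s"
      using \<sigma>[unfolded twisted_sections_def, THEN CollectD, THEN conjunct2, THEN bspec, OF P]
      by (elim exE conjE) (rule that)
    obtain h d where h: "h \<in> homog d" "P \<in> D h" "D h \<subseteq> V" using op_basic[OF V(1,2)] .
    have "\<sigma> Q = fraction (dn Q) (a * h) (s * h)" if "Q \<in> U" "s * h \<notin> Q" for Q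
    proof -
      have Q: "Q \<in> Proj homog" using that U op_subset_Proj by blast
      interpret mult_set "dn Q" by (rule mult_set_denoms[OF Q])
      have nz: "s \<notin> Q" "h \<notin> Q" using that(2) Proj_prime[OF Q] by blast+
      then have "Q \<in> V" using h(3) Q unfolding D_def by blast
      then have "\<sigma> Q = fraction (dn Q) a s" using V(7) by blast
      also have "\<dots> = fraction (dn Q) (a * h) (s * h)"
        using in_denoms[OF V(5) nz(1)] in_denoms[OF h(1) nz(2)] by (simp only: fraction_cancel)
      finally show ?thesis .
    qed
    moreover have "s * h \<notin> P"
      using V(2,7) h(2) Proj_prime[OF op_subset_Proj[OF U P]] unfolding D_def by blast
    moreover have "a * h \<in> homog (i + d)" "s * h \<in> homog (j + d)" "int (i + d) = int (j + d) + k"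
      using V(4-6) h(1) by (simp_all add: homog_mult)
    ultimately show "\<exists>a s i j. a \<in> homog i \<and> s \<in> homog j \<and>
      int i = int j + k \<and> s \<notin> P \<and> (\<forall>Q\<in>U. s \<notin> Q \<longrightarrow> \<sigma> Q = fraction (dn Q) a s)"
      by blast
  qed
next
  assume r: "\<sigma> \<in> extensional U \<and> (\<forall>P\<in>U. \<exists>a s i j. a \<in> homog i \<and> s \<in> homog j \<and>
     int i = int j + k \<and> s \<notin> P \<and> (\<forall>Q\<in>U. s \<notin> Q \<longrightarrow> \<sigma> Q = fraction (dn Q) a s))"
  show "\<sigma> \<in> tw k U"
    unfolding twisted_sections_def
  proof (intro CollectI conjI ballI)
    fix P assume P: "P \<in> U"
    then obtain a s i j where *: "a \<in> homog i" "s \<in> homog j" "int i = int j + k" "s \<notin> P"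
      "\<And>Q. Q \<in> U \<Longrightarrow> s \<notin> Q \<Longrightarrow> \<sigma> Q = fraction (dn Q) a s" using r by meson
    have "opn (U \<inter> D s)" using U op_D[OF *(2)] by (rule openin_Int)
    moreover have "P \<in> U \<inter> D s" using P *(4) op_subset_Proj[OF U P] by (simp add: D_def)
    moreover have "\<forall>Q\<in>U \<inter> D s. s \<notin> Q \<and> \<sigma> Q = fraction (dn Q) a s" using *(5) by (simp add: D_def)
    ultimately show "\<exists>V. opn V \<and> P \<in> V \<and> V \<subseteq> U \<and> (\<exists>i j a s. a \<in> homog i \<and> s \<in> homog j \<and> int i = int j + k \<and>
        (\<forall>Q\<in>V. s \<notin> Q \<and> \<sigma> Q = fraction (dn Q) a s))"
      using *(1-3) by (meson Int_lower1)
  next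
    show "\<sigma> \<in> extensional U" using r by (rule conjunct1)
  qed
qed

lemma tw_extensional: "\<sigma> \<in> tw k U \<Longrightarrow> \<sigma> \<in> extensional U"
  by (simp add: twisted_sections_def)

lemma tw_local:
  assumes "opn U" "\<sigma> \<in> tw k U" "P \<in> U"
  obtains a s i j where "a \<in> homog i" "s \<in> homog j" "int i = int j + k" "s \<notin> P"
    "\<And>Q. Q \<in> U \<Longrightarrow> s \<notin> Q \<Longrightarrow> \<sigma> Q = fraction (dn Q) a s"
proof -
  obtain a s i j where *: "a \<in> homog i" "s \<in> homog j" "int i = int j + k" "s \<notin> P"
    "\<forall>Q\<in>U. s \<notin> Q \<longrightarrow> \<sigma> Q = fraction (dn Q) a s"
    using assms(2)[unfolded tw_iff[OF assms(1)], THEN conjunct2, THEN bspec, OF assms(3)]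
    by (elim conjE exE) (rule that)
  show thesis by (rule that[OF *(1-4)]) (simp add: *(5))
qed

lemma twI:
  assumes "opn U" "\<sigma> \<in> extensional U"
    "\<And>P. P \<in> U \<Longrightarrow> \<exists>a s i j. a \<in> homog i \<and> s \<in> homog j \<and>
     int i = int j + k \<and> s \<notin> P \<and> (\<forall>Q\<in>U. s \<notin> Q \<longrightarrow> \<sigma> Q = fraction (dn Q) a s)"
  shows "\<sigma> \<in> tw k U"
  unfolding tw_iff[OF assms(1)] by (intro conjI ballI assms(2) assms(3))

lemma tw_witness:
  assumes "a \<in> homog i" "s \<in> homog j" "int i = int j + k" "s \<notin> P"
    "\<And>Q. Q \<in> U \<Longrightarrow> s \<notin> Q \<Longrightarrow> \<sigma> Q = fraction (dn Q) a s"
  shows "\<exists>a s i j. a \<in> homog i \<and> s \<in> homog j \<and>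
     int i = int j + k \<and> s \<notin> P \<and> (\<forall>Q\<in>U. s \<notin> Q \<longrightarrow> \<sigma> Q = fraction (dn Q) a s)"
  using assms by (intro exI[of _ a] exI[of _ s] exI[of _ i] exI[of _ j]) simp

lemma tw_value [simp]:
  assumes "opn U" "\<sigma> \<in> tw k U" "P \<in> U"
  shows "\<sigma> P \<in> carrier (LL P)"
proof -
  obtain a s i j where a: "a \<in> homog i" "s \<in> homog j" "int i = int j + k" "s \<notin> P"
    "\<And>Q. Q \<in> U \<Longrightarrow> s \<notin> Q \<Longrightarrow> \<sigma> Q = fraction (dn Q) a s" by (rule tw_local[OF assms]) (rule that)
  interpret mult_set "dn P" by (rule mult_set_denoms[OF op_subset_Proj[OF assms(1,3)]])
  show ?thesis
    unfolding a(5)[OF assms(3) a(4)] by (rule fraction_closed[OF in_denoms[OF a(2,4)]])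
qed

lemma tw_eqI:
  assumes "\<sigma> \<in> extensional U" "\<tau> \<in> extensional U" "\<And>P. P \<in> U \<Longrightarrow> \<sigma> P = \<tau> P"
  shows "\<sigma> = \<tau>"
  using assms by (rule extensionalityI)

lemma sec_simps [simp]:
  "P \<in> U \<Longrightarrow> sec_mult homog U \<sigma> \<tau> P = \<sigma> P \<otimes>\<^bsub>LL P\<^esub> \<tau> P"
  "P \<in> U \<Longrightarrow> sec_add homog U \<sigma> \<tau> P = \<sigma> P \<oplus>\<^bsub>LL P\<^esub> \<tau> P"
  "P \<in> U \<Longrightarrow> sec_of homog U f P = fraction (dn P) f 1"
  by (simp_all add: sec_mult_def sec_add_def sec_of_def)

lemma sec_ext [simp]:
  "sec_mult homog U \<sigma> \<tau> \<in> extensional U" "sec_add homog U \<sigma> \<tau> \<in> extensional U"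
  "sec_of homog U f \<in> extensional U"
  by (simp_all add: sec_mult_def sec_add_def sec_of_def)

lemma sec_add_closed:
  assumes U: "opn U" and \<sigma>: "\<sigma> \<in> tw k U" and \<tau>: "\<tau> \<in> tw k U"
  shows "sec_add homog U \<sigma> \<tau> \<in> tw k U"
proof (rule twI[OF U sec_ext(2)])
  fix P assume P: "P \<in> U"
  obtain a s i j where a: "a \<in> homog i" "s \<in> homog j" "int i = int j + k" "s \<notin> P"
    "\<And>Q. Q \<in> U \<Longrightarrow> s \<notin> Q \<Longrightarrow> \<sigma> Q = fraction (dn Q) a s" by (rule tw_local[OF U \<sigma> P]) (rule that)
  obtain b t i' j' where b: "b \<in> homog i'" "t \<in> homog j'" "int i' = int j' + k" "t \<notin> P"
    "\<And>Q. Q \<in> U \<Longrightarrow> t \<notin> Q \<Longrightarrow> \<tau> Q = fraction (dn Q) b t" by (rule tw_local[OF U \<tau> P]) (rule that)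
  have deg: "i' + j = i + j'" using a b by linarith
  show "\<exists>a s i j. a \<in> homog i \<and> s \<in> homog j \<and>
     int i = int j + k \<and> s \<notin> P \<and> (\<forall>Q\<in>U. s \<notin> Q \<longrightarrow> sec_add homog U \<sigma> \<tau> Q = fraction (dn Q) a s)"
  proof (rule tw_witness)
    show "a * t + b * s \<in> homog (i + j')"
      using homog_mult[OF a(1) b(2)] homog_mult[OF b(1) a(2)] unfolding deg by (rule homog_add)
    show "s * t \<in> homog (j + j')" using a(2) b(2) by (rule homog_mult)
    show "int (i + j') = int (j + j') + k" using a(3) by simp
    show "s * t \<notin> P" using a(4) b(4) Proj_prime[OF op_subset_Proj[OF U P]] by simp
  next
    fix Q assume Q: "Q \<in> U" "s * t \<notin> Q"
    interpret mult_set "dn Q" by (rule mult_set_denoms[OF op_subset_Proj[OF U Q(1)]])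
    have "s \<notin> Q" "t \<notin> Q" using Q(2) Proj_prime[OF op_subset_Proj[OF U Q(1)]] by blast+
    then show "sec_add homog U \<sigma> \<tau> Q = fraction (dn Q) (a * t + b * s) (s * t)"
      using Q(1) a(5) b(5) in_denoms[OF a(2)] in_denoms[OF b(2)] by (simp add: fraction_add)
  qed
qed

lemma sec_mult_closed:
  assumes U: "opn U" and \<sigma>: "\<sigma> \<in> tw k U" and \<tau>: "\<tau> \<in> tw k' U" and k: "k'' = k + k'"
  shows "sec_mult homog U \<sigma> \<tau> \<in> tw k'' U"
proof (rule twI[OF U sec_ext(1)])
  fix P assume P: "P \<in> U"
  obtain a s i j where a: "a \<in> homog i" "s \<in> homog j" "int i = int j + k" "s \<notin> P"
    "\<And>Q. Q \<in> U \<Longrightarrow> s \<notin> Q \<Longrightarrow> \<sigma> Q = fraction (dn Q) a s" by (rule tw_local[OF U \<sigma> P]) (rule that)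
  obtain b t i' j' where b: "b \<in> homog i'" "t \<in> homog j'" "int i' = int j' + k'" "t \<notin> P"
    "\<And>Q. Q \<in> U \<Longrightarrow> t \<notin> Q \<Longrightarrow> \<tau> Q = fraction (dn Q) b t" by (rule tw_local[OF U \<tau> P]) (rule that)
  show "\<exists>a s i j. a \<in> homog i \<and> s \<in> homog j \<and>
     int i = int j + k'' \<and> s \<notin> P \<and> (\<forall>Q\<in>U. s \<notin> Q \<longrightarrow> sec_mult homog U \<sigma> \<tau> Q = fraction (dn Q) a s)"
  proof (rule tw_witness)
    show "a * b \<in> homog (i + i')" using a(1) b(1) by (rule homog_mult)
    show "s * t \<in> homog (j + j')" using a(2) b(2) by (rule homog_mult)
    show "int (i + i') = int (j + j') + k''" using a(3) b(3) k by simp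
    show "s * t \<notin> P" using a(4) b(4) Proj_prime[OF op_subset_Proj[OF U P]] by simp
  next
    fix Q assume Q: "Q \<in> U" "s * t \<notin> Q"
    interpret mult_set "dn Q" by (rule mult_set_denoms[OF op_subset_Proj[OF U Q(1)]])
    have "s \<notin> Q" "t \<notin> Q" using Q(2) Proj_prime[OF op_subset_Proj[OF U Q(1)]] by blast+
    then show "sec_mult homog U \<sigma> \<tau> Q = fraction (dn Q) (a * b) (s * t)"
      using Q(1) a(5) b(5) in_denoms[OF a(2)] in_denoms[OF b(2)] by (simp add: fraction_mult)
  qed
qed

lemma sec_of_closed:
  assumes "opn U" "f \<in> homog d"
  shows "sec_of homog U f \<in> tw (int d) U"
proof (rule twI[OF assms(1) sec_ext(3)])
  fix P assume P: "P \<in> U"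
  show "\<exists>a s i j. a \<in> homog i \<and> s \<in> homog j \<and> int i = int j + int d \<and> s \<notin> P \<and>
      (\<forall>Q\<in>U. s \<notin> Q \<longrightarrow> sec_of homog U f Q = fraction (dn Q) a s)"
    by (rule tw_witness[OF assms(2) homog_1]) (simp_all add: Proj_one[OF op_subset_Proj[OF assms(1) P]])
qed

lemma tw_restrict:
  assumes "opn U" "opn V" "V \<subseteq> U" "\<sigma> \<in> tw k U"
  shows "restrict \<sigma> V \<in> tw k V"
proof (rule twI[OF assms(2)])
  fix P assume P: "P \<in> V"
  then have "P \<in> U" using assms by blast
  obtain a s i j where a: "a \<in> homog i" "s \<in> homog j" "int i = int j + k" "s \<notin> P"
    "\<And>Q. Q \<in> U \<Longrightarrow> s \<notin> Q \<Longrightarrow> \<sigma> Q = fraction (dn Q) a s"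
    by (rule tw_local[OF assms(1,4) \<open>P \<in> U\<close>]) (rule that)
  show "\<exists>a s i j. a \<in> homog i \<and> s \<in> homog j \<and>
     int i = int j + k \<and> s \<notin> P \<and> (\<forall>Q\<in>V. s \<notin> Q \<longrightarrow> restrict \<sigma> V Q = fraction (dn Q) a s)"
    by (rule tw_witness[OF a(1-4)]) (simp add: a(5) subsetD[OF assms(3)])
qed simp

lemma tw_glue:
  assumes "opn U" "\<sigma> \<in> extensional U"
    and loc: "\<And>P. P \<in> U \<Longrightarrow> \<exists>V. opn V \<and> P \<in> V \<and> V \<subseteq> U \<and> restrict \<sigma> V \<in> tw k V"
  shows "\<sigma> \<in> tw k U"
  unfolding twisted_sections_def
proof (intro CollectI conjI ballI assms(2))
  fix P assume "P \<in> U"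
  then obtain V where V: "opn V" "P \<in> V" "V \<subseteq> U" "restrict \<sigma> V \<in> tw k V" using loc by blast
  obtain W i j a s where W: "opn W" "P \<in> W" "W \<subseteq> V" "a \<in> homog i" "s \<in> homog j" "int i = int j + k"
      "\<forall>Q\<in>W. s \<notin> Q \<and> restrict \<sigma> V Q = fraction (dn Q) a s"
    using V(4)[unfolded twisted_sections_def, THEN CollectD, THEN conjunct2, THEN bspec, OF V(2)]
    by (elim exE conjE) (rule that)
  have eq: "\<forall>Q\<in>W. s \<notin> Q \<and> \<sigma> Q = fraction (dn Q) a s"
  proof
    fix Q assume "Q \<in> W"
    then show "s \<notin> Q \<and> \<sigma> Q = fraction (dn Q) a s"
      using bspec[OF W(7)] subsetD[OF W(3)] by simp
  qed
  have sub: "W \<subseteq> U" using W(3) V(3) by (rule subset_trans)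
  show "\<exists>V. opn V \<and> P \<in> V \<and> V \<subseteq> U \<and> (\<exists>i j a s. a \<in> homog i \<and> s \<in> homog j \<and> int i = int j + k \<and>
        (\<forall>Q\<in>V. s \<notin> Q \<and> \<sigma> Q = fraction (dn Q) a s))"
    by (intro exI[of _ W] conjI exI[of _ i] exI[of _ j] exI[of _ a] exI[of _ s] W(1,2,4-6) sub eq)
qed

text \<open>The local generator \<open>x\<^sub>i\<^sup>k\<close> of O(k) over the chart where \<open>x\<^sub>i\<close> is invertible; for negative \<open>k\<close>
  the power is in the denominator.\<close>

definition xpow :: "'v::finite \<Rightarrow> int \<Rightarrow> ('v, 'a::comm_ring_1) mpoly set set \<Rightarrow> ('v, 'a) mpoly sect" where
  "xpow i k V = (\<lambda>P\<in>V. fraction (dn P) (Xvar i ^ nat k) (Xvar i ^ nat (- k)))"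

lemma xpow_closed:
  assumes "opn V" "V \<subseteq> D (Xvar i)"
  shows "xpow i k V \<in> tw k V"
proof (rule twI[OF assms(1)])
  show "xpow i k V \<in> extensional V" by (simp add: xpow_def)
  fix P assume "P \<in> V"
  then have "P \<in> Proj homog" "Xvar i \<notin> P" using assms by (auto simp: D_def)
  then show "\<exists>a s i' j. a \<in> homog i' \<and> s \<in> homog j \<and> int i' = int j + k \<and> s \<notin> P \<and>
      (\<forall>Q\<in>V. s \<notin> Q \<longrightarrow> xpow i k V Q = fraction (dn Q) a s)"
    by (intro tw_witness[OF homog_Xvar_power homog_Xvar_power]) (simp_all add: xpow_def Proj_power)
qed

lemma Xvar_power_denoms: "P \<in> D (Xvar i) \<Longrightarrow> Xvar i ^ N \<in> dn P"
  by (intro in_denoms[OF homog_Xvar_power]) (auto simp: D_def Proj_power)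

lemma xpow_add:
  fixes i :: "'v::finite" and V :: "('v, 'a::comm_ring_1) mpoly set set"
  assumes "P \<in> V" "V \<subseteq> D (Xvar i)"
  shows "xpow i k V P \<otimes>\<^bsub>LL P\<^esub> xpow i k' V P = xpow i (k + k') V P"
proof -
  have P: "P \<in> D (Xvar i)" "P \<in> Proj homog" using assms by (auto simp: D_def)
  interpret mult_set "dn P" by (rule mult_set_denoms[OF P(2)])
  have "nat k + nat k' + nat (- (k + k')) = nat (k + k') + (nat (- k) + nat (- k'))" by linarith
  then have "Xvar i ^ nat k * Xvar i ^ nat k' * Xvar i ^ nat (- (k + k'))
     = Xvar i ^ nat (k + k') * (Xvar i ^ nat (- k) * Xvar i ^ nat (- k') :: ('v, 'a) mpoly)"
    by (simp only: power_add[symmetric])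
  then have "fraction (dn P) (Xvar i ^ nat k * Xvar i ^ nat k') (Xvar i ^ nat (- k) * Xvar i ^ nat (- k'))
      = fraction (dn P) (Xvar i ^ nat (k + k')) (Xvar i ^ nat (- (k + k')))"
    using P(1) by (intro fraction_eqI mult_mem Xvar_power_denoms)
  then show ?thesis
    using assms(1) P by (simp only: xpow_def restrict_apply if_True fraction_mult Xvar_power_denoms)
qed

lemma xpow_0: "P \<in> V \<Longrightarrow> xpow i 0 V P = \<one>\<^bsub>LL P\<^esub>"
  by (simp add: xpow_def localization_def)

lemma sec_zero_closed:
  assumes "opn U"
  shows "sec_of homog U 0 \<in> tw k U"
proof (rule twI[OF assms sec_ext(3)])
  fix P assume "P \<in> U"
  then have P: "P \<in> Proj homog" using assms op_subset_Proj by blast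
  obtain i where i: "P \<in> D (Xvar i)" using Proj_cover[OF P] by blast
  show "\<exists>a s i j. a \<in> homog i \<and> s \<in> homog j \<and> int i = int j + k \<and> s \<notin> P \<and>
      (\<forall>Q\<in>U. s \<notin> Q \<longrightarrow> sec_of homog U 0 Q = fraction (dn Q) a s)"
  proof (rule tw_witness[OF homog_0[of "nat k"] homog_Xvar_power])
    show "int (nat k) = int (nat (- k)) + k" by simp
    show "Xvar i ^ nat (- k) \<notin> P" using i by (simp add: D_def Proj_power)
    fix Q assume Q: "Q \<in> U" "Xvar i ^ nat (- k) \<notin> Q"
    interpret mult_set "dn Q" by (rule mult_set_denoms[OF op_subset_Proj[OF assms Q(1)]])
    show "sec_of homog U 0 Q = fraction (dn Q) 0 (Xvar i ^ nat (- k))"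
      using Q by (simp add: fraction_zero[OF in_denoms[OF homog_Xvar_power]])
  qed
qed

section \<open>Global sections of the twisting sheaves\<close>

lemma span_ideal_least:
  assumes "is_ideal I" "H \<subseteq> I"
  shows "span_ideal H \<subseteq> I"
proof
  fix x assume "x \<in> span_ideal H"
  then obtain F c where x: "x = (\<Sum>h\<in>F. c h * h)" and F: "F \<subseteq> H"
    unfolding span_ideal_def by blast
  show "x \<in> I" unfolding x
  proof (rule is_ideal_sum[OF assms(1)])
    fix h assume "h \<in> F"
    then have "h \<in> I" using F assms(2) by blast
    then show "c h * h \<in> I" by (rule is_idealD(3)[OF assms(1)])
  qed
qed

lemma span_ideal_image:
  fixes g :: "'i \<Rightarrow> 's::comm_ring_1"
  assumes "finite F" "x \<in> span_ideal (g ` F)"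
  shows "\<exists>c. x = (\<Sum>s\<in>F. c s * g s)"
proof -
  let ?I = "{(\<Sum>s\<in>F. c s * g s) | c. True}"
  have "is_ideal ?I"
    unfolding is_ideal_def
  proof (intro conjI ballI allI)
    show "0 \<in> ?I" by (intro CollectI exI[of _ "\<lambda>_. 0"]) simp
  next
    fix x y assume "x \<in> ?I" "y \<in> ?I"
    then obtain c d where "x = (\<Sum>s\<in>F. c s * g s)" "y = (\<Sum>s\<in>F. d s * g s)" by blast
    then have "x + y = (\<Sum>s\<in>F. (c s + d s) * g s)" by (simp add: distrib_right sum.distrib)
    then show "x + y \<in> ?I" by (intro CollectI exI conjI TrueI)
  next
    fix x e assume "x \<in> ?I"
    then obtain c where "x = (\<Sum>s\<in>F. c s * g s)" by blast
    then have "e * x = (\<Sum>s\<in>F. (e * c s) * g s)" by (simp add: sum_distrib_left mult.assoc)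
    then show "e * x \<in> ?I" by (intro CollectI exI conjI TrueI)
  qed
  moreover have "g ` F \<subseteq> ?I"
  proof
    fix y assume "y \<in> g ` F"
    then obtain s where s: "s \<in> F" "y = g s" by blast
    have "(\<Sum>t\<in>F. (if t = s then 1 else 0) * g t) = (\<Sum>t\<in>F. if t = s then g s else 0)"
      by (rule sum.cong) auto
    also have "\<dots> = y" using s assms(1) by simp
    finally show "y \<in> ?I" by (intro CollectI exI[of _ "\<lambda>t. if t = s then 1 else 0"]) simp
  qed
  ultimately have "span_ideal (g ` F) \<subseteq> ?I" by (rule span_ideal_least)
  then show ?thesis using assms(2) by blast
qed

lemma homogeneous_one: "1 \<in> homogeneous_elems homog"
  by (rule homogeneous_elemsI[OF homog_1])

lemma Proj_is_ideal: "P \<in> Proj homog \<Longrightarrow> is_ideal P"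
  by (simp add: in_Proj_iff)

lemma span_ideal_finite:
  assumes "x \<in> span_ideal H"
  shows "\<exists>F. finite F \<and> F \<subseteq> H \<and> x \<in> span_ideal F"
proof -
  obtain F c where "x = (\<Sum>h\<in>F. c h * h)" "finite F" "F \<subseteq> H"
    using assms unfolding span_ideal_def by blast
  moreover from this have "x \<in> span_ideal F"
    unfolding span_ideal_def by (intro CollectI exI[of _ F] exI[of _ c]) simp
  ultimately show ?thesis by (intro exI[of _ F] conjI)
qed

text \<open>A power of each of the finitely many variables is a combination of finitely many elements
  of \<open>H\<close>.\<close>

lemma Proj_quasicompact:
  fixes H :: "('v::finite, 'a::comm_ring_1) mpoly set"
  assumes H: "H \<subseteq> homogeneous_elems homog" and cov: "\<And>Q. Q \<in> Proj homog \<Longrightarrow> \<not> H \<subseteq> Q"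
  obtains F where "F \<subseteq> H" "finite F" "\<And>Q. Q \<in> Proj homog \<Longrightarrow> \<not> F \<subseteq> Q"
proof -
  have "\<exists>F. finite F \<and> F \<subseteq> H \<and> (\<exists>N. (1 * Xvar i) ^ N \<in> span_ideal F)" for i
  proof -
    obtain N where "(1 * Xvar i) ^ N \<in> span_ideal H"
      using Proj_Nullstellensatz[OF H homogeneous_one cov, of i] by blast
    from span_ideal_finite[OF this] show ?thesis by blast
  qed
  then have "\<exists>F. \<forall>i. finite (F i) \<and> F i \<subseteq> H \<and> (\<exists>N. (1 * Xvar i) ^ N \<in> span_ideal (F i))"
    by (intro choice allI)
  then obtain F where F: "\<And>i. finite (F i)" "\<And>i. F i \<subseteq> H" "\<And>i. \<exists>N. (1 * Xvar i) ^ N \<in> span_ideal (F i)"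
    by blast
  show thesis
  proof (rule that)
    show "(\<Union>i. F i) \<subseteq> H" using F(2) by (rule UN_least)
    show "finite (\<Union>i. F i)" using F(1) by simp
    fix Q :: "('v, 'a) mpoly set" assume Q: "Q \<in> Proj homog"
    show "\<not> (\<Union>i. F i) \<subseteq> Q"
    proof
      assume sub: "(\<Union>i. F i) \<subseteq> Q"
      obtain i where i: "Xvar i \<notin> Q" using Q by (auto simp: in_Proj_iff)
      obtain N where N: "(1 * Xvar i) ^ N \<in> span_ideal (F i)" using F(3) by blast
      have "F i \<subseteq> Q" using sub by blast
      then have "span_ideal (F i) \<subseteq> Q" by (rule span_ideal_least[OF Proj_is_ideal[OF Q]])
      then have "Xvar i ^ N \<in> Q" using N by auto
      then show False using Proj_power[OF Q i] by blast
    qed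
  qed
qed

text \<open>The homogeneous elements that annihilate \<open>x\<close> have no common zero where \<open>h\<close> is invertible.
  The Nullstellensatz then annihilates \<open>x\<close> by a power of \<open>h x\<^sub>i\<close>, and \<open>x\<^sub>i\<close> can be cancelled since it is
  not a zero divisor.\<close>

lemma vanishing_on_D:
  fixes x :: "('v::finite, 'a::comm_ring_1) mpoly"
  assumes h: "h \<in> homogeneous_elems homog"
    and loc: "\<And>Q. Q \<in> Proj homog \<Longrightarrow> h \<notin> Q \<Longrightarrow> \<exists>u\<in>dn Q. u * x = 0"
  shows "\<exists>M. h ^ M * x = 0"
proof -
  let ?H = "{u \<in> homogeneous_elems homog. u * x = 0}"
  fix i :: 'v
  have "\<exists>N. (h * Xvar i) ^ N \<in> span_ideal ?H"
  proof (rule Proj_Nullstellensatz[OF _ h])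
    fix Q :: "('v, 'a) mpoly set" assume Q: "Q \<in> Proj homog" "h \<notin> Q"
    then obtain u where "u \<in> dn Q" "u * x = 0" using loc by blast
    then have "u \<in> ?H" "u \<notin> Q" by (auto simp: denoms_def)
    then show "\<not> ?H \<subseteq> Q" by blast
  qed blast
  then obtain N where "(h * Xvar i) ^ N \<in> span_ideal ?H" by blast
  moreover have "span_ideal ?H \<subseteq> {y. y * x = 0}"
  proof (rule span_ideal_least)
    show "is_ideal {y. y * x = 0}"
      unfolding is_ideal_def by (simp add: distrib_right mult.assoc)
  qed blast
  ultimately have "(h * Xvar i) ^ N * x = 0" by blast
  then have "Xvar i ^ N * (h ^ N * x) = 0" by (simp add: power_mult_distrib mult.assoc mult.left_commute)
  then show ?thesis using Xvar_power_eq_0 by blast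
qed

lemma polynomial_determined_by_germs:
  fixes f g :: "('v::finite, 'a::comm_ring_1) mpoly"
  assumes "\<And>Q. Q \<in> Proj homog \<Longrightarrow> fraction (dn Q) f 1 = fraction (dn Q) g 1"
  shows "f = g"
proof -
  have "\<exists>M. 1 ^ M * (f - g) = 0"
  proof (rule vanishing_on_D[OF homogeneous_one])
    fix Q :: "('v, 'a) mpoly set" assume Q: "Q \<in> Proj homog"
    interpret mult_set "dn Q" by (rule mult_set_denoms[OF Q])
    show "\<exists>u\<in>dn Q. u * (f - g) = 0"
      using assms[OF Q] by (simp add: fraction_eq_iff)
  qed
  then show ?thesis by simp
qed

text \<open>A global section is given by fractions \<open>a\<^sub>s/s\<close> on finitely many basic open sets.  After passing
  to powers of the denominators the cross products \<open>a\<^sub>s t\<close> and \<open>a\<^sub>t s\<close> agree on the nose, so that a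
  partition of unity yields \<open>f\<^sub>i / x\<^sub>i\<^sup>N\<close> on each chart.  Comparing two charts shows that \<open>x\<^sub>i\<^sup>N\<close>
  divides \<open>f\<^sub>i\<close>; here at least two variables are needed.\<close>

lemma global_section_polynomial:
  fixes \<sigma> :: "('v::finite, 'a::comm_ring_1) mpoly sect"
  assumes \<sigma>: "\<sigma> \<in> tw k (Proj homog)" and two: "(i0 :: 'v) \<noteq> j0"
  obtains g where "\<And>Q. Q \<in> Proj homog \<Longrightarrow> \<sigma> Q = fraction (dn Q) g 1"
    "k \<ge> 0 \<Longrightarrow> g \<in> homog (nat k)" "k < 0 \<Longrightarrow> g = 0"
proof -
  define good where "good a s \<longleftrightarrow> (\<exists>i j. a \<in> homog i \<and> s \<in> homog j \<and> int i = int j + k) \<and>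
     (\<forall>Q\<in>Proj homog. s \<notin> Q \<longrightarrow> \<sigma> Q = fraction (dn Q) a s)" for a s
  have goodH: "s \<in> homogeneous_elems homog" if "good a s" for a s
    using that homogeneous_elemsI unfolding good_def by blast
  obtain F where F: "F \<subseteq> {s. \<exists>a. good a s}" "finite F" "\<And>Q. Q \<in> Proj homog \<Longrightarrow> \<not> F \<subseteq> Q"
  proof (rule Proj_quasicompact[of "{s. \<exists>a. good a s}"])
    show "{s. \<exists>a. good a s} \<subseteq> homogeneous_elems homog" using goodH by blast
  next
    fix Q :: "('v, 'a) mpoly set" assume Q: "Q \<in> Proj homog"
    obtain a s i j where a: "a \<in> homog i" "s \<in> homog j" "int i = int j + k" "s \<notin> Q"
      "\<And>Q. Q \<in> Proj homog \<Longrightarrow> s \<notin> Q \<Longrightarrow> \<sigma> Q = fraction (dn Q) a s"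
      by (rule tw_local[OF op_Proj \<sigma> Q]) (rule that)
    have "good a s" unfolding good_def
      by (intro conjI exI[of _ i] exI[of _ j] a(1-3) ballI impI a(5))
    then show "\<not> {s. \<exists>a. good a s} \<subseteq> Q" using a(4) by blast
  qed (rule that)
  have "\<forall>s\<in>F. \<exists>a. good a s" using F(1) by blast
  then obtain A where A: "\<And>s. s \<in> F \<Longrightarrow> good (A s) s" by metis
  have "\<exists>M. (s * t) ^ M * (A s * t - A t * s) = 0" if st: "s \<in> F" "t \<in> F" for s t
  proof (rule vanishing_on_D)
    show "s * t \<in> homogeneous_elems homog" using goodH[OF A] st by (simp add: homogeneous_mult)
    fix Q :: "('v, 'a) mpoly set" assume Q: "Q \<in> Proj homog" "s * t \<notin> Q"
    interpret mult_set "dn Q" by (rule mult_set_denoms[OF Q(1)])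
    have nz: "s \<notin> Q" "t \<notin> Q" using Q Proj_prime[OF Q(1)] by blast+
    then have d: "s \<in> dn Q" "t \<in> dn Q" using goodH[OF A] st by (simp_all add: denoms_def)
    have "\<sigma> Q = fraction (dn Q) (A s) s" "\<sigma> Q = fraction (dn Q) (A t) t"
      using A[OF st(1)] A[OF st(2)] Q(1) nz unfolding good_def by blast+
    then have "fraction (dn Q) (A s) s = fraction (dn Q) (A t) t" by simp
    then show "\<exists>u\<in>dn Q. u * (A s * t - A t * s) = 0" by (simp add: fraction_eq_iff[OF d])
  qed
  note ex_m = this
  define m where "m s t = (SOME M. (s * t) ^ M * (A s * t - A t * s) = 0)" for s t
  have m: "(s * t) ^ m s t * (A s * t - A t * s) = 0" if "s \<in> F" "t \<in> F" for s t
    unfolding m_def by (rule someI_ex[OF ex_m[OF that]])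
  (* a common bound for the finitely many exponents *)
  define M where "M = (\<Sum>s\<in>F. \<Sum>t\<in>F. m s t)"
  have cross: "(s * t) ^ M * (A s * t - A t * s) = 0" if "s \<in> F" "t \<in> F" for s t
  proof -
    have "m s t \<le> (\<Sum>t\<in>F. m s t)" using that F(2) by (intro member_le_sum) auto
    also have "\<dots> \<le> M" unfolding M_def using that F(2)
      by (intro member_le_sum[of s F "\<lambda>s. \<Sum>t\<in>F. m s t"]) auto
    finally have "M = (M - m s t) + m s t" by simp
    then obtain r where "M = r + m s t" ..
    then show ?thesis using m[OF that] by (simp add: power_add mult.assoc)
  qed
  define B where "B s = A s * s ^ M" for s
  define p where "p s = s ^ Suc M" for s :: "('v, 'a) mpoly"
  have compat: "B s * p t = B t * p s" if "s \<in> F" "t \<in> F" for s t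
  proof -
    have "B s * p t - B t * p s = (s * t) ^ M * (A s * t - A t * s)"
      by (simp add: B_def p_def power_mult_distrib algebra_simps)
    then show ?thesis using cross[OF that] by simp
  qed
  have pH: "p s \<in> homogeneous_elems homog" if s: "s \<in> F" for s
  proof -
    obtain d where "s \<in> homog d" using goodH[OF A[OF s]] unfolding homogeneous_elems_def by blast
    then show ?thesis unfolding p_def by (rule homogeneous_elemsI[OF homog_power])
  qed
  have chart: "\<exists>N c f. Xvar i ^ N = (\<Sum>s\<in>F. c s * p s) \<and> (\<forall>t\<in>F. f * p t = Xvar i ^ N * B t)" for i
  proof -
    have "\<exists>N. (1 * Xvar i) ^ N \<in> span_ideal (p ` F)"
    proof (rule Proj_Nullstellensatz[OF _ homogeneous_one])
      show "p ` F \<subseteq> homogeneous_elems homog" using pH by blast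
      fix Q :: "('v, 'a) mpoly set" assume Q: "Q \<in> Proj homog"
      then obtain s where s: "s \<in> F" "s \<notin> Q" using F(3) by blast
      then have "p s \<notin> Q" unfolding p_def using Proj_power[OF Q] by blast
      then show "\<not> p ` F \<subseteq> Q" using s(1) by blast
    qed
    then obtain N where "Xvar i ^ N \<in> span_ideal (p ` F)" unfolding mult_1 ..
    from span_ideal_image[OF F(2) this] obtain c where c: "Xvar i ^ N = (\<Sum>s\<in>F. c s * p s)" ..
    have "(\<Sum>s\<in>F. c s * B s) * p t = Xvar i ^ N * B t" if "t \<in> F" for t
    proof -
      have "(\<Sum>s\<in>F. c s * B s) * p t = (\<Sum>s\<in>F. c s * (B s * p t))"
        unfolding sum_distrib_right by (simp add: mult.assoc)
      also have "\<dots> = (\<Sum>s\<in>F. c s * (B t * p s))"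
        by (rule sum.cong) (simp_all add: compat that)
      also have "\<dots> = Xvar i ^ N * B t"
        unfolding c sum_distrib_right by (rule sum.cong) (simp_all add: mult_ac)
      finally show ?thesis .
    qed
    then show ?thesis using c by blast
  qed
  obtain N c f where i0: "Xvar i0 ^ N = (\<Sum>s\<in>F. c s * p s)" "\<And>t. t \<in> F \<Longrightarrow> f * p t = Xvar i0 ^ N * B t"
    using chart[of i0] by blast
  obtain N' f' where j0: "\<And>t. t \<in> F \<Longrightarrow> f' * p t = Xvar j0 ^ N' * B t"
    using chart[of j0] by blast
  let ?d = "Xvar j0 ^ N' * f - Xvar i0 ^ N * f'"
  have "?d * p t = 0" if "t \<in> F" for t
  proof -
    have "?d * p t = Xvar j0 ^ N' * (f * p t) - Xvar i0 ^ N * (f' * p t)"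
      by (simp add: algebra_simps)
    also have "\<dots> = 0" unfolding i0(2)[OF that] j0[OF that] by (simp add: mult.left_commute)
    finally show ?thesis .
  qed
  then have "(\<Sum>s\<in>F. c s * (?d * p s)) = 0" by simp
  then have "Xvar i0 ^ N * ?d = 0"
    unfolding i0(1) sum_distrib_right by (simp add: mult_ac)
  then have "?d = 0" by (rule Xvar_power_eq_0)
  then have "Xvar j0 ^ N' * f = Xvar i0 ^ N * f'" by simp
  then have "Xvar i0 ^ N dvd f" by (rule Xvar_power_dvd[OF two])
  then obtain g where g: "f = Xvar i0 ^ N * g" by (rule dvdE)
  have gp: "g * p t = B t" if "t \<in> F" for t
  proof -
    have "Xvar i0 ^ N * (g * p t) = Xvar i0 ^ N * B t" using i0(2)[OF that] unfolding g by (simp only: mult.assoc)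
    then show ?thesis by (rule Xvar_power_cancel)
  qed
  (* nothing is known yet about the degrees in g; only its component of degree k matters *)
  define g0 where "g0 = (if k \<ge> 0 then hcomp (nat k) g else 0)"
  have g0p: "g0 * p t = B t" if t: "t \<in> F" for t
  proof -
    obtain i j where ij: "A t \<in> homog i" "t \<in> homog j" "int i = int j + k"
      using A[OF t] unfolding good_def by blast
    have p: "p t \<in> homog (Suc M * j)" unfolding p_def using ij(2) by (rule homog_power)
    have b: "B t \<in> homog (i + M * j)" unfolding B_def using ij by (intro homog_mult homog_power)
    have deg: "int (i + M * j) = int (Suc M * j) + k" using ij(3) by simp
    show ?thesis
    proof (cases "k \<ge> 0")
      case True
      then have deg': "i + M * j = nat k + Suc M * j" using deg by linarith
      have "g0 * p t = hcomp (nat k + Suc M * j) (g * p t)"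
        using True hcomp_mult_homog(1)[OF p, of "nat k" g] by (simp add: g0_def)
      also have "\<dots> = B t" unfolding gp[OF t] hcomp_of_homog[OF b] using deg' by simp
      finally show ?thesis .
    next
      case False
      then have "i + M * j < Suc M * j" using deg by linarith
      then have "hcomp (i + M * j) (g * p t) = 0" by (rule hcomp_mult_homog(2)[OF p])
      then have "B t = 0" unfolding gp[OF t] hcomp_of_homog[OF b] by simp
      then show ?thesis using False by (simp add: g0_def)
    qed
  qed
  show thesis
  proof (rule that)
    fix Q :: "('v, 'a) mpoly set" assume Q: "Q \<in> Proj homog"
    interpret mult_set "dn Q" by (rule mult_set_denoms[OF Q])
    obtain t where t: "t \<in> F" "t \<notin> Q" using F(3)[OF Q] by blast
    have d: "t \<in> dn Q" using goodH[OF A[OF t(1)]] t(2) by (simp add: denoms_def)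
    have dp: "t ^ r \<in> dn Q" for r by (induction r) (simp_all add: d)
    have "\<sigma> Q = fraction (dn Q) (A t) t" using A[OF t(1)] Q t(2) unfolding good_def by blast
    also have "\<dots> = fraction (dn Q) (B t) (p t)"
      unfolding B_def p_def power_Suc using fraction_cancel[OF d dp] by simp
    also have "\<dots> = fraction (dn Q) g0 1"
      unfolding g0p[OF t(1), symmetric] p_def by (rule fraction_eqI[OF dp one_mem]) simp
    finally show "\<sigma> Q = fraction (dn Q) g0 1" .
  qed (simp_all add: g0_def)
qed

lemma global_sections_nonneg:
  fixes \<sigma> :: "('v::finite, 'a::comm_ring_1) mpoly sect"
  assumes \<sigma>: "\<sigma> \<in> tw (int d) (Proj homog)" and two: "(i0 :: 'v) \<noteq> j0"
  shows "\<exists>g\<in>homog d. \<sigma> = sec_of homog (Proj homog) g"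
proof -
  obtain g where g: "\<And>Q. Q \<in> Proj homog \<Longrightarrow> \<sigma> Q = fraction (dn Q) g 1" "int d \<ge> 0 \<Longrightarrow> g \<in> homog (nat (int d))"
    by (rule global_section_polynomial[OF assms]) (rule that)
  have "\<sigma> = sec_of homog (Proj homog) g"
    by (rule tw_eqI[OF tw_extensional[OF \<sigma>] sec_ext(3)]) (simp add: g(1))
  then show ?thesis using g(2) by auto
qed

lemma global_sections_neg:
  fixes \<sigma> :: "('v::finite, 'a::comm_ring_1) mpoly sect"
  assumes \<sigma>: "\<sigma> \<in> tw k (Proj homog)" "k < 0" and two: "(i0 :: 'v) \<noteq> j0"
  shows "\<sigma> = sec_of homog (Proj homog) 0"
proof -
  obtain g where g: "\<And>Q. Q \<in> Proj homog \<Longrightarrow> \<sigma> Q = fraction (dn Q) g 1" "k < 0 \<Longrightarrow> g = 0"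
    by (rule global_section_polynomial[OF \<sigma>(1) two]) (rule that)
  show ?thesis
    by (rule tw_eqI[OF tw_extensional[OF \<sigma>(1)] sec_ext(3)]) (simp add: g(1) g(2)[OF \<sigma>(2)])
qed

lemma sec_of_inject:
  fixes f g :: "('v::finite, 'a::comm_ring_1) mpoly"
  shows "sec_of homog (Proj homog) f = sec_of homog (Proj homog) g \<longleftrightarrow> f = g"
proof
  assume eq: "sec_of homog (Proj homog) f = sec_of homog (Proj homog) g"
  show "f = g"
  proof (rule polynomial_determined_by_germs)
    fix Q :: "('v, 'a) mpoly set" assume "Q \<in> Proj homog"
    then show "fraction (dn Q) f 1 = fraction (dn Q) g 1" using fun_cong[OF eq, of Q] by simp
  qed
qed simp

section \<open>Third exterior powers and alternating forms\<close>

definition ext3_gens :: "'r ring \<Rightarrow> ('r, 'm) module \<Rightarrow> ('m \<times> 'm \<times> 'm \<Rightarrow>\<^sub>0 int) set" where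
  "ext3_gens A M =
     (\<Union>u\<in>carrier M. \<Union>v\<in>carrier M. \<Union>w\<in>carrier M.
        {frag_of (u, u, w), frag_of (u, w, w), frag_of (u, w, u)}
        \<union> (\<Union>x\<in>carrier M.
             {frag_of (u \<oplus>\<^bsub>M\<^esub> x, v, w) - frag_of (u, v, w) - frag_of (x, v, w),
              frag_of (u, v \<oplus>\<^bsub>M\<^esub> x, w) - frag_of (u, v, w) - frag_of (u, x, w),
              frag_of (u, v, w \<oplus>\<^bsub>M\<^esub> x) - frag_of (u, v, w) - frag_of (u, v, x)})
        \<union> (\<Union>c\<in>carrier A.
             {frag_of (c \<odot>\<^bsub>M\<^esub> u, v, w) - frag_of (u, c \<odot>\<^bsub>M\<^esub> v, w),
              frag_of (u, c \<odot>\<^bsub>M\<^esub> v, w) - frag_of (u, v, c \<odot>\<^bsub>M\<^esub> w)}))"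

lemma ext3_rels_gens: "ext3_rels A M = generate (ext3_free M) (ext3_gens A M)"
  unfolding ext3_rels_def ext3_gens_def ..

lemma ext3_gens_supset:
  assumes "u \<in> carrier M" "v \<in> carrier M" "w \<in> carrier M"
  shows "{frag_of (u, u, w), frag_of (u, w, w), frag_of (u, w, u)}
        \<union> (\<Union>x\<in>carrier M.
             {frag_of (u \<oplus>\<^bsub>M\<^esub> x, v, w) - frag_of (u, v, w) - frag_of (x, v, w),
              frag_of (u, v \<oplus>\<^bsub>M\<^esub> x, w) - frag_of (u, v, w) - frag_of (u, x, w),
              frag_of (u, v, w \<oplus>\<^bsub>M\<^esub> x) - frag_of (u, v, w) - frag_of (u, v, x)})
        \<union> (\<Union>c\<in>carrier A.
             {frag_of (c \<odot>\<^bsub>M\<^esub> u, v, w) - frag_of (u, c \<odot>\<^bsub>M\<^esub> v, w),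
              frag_of (u, c \<odot>\<^bsub>M\<^esub> v, w) - frag_of (u, v, c \<odot>\<^bsub>M\<^esub> w)}) \<subseteq> ext3_gens A M"
  unfolding ext3_gens_def
  by (rule SUP_upper2[OF assms(1)], rule SUP_upper2[OF assms(2)], rule SUP_upper2[OF assms(3)], rule subset_refl)

lemma ext3_gens_induct:
  assumes "z \<in> ext3_gens A M"
    and "\<And>u w. u \<in> carrier M \<Longrightarrow> w \<in> carrier M \<Longrightarrow> Q (frag_of (u, u, w))"
    and "\<And>u w. u \<in> carrier M \<Longrightarrow> w \<in> carrier M \<Longrightarrow> Q (frag_of (u, w, w))"
    and "\<And>u w. u \<in> carrier M \<Longrightarrow> w \<in> carrier M \<Longrightarrow> Q (frag_of (u, w, u))"
    and "\<And>u v w x. u \<in> carrier M \<Longrightarrow> v \<in> carrier M \<Longrightarrow> w \<in> carrier M \<Longrightarrow> x \<in> carrier M \<Longrightarrow>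
       Q (frag_of (u \<oplus>\<^bsub>M\<^esub> x, v, w) - frag_of (u, v, w) - frag_of (x, v, w))"
    and "\<And>u v w x. u \<in> carrier M \<Longrightarrow> v \<in> carrier M \<Longrightarrow> w \<in> carrier M \<Longrightarrow> x \<in> carrier M \<Longrightarrow>
       Q (frag_of (u, v \<oplus>\<^bsub>M\<^esub> x, w) - frag_of (u, v, w) - frag_of (u, x, w))"
    and "\<And>u v w x. u \<in> carrier M \<Longrightarrow> v \<in> carrier M \<Longrightarrow> w \<in> carrier M \<Longrightarrow> x \<in> carrier M \<Longrightarrow>
       Q (frag_of (u, v, w \<oplus>\<^bsub>M\<^esub> x) - frag_of (u, v, w) - frag_of (u, v, x))"
    and "\<And>c u v w. c \<in> carrier A \<Longrightarrow> u \<in> carrier M \<Longrightarrow> v \<in> carrier M \<Longrightarrow> w \<in> carrier M \<Longrightarrow>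
       Q (frag_of (c \<odot>\<^bsub>M\<^esub> u, v, w) - frag_of (u, c \<odot>\<^bsub>M\<^esub> v, w))"
    and "\<And>c u v w. c \<in> carrier A \<Longrightarrow> u \<in> carrier M \<Longrightarrow> v \<in> carrier M \<Longrightarrow> w \<in> carrier M \<Longrightarrow>
       Q (frag_of (u, c \<odot>\<^bsub>M\<^esub> v, w) - frag_of (u, v, c \<odot>\<^bsub>M\<^esub> w))"
  shows "Q z"
  using assms(1) unfolding ext3_gens_def
  by (elim UN_E UnE insertE emptyE) (simp_all only: assms(2-))

definition alt_form :: "'r ring \<Rightarrow> ('r, 'm) module \<Rightarrow> ('m \<Rightarrow> 'm \<Rightarrow> 'm \<Rightarrow> 'r) \<Rightarrow> bool" where
  "alt_form A M \<omega> \<longleftrightarrow> (\<forall>u\<in>carrier M. \<forall>v\<in>carrier M. \<forall>w\<in>carrier M.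
     \<omega> u v w \<in> carrier A \<and>
     \<omega> u u w = \<zero>\<^bsub>A\<^esub> \<and> \<omega> u w w = \<zero>\<^bsub>A\<^esub> \<and> \<omega> u w u = \<zero>\<^bsub>A\<^esub> \<and>
     (\<forall>x\<in>carrier M. \<omega> (u \<oplus>\<^bsub>M\<^esub> x) v w = \<omega> u v w \<oplus>\<^bsub>A\<^esub> \<omega> x v w \<and>
        \<omega> u (v \<oplus>\<^bsub>M\<^esub> x) w = \<omega> u v w \<oplus>\<^bsub>A\<^esub> \<omega> u x w \<and>
        \<omega> u v (w \<oplus>\<^bsub>M\<^esub> x) = \<omega> u v w \<oplus>\<^bsub>A\<^esub> \<omega> u v x) \<and>
     (\<forall>c\<in>carrier A. \<omega> (c \<odot>\<^bsub>M\<^esub> u) v w = c \<otimes>\<^bsub>A\<^esub> \<omega> u v w \<and>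
        \<omega> u (c \<odot>\<^bsub>M\<^esub> v) w = c \<otimes>\<^bsub>A\<^esub> \<omega> u v w \<and> \<omega> u v (c \<odot>\<^bsub>M\<^esub> w) = c \<otimes>\<^bsub>A\<^esub> \<omega> u v w))"

lemma alt_formD:
  assumes "alt_form A M \<omega>" "u \<in> carrier M" "v \<in> carrier M" "w \<in> carrier M"
  shows "\<omega> u v w \<in> carrier A" "\<omega> u u w = \<zero>\<^bsub>A\<^esub>" "\<omega> u w w = \<zero>\<^bsub>A\<^esub>" "\<omega> u w u = \<zero>\<^bsub>A\<^esub>"
    "x \<in> carrier M \<Longrightarrow> \<omega> (u \<oplus>\<^bsub>M\<^esub> x) v w = \<omega> u v w \<oplus>\<^bsub>A\<^esub> \<omega> x v w"
    "x \<in> carrier M \<Longrightarrow> \<omega> u (v \<oplus>\<^bsub>M\<^esub> x) w = \<omega> u v w \<oplus>\<^bsub>A\<^esub> \<omega> u x w"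
    "x \<in> carrier M \<Longrightarrow> \<omega> u v (w \<oplus>\<^bsub>M\<^esub> x) = \<omega> u v w \<oplus>\<^bsub>A\<^esub> \<omega> u v x"
    "c \<in> carrier A \<Longrightarrow> \<omega> (c \<odot>\<^bsub>M\<^esub> u) v w = c \<otimes>\<^bsub>A\<^esub> \<omega> u v w"
    "c \<in> carrier A \<Longrightarrow> \<omega> u (c \<odot>\<^bsub>M\<^esub> v) w = c \<otimes>\<^bsub>A\<^esub> \<omega> u v w"
    "c \<in> carrier A \<Longrightarrow> \<omega> u v (c \<odot>\<^bsub>M\<^esub> w) = c \<otimes>\<^bsub>A\<^esub> \<omega> u v w"
  using assms unfolding alt_form_def by blast+

text \<open>Restriction maps of a sheaf of modules relate modules over different rings; \<open>\<rho>\<close> is the map on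
  the scalars.\<close>

definition semilinear :: "'r ring \<Rightarrow> ('r, 'm) module \<Rightarrow> ('r, 'm) module \<Rightarrow> ('r \<Rightarrow> 'r) \<Rightarrow> ('m \<Rightarrow> 'm) \<Rightarrow> 'r ring \<Rightarrow> bool" where
  "semilinear A M N \<rho> r B \<longleftrightarrow> (\<forall>u\<in>carrier M. r u \<in> carrier N \<and>
     (\<forall>v\<in>carrier M. r (u \<oplus>\<^bsub>M\<^esub> v) = r u \<oplus>\<^bsub>N\<^esub> r v) \<and>
     (\<forall>c\<in>carrier A. \<rho> c \<in> carrier B \<and> r (c \<odot>\<^bsub>M\<^esub> u) = \<rho> c \<odot>\<^bsub>N\<^esub> r u))"

lemma semilinearD:
  assumes "semilinear A M N \<rho> r B" "u \<in> carrier M"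
  shows "r u \<in> carrier N" "v \<in> carrier M \<Longrightarrow> r (u \<oplus>\<^bsub>M\<^esub> v) = r u \<oplus>\<^bsub>N\<^esub> r v"
    "c \<in> carrier A \<Longrightarrow> \<rho> c \<in> carrier B" "c \<in> carrier A \<Longrightarrow> r (c \<odot>\<^bsub>M\<^esub> u) = \<rho> c \<odot>\<^bsub>N\<^esub> r u"
  using assms unfolding semilinear_def by blast+

locale ext3_module =
  fixes A :: "'r ring" and M :: "('r, 'm) module"
  assumes module: "Module.module A M"
begin

sublocale MM: Module.module A M by (rule module)

abbreviation "K \<equiv> ext3_rels A M"
abbreviation "FM \<equiv> ext3_free M"

lemma comm_group_FM: "comm_group FM"
  unfolding ext3_free_def by (rule abelian_free_Abelian_group)

lemma FM_simps [simp]: "x \<otimes>\<^bsub>FM\<^esub> y = x + y" "\<one>\<^bsub>FM\<^esub> = 0"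
  by (simp_all add: ext3_free_def)

lemma carrier_FM: "z \<in> carrier FM \<longleftrightarrow> Poly_Mapping.keys z \<subseteq> carrier M \<times> carrier M \<times> carrier M"
  by (simp add: ext3_free_def)

lemma inv_FM: "z \<in> carrier FM \<Longrightarrow> inv\<^bsub>FM\<^esub> z = - z"
  by (simp add: ext3_free_def)

lemma frag_FM: "u \<in> carrier M \<Longrightarrow> v \<in> carrier M \<Longrightarrow> w \<in> carrier M \<Longrightarrow> frag_of (u, v, w) \<in> carrier FM"
  by (simp add: carrier_FM)

lemma FM_add: "x \<in> carrier FM \<Longrightarrow> y \<in> carrier FM \<Longrightarrow> x + y \<in> carrier FM"
  using keys_add[of x y] by (auto simp: carrier_FM)

lemma FM_diff: "x \<in> carrier FM \<Longrightarrow> y \<in> carrier FM \<Longrightarrow> x - y \<in> carrier FM"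
  using keys_diff[of x y] by (auto simp: carrier_FM)

lemma gens_FM: "ext3_gens A M \<subseteq> carrier FM"
proof
  fix z assume "z \<in> ext3_gens A M"
  then show "z \<in> carrier FM"
    by (rule ext3_gens_induct) (simp_all add: FM_diff frag_FM)
qed

lemma subgroup_K: "subgroup K FM"
  unfolding ext3_rels_gens
  by (rule group.generate_is_subgroup[OF comm_group.axioms(2)[OF comm_group_FM] gens_FM])

lemma normal_K: "K \<lhd> FM"
  by (rule comm_group.subgroup_imp_normal[OF comm_group_FM subgroup_K])

lemma K_FM: "x \<in> K \<Longrightarrow> x \<in> carrier FM"
  using subgroup.subset[OF subgroup_K] by blast

lemma K_zero: "0 \<in> K" using subgroup.one_closed[OF subgroup_K] by simp

lemma K_add: "x \<in> K \<Longrightarrow> y \<in> K \<Longrightarrow> x + y \<in> K"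
  using subgroup.m_closed[OF subgroup_K] by simp

lemma K_uminus: "x \<in> K \<Longrightarrow> - x \<in> K"
  using subgroup.m_inv_closed[OF subgroup_K] inv_FM[OF K_FM] by metis

lemma gens_K: "z \<in> ext3_gens A M \<Longrightarrow> z \<in> K"
  unfolding ext3_rels_gens by (rule generate.incl)

definition eqv :: "('m \<times> 'm \<times> 'm \<Rightarrow>\<^sub>0 int) \<Rightarrow> ('m \<times> 'm \<times> 'm \<Rightarrow>\<^sub>0 int) \<Rightarrow> bool" (infix "\<approx>\<^sub>K" 50) where
  "x \<approx>\<^sub>K y \<longleftrightarrow> x - y \<in> K"

lemma eqv_refl [simp]: "x \<approx>\<^sub>K x" by (simp add: eqv_def K_zero)
lemma eqv_sym: "x \<approx>\<^sub>K y \<Longrightarrow> y \<approx>\<^sub>K x" unfolding eqv_def using K_uminus by fastforce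
lemma eqv_trans [trans]: "x \<approx>\<^sub>K y \<Longrightarrow> y \<approx>\<^sub>K z \<Longrightarrow> x \<approx>\<^sub>K z" unfolding eqv_def using K_add by fastforce
lemma eqv_add: "x \<approx>\<^sub>K y \<Longrightarrow> x' \<approx>\<^sub>K y' \<Longrightarrow> x + x' \<approx>\<^sub>K y + y'"
  unfolding eqv_def using K_add[of "x - y" "x' - y'"] by (simp add: algebra_simps)
lemma eqv_uminus: "x \<approx>\<^sub>K y \<Longrightarrow> - x \<approx>\<^sub>K - y"
  unfolding eqv_def using K_uminus[of "x - y"] by (simp add: algebra_simps)

lemma eqv_coset: "K #>\<^bsub>FM\<^esub> x = K #>\<^bsub>FM\<^esub> y \<longleftrightarrow> x \<approx>\<^sub>K y"
proof
  assume eq: "K #>\<^bsub>FM\<^esub> x = K #>\<^bsub>FM\<^esub> y"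
  have "x \<in> K #>\<^bsub>FM\<^esub> x" unfolding r_coset_def using K_zero by force
  then obtain k where "k \<in> K" "x = k + y" unfolding eq by (auto simp: r_coset_def)
  then show "x \<approx>\<^sub>K y" by (simp add: eqv_def)
next
  have sub: "K #>\<^bsub>FM\<^esub> x \<subseteq> K #>\<^bsub>FM\<^esub> y" if xy: "x \<approx>\<^sub>K y" for x y
  proof
    fix z assume "z \<in> K #>\<^bsub>FM\<^esub> x"
    then obtain k where k: "k \<in> K" "z = k + x" by (auto simp: r_coset_def)
    have "k + (x - y) \<in> K" using k(1) xy unfolding eqv_def by (rule K_add)
    moreover have "z = (k + (x - y)) \<otimes>\<^bsub>FM\<^esub> y" using k by simp
    ultimately show "z \<in> K #>\<^bsub>FM\<^esub> y" unfolding r_coset_def by blast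
  qed
  assume "x \<approx>\<^sub>K y"
  then show "K #>\<^bsub>FM\<^esub> x = K #>\<^bsub>FM\<^esub> y" using sub eqv_sym by blast
qed

lemma gens_eqv:
  assumes "u \<in> carrier M" "v \<in> carrier M" "w \<in> carrier M"
  shows "frag_of (u, u, w) \<approx>\<^sub>K 0" "frag_of (u, w, w) \<approx>\<^sub>K 0" "frag_of (u, w, u) \<approx>\<^sub>K 0"
    "x \<in> carrier M \<Longrightarrow> frag_of (u \<oplus>\<^bsub>M\<^esub> x, v, w) \<approx>\<^sub>K frag_of (u, v, w) + frag_of (x, v, w)"
    "x \<in> carrier M \<Longrightarrow> frag_of (u, v \<oplus>\<^bsub>M\<^esub> x, w) \<approx>\<^sub>K frag_of (u, v, w) + frag_of (u, x, w)"
    "x \<in> carrier M \<Longrightarrow> frag_of (u, v, w \<oplus>\<^bsub>M\<^esub> x) \<approx>\<^sub>K frag_of (u, v, w) + frag_of (u, v, x)"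
    "c \<in> carrier A \<Longrightarrow> frag_of (c \<odot>\<^bsub>M\<^esub> u, v, w) \<approx>\<^sub>K frag_of (u, c \<odot>\<^bsub>M\<^esub> v, w)"
    "c \<in> carrier A \<Longrightarrow> frag_of (u, c \<odot>\<^bsub>M\<^esub> v, w) \<approx>\<^sub>K frag_of (u, v, c \<odot>\<^bsub>M\<^esub> w)"
proof -
  note G = gens_K[OF subsetD[OF ext3_gens_supset[OF assms]]]
  show "frag_of (u, u, w) \<approx>\<^sub>K 0" unfolding eqv_def diff_zero
    by (rule G[OF UnI1[OF UnI1[OF insertI1]]])
  show "frag_of (u, w, w) \<approx>\<^sub>K 0" unfolding eqv_def diff_zero
    by (rule G[OF UnI1[OF UnI1[OF insertI2[OF insertI1]]]])
  show "frag_of (u, w, u) \<approx>\<^sub>K 0" unfolding eqv_def diff_zero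
    by (rule G[OF UnI1[OF UnI1[OF insertI2[OF insertI2[OF insertI1]]]]])
  show "frag_of (u \<oplus>\<^bsub>M\<^esub> x, v, w) \<approx>\<^sub>K frag_of (u, v, w) + frag_of (x, v, w)" if "x \<in> carrier M"
    unfolding eqv_def diff_diff_eq[symmetric] by (rule G[OF UnI1[OF UnI2[OF UN_I[OF that insertI1]]]])
  show "frag_of (u, v \<oplus>\<^bsub>M\<^esub> x, w) \<approx>\<^sub>K frag_of (u, v, w) + frag_of (u, x, w)" if "x \<in> carrier M"
    unfolding eqv_def diff_diff_eq[symmetric]
    by (rule G[OF UnI1[OF UnI2[OF UN_I[OF that insertI2[OF insertI1]]]]])
  show "frag_of (u, v, w \<oplus>\<^bsub>M\<^esub> x) \<approx>\<^sub>K frag_of (u, v, w) + frag_of (u, v, x)" if "x \<in> carrier M"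
    unfolding eqv_def diff_diff_eq[symmetric]
    by (rule G[OF UnI1[OF UnI2[OF UN_I[OF that insertI2[OF insertI2[OF insertI1]]]]]])
  show "frag_of (c \<odot>\<^bsub>M\<^esub> u, v, w) \<approx>\<^sub>K frag_of (u, c \<odot>\<^bsub>M\<^esub> v, w)" if "c \<in> carrier A"
    unfolding eqv_def by (rule G[OF UnI2[OF UN_I[OF that insertI1]]])
  show "frag_of (u, c \<odot>\<^bsub>M\<^esub> v, w) \<approx>\<^sub>K frag_of (u, v, c \<odot>\<^bsub>M\<^esub> w)" if "c \<in> carrier A"
    unfolding eqv_def by (rule G[OF UnI2[OF UN_I[OF that insertI2[OF insertI1]]]])
qed

text \<open>Antisymmetry follows from alternation by expanding \<open>(u + v) \<and> (u + v) \<and> w\<close>.\<close>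

lemma swap12:
  assumes "u \<in> carrier M" "v \<in> carrier M" "w \<in> carrier M"
  shows "frag_of (v, u, w) \<approx>\<^sub>K - frag_of (u, v, w)"
proof -
  have "0 \<approx>\<^sub>K frag_of (u \<oplus>\<^bsub>M\<^esub> v, u \<oplus>\<^bsub>M\<^esub> v, w)" using assms by (intro eqv_sym[OF gens_eqv(1)]) auto
  also have "\<dots> \<approx>\<^sub>K frag_of (u, u \<oplus>\<^bsub>M\<^esub> v, w) + frag_of (v, u \<oplus>\<^bsub>M\<^esub> v, w)"
    using assms by (intro gens_eqv(4)) auto
  also have "\<dots> \<approx>\<^sub>K (frag_of (u, u, w) + frag_of (u, v, w)) + (frag_of (v, u, w) + frag_of (v, v, w))"
    using assms by (intro eqv_add gens_eqv(5)) auto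
  also have "\<dots> \<approx>\<^sub>K (0 + frag_of (u, v, w)) + (frag_of (v, u, w) + 0)"
    using assms by (intro eqv_add gens_eqv(1) eqv_refl)
  finally have "0 \<approx>\<^sub>K frag_of (u, v, w) + frag_of (v, u, w)" by simp
  from eqv_sym[OF this] show ?thesis by (simp add: eqv_def add.commute)
qed

lemma swap23:
  assumes "u \<in> carrier M" "v \<in> carrier M" "w \<in> carrier M"
  shows "frag_of (u, w, v) \<approx>\<^sub>K - frag_of (u, v, w)"
proof -
  have "0 \<approx>\<^sub>K frag_of (u, v \<oplus>\<^bsub>M\<^esub> w, v \<oplus>\<^bsub>M\<^esub> w)" using assms by (intro eqv_sym[OF gens_eqv(2)]) auto
  also have "\<dots> \<approx>\<^sub>K frag_of (u, v, v \<oplus>\<^bsub>M\<^esub> w) + frag_of (u, w, v \<oplus>\<^bsub>M\<^esub> w)"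
    using assms by (intro gens_eqv(5)) auto
  also have "\<dots> \<approx>\<^sub>K (frag_of (u, v, v) + frag_of (u, v, w)) + (frag_of (u, w, v) + frag_of (u, w, w))"
    using assms by (intro eqv_add gens_eqv(6)) auto
  also have "\<dots> \<approx>\<^sub>K (0 + frag_of (u, v, w)) + (frag_of (u, w, v) + 0)"
    using assms by (intro eqv_add gens_eqv(2) eqv_refl)
  finally have "0 \<approx>\<^sub>K frag_of (u, v, w) + frag_of (u, w, v)" by simp
  from eqv_sym[OF this] show ?thesis by (simp add: eqv_def add.commute)
qed

lemma frag_zero: "v \<in> carrier M \<Longrightarrow> w \<in> carrier M \<Longrightarrow> frag_of (\<zero>\<^bsub>M\<^esub>, v, w) \<approx>\<^sub>K 0"
  using gens_eqv(4)[of "\<zero>\<^bsub>M\<^esub>" v w "\<zero>\<^bsub>M\<^esub>"] K_uminus[of "- frag_of (\<zero>\<^bsub>M\<^esub>, v, w)"] by (simp add: eqv_def)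

end

text \<open>If three elements generate \<open>M\<close>, then their exterior product generates the third exterior
  power: multilinearity reduces to exterior products of the generators.\<close>

locale ext3_generated = ext3_module A M for A :: "'r ring" and M :: "('r, 'm) module" +
  fixes e1 e2 e3 :: 'm
  assumes e: "e1 \<in> carrier M" "e2 \<in> carrier M" "e3 \<in> carrier M"
    and span: "\<And>u. u \<in> carrier M \<Longrightarrow> \<exists>a\<in>carrier A. \<exists>b\<in>carrier A. \<exists>c\<in>carrier A.
        u = a \<odot>\<^bsub>M\<^esub> e1 \<oplus>\<^bsub>M\<^esub> (b \<odot>\<^bsub>M\<^esub> e2 \<oplus>\<^bsub>M\<^esub> c \<odot>\<^bsub>M\<^esub> e3)"
begin

definition f :: "'r \<Rightarrow> ('m \<times> 'm \<times> 'm \<Rightarrow>\<^sub>0 int)" where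
  "f a = frag_of (a \<odot>\<^bsub>M\<^esub> e1, e2, e3)"

text \<open>The elements that are congruent to a scalar multiple of the chosen exterior product.\<close>

definition multiples :: "('m \<times> 'm \<times> 'm \<Rightarrow>\<^sub>0 int) set" where
  "multiples = {z. \<exists>a\<in>carrier A. z \<approx>\<^sub>K f a}"

lemma f_add: "a \<in> carrier A \<Longrightarrow> b \<in> carrier A \<Longrightarrow> f (a \<oplus>\<^bsub>A\<^esub> b) \<approx>\<^sub>K f a + f b"
  unfolding f_def using e by (simp add: MM.smult_l_distr gens_eqv(4))

lemma f_multiples: "a \<in> carrier A \<Longrightarrow> f a \<in> multiples"
  unfolding multiples_def using eqv_refl by blast

lemma multiples_eqv: "x \<approx>\<^sub>K y \<Longrightarrow> y \<in> multiples \<Longrightarrow> x \<in> multiples"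
  unfolding multiples_def using eqv_trans by blast

lemma multiples_zero: "0 \<in> multiples"
proof -
  have "f \<zero>\<^bsub>A\<^esub> \<approx>\<^sub>K 0" unfolding f_def using e by (simp add: frag_zero)
  then show ?thesis unfolding multiples_def using eqv_sym by blast
qed

lemma multiples_add: assumes "x \<in> multiples" "y \<in> multiples" shows "x + y \<in> multiples"
proof -
  obtain a b where ab: "a \<in> carrier A" "x \<approx>\<^sub>K f a" "b \<in> carrier A" "y \<approx>\<^sub>K f b"
    using assms unfolding multiples_def by blast
  have "x + y \<approx>\<^sub>K f a + f b" by (intro eqv_add ab)
  also have "\<dots> \<approx>\<^sub>K f (a \<oplus>\<^bsub>A\<^esub> b)" by (rule eqv_sym[OF f_add[OF ab(1,3)]])
  finally show ?thesis unfolding multiples_def using ab by blast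
qed

lemma multiples_uminus: assumes "x \<in> multiples" shows "- x \<in> multiples"
proof -
  obtain a where a: "a \<in> carrier A" "x \<approx>\<^sub>K f a" using assms unfolding multiples_def by blast
  have "f (a \<oplus>\<^bsub>A\<^esub> \<ominus>\<^bsub>A\<^esub> a) \<approx>\<^sub>K f a + f (\<ominus>\<^bsub>A\<^esub> a)" using a by (intro f_add) auto
  moreover have "f \<zero>\<^bsub>A\<^esub> \<approx>\<^sub>K 0" unfolding f_def using e by (simp add: frag_zero)
  ultimately have "0 \<approx>\<^sub>K f a + f (\<ominus>\<^bsub>A\<^esub> a)" using a eqv_sym eqv_trans by (metis MM.R.r_neg)
  then have "- f a \<approx>\<^sub>K f (\<ominus>\<^bsub>A\<^esub> a)" unfolding eqv_def by (simp add: algebra_simps)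
  with eqv_uminus[OF a(2)] have "- x \<approx>\<^sub>K f (\<ominus>\<^bsub>A\<^esub> a)" by (rule eqv_trans)
  then show ?thesis unfolding multiples_def using a by blast
qed

lemma smult_move:
  assumes "c \<in> carrier A" "u \<in> carrier M" "v \<in> carrier M" "w \<in> carrier M"
  shows "frag_of (c \<odot>\<^bsub>M\<^esub> u, v, w) \<approx>\<^sub>K frag_of (u, v, c \<odot>\<^bsub>M\<^esub> w)"
  using gens_eqv(7,8)[OF assms(2-4,1)] eqv_trans by blast

lemma basis_multiples:
  assumes d: "d \<in> carrier A" and x: "x \<in> {e1, e2, e3}" "y \<in> {e1, e2, e3}" "z \<in> {e1, e2, e3}"
  shows "frag_of (d \<odot>\<^bsub>M\<^esub> x, y, z) \<in> multiples"
proof -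
  have M: "x \<in> carrier M" "y \<in> carrier M" "z \<in> carrier M" using x e by auto
  have z1: "frag_of (d \<odot>\<^bsub>M\<^esub> u, u, w) \<in> multiples" if "u \<in> carrier M" "w \<in> carrier M" for u w
  proof -
    have "frag_of (d \<odot>\<^bsub>M\<^esub> u, u, w) \<approx>\<^sub>K frag_of (u, u, d \<odot>\<^bsub>M\<^esub> w)"
      using that d by (intro smult_move)
    also have "\<dots> \<approx>\<^sub>K 0" using that d by (intro gens_eqv(1)) auto
    finally show ?thesis using multiples_zero by (rule multiples_eqv)
  qed
  have z2: "frag_of (d \<odot>\<^bsub>M\<^esub> u, w, w) \<in> multiples" if "u \<in> carrier M" "w \<in> carrier M" for u w
    using that d by (intro multiples_eqv[OF gens_eqv(2) multiples_zero]) auto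
  have z3: "frag_of (d \<odot>\<^bsub>M\<^esub> u, w, u) \<in> multiples" if "u \<in> carrier M" "w \<in> carrier M" for u w
  proof -
    have "frag_of (d \<odot>\<^bsub>M\<^esub> u, w, u) \<approx>\<^sub>K frag_of (u, d \<odot>\<^bsub>M\<^esub> w, u)"
      using that d by (intro gens_eqv(7))
    also have "\<dots> \<approx>\<^sub>K 0" using that d by (intro gens_eqv(3)) auto
    finally show ?thesis using multiples_zero by (rule multiples_eqv)
  qed
  have s12: "frag_of (d \<odot>\<^bsub>M\<^esub> v, u, w) \<in> multiples" if uvw: "u \<in> carrier M" "v \<in> carrier M" "w \<in> carrier M"
    and S: "frag_of (d \<odot>\<^bsub>M\<^esub> u, v, w) \<in> multiples" for u v w
  proof -
    have "frag_of (d \<odot>\<^bsub>M\<^esub> v, u, w) \<approx>\<^sub>K - frag_of (u, d \<odot>\<^bsub>M\<^esub> v, w)"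
      using uvw d by (intro swap12) auto
    also have "\<dots> \<approx>\<^sub>K - frag_of (d \<odot>\<^bsub>M\<^esub> u, v, w)"
      using uvw d by (intro eqv_uminus eqv_sym[OF gens_eqv(7)])
    finally show ?thesis using multiples_uminus[OF S] by (rule multiples_eqv)
  qed
  have s23: "frag_of (d \<odot>\<^bsub>M\<^esub> u, w, v) \<in> multiples" if uvw: "u \<in> carrier M" "v \<in> carrier M" "w \<in> carrier M"
    and S: "frag_of (d \<odot>\<^bsub>M\<^esub> u, v, w) \<in> multiples" for u v w
  proof -
    have "frag_of (d \<odot>\<^bsub>M\<^esub> u, w, v) \<approx>\<^sub>K - frag_of (d \<odot>\<^bsub>M\<^esub> u, v, w)"
      using uvw d by (intro swap23) auto
    then show ?thesis using multiples_uminus[OF S] by (rule multiples_eqv)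
  qed
  have p123: "frag_of (d \<odot>\<^bsub>M\<^esub> e1, e2, e3) \<in> multiples" using f_multiples[OF d] unfolding f_def .
  have p213: "frag_of (d \<odot>\<^bsub>M\<^esub> e2, e1, e3) \<in> multiples" by (rule s12[OF e(1,2,3) p123])
  have p132: "frag_of (d \<odot>\<^bsub>M\<^esub> e1, e3, e2) \<in> multiples" by (rule s23[OF e(1,2,3) p123])
  have p231: "frag_of (d \<odot>\<^bsub>M\<^esub> e2, e3, e1) \<in> multiples" by (rule s23[OF e(2,1,3) p213])
  have p312: "frag_of (d \<odot>\<^bsub>M\<^esub> e3, e1, e2) \<in> multiples" by (rule s12[OF e(1,3,2) p132])
  have p321: "frag_of (d \<odot>\<^bsub>M\<^esub> e3, e2, e1) \<in> multiples" by (rule s12[OF e(2,3,1) p231])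
  show ?thesis
    using x by (elim insertE emptyE) (simp_all only: z1 z2 z3 e p123 p213 p132 p231 p312 p321)
qed

lemma smult_basis_multiples:
  assumes "a \<in> carrier A" "b \<in> carrier A" "c \<in> carrier A"
    and x: "x \<in> {e1, e2, e3}" "y \<in> {e1, e2, e3}" "z \<in> {e1, e2, e3}"
  shows "frag_of (a \<odot>\<^bsub>M\<^esub> x, b \<odot>\<^bsub>M\<^esub> y, c \<odot>\<^bsub>M\<^esub> z) \<in> multiples"
proof -
  have M: "x \<in> carrier M" "y \<in> carrier M" "z \<in> carrier M" using x e by auto
  have "frag_of (a \<odot>\<^bsub>M\<^esub> x, b \<odot>\<^bsub>M\<^esub> y, c \<odot>\<^bsub>M\<^esub> z) \<approx>\<^sub>K frag_of (b \<odot>\<^bsub>M\<^esub> (a \<odot>\<^bsub>M\<^esub> x), y, c \<odot>\<^bsub>M\<^esub> z)"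
    using assms(1-3) M by (intro eqv_sym[OF gens_eqv(7)]) auto
  also have "\<dots> \<approx>\<^sub>K frag_of (c \<odot>\<^bsub>M\<^esub> (b \<odot>\<^bsub>M\<^esub> (a \<odot>\<^bsub>M\<^esub> x)), y, z)"
    using assms(1-3) M by (intro eqv_sym[OF smult_move]) auto
  also have "c \<odot>\<^bsub>M\<^esub> (b \<odot>\<^bsub>M\<^esub> (a \<odot>\<^bsub>M\<^esub> x)) = (c \<otimes>\<^bsub>A\<^esub> (b \<otimes>\<^bsub>A\<^esub> a)) \<odot>\<^bsub>M\<^esub> x"
    using assms(1-3) M by (simp add: MM.smult_assoc1)
  finally show ?thesis
    by (rule multiples_eqv[OF _ basis_multiples[OF _ x]]) (use assms(1-3) in simp)
qed

lemma wedge_multiples: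
  assumes "u \<in> carrier M" "v \<in> carrier M" "w \<in> carrier M"
  shows "frag_of (u, v, w) \<in> multiples"
proof -
  let ?E = "{e1, e2, e3}"
  have E: "x \<in> carrier M" if "x \<in> ?E" for x using that e by auto
  note cl = MM.smult_closed MM.M.a_closed e
  have 1: "frag_of (a \<odot>\<^bsub>M\<^esub> x, b \<odot>\<^bsub>M\<^esub> y, w) \<in> multiples"
    if abxy: "a \<in> carrier A" "b \<in> carrier A" "x \<in> ?E" "y \<in> ?E" and w: "w \<in> carrier M" for a b x y w
  proof -
    obtain c1 c2 c3 where c: "c1 \<in> carrier A" "c2 \<in> carrier A" "c3 \<in> carrier A"
      "w = c1 \<odot>\<^bsub>M\<^esub> e1 \<oplus>\<^bsub>M\<^esub> (c2 \<odot>\<^bsub>M\<^esub> e2 \<oplus>\<^bsub>M\<^esub> c3 \<odot>\<^bsub>M\<^esub> e3)" using span[OF w] by blast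
    have xy: "a \<odot>\<^bsub>M\<^esub> x \<in> carrier M" "b \<odot>\<^bsub>M\<^esub> y \<in> carrier M" using abxy E by auto
    show ?thesis unfolding c(4)
      using abxy c xy e by (intro multiples_eqv[OF gens_eqv(6)] multiples_add smult_basis_multiples) auto
  qed
  have 2: "frag_of (a \<odot>\<^bsub>M\<^esub> x, v, w) \<in> multiples"
    if ax: "a \<in> carrier A" "x \<in> ?E" and v: "v \<in> carrier M" "w \<in> carrier M" for a x v w
  proof -
    obtain c1 c2 c3 where c: "c1 \<in> carrier A" "c2 \<in> carrier A" "c3 \<in> carrier A"
      "v = c1 \<odot>\<^bsub>M\<^esub> e1 \<oplus>\<^bsub>M\<^esub> (c2 \<odot>\<^bsub>M\<^esub> e2 \<oplus>\<^bsub>M\<^esub> c3 \<odot>\<^bsub>M\<^esub> e3)" using span[OF v(1)] by blast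
    have x: "a \<odot>\<^bsub>M\<^esub> x \<in> carrier M" using ax E by auto
    show ?thesis unfolding c(4)
      using ax c x e v(2) by (intro multiples_eqv[OF gens_eqv(5)] multiples_add 1) auto
  qed
  obtain c1 c2 c3 where c: "c1 \<in> carrier A" "c2 \<in> carrier A" "c3 \<in> carrier A"
    "u = c1 \<odot>\<^bsub>M\<^esub> e1 \<oplus>\<^bsub>M\<^esub> (c2 \<odot>\<^bsub>M\<^esub> e2 \<oplus>\<^bsub>M\<^esub> c3 \<odot>\<^bsub>M\<^esub> e3)" using span[OF assms(1)] by blast
  show ?thesis unfolding c(4)
    using c e assms by (intro multiples_eqv[OF gens_eqv(4)] multiples_add 2) auto
qed

lemma FM_multiples: "z \<in> carrier FM \<Longrightarrow> z \<in> multiples"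
proof -
  assume "z \<in> carrier FM"
  then have "Poly_Mapping.keys z \<subseteq> carrier M \<times> carrier M \<times> carrier M" by (simp add: carrier_FM)
  then show ?thesis
  proof (rule free_Abelian_group_induct)
    show "0 \<in> multiples" by (rule multiples_zero)
    fix x y assume "x \<in> multiples" "y \<in> multiples"
    then show "x - y \<in> multiples" using multiples_add[OF _ multiples_uminus] by fastforce
  next
    fix a assume "a \<in> carrier M \<times> carrier M \<times> carrier M"
    then show "frag_of a \<in> multiples" using wedge_multiples by auto
  qed
qed

lemma ext3_generated_by_wedge:
  assumes "\<xi> \<in> carrier (ext3 A M)"
  shows "\<exists>a\<in>carrier A. \<xi> = wedge3 A M (a \<odot>\<^bsub>M\<^esub> e1) e2 e3"
proof -
  obtain z where z: "z \<in> carrier FM" "\<xi> = K #>\<^bsub>FM\<^esub> z"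
    using assms by (auto simp: ext3_def carrier_FactGroup)
  obtain a where "a \<in> carrier A" "z \<approx>\<^sub>K f a" using FM_multiples[OF z(1)] unfolding multiples_def by blast
  then show ?thesis unfolding z(2) wedge3_def using eqv_coset by (auto simp: f_def)
qed

end

context ext3_module
begin

lemma group_ext3: "group (ext3 A M)"
  unfolding ext3_def by (rule normal.factorgroup_is_group[OF normal_K])

lemma ext3_mult: "x \<in> carrier FM \<Longrightarrow> y \<in> carrier FM \<Longrightarrow>
    (K #>\<^bsub>FM\<^esub> x) \<otimes>\<^bsub>ext3 A M\<^esub> (K #>\<^bsub>FM\<^esub> y) = K #>\<^bsub>FM\<^esub> (x + y)"
  unfolding ext3_def using normal.rcos_sum[OF normal_K] by simp

lemma ext3_one: "\<one>\<^bsub>ext3 A M\<^esub> = K #>\<^bsub>FM\<^esub> 0"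
  by (auto simp: ext3_def r_coset_def)

lemma coset_ext3: "z \<in> carrier FM \<Longrightarrow> K #>\<^bsub>FM\<^esub> z \<in> carrier (ext3 A M)"
  by (auto simp: ext3_def carrier_FactGroup)

lemma ext3_cosetE:
  assumes "\<xi> \<in> carrier (ext3 A M)"
  obtains z where "z \<in> carrier FM" "\<xi> = K #>\<^bsub>FM\<^esub> z"
  using assms by (auto simp: ext3_def carrier_FactGroup)

lemma wedge_ext3: "u \<in> carrier M \<Longrightarrow> v \<in> carrier M \<Longrightarrow> w \<in> carrier M \<Longrightarrow> wedge3 A M u v w \<in> carrier (ext3 A M)"
  unfolding wedge3_def by (intro coset_ext3 frag_FM)

lemma wedge_zero: "v \<in> carrier M \<Longrightarrow> w \<in> carrier M \<Longrightarrow> wedge3 A M \<zero>\<^bsub>M\<^esub> v w = \<one>\<^bsub>ext3 A M\<^esub>"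
  unfolding wedge3_def ext3_one eqv_coset by (rule frag_zero)

lemma hom_eq_on_wedges:
  assumes \<chi>: "\<chi> \<in> hom (ext3 A M) H" "\<chi>' \<in> hom (ext3 A M) H" and H: "group H"
    and eq: "\<And>u v w. u \<in> carrier M \<Longrightarrow> v \<in> carrier M \<Longrightarrow> w \<in> carrier M \<Longrightarrow>
      \<chi> (wedge3 A M u v w) = \<chi>' (wedge3 A M u v w)"
    and \<xi>: "\<xi> \<in> carrier (ext3 A M)"
  shows "\<chi> \<xi> = \<chi>' \<xi>"
proof -
  interpret g: group_hom "ext3 A M" H \<chi>
    using group_ext3 H \<chi> by (simp add: group_hom_def group_hom_axioms_def)
  interpret g': group_hom "ext3 A M" H \<chi>'
    using group_ext3 H \<chi> by (simp add: group_hom_def group_hom_axioms_def)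
  obtain z where z: "z \<in> carrier FM" "\<xi> = K #>\<^bsub>FM\<^esub> z" by (rule ext3_cosetE[OF \<xi>])
  have "Poly_Mapping.keys z \<subseteq> carrier M \<times> carrier M \<times> carrier M" using z(1) by (simp add: carrier_FM)
  then have "\<chi> (K #>\<^bsub>FM\<^esub> z) = \<chi>' (K #>\<^bsub>FM\<^esub> z)"
  proof (rule free_Abelian_group_induct)
    show "\<chi> (K #>\<^bsub>FM\<^esub> 0) = \<chi>' (K #>\<^bsub>FM\<^esub> 0)"
      unfolding ext3_one[symmetric] by (simp only: g.hom_one g'.hom_one)
  next
    fix x y
    assume xy: "Poly_Mapping.keys x \<subseteq> carrier M \<times> carrier M \<times> carrier M"
      "Poly_Mapping.keys y \<subseteq> carrier M \<times> carrier M \<times> carrier M"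
      and IH: "\<chi> (K #>\<^bsub>FM\<^esub> x) = \<chi>' (K #>\<^bsub>FM\<^esub> x)" "\<chi> (K #>\<^bsub>FM\<^esub> y) = \<chi>' (K #>\<^bsub>FM\<^esub> y)"
    have x: "x \<in> carrier FM" and y: "y \<in> carrier FM" using xy by (simp_all add: carrier_FM)
    note d = FM_diff[OF x y]
    have "\<chi> (K #>\<^bsub>FM\<^esub> (x - y)) \<otimes>\<^bsub>H\<^esub> \<chi> (K #>\<^bsub>FM\<^esub> y) = \<chi> (K #>\<^bsub>FM\<^esub> x)"
      using g.hom_mult[OF coset_ext3[OF d] coset_ext3[OF y]] ext3_mult[OF d y] by simp
    moreover have "\<chi>' (K #>\<^bsub>FM\<^esub> (x - y)) \<otimes>\<^bsub>H\<^esub> \<chi>' (K #>\<^bsub>FM\<^esub> y) = \<chi>' (K #>\<^bsub>FM\<^esub> x)"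
      using g'.hom_mult[OF coset_ext3[OF d] coset_ext3[OF y]] ext3_mult[OF d y] by simp
    ultimately have "\<chi> (K #>\<^bsub>FM\<^esub> (x - y)) \<otimes>\<^bsub>H\<^esub> \<chi> (K #>\<^bsub>FM\<^esub> y) = \<chi>' (K #>\<^bsub>FM\<^esub> (x - y)) \<otimes>\<^bsub>H\<^esub> \<chi> (K #>\<^bsub>FM\<^esub> y)"
      unfolding IH by simp
    then show "\<chi> (K #>\<^bsub>FM\<^esub> (x - y)) = \<chi>' (K #>\<^bsub>FM\<^esub> (x - y))"
      using g.hom_closed[OF coset_ext3[OF d]] g.hom_closed[OF coset_ext3[OF y]]
        g'.hom_closed[OF coset_ext3[OF d]] by (simp only: g.H.right_cancel)
  next
    fix a assume "a \<in> carrier M \<times> carrier M \<times> carrier M"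
    then obtain u v w where "a = (u, v, w)" "u \<in> carrier M" "v \<in> carrier M" "w \<in> carrier M" by blast
    then show "\<chi> (K #>\<^bsub>FM\<^esub> frag_of a) = \<chi>' (K #>\<^bsub>FM\<^esub> frag_of a)"
      using eq unfolding wedge3_def by simp
  qed
  then show ?thesis unfolding z(2) .
qed

lemma alternating_K:
  assumes "u \<in> carrier M" "w \<in> carrier M"
  shows "frag_of (u, u, w) \<in> K" "frag_of (u, w, w) \<in> K" "frag_of (u, w, u) \<in> K"
  using gens_eqv(1-3)[OF assms(1,1,2)] by (simp_all add: eqv_def)

text \<open>The universal property: the additive extension of the form to the free abelian group is zero
  on the defining relations.\<close>

lemma alternating_form_lifts:
  assumes \<omega>: "alt_form A M \<omega>"
  shows "\<exists>\<alpha>. \<alpha> \<in> hom (ext3 A M) (add_monoid A) \<and>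
    (\<forall>u\<in>carrier M. \<forall>v\<in>carrier M. \<forall>w\<in>carrier M. \<alpha> (wedge3 A M u v w) = \<omega> u v w)"
proof -
  let ?S = "carrier M \<times> carrier M \<times> carrier M"
  have im: "(\<lambda>(u, v, w). \<omega> u v w) ` ?S \<subseteq> carrier (add_monoid A)"
    using alt_formD(1)[OF \<omega>] by auto
  obtain h where h: "h \<in> hom FM (add_monoid A)" "\<And>x. x \<in> ?S \<Longrightarrow> h (frag_of x) = (\<lambda>(u, v, w). \<omega> u v w) x"
    using comm_group.free_Abelian_group_universal[OF MM.R.a_comm_group im] unfolding ext3_free_def by blast
  interpret gh: group_hom FM "add_monoid A" h
    using comm_group.axioms(2)[OF comm_group_FM] MM.R.a_group h by (simp add: group_hom_def group_hom_axioms_def)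
  have hf: "h (frag_of (u, v, w)) = \<omega> u v w" if "u \<in> carrier M" "v \<in> carrier M" "w \<in> carrier M" for u v w
    using h(2)[of "(u, v, w)"] that by simp
  have hd: "h (x - y) = h x \<ominus>\<^bsub>A\<^esub> h y" if xy: "x \<in> carrier FM" "y \<in> carrier FM" for x y
  proof -
    have cl: "h x \<in> carrier A" "h y \<in> carrier A" "h (x - y) \<in> carrier A"
      using gh.hom_closed xy FM_diff[OF xy] by simp_all
    have "h (x - y) \<oplus>\<^bsub>A\<^esub> h y = h x" using gh.hom_mult[OF FM_diff[OF xy] xy(2)] by simp
    then have "h x \<ominus>\<^bsub>A\<^esub> h y = (h (x - y) \<oplus>\<^bsub>A\<^esub> h y) \<ominus>\<^bsub>A\<^esub> h y" by simp
    also have "\<dots> = h (x - y)" using cl by (simp add: MM.R.minus_eq MM.R.add.m_assoc MM.R.r_neg)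
    finally show ?thesis by simp
  qed
  have gens: "h z = \<zero>\<^bsub>A\<^esub>" if z: "z \<in> ext3_gens A M" for z
  proof -
    note cl = alt_formD(1)[OF \<omega>]
    have sub0: "(a \<oplus>\<^bsub>A\<^esub> b) \<ominus>\<^bsub>A\<^esub> a \<ominus>\<^bsub>A\<^esub> b = \<zero>\<^bsub>A\<^esub>" if "a \<in> carrier A" "b \<in> carrier A" for a b
    proof -
      have "a \<oplus>\<^bsub>A\<^esub> b = b \<oplus>\<^bsub>A\<^esub> a" using that by (rule MM.R.a_comm)
      then have "(a \<oplus>\<^bsub>A\<^esub> b) \<ominus>\<^bsub>A\<^esub> a = b" using that by (simp add: MM.R.minus_eq MM.R.a_assoc MM.R.r_neg)
      then show ?thesis using that by (simp add: MM.R.minus_eq MM.R.r_neg)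
    qed
    show ?thesis using z
    proof (rule ext3_gens_induct)
      fix u v w x assume m: "u \<in> carrier M" "v \<in> carrier M" "w \<in> carrier M" "x \<in> carrier M"
      show "h (frag_of (u \<oplus>\<^bsub>M\<^esub> x, v, w) - frag_of (u, v, w) - frag_of (x, v, w)) = \<zero>\<^bsub>A\<^esub>"
        using m by (simp add: hd FM_diff frag_FM hf alt_formD(5)[OF \<omega>] sub0 cl)
      show "h (frag_of (u, v \<oplus>\<^bsub>M\<^esub> x, w) - frag_of (u, v, w) - frag_of (u, x, w)) = \<zero>\<^bsub>A\<^esub>"
        using m by (simp add: hd FM_diff frag_FM hf alt_formD(6)[OF \<omega>] sub0 cl)
      show "h (frag_of (u, v, w \<oplus>\<^bsub>M\<^esub> x) - frag_of (u, v, w) - frag_of (u, v, x)) = \<zero>\<^bsub>A\<^esub>"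
        using m by (simp add: hd FM_diff frag_FM hf alt_formD(7)[OF \<omega>] sub0 cl)
    next
      fix c u v w assume m: "c \<in> carrier A" "u \<in> carrier M" "v \<in> carrier M" "w \<in> carrier M"
      show "h (frag_of (c \<odot>\<^bsub>M\<^esub> u, v, w) - frag_of (u, c \<odot>\<^bsub>M\<^esub> v, w)) = \<zero>\<^bsub>A\<^esub>"
        using m by (simp add: hd frag_FM hf alt_formD(8,9)[OF \<omega>] cl)
      show "h (frag_of (u, c \<odot>\<^bsub>M\<^esub> v, w) - frag_of (u, v, c \<odot>\<^bsub>M\<^esub> w)) = \<zero>\<^bsub>A\<^esub>"
        using m by (simp add: hd frag_FM hf alt_formD(9,10)[OF \<omega>] cl)
    next
      fix u w assume m: "u \<in> carrier M" "w \<in> carrier M"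
      show "h (frag_of (u, u, w)) = \<zero>\<^bsub>A\<^esub>" "h (frag_of (u, w, w)) = \<zero>\<^bsub>A\<^esub>" "h (frag_of (u, w, u)) = \<zero>\<^bsub>A\<^esub>"
        using m by (simp_all add: hf alt_formD(2-4)[OF \<omega>])
    qed
  qed
  have "ext3_gens A M \<subseteq> kernel FM (add_monoid A) h"
    using gens gens_FM unfolding kernel_def by auto
  then have "K \<subseteq> kernel FM (add_monoid A) h"
    unfolding ext3_rels_gens by (rule gh.G.generate_subgroup_incl[OF _ gh.subgroup_kernel])
  then have K0: "h k = \<zero>\<^bsub>A\<^esub>" if "k \<in> K" for k using that unfolding kernel_def by auto
  obtain \<alpha> where \<alpha>: "\<alpha> \<in> hom (FM Mod K) (add_monoid A)" "\<And>x. x \<in> carrier FM \<Longrightarrow> \<alpha> (K #>\<^bsub>FM\<^esub> x) = h x"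
  proof (rule FactGroup_universal[OF h(1) normal_K])
    fix x y assume x: "x \<in> carrier FM" and y: "y \<in> carrier FM" and eq: "K #>\<^bsub>FM\<^esub> x = K #>\<^bsub>FM\<^esub> y"
    then have "x - y \<in> K" unfolding eqv_coset eqv_def by blast
    then have "h x \<ominus>\<^bsub>A\<^esub> h y = \<zero>\<^bsub>A\<^esub>" using K0 hd[OF x y] by simp
    then show "h x = h y" using gh.hom_closed[OF x] gh.hom_closed[OF y] by (simp add: MM.R.r_right_minus_eq)
  qed (rule that)
  show ?thesis
    using \<alpha> hf frag_FM unfolding ext3_def wedge3_def by (intro exI[of _ \<alpha>]) simp
qed

end

lemma ext3_map_coset:
  assumes "ext3_module A M" "ext3_module B N" and r: "semilinear A M N \<rho> r B"
  defines "G \<equiv> frag_extend (\<lambda>(u, v, w). frag_of (r u, r v, r w))"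
  assumes z: "z \<in> carrier (ext3_free M)"
  shows "ext3_map B N r (ext3_rels A M #>\<^bsub>ext3_free M\<^esub> z) = ext3_rels B N #>\<^bsub>ext3_free N\<^esub> G z"
    and "G z \<in> carrier (ext3_free N)"
proof -
  interpret M: ext3_module A M by fact
  interpret N: ext3_module B N by fact
  note r' = semilinearD[OF r]
  have GF: "G z \<in> carrier N.FM" if "z \<in> carrier M.FM" for z
  proof -
    have "Poly_Mapping.keys z \<subseteq> carrier M \<times> carrier M \<times> carrier M" using that by (simp add: M.carrier_FM)
    then show ?thesis
    proof (rule free_Abelian_group_induct)
      show "G 0 \<in> carrier N.FM" by (simp add: G_def N.carrier_FM)
      show "G (x - y) \<in> carrier N.FM" if "G x \<in> carrier N.FM" "G y \<in> carrier N.FM" for x y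
        using that by (simp add: G_def frag_extend_diff N.FM_diff)
      show "G (frag_of a) \<in> carrier N.FM" if "a \<in> carrier M \<times> carrier M \<times> carrier M" for a
        using that r'(1) by (auto simp: G_def intro!: N.frag_FM)
    qed
  qed
  then show "G z \<in> carrier N.FM" using z .
  have "subgroup {z \<in> carrier M.FM. G z \<in> N.K} M.FM"
    using N.K_zero N.K_add N.K_uminus M.FM_add M.FM_diff[of 0]
    by unfold_locales (auto simp: G_def frag_extend_add frag_extend_minus M.inv_FM M.carrier_FM)
  moreover have "ext3_gens A M \<subseteq> {z \<in> carrier M.FM. G z \<in> N.K}"
  proof
    fix z assume z: "z \<in> ext3_gens A M"
    have "G z \<in> N.K" using z
      by (rule ext3_gens_induct)
        (simp_all add: G_def frag_extend_diff r' N.alternating_K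
          N.gens_eqv(4-8)[unfolded N.eqv_def diff_diff_eq[symmetric]])
    then show "z \<in> {z \<in> carrier M.FM. G z \<in> N.K}" using z M.gens_FM by blast
  qed
  ultimately have "M.K \<subseteq> {z \<in> carrier M.FM. G z \<in> N.K}"
    unfolding ext3_rels_gens[of A M]
    by (intro group.generate_subgroup_incl[OF comm_group.axioms(2)[OF M.comm_group_FM]])
  then have GK: "G k \<in> N.K" if "k \<in> M.K" for k using that by blast
  have eq: "N.K #>\<^bsub>N.FM\<^esub> G y = N.K #>\<^bsub>N.FM\<^esub> G z" if y: "y \<in> M.K #>\<^bsub>M.FM\<^esub> z" for y
  proof -
    obtain k where "k \<in> M.K" "y = k + z" using y by (auto simp: r_coset_def)
    then show ?thesis using GK[of k] by (simp add: N.eqv_coset N.eqv_def G_def frag_extend_add)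
  qed
  have ne: "z \<in> M.K #>\<^bsub>M.FM\<^esub> z" unfolding r_coset_def using M.K_zero by force
  have "ext3_map B N r (M.K #>\<^bsub>M.FM\<^esub> z) = (\<Union>y\<in>M.K #>\<^bsub>M.FM\<^esub> z. N.K #>\<^bsub>N.FM\<^esub> G y)"
    unfolding ext3_map_def G_def ..
  also have "\<dots> = (\<Union>y\<in>M.K #>\<^bsub>M.FM\<^esub> z. N.K #>\<^bsub>N.FM\<^esub> G z)" by (rule SUP_cong[OF refl eq])
  also have "\<dots> = N.K #>\<^bsub>N.FM\<^esub> G z" using ne by (intro SUP_const) blast
  finally show "ext3_map B N r (M.K #>\<^bsub>M.FM\<^esub> z) = N.K #>\<^bsub>N.FM\<^esub> G z" .
qed

lemma ext3_map_hom:
  assumes AM: "ext3_module A M" and BN: "ext3_module B N" and r: "semilinear A M N \<rho> r B"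
  shows "ext3_map B N r \<in> hom (ext3 A M) (ext3 B N)"
proof (rule homI)
  interpret M: ext3_module A M by fact
  interpret N: ext3_module B N by fact
  note map = ext3_map_coset[OF AM BN r]
  fix \<xi> \<eta> assume "\<xi> \<in> carrier (ext3 A M)" "\<eta> \<in> carrier (ext3 A M)"
  then obtain x y where x: "x \<in> carrier M.FM" "\<xi> = M.K #>\<^bsub>M.FM\<^esub> x" and y: "y \<in> carrier M.FM" "\<eta> = M.K #>\<^bsub>M.FM\<^esub> y"
    by (meson M.ext3_cosetE)
  show "ext3_map B N r \<xi> \<in> carrier (ext3 B N)"
    unfolding x(2) map(1)[OF x(1)] by (rule N.coset_ext3[OF map(2)[OF x(1)]])
  show "ext3_map B N r (\<xi> \<otimes>\<^bsub>ext3 A M\<^esub> \<eta>) = ext3_map B N r \<xi> \<otimes>\<^bsub>ext3 B N\<^esub> ext3_map B N r \<eta>"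
    unfolding x(2) y(2) M.ext3_mult[OF x(1) y(1)] map(1)[OF x(1)] map(1)[OF y(1)]
      map(1)[OF M.FM_add[OF x(1) y(1)]] N.ext3_mult[OF map(2)[OF x(1)] map(2)[OF y(1)]]
    by (simp add: frag_extend_add)
qed

lemma ext3_map_wedge:
  assumes AM: "ext3_module A M" and BN: "ext3_module B N" and r: "semilinear A M N \<rho> r B"
    and "u \<in> carrier M" "v \<in> carrier M" "w \<in> carrier M"
  shows "ext3_map B N r (wedge3 A M u v w) = wedge3 B N (r u) (r v) (r w)"
  unfolding wedge3_def
  using ext3_map_coset(1)[OF AM BN r ext3_module.frag_FM[OF AM assms(4-6)]] by simp

locale presheaf_of_modules =
  fixes Y :: "('x, 'r) ringed_space" and M :: "('x, 'r, 'm) sheaf_module"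
  assumes ext3_module_sections: "\<And>U. openin (space Y) U \<Longrightarrow> ext3_module (str Y U) (sections M U)"
    and res_semilinear: "\<And>U V. openin (space Y) U \<Longrightarrow> V \<in> opens Y U \<Longrightarrow>
      semilinear (str Y U) (sections M U) (sections M V) (str_res Y V) (res M V) (str Y V)"
    and str_res_hom: "\<And>U V. openin (space Y) U \<Longrightarrow> V \<in> opens Y U \<Longrightarrow>
      str_res Y V \<in> hom (add_monoid (str Y U)) (add_monoid (str Y V))"
begin

text \<open>Locally the exterior power is generated by one exterior product on which the form takes an
  invertible value.  So a class with value zero is a multiple of the generator by the scalar zero, and
  multiples of the generator attain every function.\<close>

lemma exists_det_iso:
  assumes alt: "\<And>U. openin (space Y) U \<Longrightarrow> alt_form (str Y U) (sections M U) (\<omega> U)"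
    and nat: "\<And>U V u v w. openin (space Y) U \<Longrightarrow> V \<in> opens Y U \<Longrightarrow> u \<in> carrier (sections M U) \<Longrightarrow>
       v \<in> carrier (sections M U) \<Longrightarrow> w \<in> carrier (sections M U) \<Longrightarrow>
       str_res Y V (\<omega> U u v w) = \<omega> V (res M V u) (res M V v) (res M V w)"
    and basis: "\<And>U P. openin (space Y) U \<Longrightarrow> P \<in> U \<Longrightarrow> \<exists>V\<in>opens Y U. P \<in> V \<and>
       (\<exists>e1 e2 e3 d. ext3_generated (str Y V) (sections M V) e1 e2 e3 \<and> d \<in> carrier (str Y V) \<and>
          d \<otimes>\<^bsub>str Y V\<^esub> \<omega> V e1 e2 e3 = \<one>\<^bsub>str Y V\<^esub>)"
  shows "\<exists>\<alpha>. det_iso Y M \<alpha> \<and> (\<forall>U. openin (space Y) U \<longrightarrow> (\<forall>u\<in>carrier (sections M U).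
     \<forall>v\<in>carrier (sections M U). \<forall>w\<in>carrier (sections M U). \<alpha> U (wedge_over Y M U u v w) = \<omega> U u v w))"
proof -
  have "\<exists>\<alpha>. \<alpha> \<in> hom (ext3 (str Y U) (sections M U)) (add_monoid (str Y U)) \<and>
    (\<forall>u\<in>carrier (sections M U). \<forall>v\<in>carrier (sections M U). \<forall>w\<in>carrier (sections M U).
       \<alpha> (wedge_over Y M U u v w) = \<omega> U u v w)" if "openin (space Y) U" for U
    unfolding wedge_over_def
    by (rule ext3_module.alternating_form_lifts[OF ext3_module_sections[OF that] alt[OF that]])
  note lift = this
  define \<alpha> where "\<alpha> U = (SOME \<alpha>. \<alpha> \<in> hom (ext3 (str Y U) (sections M U)) (add_monoid (str Y U)) \<and>
    (\<forall>u\<in>carrier (sections M U). \<forall>v\<in>carrier (sections M U). \<forall>w\<in>carrier (sections M U).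
       \<alpha> (wedge_over Y M U u v w) = \<omega> U u v w))" for U
  have \<alpha>: "\<alpha> U \<in> hom (ext3 (str Y U) (sections M U)) (add_monoid (str Y U)) \<and>
    (\<forall>u\<in>carrier (sections M U). \<forall>v\<in>carrier (sections M U). \<forall>w\<in>carrier (sections M U).
       \<alpha> U (wedge_over Y M U u v w) = \<omega> U u v w)" if "openin (space Y) U" for U
    unfolding \<alpha>_def by (rule someI_ex[OF lift[OF that]])
  note hom = \<alpha>[THEN conjunct1]
  have val: "\<alpha> U (wedge3 (str Y U) (sections M U) u v w) = \<omega> U u v w" if "openin (space Y) U" "u \<in> carrier (sections M U)"
    "v \<in> carrier (sections M U)" "w \<in> carrier (sections M U)" for U u v w
    using \<alpha>[OF that(1), THEN conjunct2] that(2-4) unfolding wedge_over_def by blast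
  have res: "str_res Y V (\<alpha> U \<xi>) = \<alpha> V (ext3_map (str Y V) (sections M V) (res M V) \<xi>)"
    if U: "openin (space Y) U" and V: "V \<in> opens Y U" and \<xi>: "\<xi> \<in> carrier (ext3 (str Y U) (sections M U))" for U V \<xi>
  proof -
    have oV: "openin (space Y) V" using V by simp
    note MU = ext3_module_sections[OF U] and MV = ext3_module_sections[OF oV]
    interpret U: ext3_module "str Y U" "sections M U" by (rule MU)
    interpret V: ext3_module "str Y V" "sections M V" by (rule MV)
    note r = res_semilinear[OF U V]
    have "(str_res Y V \<circ> \<alpha> U) \<xi> = (\<alpha> V \<circ> ext3_map (str Y V) (sections M V) (res M V)) \<xi>"
    proof (rule U.hom_eq_on_wedges[OF hom_compose[OF hom[OF U] str_res_hom[OF U V]]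
          hom_compose[OF ext3_map_hom[OF MU MV r] hom[OF oV]] _ _ \<xi>])
      show "group (add_monoid (str Y V))" by (rule V.MM.R.a_group)
      fix u v w assume "u \<in> carrier (sections M U)" "v \<in> carrier (sections M U)" "w \<in> carrier (sections M U)"
      then show "(str_res Y V \<circ> \<alpha> U) (wedge3 (str Y U) (sections M U) u v w) =
         (\<alpha> V \<circ> ext3_map (str Y V) (sections M V) (res M V)) (wedge3 (str Y U) (sections M U) u v w)"
        by (simp add: val[OF U] val[OF oV] nat[OF U V] ext3_map_wedge[OF MU MV r] semilinearD(1)[OF r])
    qed
    then show ?thesis by simp
  qed
  have "det_iso Y M \<alpha>"
    unfolding det_iso_def
  proof (intro allI impI conjI ballI)
    fix U assume U: "openin (space Y) U"
    interpret U: ext3_module "str Y U" "sections M U" by (rule ext3_module_sections[OF U])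
    show "\<alpha> U \<in> hom (ext3 (str Y U) (sections M U)) (add_monoid (str Y U))" by (rule hom[OF U])
    show "\<alpha> U (wedge_over Y M U (c \<odot>\<^bsub>sections M U\<^esub> u) v w) = c \<otimes>\<^bsub>str Y U\<^esub> \<alpha> U (wedge_over Y M U u v w)"
      if "c \<in> carrier (str Y U)" "u \<in> carrier (sections M U)" "v \<in> carrier (sections M U)" "w \<in> carrier (sections M U)"
      for c u v w
      using that unfolding wedge_over_def by (simp add: val[OF U] alt_formD(8)[OF alt[OF U]])
    show "str_res Y V (\<alpha> U \<xi>) = \<alpha> V (ext3_map (str Y V) (sections M V) (res M V) \<xi>)"
      if "V \<in> opens Y U" "\<xi> \<in> carrier (ext3 (str Y U) (sections M U))" for V \<xi>
      by (rule res[OF U that])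
    fix P assume P: "P \<in> U"
    obtain V e1 e2 e3 d where V: "V \<in> opens Y U" "P \<in> V" and gen: "ext3_generated (str Y V) (sections M V) e1 e2 e3"
      and d: "d \<in> carrier (str Y V)" "d \<otimes>\<^bsub>str Y V\<^esub> \<omega> V e1 e2 e3 = \<one>\<^bsub>str Y V\<^esub>"
      using basis[OF U P] by blast
    have oV: "openin (space Y) V" using V(1) by simp
    interpret V: ext3_generated "str Y V" "sections M V" e1 e2 e3 by (rule gen)
    note e = V.e
    have \<omega>e: "\<omega> V e1 e2 e3 \<in> carrier (str Y V)" by (rule alt_formD(1)[OF alt[OF oV] e])
    have val_e: "\<alpha> V (wedge3 (str Y V) (sections M V) (a \<odot>\<^bsub>sections M V\<^esub> e1) e2 e3) = a \<otimes>\<^bsub>str Y V\<^esub> \<omega> V e1 e2 e3"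
      if "a \<in> carrier (str Y V)" for a
      using that e by (simp add: val[OF oV] alt_formD(8)[OF alt[OF oV]])
    show "\<exists>V\<in>opens Y U. P \<in> V \<and> ext3_map (str Y V) (sections M V) (res M V) \<xi> = \<one>\<^bsub>ext3 (str Y V) (sections M V)\<^esub>"
      if \<xi>: "\<xi> \<in> carrier (ext3 (str Y U) (sections M U))" and 0: "\<alpha> U \<xi> = \<zero>\<^bsub>str Y U\<^esub>" for \<xi>
    proof (intro bexI[OF _ V(1)] conjI V(2))
      let ?\<eta> = "ext3_map (str Y V) (sections M V) (res M V) \<xi>"
      have "?\<eta> \<in> carrier (ext3 (str Y V) (sections M V))"
        by (rule hom_in_carrier[OF ext3_map_hom[OF ext3_module_sections[OF U] ext3_module_sections[OF oV]
            res_semilinear[OF U V(1)]] \<xi>])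
      then obtain a where a: "a \<in> carrier (str Y V)" "?\<eta> = wedge3 (str Y V) (sections M V) (a \<odot>\<^bsub>sections M V\<^esub> e1) e2 e3"
        using V.ext3_generated_by_wedge by blast
      have "a \<otimes>\<^bsub>str Y V\<^esub> \<omega> V e1 e2 e3 = \<alpha> V ?\<eta>" unfolding a(2) by (rule val_e[OF a(1), symmetric])
      also have "\<dots> = str_res Y V \<zero>\<^bsub>str Y U\<^esub>" unfolding res[OF U V(1) \<xi>, symmetric] 0 ..
      also have "\<dots> = \<zero>\<^bsub>str Y V\<^esub>"
        using hom_one[OF str_res_hom[OF U V(1)] U.MM.R.a_group V.MM.R.a_group] by simp
      finally have az: "a \<otimes>\<^bsub>str Y V\<^esub> \<omega> V e1 e2 e3 = \<zero>\<^bsub>str Y V\<^esub>" .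
      have "a = a \<otimes>\<^bsub>str Y V\<^esub> (d \<otimes>\<^bsub>str Y V\<^esub> \<omega> V e1 e2 e3)" unfolding d(2) using a(1) by simp
      also have "\<dots> = d \<otimes>\<^bsub>str Y V\<^esub> (a \<otimes>\<^bsub>str Y V\<^esub> \<omega> V e1 e2 e3)" using a(1) d(1) \<omega>e by (rule V.MM.R.m_lcomm)
      also have "\<dots> = \<zero>\<^bsub>str Y V\<^esub>" unfolding az using d(1) by simp
      finally show "?\<eta> = \<one>\<^bsub>ext3 (str Y V) (sections M V)\<^esub>"
        unfolding a(2) using e by (simp add: V.wedge_zero)
    qed
    show "\<exists>V\<in>opens Y U. P \<in> V \<and> str_res Y V f \<in> \<alpha> V ` carrier (ext3 (str Y V) (sections M V))"
      if f: "f \<in> carrier (str Y U)" for f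
    proof (intro bexI[OF _ V(1)] conjI V(2))
      have fV: "str_res Y V f \<in> carrier (str Y V)" using hom_in_carrier[OF str_res_hom[OF U V(1)]] f by simp
      let ?w = "wedge3 (str Y V) (sections M V) ((str_res Y V f \<otimes>\<^bsub>str Y V\<^esub> d) \<odot>\<^bsub>sections M V\<^esub> e1) e2 e3"
      have "\<alpha> V ?w = (str_res Y V f \<otimes>\<^bsub>str Y V\<^esub> d) \<otimes>\<^bsub>str Y V\<^esub> \<omega> V e1 e2 e3"
        using fV d(1) by (intro val_e) simp
      also have "\<dots> = str_res Y V f" using fV d \<omega>e by (simp add: V.MM.R.m_assoc)
      finally have "str_res Y V f = \<alpha> V ?w" by simp
      moreover have "?w \<in> carrier (ext3 (str Y V) (sections M V))"
        using fV d(1) e by (intro V.wedge_ext3) simp_all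
      ultimately show "str_res Y V f \<in> \<alpha> V ` carrier (ext3 (str Y V) (sections M V))" by (rule image_eqI)
    qed
  qed
  then show ?thesis using val unfolding wedge_over_def by blast
qed

end

section \<open>Three by three determinants in a commutative ring\<close>

definition D3 :: "('r, 'b) ring_scheme \<Rightarrow> 'r \<Rightarrow> 'r \<Rightarrow> 'r \<Rightarrow> 'r \<Rightarrow> 'r \<Rightarrow> 'r \<Rightarrow> 'r \<Rightarrow> 'r \<Rightarrow> 'r \<Rightarrow> 'r" where
  "D3 R a1 a2 a3 b1 b2 b3 c1 c2 c3 =
     (a1 \<otimes>\<^bsub>R\<^esub> (b2 \<otimes>\<^bsub>R\<^esub> c3 \<ominus>\<^bsub>R\<^esub> b3 \<otimes>\<^bsub>R\<^esub> c2) \<ominus>\<^bsub>R\<^esub> a2 \<otimes>\<^bsub>R\<^esub> (b1 \<otimes>\<^bsub>R\<^esub> c3 \<ominus>\<^bsub>R\<^esub> b3 \<otimes>\<^bsub>R\<^esub> c1))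
       \<oplus>\<^bsub>R\<^esub> a3 \<otimes>\<^bsub>R\<^esub> (b1 \<otimes>\<^bsub>R\<^esub> c2 \<ominus>\<^bsub>R\<^esub> b2 \<otimes>\<^bsub>R\<^esub> c1)"
context cring begin
lemma D3_closed: assumes "a1 \<in> carrier R" "a2 \<in> carrier R" "a3 \<in> carrier R" "b1 \<in> carrier R" "b2 \<in> carrier R" "b3 \<in> carrier R"
    "c1 \<in> carrier R" "c2 \<in> carrier R" "c3 \<in> carrier R"
  shows "D3 R a1 a2 a3 b1 b2 b3 c1 c2 c3 \<in> carrier R"
  using assms by (simp add: D3_def)
lemma D3_alt: assumes "a1 \<in> carrier R" "a2 \<in> carrier R" "a3 \<in> carrier R" "c1 \<in> carrier R" "c2 \<in> carrier R" "c3 \<in> carrier R"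
  shows "D3 R a1 a2 a3 a1 a2 a3 c1 c2 c3 = \<zero>" "D3 R a1 a2 a3 c1 c2 c3 c1 c2 c3 = \<zero>" "D3 R a1 a2 a3 c1 c2 c3 a1 a2 a3 = \<zero>"
  unfolding D3_def using assms by algebra+
lemma D3_transpose: assumes "a1 \<in> carrier R" "a2 \<in> carrier R" "a3 \<in> carrier R" "b1 \<in> carrier R" "b2 \<in> carrier R" "b3 \<in> carrier R"
    "c1 \<in> carrier R" "c2 \<in> carrier R" "c3 \<in> carrier R"
  shows "D3 R a1 a2 a3 b1 b2 b3 c1 c2 c3 = D3 R a1 b1 c1 a2 b2 c2 a3 b3 c3"
  unfolding D3_def using assms by algebra
lemma D3_swap:
  assumes "a1 \<in> carrier R" "a2 \<in> carrier R" "a3 \<in> carrier R" "b1 \<in> carrier R" "b2 \<in> carrier R" "b3 \<in> carrier R"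
    "c1 \<in> carrier R" "c2 \<in> carrier R" "c3 \<in> carrier R"
  shows "D3 R a1 a2 a3 b1 b2 b3 c1 c2 c3 = \<ominus> D3 R b1 b2 b3 a1 a2 a3 c1 c2 c3"
    "D3 R a1 a2 a3 b1 b2 b3 c1 c2 c3 = \<ominus> D3 R a1 a2 a3 c1 c2 c3 b1 b2 b3"
  unfolding D3_def using assms by algebra+

lemma D3_row1_linear:
  assumes "a1 \<in> carrier R" "a2 \<in> carrier R" "a3 \<in> carrier R" "b1 \<in> carrier R" "b2 \<in> carrier R" "b3 \<in> carrier R"
    "c1 \<in> carrier R" "c2 \<in> carrier R" "c3 \<in> carrier R"
  shows "x1 \<in> carrier R \<Longrightarrow> x2 \<in> carrier R \<Longrightarrow> x3 \<in> carrier R \<Longrightarrow> D3 R (a1 \<oplus> x1) (a2 \<oplus> x2) (a3 \<oplus> x3) b1 b2 b3 c1 c2 c3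
      = D3 R a1 a2 a3 b1 b2 b3 c1 c2 c3 \<oplus> D3 R x1 x2 x3 b1 b2 b3 c1 c2 c3"
    "x \<in> carrier R \<Longrightarrow> D3 R (x \<otimes> a1) (x \<otimes> a2) (x \<otimes> a3) b1 b2 b3 c1 c2 c3 = x \<otimes> D3 R a1 a2 a3 b1 b2 b3 c1 c2 c3"
proof -
  have 1: "((a1 \<oplus> x1) \<otimes> p \<ominus> (a2 \<oplus> x2) \<otimes> q) \<oplus> (a3 \<oplus> x3) \<otimes> r
      = ((a1 \<otimes> p \<ominus> a2 \<otimes> q) \<oplus> a3 \<otimes> r) \<oplus> ((x1 \<otimes> p \<ominus> x2 \<otimes> q) \<oplus> x3 \<otimes> r)"
    if "x1 \<in> carrier R" "x2 \<in> carrier R" "x3 \<in> carrier R" "p \<in> carrier R" "q \<in> carrier R" "r \<in> carrier R" for p q r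
    using that assms by algebra
  have 2: "((x \<otimes> a1) \<otimes> p \<ominus> (x \<otimes> a2) \<otimes> q) \<oplus> (x \<otimes> a3) \<otimes> r = x \<otimes> ((a1 \<otimes> p \<ominus> a2 \<otimes> q) \<oplus> a3 \<otimes> r)"
    if "x \<in> carrier R" "p \<in> carrier R" "q \<in> carrier R" "r \<in> carrier R" for p q r
    using that assms by algebra
  show "D3 R (a1 \<oplus> x1) (a2 \<oplus> x2) (a3 \<oplus> x3) b1 b2 b3 c1 c2 c3
      = D3 R a1 a2 a3 b1 b2 b3 c1 c2 c3 \<oplus> D3 R x1 x2 x3 b1 b2 b3 c1 c2 c3"
    if "x1 \<in> carrier R" "x2 \<in> carrier R" "x3 \<in> carrier R"
    unfolding D3_def using assms that by (intro 1) simp_all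
  show "D3 R (x \<otimes> a1) (x \<otimes> a2) (x \<otimes> a3) b1 b2 b3 c1 c2 c3 = x \<otimes> D3 R a1 a2 a3 b1 b2 b3 c1 c2 c3" if "x \<in> carrier R"
    unfolding D3_def using assms that by (intro 2) simp_all
qed

lemma D3_row2_linear:
  assumes "a1 \<in> carrier R" "a2 \<in> carrier R" "a3 \<in> carrier R" "b1 \<in> carrier R" "b2 \<in> carrier R" "b3 \<in> carrier R"
    "c1 \<in> carrier R" "c2 \<in> carrier R" "c3 \<in> carrier R"
  shows "x1 \<in> carrier R \<Longrightarrow> x2 \<in> carrier R \<Longrightarrow> x3 \<in> carrier R \<Longrightarrow> D3 R a1 a2 a3 (b1 \<oplus> x1) (b2 \<oplus> x2) (b3 \<oplus> x3) c1 c2 c3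
      = D3 R a1 a2 a3 b1 b2 b3 c1 c2 c3 \<oplus> D3 R a1 a2 a3 x1 x2 x3 c1 c2 c3"
    "x \<in> carrier R \<Longrightarrow> D3 R a1 a2 a3 (x \<otimes> b1) (x \<otimes> b2) (x \<otimes> b3) c1 c2 c3 = x \<otimes> D3 R a1 a2 a3 b1 b2 b3 c1 c2 c3"
  using assms by (simp_all add: D3_swap(1)[of a1 a2 a3] D3_row1_linear D3_closed minus_add r_minus)

lemma D3_row3_linear:
  assumes "a1 \<in> carrier R" "a2 \<in> carrier R" "a3 \<in> carrier R" "b1 \<in> carrier R" "b2 \<in> carrier R" "b3 \<in> carrier R"
    "c1 \<in> carrier R" "c2 \<in> carrier R" "c3 \<in> carrier R"
  shows "x1 \<in> carrier R \<Longrightarrow> x2 \<in> carrier R \<Longrightarrow> x3 \<in> carrier R \<Longrightarrow> D3 R a1 a2 a3 b1 b2 b3 (c1 \<oplus> x1) (c2 \<oplus> x2) (c3 \<oplus> x3)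
      = D3 R a1 a2 a3 b1 b2 b3 c1 c2 c3 \<oplus> D3 R a1 a2 a3 b1 b2 b3 x1 x2 x3"
    "x \<in> carrier R \<Longrightarrow> D3 R a1 a2 a3 b1 b2 b3 (x \<otimes> c1) (x \<otimes> c2) (x \<otimes> c3) = x \<otimes> D3 R a1 a2 a3 b1 b2 b3 c1 c2 c3"
  using assms by (simp_all add: D3_swap(2)[of _ _ _ b1 b2 b3] D3_row2_linear D3_closed minus_add r_minus)

end

section \<open>Sums of three twisting sheaves\<close>

lemma cring_LL: "P \<in> Proj homog \<Longrightarrow> cring (LL P)"
  by (rule mult_set.cring_localization[OF mult_set_denoms])

lemma LL_one: "\<one>\<^bsub>LL P\<^esub> = fraction (dn P) 1 1" and LL_zero: "\<zero>\<^bsub>LL P\<^esub> = fraction (dn P) 0 1"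
  by (simp_all add: localization_def)

lemma sec_restrict:
  assumes "V \<subseteq> U"
  shows "restrict (sec_add homog U \<sigma> \<tau>) V = sec_add homog V (restrict \<sigma> V) (restrict \<tau> V)"
    "restrict (sec_mult homog U \<sigma> \<tau>) V = sec_mult homog V (restrict \<sigma> V) (restrict \<tau> V)"
    "restrict (sec_of homog U f) V = sec_of homog V f"
  using assms by (auto simp: fun_eq_iff restrict_def sec_add_def sec_mult_def sec_of_def subset_iff)

lemma PP_simps:
  "space PP = Proj_topology homog"
  "carrier (str PP U) = tw 0 U" "\<sigma> \<otimes>\<^bsub>str PP U\<^esub> \<tau> = sec_mult homog U \<sigma> \<tau>"
  "\<sigma> \<oplus>\<^bsub>str PP U\<^esub> \<tau> = sec_add homog U \<sigma> \<tau>" "\<one>\<^bsub>str PP U\<^esub> = sec_of homog U 1"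
  "\<zero>\<^bsub>str PP U\<^esub> = sec_of homog U 0" "str_res PP V \<sigma> = restrict \<sigma> V"
  by (simp_all add: PP_def Proj_space_def)

lemma twist_simps:
  "carrier (sections (twist homog k) U) = tw k U"
  "\<sigma> \<oplus>\<^bsub>sections (twist homog k) U\<^esub> \<tau> = sec_add homog U \<sigma> \<tau>"
  "\<zero>\<^bsub>sections (twist homog k) U\<^esub> = sec_of homog U 0"
  "c \<odot>\<^bsub>sections (twist homog k) U\<^esub> \<sigma> = sec_mult homog U c \<sigma>"
  "res (twist homog k) V \<sigma> = restrict \<sigma> V"
  by (simp_all add: twist_def)

context
  fixes U :: "('v::finite, 'a::comm_ring_1) mpoly set set"
  assumes U: "opn U"
begin

lemma LL_cring_U: "P \<in> U \<Longrightarrow> cring (LL P)"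
  using cring_LL op_subset_Proj[OF U] by blast

lemma sec_assoc:
  assumes "\<sigma> \<in> tw i U" "\<tau> \<in> tw j U" "\<rho> \<in> tw k U"
  shows "sec_mult homog U (sec_mult homog U \<sigma> \<tau>) \<rho> = sec_mult homog U \<sigma> (sec_mult homog U \<tau> \<rho>)"
    "sec_add homog U (sec_add homog U \<sigma> \<tau>) \<rho> = sec_add homog U \<sigma> (sec_add homog U \<tau> \<rho>)"
    "sec_mult homog U (sec_add homog U \<sigma> \<tau>) \<rho> = sec_add homog U (sec_mult homog U \<sigma> \<rho>) (sec_mult homog U \<tau> \<rho>)"
    "sec_mult homog U \<rho> (sec_add homog U \<sigma> \<tau>) = sec_add homog U (sec_mult homog U \<rho> \<sigma>) (sec_mult homog U \<rho> \<tau>)"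
  by - (rule tw_eqI[of _ U]; use assms[THEN tw_value[OF U]] in \<open>simp add: LL_cring_U cring.cring_simprules\<close>)+

lemma sec_comm:
  assumes "\<sigma> \<in> tw i U" "\<tau> \<in> tw j U"
  shows "sec_mult homog U \<sigma> \<tau> = sec_mult homog U \<tau> \<sigma>"
    "sec_add homog U \<sigma> \<tau> = sec_add homog U \<tau> \<sigma>"
proof -
  show "sec_mult homog U \<sigma> \<tau> = sec_mult homog U \<tau> \<sigma>"
  proof (rule tw_eqI)
    fix P assume P: "P \<in> U"
    then show "sec_mult homog U \<sigma> \<tau> P = sec_mult homog U \<tau> \<sigma> P"
      using cring.cring_simprules(14)[OF LL_cring_U[OF P]] assms[THEN tw_value[OF U]] by simp
  qed simp_all
  show "sec_add homog U \<sigma> \<tau> = sec_add homog U \<tau> \<sigma>"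
  proof (rule tw_eqI)
    fix P assume P: "P \<in> U"
    then show "sec_add homog U \<sigma> \<tau> P = sec_add homog U \<tau> \<sigma> P"
      using cring.cring_simprules(10)[OF LL_cring_U[OF P]] assms[THEN tw_value[OF U]] by simp
  qed simp_all
qed

lemma sec_units:
  assumes "\<sigma> \<in> tw i U"
  shows "sec_mult homog U (sec_of homog U 1) \<sigma> = \<sigma>" "sec_add homog U (sec_of homog U 0) \<sigma> = \<sigma>"
    "sec_mult homog U (sec_of homog U 0) \<sigma> = sec_of homog U 0"
proof -
  have *: "sec_of homog U 1 P \<otimes>\<^bsub>LL P\<^esub> \<sigma> P = \<sigma> P \<and> sec_of homog U 0 P \<oplus>\<^bsub>LL P\<^esub> \<sigma> P = \<sigma> P \<and>
      sec_of homog U 0 P \<otimes>\<^bsub>LL P\<^esub> \<sigma> P = sec_of homog U 0 P" if P: "P \<in> U" for P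
  proof -
    interpret L: cring "LL P" by (rule LL_cring_U[OF P])
    show ?thesis using P tw_value[OF U assms P] by (simp add: LL_one[symmetric] LL_zero[symmetric])
  qed
  show "sec_mult homog U (sec_of homog U 1) \<sigma> = \<sigma>" "sec_add homog U (sec_of homog U 0) \<sigma> = \<sigma>"
    "sec_mult homog U (sec_of homog U 0) \<sigma> = sec_of homog U 0"
    using * tw_extensional[OF assms] by - (rule tw_eqI[of _ U]; simp only: sec_ext sec_simps)+
qed

lemma sec_units_right:
  assumes "\<sigma> \<in> tw i U"
  shows "sec_add homog U \<sigma> (sec_of homog U 0) = \<sigma>" "sec_mult homog U \<sigma> (sec_of homog U 0) = sec_of homog U 0"
  using sec_comm(2)[OF assms sec_zero_closed[OF U]] sec_comm(1)[OF assms sec_zero_closed[OF U, of 0]]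
    sec_units[OF assms] by simp_all

definition sec_uminus :: "('v, 'a) mpoly sect \<Rightarrow> ('v, 'a) mpoly sect" where
  "sec_uminus \<sigma> = sec_mult homog U (sec_of homog U (- 1)) \<sigma>"

lemma sec_uminus_closed: "\<sigma> \<in> tw k U \<Longrightarrow> sec_uminus \<sigma> \<in> tw k U"
  unfolding sec_uminus_def using sec_of_closed[OF U homog_uminus[OF homog_1]]
  by (rule sec_mult_closed[OF U]) auto

lemma sec_uminus_value:
  assumes "\<sigma> \<in> tw k U" "P \<in> U"
  shows "sec_uminus \<sigma> P = \<ominus>\<^bsub>LL P\<^esub> \<sigma> P"
proof -
  interpret mult_set "dn P" by (rule mult_set_denoms[OF op_subset_Proj[OF U assms(2)]])
  have "fraction (dn P) (- 1) 1 = \<ominus>\<^bsub>LL P\<^esub> \<one>\<^bsub>LL P\<^esub>" by (simp add: LL_one fraction_uminus)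
  then show ?thesis
    using assms(2) tw_value[OF U assms] by (simp add: sec_uminus_def L.l_minus)
qed

lemma sec_uminus_ext [simp]: "sec_uminus \<sigma> \<in> extensional U"
  by (simp add: sec_uminus_def)

lemma sec_uminus_left: "\<sigma> \<in> tw k U \<Longrightarrow> sec_add homog U (sec_uminus \<sigma>) \<sigma> = sec_of homog U 0"
  by (rule tw_eqI[of _ U]) (use tw_value[OF U] in \<open>simp_all add: sec_uminus_value LL_cring_U cring.cring_simprules LL_zero[symmetric]\<close>)

lemma cring_PP: "cring (str PP U)"
proof (rule cringI)
  show "abelian_group (str PP U)"
  proof (rule abelian_groupI, unfold PP_simps)
    show "\<exists>y\<in>tw 0 U. sec_add homog U y x = sec_of homog U 0" if "x \<in> tw 0 U" for x
      using sec_uminus_left[OF that] sec_uminus_closed[OF that] by blast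
  qed (simp_all add: sec_add_closed[OF U] sec_zero_closed[OF U] sec_assoc sec_comm(2) sec_units sec_units_right)
  show "comm_monoid (str PP U)"
    by (rule comm_monoidI, unfold PP_simps)
      (simp_all add: sec_mult_closed[OF U] sec_of_closed[OF U homog_1, simplified] sec_assoc sec_comm(1) sec_units)
qed (unfold PP_simps, simp add: sec_assoc)

lemma module_twist: "Module.module (str PP U) (sections (twist homog k) U)"
proof (rule moduleI[OF cring_PP])
  show "abelian_group (sections (twist homog k) U)"
  proof (rule abelian_groupI, unfold twist_simps)
    show "\<exists>y\<in>tw k U. sec_add homog U y x = sec_of homog U 0" if "x \<in> tw k U" for x
      using sec_uminus_left[OF that] sec_uminus_closed[OF that] by blast
  qed (simp_all add: sec_add_closed[OF U] sec_zero_closed[OF U] sec_assoc sec_comm(2) sec_units sec_units_right)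
qed (unfold twist_simps PP_simps, simp_all add: sec_mult_closed[OF U] sec_assoc sec_units)

end

lemma sheaf_sum3_simps:
  "carrier (sections (sheaf_sum3 K M N) U) = carrier (sections K U) \<times> carrier (sections M U) \<times> carrier (sections N U)"
  "\<zero>\<^bsub>sections (sheaf_sum3 K M N) U\<^esub> = (\<zero>\<^bsub>sections K U\<^esub>, \<zero>\<^bsub>sections M U\<^esub>, \<zero>\<^bsub>sections N U\<^esub>)"
  "(u1, u2, u3) \<oplus>\<^bsub>sections (sheaf_sum3 K M N) U\<^esub> (v1, v2, v3)
     = (u1 \<oplus>\<^bsub>sections K U\<^esub> v1, u2 \<oplus>\<^bsub>sections M U\<^esub> v2, u3 \<oplus>\<^bsub>sections N U\<^esub> v3)"
  "c \<odot>\<^bsub>sections (sheaf_sum3 K M N) U\<^esub> (u1, u2, u3)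
     = (c \<odot>\<^bsub>sections K U\<^esub> u1, c \<odot>\<^bsub>sections M U\<^esub> u2, c \<odot>\<^bsub>sections N U\<^esub> u3)"
  "res (sheaf_sum3 K M N) V (u1, u2, u3) = (res K V u1, res M V u2, res N V u3)"
  by (simp_all add: sheaf_sum3_def)

lemma module_sheaf_sum3:
  assumes "Module.module A (sections K U)" "Module.module A (sections M U)" "Module.module A (sections N U)"
  shows "Module.module A (sections (sheaf_sum3 K M N) U)"
proof -
  interpret K: Module.module A "sections K U" by fact
  interpret M: Module.module A "sections M U" by fact
  interpret N: Module.module A "sections N U" by fact
  show ?thesis
  proof (rule moduleI[OF K.R.is_cring])
    show "abelian_group (sections (sheaf_sum3 K M N) U)"
    proof (rule abelian_groupI)
      fix x assume "x \<in> carrier (sections (sheaf_sum3 K M N) U)"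
      then obtain x1 x2 x3 where x: "x = (x1, x2, x3)" "x1 \<in> carrier (sections K U)"
        "x2 \<in> carrier (sections M U)" "x3 \<in> carrier (sections N U)" by (auto simp: sheaf_sum3_simps)
      show "\<exists>y\<in>carrier (sections (sheaf_sum3 K M N) U).
          y \<oplus>\<^bsub>sections (sheaf_sum3 K M N) U\<^esub> x = \<zero>\<^bsub>sections (sheaf_sum3 K M N) U\<^esub>"
        by (rule bexI[of _ "(\<ominus>\<^bsub>sections K U\<^esub> x1, \<ominus>\<^bsub>sections M U\<^esub> x2, \<ominus>\<^bsub>sections N U\<^esub> x3)"])
          (use x in \<open>simp_all add: sheaf_sum3_simps K.M.l_neg M.M.l_neg N.M.l_neg\<close>)
    qed (auto simp: sheaf_sum3_simps K.M.a_ac M.M.a_ac N.M.a_ac)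
  qed (auto simp: sheaf_sum3_simps K.smult_l_distr M.smult_l_distr N.smult_l_distr
      K.smult_r_distr M.smult_r_distr N.smult_r_distr K.smult_assoc1 M.smult_assoc1 N.smult_assoc1)
qed

abbreviation TT :: "int \<Rightarrow> int \<Rightarrow> int \<Rightarrow> (('v::finite, 'a::comm_ring_1) mpoly set, ('v, 'a) mpoly sect,
     ('v, 'a) mpoly sect \<times> ('v, 'a) mpoly sect \<times> ('v, 'a) mpoly sect) sheaf_module" where
  "TT k1 k2 k3 \<equiv> sheaf_sum3 (twist homog k1) (twist homog k2) (twist homog k3)"

lemmas TT_simps = sheaf_sum3_simps[of "twist homog _" "twist homog _" "twist homog _", unfolded twist_simps]

lemma TT_cases:
  assumes "u \<in> carrier (sections (TT k1 k2 k3) U)"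
  obtains u1 u2 u3 where "u = (u1, u2, u3)" "u1 \<in> tw k1 U" "u2 \<in> tw k2 U" "u3 \<in> tw k3 U"
  using assms by (auto simp: TT_simps)

lemma module_TT: "opn U \<Longrightarrow> Module.module (str PP U) (sections (TT k1 k2 k3) U)"
  by (intro module_sheaf_sum3 module_twist)

lemma presheaf_TT:
  "presheaf_of_modules (PP :: (('v::finite, 'a::comm_ring_1) mpoly set, ('v, 'a) mpoly sect) ringed_space) (TT k1 k2 k3)"
proof (rule presheaf_of_modules.intro)
  fix U :: "('v, 'a) mpoly set set"
  assume "openin (space PP) U"
  then have U: "opn U" by (simp add: PP_simps)
  show "ext3_module (str PP U) (sections (TT k1 k2 k3) U)" by (rule ext3_module.intro[OF module_TT[OF U]])
  fix V assume "V \<in> opens PP U"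
  then have V: "opn V" "V \<subseteq> U" by (simp_all add: PP_simps)
  note r = tw_restrict[OF U V]
  show "semilinear (str PP U) (sections (TT k1 k2 k3) U) (sections (TT k1 k2 k3) V) (str_res PP V) (res (TT k1 k2 k3) V) (str PP V)"
    unfolding semilinear_def by (auto simp: TT_simps PP_simps r sec_restrict[OF V(2)])
  show "str_res PP V \<in> hom (add_monoid (str PP U)) (add_monoid (str PP V))"
    by (rule homI) (simp_all add: PP_simps r sec_restrict[OF V(2)])
qed

text \<open>Sections of all degrees take values in the same localizations, where the determinant of the
  coordinates can be formed; it is homogeneous of degree \<open>k1 + k2 + k3\<close>.\<close>

definition dform :: "('v::finite, 'a::comm_ring_1) mpoly set set \<Rightarrow>
    ('v, 'a) mpoly sect \<times> ('v, 'a) mpoly sect \<times> ('v, 'a) mpoly sect \<Rightarrow>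
    ('v, 'a) mpoly sect \<times> ('v, 'a) mpoly sect \<times> ('v, 'a) mpoly sect \<Rightarrow>
    ('v, 'a) mpoly sect \<times> ('v, 'a) mpoly sect \<times> ('v, 'a) mpoly sect \<Rightarrow> ('v, 'a) mpoly sect" where
  "dform U = (\<lambda>(u1, u2, u3) (v1, v2, v3) (w1, w2, w3). \<lambda>P\<in>U.
     D3 (LL P) (u1 P) (u2 P) (u3 P) (v1 P) (v2 P) (v3 P) (w1 P) (w2 P) (w3 P))"

lemma dform_value: "P \<in> U \<Longrightarrow> dform U (u1, u2, u3) (v1, v2, v3) (w1, w2, w3) P =
    D3 (LL P) (u1 P) (u2 P) (u3 P) (v1 P) (v2 P) (v3 P) (w1 P) (w2 P) (w3 P)"
  by (simp add: dform_def)

lemma dform_ext [simp]: "dform U u v w \<in> extensional U"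
  by (simp add: dform_def split: prod.split)

lemma dform_closed:
  assumes U: "opn U" and k: "k1 + k2 + k3 = 0"
    and u: "u1 \<in> tw k1 U" "u2 \<in> tw k2 U" "u3 \<in> tw k3 U"
    and v: "v1 \<in> tw k1 U" "v2 \<in> tw k2 U" "v3 \<in> tw k3 U"
    and w: "w1 \<in> tw k1 U" "w2 \<in> tw k2 U" "w3 \<in> tw k3 U"
  shows "dform U (u1, u2, u3) (v1, v2, v3) (w1, w2, w3) \<in> tw 0 U"
proof -
  let ?m = "sec_mult homog U" and ?a = "sec_add homog U" and ?n = "sec_uminus U"
  let ?M1 = "?a (?m v2 w3) (?n (?m v3 w2))"
  let ?M2 = "?a (?m v1 w3) (?n (?m v3 w1))"
  let ?M3 = "?a (?m v1 w2) (?n (?m v2 w1))"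
  let ?s = "?a (?a (?m u1 ?M1) (?n (?m u2 ?M2))) (?m u3 ?M3)"
  have m: "?m v2 w3 \<in> tw (k2 + k3) U" "?m v3 w2 \<in> tw (k2 + k3) U" "?m v1 w3 \<in> tw (k1 + k3) U"
    "?m v3 w1 \<in> tw (k1 + k3) U" "?m v1 w2 \<in> tw (k1 + k2) U" "?m v2 w1 \<in> tw (k1 + k2) U"
    by (rule sec_mult_closed[OF U v(2) w(3) refl] sec_mult_closed[OF U v(3) w(2)]
        sec_mult_closed[OF U v(1) w(3) refl] sec_mult_closed[OF U v(3) w(1)]
        sec_mult_closed[OF U v(1) w(2) refl] sec_mult_closed[OF U v(2) w(1)]; simp)+
  note n = sec_uminus_closed[OF U]
  have M: "?M1 \<in> tw (k2 + k3) U" "?M2 \<in> tw (k1 + k3) U" "?M3 \<in> tw (k1 + k2) U"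
    by (intro sec_add_closed[OF U] m n)+
  have uM: "?m u1 ?M1 \<in> tw 0 U" "?m u2 ?M2 \<in> tw 0 U" "?m u3 ?M3 \<in> tw 0 U"
    using k by (intro sec_mult_closed[OF U u(1) M(1)] sec_mult_closed[OF U u(2) M(2)] sec_mult_closed[OF U u(3) M(3)]; simp)+
  have "?s \<in> tw 0 U" by (intro sec_add_closed[OF U] uM n)
  moreover have "dform U (u1, u2, u3) (v1, v2, v3) (w1, w2, w3) = ?s"
  proof (rule tw_eqI)
    fix P assume P: "P \<in> U"
    note val = sec_uminus_value[OF U _ P]
    show "dform U (u1, u2, u3) (v1, v2, v3) (w1, w2, w3) P = ?s P"
      using P by (simp add: dform_value D3_def a_minus_def val[OF m(2)] val[OF m(4)] val[OF m(6)] val[OF uM(2)])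
  qed simp_all
  ultimately show ?thesis by simp
qed

lemma alt_form_dform:
  assumes U: "opn U" and k: "k1 + k2 + k3 = 0"
  shows "alt_form (str PP U) (sections (TT k1 k2 k3) U) (dform U)"
proof -
  show ?thesis
    unfolding alt_form_def
  proof (intro ballI)
    fix u v w assume "u \<in> carrier (sections (TT k1 k2 k3) U)" "v \<in> carrier (sections (TT k1 k2 k3) U)"
      "w \<in> carrier (sections (TT k1 k2 k3) U)"
    then obtain u1 u2 u3 v1 v2 v3 w1 w2 w3 where u: "u = (u1, u2, u3)" "u1 \<in> tw k1 U" "u2 \<in> tw k2 U" "u3 \<in> tw k3 U"
      and v: "v = (v1, v2, v3)" "v1 \<in> tw k1 U" "v2 \<in> tw k2 U" "v3 \<in> tw k3 U"
      and w: "w = (w1, w2, w3)" "w1 \<in> tw k1 U" "w2 \<in> tw k2 U" "w3 \<in> tw k3 U"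
      by (elim TT_cases) (rule that)
    note uv = u(2-4)[THEN tw_value[OF U]] v(2-4)[THEN tw_value[OF U]] w(2-4)[THEN tw_value[OF U]]
    note cr = LL_cring_U[OF U]
    have z: "sec_of homog U 0 P = \<zero>\<^bsub>LL P\<^esub>" if "P \<in> U" for P using that by (simp add: LL_zero)
    have 1: "dform U u v w \<in> carrier (str PP U)"
      unfolding u(1) v(1) w(1) PP_simps by (rule dform_closed[OF U k u(2-4) v(2-4) w(2-4)])
    have 2: "dform U u u w = \<zero>\<^bsub>str PP U\<^esub>" "dform U u w w = \<zero>\<^bsub>str PP U\<^esub>" "dform U u w u = \<zero>\<^bsub>str PP U\<^esub>"
      unfolding u(1) w(1) PP_simps
      by - (rule tw_eqI[of _ U]; simp add: dform_value LL_zero[symmetric] cring.D3_alt[OF cr] uv)+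
    have 3: "dform U (u \<oplus>\<^bsub>sections (TT k1 k2 k3) U\<^esub> x) v w = dform U u v w \<oplus>\<^bsub>str PP U\<^esub> dform U x v w"
      "dform U u (v \<oplus>\<^bsub>sections (TT k1 k2 k3) U\<^esub> x) w = dform U u v w \<oplus>\<^bsub>str PP U\<^esub> dform U u x w"
      "dform U u v (w \<oplus>\<^bsub>sections (TT k1 k2 k3) U\<^esub> x) = dform U u v w \<oplus>\<^bsub>str PP U\<^esub> dform U u v x"
      if xT: "x \<in> carrier (sections (TT k1 k2 k3) U)" for x
    proof -
      obtain x1 x2 x3 where x: "x = (x1, x2, x3)" "x1 \<in> tw k1 U" "x2 \<in> tw k2 U" "x3 \<in> tw k3 U"
        by (rule TT_cases[OF xT]) (rule that)
      note xv = x(2-4)[THEN tw_value[OF U]]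
      have o: "\<one>\<^bsub>LL P\<^esub> \<in> carrier (LL P)" if "P \<in> U" for P by (rule cring.cring_simprules(6)[OF cr[OF that]])
      show "dform U (u \<oplus>\<^bsub>sections (TT k1 k2 k3) U\<^esub> x) v w = dform U u v w \<oplus>\<^bsub>str PP U\<^esub> dform U x v w"
        "dform U u (v \<oplus>\<^bsub>sections (TT k1 k2 k3) U\<^esub> x) w = dform U u v w \<oplus>\<^bsub>str PP U\<^esub> dform U u x w"
        "dform U u v (w \<oplus>\<^bsub>sections (TT k1 k2 k3) U\<^esub> x) = dform U u v w \<oplus>\<^bsub>str PP U\<^esub> dform U u v x"
        unfolding u(1) v(1) w(1) x(1) PP_simps TT_simps
        by - (rule tw_eqI[of _ U]; simp add: dform_value uv xv o cring.D3_row1_linear(1)[OF cr]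
            cring.D3_row2_linear(1)[OF cr] cring.D3_row3_linear(1)[OF cr])+
    qed
    have 4: "dform U (c \<odot>\<^bsub>sections (TT k1 k2 k3) U\<^esub> u) v w = c \<otimes>\<^bsub>str PP U\<^esub> dform U u v w"
      "dform U u (c \<odot>\<^bsub>sections (TT k1 k2 k3) U\<^esub> v) w = c \<otimes>\<^bsub>str PP U\<^esub> dform U u v w"
      "dform U u v (c \<odot>\<^bsub>sections (TT k1 k2 k3) U\<^esub> w) = c \<otimes>\<^bsub>str PP U\<^esub> dform U u v w"
      if c: "c \<in> carrier (str PP U)" for c
    proof -
      have cv: "c P \<in> carrier (LL P)" if "P \<in> U" for P using c that tw_value[OF U] unfolding PP_simps by blast
      show "dform U (c \<odot>\<^bsub>sections (TT k1 k2 k3) U\<^esub> u) v w = c \<otimes>\<^bsub>str PP U\<^esub> dform U u v w"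
        "dform U u (c \<odot>\<^bsub>sections (TT k1 k2 k3) U\<^esub> v) w = c \<otimes>\<^bsub>str PP U\<^esub> dform U u v w"
        "dform U u v (c \<odot>\<^bsub>sections (TT k1 k2 k3) U\<^esub> w) = c \<otimes>\<^bsub>str PP U\<^esub> dform U u v w"
        unfolding u(1) v(1) w(1) PP_simps TT_simps
        by - (rule tw_eqI[of _ U]; simp add: dform_value uv cv cring.D3_row1_linear(2)[OF cr] cring.D3_row2_linear(2)[OF cr] cring.D3_row3_linear(2)[OF cr])+
    qed
    show "dform U u v w \<in> carrier (str PP U) \<and>
     dform U u u w = \<zero>\<^bsub>str PP U\<^esub> \<and> dform U u w w = \<zero>\<^bsub>str PP U\<^esub> \<and> dform U u w u = \<zero>\<^bsub>str PP U\<^esub> \<and>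
     (\<forall>x\<in>carrier (sections (TT k1 k2 k3) U). dform U (u \<oplus>\<^bsub>sections (TT k1 k2 k3) U\<^esub> x) v w = dform U u v w \<oplus>\<^bsub>str PP U\<^esub> dform U x v w \<and>
        dform U u (v \<oplus>\<^bsub>sections (TT k1 k2 k3) U\<^esub> x) w = dform U u v w \<oplus>\<^bsub>str PP U\<^esub> dform U u x w \<and>
        dform U u v (w \<oplus>\<^bsub>sections (TT k1 k2 k3) U\<^esub> x) = dform U u v w \<oplus>\<^bsub>str PP U\<^esub> dform U u v x) \<and>
     (\<forall>c\<in>carrier (str PP U). dform U (c \<odot>\<^bsub>sections (TT k1 k2 k3) U\<^esub> u) v w = c \<otimes>\<^bsub>str PP U\<^esub> dform U u v w \<and>
        dform U u (c \<odot>\<^bsub>sections (TT k1 k2 k3) U\<^esub> v) w = c \<otimes>\<^bsub>str PP U\<^esub> dform U u v w \<and>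
        dform U u v (c \<odot>\<^bsub>sections (TT k1 k2 k3) U\<^esub> w) = c \<otimes>\<^bsub>str PP U\<^esub> dform U u v w)"
      by (intro conjI ballI 1 2 3 4)
  qed
qed

lemma det_isoD:
  assumes "det_iso Y M \<alpha>" "openin (space Y) U"
  shows "\<alpha> U \<in> hom (ext3 (str Y U) (sections M U)) (add_monoid (str Y U))"
    "c \<in> carrier (str Y U) \<Longrightarrow> u \<in> carrier (sections M U) \<Longrightarrow> v \<in> carrier (sections M U) \<Longrightarrow> w \<in> carrier (sections M U) \<Longrightarrow>
       \<alpha> U (wedge_over Y M U (c \<odot>\<^bsub>sections M U\<^esub> u) v w) = c \<otimes>\<^bsub>str Y U\<^esub> \<alpha> U (wedge_over Y M U u v w)"
    "\<xi> \<in> carrier (ext3 (str Y U) (sections M U)) \<Longrightarrow> V \<in> opens Y U \<Longrightarrow>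
       str_res Y V (\<alpha> U \<xi>) = \<alpha> V (ext3_map (str Y V) (sections M V) (res M V) \<xi>)"
    "f \<in> carrier (str Y U) \<Longrightarrow> P \<in> U \<Longrightarrow> \<exists>V\<in>opens Y U. P \<in> V \<and>
        str_res Y V f \<in> \<alpha> V ` carrier (ext3 (str Y V) (sections M V))"
proof -
  note d = assms(1)[unfolded det_iso_def, rule_format, OF assms(2)]
  show "\<alpha> U \<in> hom (ext3 (str Y U) (sections M U)) (add_monoid (str Y U))" by (rule d[THEN conjunct1])
  show "\<alpha> U (wedge_over Y M U (c \<odot>\<^bsub>sections M U\<^esub> u) v w) = c \<otimes>\<^bsub>str Y U\<^esub> \<alpha> U (wedge_over Y M U u v w)"
    if "c \<in> carrier (str Y U)" "u \<in> carrier (sections M U)" "v \<in> carrier (sections M U)" "w \<in> carrier (sections M U)"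
    by (rule d[THEN conjunct2, THEN conjunct1, rule_format, OF that])
  show "str_res Y V (\<alpha> U \<xi>) = \<alpha> V (ext3_map (str Y V) (sections M V) (res M V) \<xi>)"
    if "\<xi> \<in> carrier (ext3 (str Y U) (sections M U))" "V \<in> opens Y U"
    by (rule d[THEN conjunct2, THEN conjunct2, THEN conjunct1, rule_format, OF that])
  show "\<exists>V\<in>opens Y U. P \<in> V \<and> str_res Y V f \<in> \<alpha> V ` carrier (ext3 (str Y V) (sections M V))"
    if "f \<in> carrier (str Y U)" "P \<in> U"
    by (rule d[THEN conjunct2, THEN conjunct2, THEN conjunct2, THEN conjunct2, rule_format, OF that])
qed

lemma (in presheaf_of_modules) det_iso_restrict:
  assumes \<alpha>: "det_iso Y M \<alpha>" and U: "openin (space Y) U" and V: "V \<in> opens Y U"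
    and "u \<in> carrier (sections M U)" "v \<in> carrier (sections M U)" "w \<in> carrier (sections M U)"
  shows "str_res Y V (\<alpha> U (wedge_over Y M U u v w)) = \<alpha> V (wedge_over Y M V (res M V u) (res M V v) (res M V w))"
proof -
  have oV: "openin (space Y) V" using V by simp
  note MU = ext3_module_sections[OF U]
  show ?thesis
    unfolding wedge_over_def det_isoD(3)[OF \<alpha> U ext3_module.wedge_ext3[OF MU assms(4-6)] V]
      ext3_map_wedge[OF MU ext3_module_sections[OF oV] res_semilinear[OF U V] assms(4-6)] ..
qed

lemma chart_neighbourhood:
  assumes U: "opn U" and P: "P \<in> U"
  obtains i where "opn (U \<inter> D (Xvar i))" "P \<in> U \<inter> D (Xvar i)"
proof -
  obtain i where "P \<in> D (Xvar i)" using Proj_cover[OF op_subset_Proj[OF U P]] by blast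
  then show thesis using that[of i] openin_Int[OF U op_D[OF homog_Xvar, of i]] P by blast
qed

subsection \<open>Bases on the standard charts\<close>

definition zero_sec :: "('v::finite, 'a::comm_ring_1) mpoly set set \<Rightarrow> ('v, 'a) mpoly sect" where
  "zero_sec U = sec_of homog U 0"

lemma zero_sec_closed: "opn U \<Longrightarrow> zero_sec U \<in> tw k U" unfolding zero_sec_def by (rule sec_zero_closed)
lemma zero_sec_value: "P \<in> U \<Longrightarrow> zero_sec U P = \<zero>\<^bsub>LL P\<^esub>" by (simp add: zero_sec_def LL_zero)
lemma zero_sec_restrict: "V \<subseteq> U \<Longrightarrow> restrict (zero_sec U) V = zero_sec V" unfolding zero_sec_def by (rule sec_restrict(3))
lemma xpow_restrict: "V \<subseteq> U \<Longrightarrow> restrict (xpow i k U) V = xpow i k V"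
  by (auto simp: xpow_def fun_eq_iff restrict_def)
lemma xpow_ext [simp]: "xpow i k V \<in> extensional V" by (simp add: xpow_def)

lemma xpow_mult_inverse:
  assumes "V \<subseteq> D (Xvar i)" "P \<in> V"
  shows "xpow i k V P \<otimes>\<^bsub>LL P\<^esub> xpow i (- k) V P = \<one>\<^bsub>LL P\<^esub>"
    "xpow i (- k) V P \<otimes>\<^bsub>LL P\<^esub> xpow i k V P = \<one>\<^bsub>LL P\<^esub>"
  using xpow_add[OF assms(2,1), of k "- k"] xpow_add[OF assms(2,1), of "- k" k] xpow_0[OF assms(2), of i] by simp_all

context
  fixes V :: "('v::finite, 'a::comm_ring_1) mpoly set set" and i :: 'v
  assumes V: "opn V" and Vi: "V \<subseteq> D (Xvar i)"
begin

lemma xpow_tw: "xpow i k V \<in> tw k V"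
  by (rule xpow_closed[OF V Vi])

lemma xpow_cancel:
  assumes "\<sigma> \<in> tw k V"
  shows "sec_mult homog V (sec_mult homog V \<sigma> (xpow i (- k) V)) (xpow i k V) = \<sigma>"
proof (rule tw_eqI)
  fix P assume P: "P \<in> V"
  interpret L: cring "LL P" by (rule LL_cring_U[OF V P])
  show "sec_mult homog V (sec_mult homog V \<sigma> (xpow i (- k) V)) (xpow i k V) P = \<sigma> P"
    using P tw_value[OF V assms P] tw_value[OF V xpow_tw P] xpow_mult_inverse[OF Vi P]
    by (simp add: L.m_assoc)
qed (simp_all add: tw_extensional[OF assms])

lemma TT_chart_basis:
  "ext3_generated (str PP V) (sections (TT k1 k2 k3) V) (xpow i k1 V, zero_sec V, zero_sec V) (zero_sec V, xpow i k2 V, zero_sec V) (zero_sec V, zero_sec V, xpow i k3 V)"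
proof (intro ext3_generated.intro ext3_module.intro module_TT[OF V] ext3_generated_axioms.intro)
  show "(xpow i k1 V, zero_sec V, zero_sec V) \<in> carrier (sections (TT k1 k2 k3) V)"
    "(zero_sec V, xpow i k2 V, zero_sec V) \<in> carrier (sections (TT k1 k2 k3) V)"
    "(zero_sec V, zero_sec V, xpow i k3 V) \<in> carrier (sections (TT k1 k2 k3) V)"
    by (simp_all add: TT_simps xpow_tw zero_sec_closed[OF V])
  fix u assume "u \<in> carrier (sections (TT k1 k2 k3) V)"
  then obtain u1 u2 u3 where u: "u = (u1, u2, u3)" "u1 \<in> tw k1 V" "u2 \<in> tw k2 V" "u3 \<in> tw k3 V" by (rule TT_cases)
  let ?a = "sec_mult homog V u1 (xpow i (- k1) V)"
  let ?b = "sec_mult homog V u2 (xpow i (- k2) V)"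
  let ?c = "sec_mult homog V u3 (xpow i (- k3) V)"
  have cl: "?a \<in> tw 0 V" "?b \<in> tw 0 V" "?c \<in> tw 0 V"
    by (rule sec_mult_closed[OF V u(2) xpow_tw], simp) (rule sec_mult_closed[OF V u(3) xpow_tw], simp,
        rule sec_mult_closed[OF V u(4) xpow_tw], simp)
  have "u = ?a \<odot>\<^bsub>sections (TT k1 k2 k3) V\<^esub> (xpow i k1 V, zero_sec V, zero_sec V) \<oplus>\<^bsub>sections (TT k1 k2 k3) V\<^esub>
     (?b \<odot>\<^bsub>sections (TT k1 k2 k3) V\<^esub> (zero_sec V, xpow i k2 V, zero_sec V) \<oplus>\<^bsub>sections (TT k1 k2 k3) V\<^esub>
      ?c \<odot>\<^bsub>sections (TT k1 k2 k3) V\<^esub> (zero_sec V, zero_sec V, xpow i k3 V))"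
    unfolding u(1) TT_simps zero_sec_def
    by (simp add: xpow_cancel u(2-4) sec_units_right[OF V cl(1)] sec_units_right[OF V cl(2)] sec_units_right[OF V cl(3)]
        sec_units[OF V u(3)] sec_units[OF V u(4)] sec_units_right[OF V u(2)] sec_units_right[OF V u(3)]
        sec_units[OF V sec_zero_closed[OF V, of 0]])
  then show "\<exists>a\<in>carrier (str PP V). \<exists>b\<in>carrier (str PP V). \<exists>c\<in>carrier (str PP V).
     u = a \<odot>\<^bsub>sections (TT k1 k2 k3) V\<^esub> (xpow i k1 V, zero_sec V, zero_sec V) \<oplus>\<^bsub>sections (TT k1 k2 k3) V\<^esub>
     (b \<odot>\<^bsub>sections (TT k1 k2 k3) V\<^esub> (zero_sec V, xpow i k2 V, zero_sec V) \<oplus>\<^bsub>sections (TT k1 k2 k3) V\<^esub>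
      c \<odot>\<^bsub>sections (TT k1 k2 k3) V\<^esub> (zero_sec V, zero_sec V, xpow i k3 V))"
    unfolding PP_simps using cl by blast
qed

end

lemma (in cring) D3_diagonal:
  assumes "a \<in> carrier R" "b \<in> carrier R" "c \<in> carrier R"
  shows "D3 R a \<zero> \<zero> \<zero> b \<zero> \<zero> \<zero> c = a \<otimes> b \<otimes> c"
  using assms by (simp add: D3_def a_minus_def m_assoc)

lemma dform_diagonal:
  assumes U: "opn U" and f: "f \<in> tw k1 U" "g \<in> tw k2 U" "h \<in> tw k3 U"
  shows "dform U (f, zero_sec U, zero_sec U) (zero_sec U, g, zero_sec U) (zero_sec U, zero_sec U, h) = sec_mult homog U (sec_mult homog U f g) h"
proof (rule tw_eqI[of _ U])
  fix P assume P: "P \<in> U"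
  show "dform U (f, zero_sec U, zero_sec U) (zero_sec U, g, zero_sec U) (zero_sec U, zero_sec U, h) P = sec_mult homog U (sec_mult homog U f g) h P"
    using P f[THEN tw_value[OF U]] by (simp add: dform_value zero_sec_value cring.D3_diagonal[OF LL_cring_U[OF U]])
qed simp_all

lemma dform_chart_basis:
  assumes V: "opn V" "V \<subseteq> D (Xvar i)" and k: "k1 + k2 + k3 = 0"
  shows "dform V (xpow i k1 V, zero_sec V, zero_sec V) (zero_sec V, xpow i k2 V, zero_sec V) (zero_sec V, zero_sec V, xpow i k3 V) = sec_of homog V 1"
  unfolding dform_diagonal[OF V(1) xpow_tw[OF V] xpow_tw[OF V] xpow_tw[OF V]]
  by (rule tw_eqI[of _ V]) (simp_all add: xpow_add[OF _ V(2)] k xpow_0 LL_one)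

lemma dform_restrict:
  assumes "V \<subseteq> U"
  shows "restrict (dform U u v w) V = dform V (res (TT k1 k2 k3) V u) (res (TT k1 k2 k3) V v) (res (TT k1 k2 k3) V w)"
proof -
  obtain u1 u2 u3 v1 v2 v3 w1 w2 w3 where "u = (u1, u2, u3)" "v = (v1, v2, v3)" "w = (w1, w2, w3)"
    by (cases u, cases v, cases w) blast
  then show ?thesis
    using assms by (auto simp: dform_def TT_simps fun_eq_iff restrict_def subset_iff)
qed

lemma opens_PP: "V \<in> opens PP U \<longleftrightarrow> opn V \<and> V \<subseteq> U"
  by (simp add: PP_simps)

text \<open>On the chart of \<open>x\<^sub>i\<close> the determinant takes the value \<open>x\<^sub>i\<^sup>0\<close> on the basis of powers of \<open>x\<^sub>i\<close>.\<close>

lemma exists_canonical_det: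
  assumes k: "k1 + k2 + k3 = 0"
  shows "\<exists>\<alpha>. det_iso (PP :: (('v::finite, 'a::comm_ring_1) mpoly set, _) ringed_space) (TT k1 k2 k3) \<alpha> \<and>
    (\<forall>U. opn U \<longrightarrow> (\<forall>u\<in>carrier (sections (TT k1 k2 k3) U). \<forall>v\<in>carrier (sections (TT k1 k2 k3) U).
       \<forall>w\<in>carrier (sections (TT k1 k2 k3) U). \<alpha> U (wedge_over PP (TT k1 k2 k3) U u v w) = dform U u v w))"
proof -
  have "\<exists>\<alpha>. det_iso (PP :: (('v, 'a) mpoly set, _) ringed_space) (TT k1 k2 k3) \<alpha> \<and>
    (\<forall>U. openin (space PP) U \<longrightarrow> (\<forall>u\<in>carrier (sections (TT k1 k2 k3) U). \<forall>v\<in>carrier (sections (TT k1 k2 k3) U).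
       \<forall>w\<in>carrier (sections (TT k1 k2 k3) U). \<alpha> U (wedge_over PP (TT k1 k2 k3) U u v w) = dform U u v w))"
  proof (rule presheaf_of_modules.exists_det_iso[OF presheaf_TT])
    fix U :: "('v, 'a) mpoly set set"
    assume "openin (space PP) U"
    then have U: "opn U" by (simp add: PP_simps)
    show "alt_form (str PP U) (sections (TT k1 k2 k3) U) (dform U)" by (rule alt_form_dform[OF U k])
    show "str_res PP V (dform U u v w) = dform V (res (TT k1 k2 k3) V u) (res (TT k1 k2 k3) V v) (res (TT k1 k2 k3) V w)"
      if "V \<in> opens PP U" for V u v w
      using that unfolding opens_PP PP_simps by (intro dform_restrict) blast
    fix P assume "P \<in> U"
    then obtain i where i: "opn (U \<inter> D (Xvar i))" "P \<in> U \<inter> D (Xvar i)" by (rule chart_neighbourhood[OF U])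
    let ?V = "U \<inter> D (Xvar i)"
    have "?V \<in> opens PP U" unfolding opens_PP using i(1) by simp
    moreover have "sec_of homog ?V 1 \<in> carrier (str PP ?V)"
      unfolding PP_simps using sec_of_closed[OF i(1) homog_1] by simp
    moreover have "sec_of homog ?V 1 \<otimes>\<^bsub>str PP ?V\<^esub> dform ?V (xpow i k1 ?V, zero_sec ?V, zero_sec ?V) (zero_sec ?V, xpow i k2 ?V, zero_sec ?V)
       (zero_sec ?V, zero_sec ?V, xpow i k3 ?V) = \<one>\<^bsub>str PP ?V\<^esub>"
      unfolding dform_chart_basis[OF i(1) Int_lower2 k] PP_simps
      by (rule sec_units(1)[OF i(1) sec_of_closed[OF i(1) homog_1]])
    ultimately show "\<exists>V\<in>opens PP U. P \<in> V \<and> (\<exists>e1 e2 e3 d. ext3_generated (str PP V) (sections (TT k1 k2 k3) V) e1 e2 e3 \<and>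
       d \<in> carrier (str PP V) \<and> d \<otimes>\<^bsub>str PP V\<^esub> dform V e1 e2 e3 = \<one>\<^bsub>str PP V\<^esub>)"
      using i(2) TT_chart_basis[OF i(1) Int_lower2, of k1 k2 k3] by blast
  qed
  then show ?thesis unfolding PP_simps .
qed

lemma exists_canonical_det_T_sheaf: "\<exists>\<alpha> :: ('v::finite, 'a::comm_ring_1) T_form. canonical_det l m \<alpha>"
proof -
  let ?k = "- int l - int m"
  have eq0: "int l + int m + ?k = 0" by simp
  obtain \<alpha> :: "('v, 'a) T_form" where \<alpha>: "det_iso PP (TT (int l) (int m) ?k) \<alpha>"
    "\<forall>U. opn U \<longrightarrow> (\<forall>u\<in>carrier (sections (TT (int l) (int m) ?k) U). \<forall>v\<in>carrier (sections (TT (int l) (int m) ?k) U).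
       \<forall>w\<in>carrier (sections (TT (int l) (int m) ?k) U). \<alpha> U (wedge_over PP (TT (int l) (int m) ?k) U u v w) = dform U u v w)"
    using exists_canonical_det[of "int l" "int m" ?k, OF eq0] by (elim exE conjE) (rule that)
  have "canonical_det l m \<alpha>"
    unfolding canonical_det_def T_sheaf_def
  proof (intro conjI allI impI ballI)
    show "det_iso PP (TT (int l) (int m) ?k) \<alpha>" by (rule \<alpha>(1))
    fix U :: "('v, 'a) mpoly set set" and f g h
    assume U': "openin (space PP) U" and f: "f \<in> tw (int l) U" and g: "g \<in> tw (int m) U" and h: "h \<in> tw ?k U"
    then have U: "opn U" by (simp add: PP_simps)
    note z = zero_sec_closed[OF U]
    show "\<alpha> U (wedge_over PP (TT (int l) (int m) ?k) U (f, sec_of homog U 0, sec_of homog U 0)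
        (sec_of homog U 0, g, sec_of homog U 0) (sec_of homog U 0, sec_of homog U 0, h)) = sec_mult homog U (sec_mult homog U f g) h"
      unfolding zero_sec_def[symmetric] dform_diagonal[OF U f g h, symmetric]
      by (rule \<alpha>(2)[rule_format, OF U]) (simp_all add: TT_simps f g h z)
  qed
  then show ?thesis by blast
qed

subsection \<open>Every orientation is a constant multiple of the canonical one\<close>

text \<open>A chart has a basis of sections, so an alternating form is its value on the basis times the
  determinant of the coordinates.\<close>

lemma det_iso_on_chart:
  fixes V :: "('v::finite, 'a::comm_ring_1) mpoly set set"
  assumes \<alpha>: "det_iso PP (TT k1 k2 k3) \<alpha>" and k: "k1 + k2 + k3 = 0"
    and V: "opn V" "V \<subseteq> D (Xvar i)"
    and \<xi>: "\<xi> \<in> carrier (ext3 (str PP V) (sections (TT k1 k2 k3) V))"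
  shows "\<exists>a\<in>tw 0 V. \<alpha> V \<xi> = sec_mult homog V a (\<alpha> V (wedge_over PP (TT k1 k2 k3) V (xpow i k1 V, zero_sec V, zero_sec V) (zero_sec V, xpow i k2 V, zero_sec V) (zero_sec V, zero_sec V, xpow i k3 V)))
    \<and> (\<forall>u\<in>carrier (sections (TT k1 k2 k3) V). \<forall>v\<in>carrier (sections (TT k1 k2 k3) V). \<forall>w\<in>carrier (sections (TT k1 k2 k3) V).
         \<xi> = wedge_over PP (TT k1 k2 k3) V u v w \<longrightarrow> a = dform V u v w)"
proof -
  let ?T = "sections (TT k1 k2 k3) V"
  let ?e1 = "(xpow i k1 V, zero_sec V, zero_sec V)" and ?e2 = "(zero_sec V, xpow i k2 V, zero_sec V)" and ?e3 = "(zero_sec V, zero_sec V, xpow i k3 V)"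
  interpret E: ext3_generated "str PP V" ?T ?e1 ?e2 ?e3 by (rule TT_chart_basis[OF V])
  have oV: "openin (space PP) V" using V by (simp add: PP_simps)
  obtain \<alpha>0 where \<alpha>0: "det_iso (PP :: (('v, 'a) mpoly set, _) ringed_space) (TT k1 k2 k3) \<alpha>0"
    "\<forall>U. opn U \<longrightarrow> (\<forall>u\<in>carrier (sections (TT k1 k2 k3) U). \<forall>v\<in>carrier (sections (TT k1 k2 k3) U).
       \<forall>w\<in>carrier (sections (TT k1 k2 k3) U). \<alpha>0 U (wedge_over PP (TT k1 k2 k3) U u v w) = dform U u v w)"
    using exists_canonical_det[OF k] by blast
  obtain a where a: "a \<in> carrier (str PP V)" "\<xi> = wedge_over PP (TT k1 k2 k3) V (a \<odot>\<^bsub>?T\<^esub> ?e1) ?e2 ?e3"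
    using E.ext3_generated_by_wedge[OF \<xi>] unfolding wedge_over_def by blast
  have a0: "a \<in> tw 0 V" using a(1) by (simp add: PP_simps)
  have "a = dform V u v w" if uvw: "u \<in> carrier ?T" "v \<in> carrier ?T" "w \<in> carrier ?T"
    and eq: "\<xi> = wedge_over PP (TT k1 k2 k3) V u v w" for u v w
  proof -
    have "dform V u v w = \<alpha>0 V \<xi>" unfolding eq using \<alpha>0(2) V(1) uvw by simp
    also have "\<dots> = a \<otimes>\<^bsub>str PP V\<^esub> \<alpha>0 V (wedge_over PP (TT k1 k2 k3) V ?e1 ?e2 ?e3)"
      unfolding a(2) by (rule det_isoD(2)[OF \<alpha>0(1) oV a(1) E.e])
    also have "\<alpha>0 V (wedge_over PP (TT k1 k2 k3) V ?e1 ?e2 ?e3) = sec_of homog V 1"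
      using \<alpha>0(2) V(1) E.e unfolding dform_chart_basis[OF V k, symmetric] by blast
    also have "a \<otimes>\<^bsub>str PP V\<^esub> sec_of homog V 1 = a"
      using E.MM.R.r_one[OF a(1)] unfolding PP_simps .
    finally show ?thesis by (rule sym)
  qed
  moreover have "\<alpha> V \<xi> = sec_mult homog V a (\<alpha> V (wedge_over PP (TT k1 k2 k3) V ?e1 ?e2 ?e3))"
    using det_isoD(2)[OF \<alpha> oV a(1) E.e] unfolding a(2) PP_simps .
  ultimately show ?thesis using a0 by blast
qed

text \<open>Inverses are unique, so local inverses glue to a global function, which is constant as well.\<close>

lemma global_unit:
  fixes c :: "('v::finite, 'a::comm_ring_1) mpoly sect"
  assumes c: "c \<in> tw 0 (Proj homog)" and two: "(i0 :: 'v) \<noteq> j0"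
    and inv: "\<And>P. P \<in> Proj homog \<Longrightarrow> \<exists>V a. opn V \<and> P \<in> V \<and> a \<in> tw 0 V \<and> (\<forall>Q\<in>V. a Q \<otimes>\<^bsub>LL Q\<^esub> c Q = \<one>\<^bsub>LL Q\<^esub>)"
  shows "\<exists>c0 d0. c0 * d0 = 1 \<and> c = sec_of homog (Proj homog) (Const c0)"
proof -
  let ?X = "Proj homog :: ('v, 'a) mpoly set set"
  define d where "d = (\<lambda>P\<in>?X. SOME y. y \<in> carrier (LL P) \<and> y \<otimes>\<^bsub>LL P\<^esub> c P = \<one>\<^bsub>LL P\<^esub>)"
  have d_eq: "d Q = y" if Q: "Q \<in> ?X" and y: "y \<in> carrier (LL Q)" "y \<otimes>\<^bsub>LL Q\<^esub> c Q = \<one>\<^bsub>LL Q\<^esub>" for Q y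
  proof -
    interpret L: cring "LL Q" by (rule cring_LL[OF Q])
    have cQ: "c Q \<in> carrier (LL Q)" by (rule tw_value[OF op_Proj c Q])
    have "d Q \<in> carrier (LL Q) \<and> d Q \<otimes>\<^bsub>LL Q\<^esub> c Q = \<one>\<^bsub>LL Q\<^esub>"
      unfolding d_def restrict_apply' [OF Q] by (rule someI[of _ y]) (use y in blast)
    then have dQ: "d Q \<in> carrier (LL Q)" "c Q \<otimes>\<^bsub>LL Q\<^esub> d Q = \<one>\<^bsub>LL Q\<^esub>"
      using L.m_comm[OF cQ, of "d Q"] by simp_all
    show ?thesis using L.inv_unique[OF y(2) dQ(2) cQ y(1) dQ(1)] by simp
  qed
  have "d \<in> tw 0 ?X"
  proof (rule tw_glue[OF op_Proj])
    show "d \<in> extensional ?X" by (simp add: d_def)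
    fix P assume "P \<in> ?X"
    then obtain V a where V: "opn V" "P \<in> V" "a \<in> tw 0 V" "\<forall>Q\<in>V. a Q \<otimes>\<^bsub>LL Q\<^esub> c Q = \<one>\<^bsub>LL Q\<^esub>"
      using inv by blast
    have VX: "V \<subseteq> ?X" using op_subset_Proj[OF V(1)] by blast
    have "restrict d V = a"
    proof (rule tw_eqI[of _ V])
      fix Q assume Q: "Q \<in> V"
      then show "restrict d V Q = a Q"
        using d_eq[OF subsetD[OF VX Q] tw_value[OF V(1,3) Q] bspec[OF V(4) Q]] by simp
    qed (simp_all add: tw_extensional[OF V(3)])
    then show "\<exists>V. opn V \<and> P \<in> V \<and> V \<subseteq> ?X \<and> restrict d V \<in> tw 0 V" using V VX by auto
  qed
  then obtain q where q: "q \<in> homog 0" "d = sec_of homog ?X q"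
    using global_sections_nonneg[of d 0, OF _ two] by auto
  obtain p where p: "p \<in> homog 0" "c = sec_of homog ?X p"
    using global_sections_nonneg[of c 0, OF _ two] c by auto
  obtain c0 d0 where cd: "p = Const c0" "q = Const d0" using homog_zero_Const p(1) q(1) by blast
  have "sec_of homog ?X (p * q) = sec_of homog ?X 1"
  proof (rule tw_eqI[of _ ?X])
    fix Q assume Q: "Q \<in> ?X"
    interpret mult_set "dn Q" by (rule mult_set_denoms[OF Q])
    obtain V a where V: "opn V" "Q \<in> V" "a \<in> tw 0 V" "\<forall>Q\<in>V. a Q \<otimes>\<^bsub>LL Q\<^esub> c Q = \<one>\<^bsub>LL Q\<^esub>"
      using inv[OF Q] by blast
    have "d Q = a Q" by (rule d_eq[OF Q tw_value[OF V(1,3,2)] bspec[OF V(4,2)]])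
    then have "d Q \<otimes>\<^bsub>LL Q\<^esub> c Q = \<one>\<^bsub>LL Q\<^esub>" using V by simp
    then show "sec_of homog ?X (p * q) Q = sec_of homog ?X 1 Q"
      using Q unfolding p(2) q(2) by (simp add: fraction_mult LL_one mult.commute)
  qed simp_all
  then have "Const (c0 * d0) = (1 :: ('v, 'a) mpoly)" unfolding sec_of_inject cd by simp
  then have "Const (c0 * d0) = (Const 1 :: ('v, 'a) mpoly)" by simp
  then have "c0 * d0 = 1" unfolding Const_eq_iff .
  then show ?thesis using p(2) cd(1) by blast
qed

text \<open>On the chart of \<open>x\<^sub>i\<close> the orientation is the determinant times its value on the chart basis.
  The determinant of any chart basis is one, so these values agree on overlaps and glue to a global
  function.  Local surjectivity of the orientation makes this function locally invertible.\<close>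

lemma det_iso_is_multiple_of_canonical:
  fixes \<alpha> :: "(('v::finite, 'a::comm_ring_1) mpoly set, _, _) det_form"
  assumes \<alpha>: "det_iso PP (TT k1 k2 k3) \<alpha>" and k: "k1 + k2 + k3 = 0" and two: "(i0 :: 'v) \<noteq> j0"
  obtains c0 d0 :: 'a where "c0 * d0 = 1"
    "\<And>U u v w. opn U \<Longrightarrow> u \<in> carrier (sections (TT k1 k2 k3) U) \<Longrightarrow> v \<in> carrier (sections (TT k1 k2 k3) U) \<Longrightarrow>
       w \<in> carrier (sections (TT k1 k2 k3) U) \<Longrightarrow>
       \<alpha> U (wedge_over PP (TT k1 k2 k3) U u v w) = sec_mult homog U (sec_of homog U (Const c0)) (dform U u v w)"
proof -
  let ?X = "Proj homog :: ('v, 'a) mpoly set set"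
  let ?T = "\<lambda>V. sections (TT k1 k2 k3) V"
  let ?W = "wedge_over PP (TT k1 k2 k3)"
  define e1 where "e1 i V = (xpow i k1 V, zero_sec V, zero_sec V)" for i and V :: "('v, 'a) mpoly set set"
  define e2 where "e2 i V = (zero_sec V, xpow i k2 V, zero_sec V)" for i and V :: "('v, 'a) mpoly set set"
  define e3 where "e3 i V = (zero_sec V, zero_sec V, xpow i k3 V)" for i and V :: "('v, 'a) mpoly set set"
  note e_defs = e1_def e2_def e3_def
  define \<gamma> where "\<gamma> i V = \<alpha> V (?W V (e1 i V) (e2 i V) (e3 i V))" for i V
  have oX: "openin (space PP) V" if "opn V" for V :: "('v, 'a) mpoly set set" using that by (simp add: PP_simps)
  have eT: "e1 i V \<in> carrier (?T V)" "e2 i V \<in> carrier (?T V)" "e3 i V \<in> carrier (?T V)"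
    if "opn V" "V \<subseteq> D (Xvar i)" for i V
    unfolding e_defs by (simp_all add: TT_simps xpow_tw[OF that] zero_sec_closed[OF that(1)])
  have W: "?W V u v w \<in> carrier (ext3 (str PP V) (?T V))"
    if "opn V" "u \<in> carrier (?T V)" "v \<in> carrier (?T V)" "w \<in> carrier (?T V)" for V u v w
    unfolding wedge_over_def by (rule ext3_module.wedge_ext3[OF ext3_module.intro[OF module_TT[OF that(1)]] that(2-4)])
  have \<alpha>tw: "\<alpha> V \<xi> \<in> tw 0 V" if "opn V" "\<xi> \<in> carrier (ext3 (str PP V) (?T V))" for V \<xi>
    using hom_in_carrier[OF det_isoD(1)[OF \<alpha> oX[OF that(1)]] that(2)] by (simp add: PP_simps)
  have \<gamma>tw: "\<gamma> i V \<in> tw 0 V" if "opn V" "V \<subseteq> D (Xvar i)" for i V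
    unfolding \<gamma>_def by (rule \<alpha>tw[OF that(1) W[OF that(1) eT[OF that]]])
  have chart: "\<alpha> V (?W V u v w) = sec_mult homog V (dform V u v w) (\<gamma> i V)"
    if "opn V" "V \<subseteq> D (Xvar i)" "u \<in> carrier (?T V)" "v \<in> carrier (?T V)" "w \<in> carrier (?T V)" for i V u v w
    using det_iso_on_chart[OF \<alpha> k that(1,2) W[OF that(1,3-5)]] that(3-5) unfolding \<gamma>_def e_defs by blast
  have res: "restrict (\<alpha> U (?W U u v w)) V = \<alpha> V (?W V (res (TT k1 k2 k3) V u) (res (TT k1 k2 k3) V v) (res (TT k1 k2 k3) V w))"
    if "opn U" "opn V" "V \<subseteq> U" "u \<in> carrier (?T U)" "v \<in> carrier (?T U)" "w \<in> carrier (?T U)" for U V u v w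
    using presheaf_of_modules.det_iso_restrict[OF presheaf_TT \<alpha> oX[OF that(1)] _ that(4-6), of V] that(2,3)
    unfolding opens_PP PP_simps(7) by blast
  have \<gamma>res: "restrict (\<gamma> i U) V = \<gamma> i V" if "opn U" "opn V" "V \<subseteq> U" "U \<subseteq> D (Xvar i)" for i U V
    unfolding \<gamma>_def res[OF that(1-3) eT[OF that(1,4)]]
    by (simp add: e_defs TT_simps xpow_restrict[OF that(3)] zero_sec_restrict[OF that(3)])
  have \<gamma>eq: "\<gamma> j V = \<gamma> i V" if V: "opn V" "V \<subseteq> D (Xvar i)" "V \<subseteq> D (Xvar j)" for i j V
  proof -
    have "\<gamma> j V = sec_mult homog V (dform V (e1 j V) (e2 j V) (e3 j V)) (\<gamma> i V)"
      unfolding \<gamma>_def[of j] by (rule chart[OF V(1,2) eT[OF V(1,3)]])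
    also have "dform V (e1 j V) (e2 j V) (e3 j V) = sec_of homog V 1"
      unfolding e_defs by (rule dform_chart_basis[OF V(1,3) k])
    finally show ?thesis using sec_units(1)[OF V(1) \<gamma>tw[OF V(1,2)]] by simp
  qed
  have oD: "opn (D (Xvar i))" for i :: 'v by (rule op_D[OF homog_Xvar])
  define c where "c = (\<lambda>P\<in>?X. \<gamma> (SOME i. P \<in> D (Xvar i)) (D (Xvar (SOME i. P \<in> D (Xvar i)))) P)"
  have c_eq: "c P = \<gamma> i V P" if V: "opn V" "V \<subseteq> D (Xvar i)" and P: "P \<in> V" for i V P
  proof -
    have PX: "P \<in> ?X" using op_subset_Proj[OF V(1) P] .
    define j where "j = (SOME i. P \<in> D (Xvar i))"
    have j: "P \<in> D (Xvar j)" unfolding j_def by (rule someI_ex[OF Proj_cover[OF PX]])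
    let ?V = "V \<inter> D (Xvar j)"
    have oV: "opn ?V" by (rule openin_Int[OF V(1) oD])
    have "c P = \<gamma> j (D (Xvar j)) P" unfolding c_def j_def using PX by simp
    also have "\<dots> = \<gamma> j ?V P" using \<gamma>res[OF oD oV Int_lower2 subset_refl] P j by (metis IntI restrict_apply')
    also have "\<gamma> j ?V = \<gamma> i ?V" by (rule \<gamma>eq[OF oV]) (use V in auto)
    also have "\<gamma> i ?V P = \<gamma> i V P" using \<gamma>res[OF V(1) oV Int_lower1 V(2)] P j by (metis IntI restrict_apply')
    finally show ?thesis .
  qed
  have cX: "c \<in> tw 0 ?X"
  proof (rule tw_glue[OF op_Proj])
    show "c \<in> extensional ?X" by (simp add: c_def)
    fix P assume "P \<in> ?X"
    then obtain i where i: "P \<in> D (Xvar i)" using Proj_cover by blast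
    have "restrict c (D (Xvar i)) = \<gamma> i (D (Xvar i))"
      by (rule tw_eqI[of _ "D (Xvar i)"])
        (simp_all add: tw_extensional[OF \<gamma>tw[OF oD subset_refl]] c_eq[OF oD subset_refl])
    then have "restrict c (D (Xvar i)) \<in> tw 0 (D (Xvar i))" using \<gamma>tw[OF oD subset_refl] by simp
    moreover have "D (Xvar i) \<subseteq> ?X" by (auto simp: D_def)
    ultimately show "\<exists>V. opn V \<and> P \<in> V \<and> V \<subseteq> ?X \<and> restrict c V \<in> tw 0 V" using i oD by blast
  qed
  have "\<exists>c0 d0. c0 * d0 = 1 \<and> c = sec_of homog ?X (Const c0)"
  proof (rule global_unit[OF cX two])
    fix P assume P: "P \<in> ?X"
    have "sec_of homog ?X 1 \<in> carrier (str PP ?X)" unfolding PP_simps using sec_of_closed[OF op_Proj homog_1] by simp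
    then obtain V \<xi> where V: "opn V" "P \<in> V" and \<xi>: "\<xi> \<in> carrier (ext3 (str PP V) (?T V))"
      "restrict (sec_of homog ?X 1) V = \<alpha> V \<xi>"
      using det_isoD(4)[OF \<alpha> oX[OF op_Proj] _ P] unfolding PP_simps(7) opens_PP Bex_def by blast
    have VX: "V \<subseteq> ?X" using op_subset_Proj[OF V(1)] by blast
    obtain i where i: "opn (V \<inter> D (Xvar i))" "P \<in> V \<inter> D (Xvar i)" by (rule chart_neighbourhood[OF V])
    let ?V = "V \<inter> D (Xvar i)"
    have Vo: "?V \<in> opens PP V" unfolding opens_PP using i(1) by simp
    let ?\<eta> = "ext3_map (str PP ?V) (?T ?V) (res (TT k1 k2 k3) ?V) \<xi>"
    have \<eta>: "?\<eta> \<in> carrier (ext3 (str PP ?V) (?T ?V))"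
      by (rule hom_in_carrier[OF ext3_map_hom[OF ext3_module.intro[OF module_TT[OF V(1)]] ext3_module.intro[OF module_TT[OF i(1)]]
            presheaf_of_modules.res_semilinear[OF presheaf_TT oX[OF V(1)] Vo]] \<xi>(1)])
    obtain a where a: "a \<in> tw 0 ?V" "\<alpha> ?V ?\<eta> = sec_mult homog ?V a (\<gamma> i ?V)"
      using det_iso_on_chart[OF \<alpha> k i(1) Int_lower2 \<eta>] unfolding \<gamma>_def e_defs by blast
    have "sec_of homog ?V 1 = restrict (restrict (sec_of homog ?X 1) V) ?V"
      using VX by (simp add: sec_restrict(3) Int_absorb1)
    also have "\<dots> = \<alpha> ?V ?\<eta>" unfolding \<xi>(2) using det_isoD(3)[OF \<alpha> oX[OF V(1)] \<xi>(1) Vo] unfolding PP_simps(7) .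
    finally have one: "sec_mult homog ?V a (\<gamma> i ?V) = sec_of homog ?V 1" unfolding a(2) by (rule sym)
    have "a Q \<otimes>\<^bsub>LL Q\<^esub> c Q = \<one>\<^bsub>LL Q\<^esub>" if Q: "Q \<in> ?V" for Q
    proof -
      have "a Q \<otimes>\<^bsub>LL Q\<^esub> c Q = sec_mult homog ?V a (\<gamma> i ?V) Q"
        unfolding c_eq[OF i(1) Int_lower2 Q] sec_simps(1)[OF Q] ..
      then show ?thesis unfolding one sec_simps(3)[OF Q] LL_one .
    qed
    then show "\<exists>V a. opn V \<and> P \<in> V \<and> a \<in> tw 0 V \<and> (\<forall>Q\<in>V. a Q \<otimes>\<^bsub>LL Q\<^esub> c Q = \<one>\<^bsub>LL Q\<^esub>)"
      using i a(1) by blast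
  qed
  then obtain c0 d0 where cd: "c0 * d0 = 1" "c = sec_of homog ?X (Const c0)" by blast
  show thesis
  proof (rule that[OF cd(1)])
    fix U :: "('v, 'a) mpoly set set" and u v w
    assume U: "opn U" and uvw: "u \<in> carrier (?T U)" "v \<in> carrier (?T U)" "w \<in> carrier (?T U)"
    show "\<alpha> U (?W U u v w) = sec_mult homog U (sec_of homog U (Const c0)) (dform U u v w)"
    proof (rule tw_eqI[OF tw_extensional[OF \<alpha>tw[OF U W[OF U uvw]]] sec_ext(1)])
      fix P assume P: "P \<in> U"
      obtain i where i: "opn (U \<inter> D (Xvar i))" "P \<in> U \<inter> D (Xvar i)" by (rule chart_neighbourhood[OF U P])
      let ?V = "U \<inter> D (Xvar i)"
      have Vo: "?V \<in> opens PP U" unfolding opens_PP using i(1) by simp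
      note r = semilinearD(1)[OF presheaf_of_modules.res_semilinear[OF presheaf_TT oX[OF U] Vo]]
      have dU: "dform U u v w P \<in> carrier (LL P)"
        using tw_value[OF U _ P] alt_formD(1)[OF alt_form_dform[OF U k] uvw] unfolding PP_simps by blast
      interpret L: cring "LL P" by (rule LL_cring_U[OF U P])
      have "\<alpha> U (?W U u v w) P = restrict (\<alpha> U (?W U u v w)) ?V P" using i(2) by simp
      also have "\<dots> = sec_mult homog ?V (dform ?V (res (TT k1 k2 k3) ?V u) (res (TT k1 k2 k3) ?V v) (res (TT k1 k2 k3) ?V w)) (\<gamma> i ?V) P"
        unfolding res[OF U i(1) Int_lower1 uvw] chart[OF i(1) Int_lower2 r[OF uvw(1)] r[OF uvw(2)] r[OF uvw(3)]] ..
      also have "\<dots> = dform U u v w P \<otimes>\<^bsub>LL P\<^esub> c P"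
        unfolding dform_restrict[OF Int_lower1, symmetric] sec_simps(1)[OF i(2)] c_eq[OF i(1) Int_lower2 i(2)] using i(2) by simp
      also have "\<dots> = c P \<otimes>\<^bsub>LL P\<^esub> dform U u v w P"
        by (rule L.m_comm[OF dU tw_value[OF op_Proj cX op_subset_Proj[OF U P]]])
      also have "c P = sec_of homog U (Const c0) P" unfolding cd(2) using P op_subset_Proj[OF U P] by simp
      finally show "\<alpha> U (?W U u v w) P = sec_mult homog U (sec_of homog U (Const c0)) (dform U u v w) P"
        using P by simp
    qed
  qed
qed

lemma canonical_det_constant:
  fixes \<alpha> :: "('v::finite, 'a::comm_ring_1) T_form"
  assumes \<alpha>: "canonical_det l m \<alpha>"
    and c: "\<And>U u v w. opn U \<Longrightarrow> u \<in> carrier (sections (T_sheaf l m) U) \<Longrightarrow> v \<in> carrier (sections (T_sheaf l m) U) \<Longrightarrow>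
       w \<in> carrier (sections (T_sheaf l m) U) \<Longrightarrow>
       \<alpha> U (wedge_over PP (T_sheaf l m) U u v w) = sec_mult homog U (sec_of homog U (Const c0)) (dform U u v w)"
  shows "c0 = 1"
proof -
  let ?k = "- int l - int m"
  have "(Const c0 :: ('v, 'a) mpoly) = 1"
  proof (rule polynomial_determined_by_germs)
    fix Q :: "('v, 'a) mpoly set" assume Q: "Q \<in> Proj homog"
    obtain i where i: "Q \<in> D (Xvar i)" using Proj_cover[OF Q] by blast
    let ?V = "D (Xvar i) :: ('v, 'a) mpoly set set"
    have V: "opn ?V" "?V \<subseteq> D (Xvar i)" by (rule op_D[OF homog_Xvar]) simp
    note x = xpow_tw[OF V]
    have z: "zero_sec ?V \<in> tw k ?V" for k by (rule zero_sec_closed[OF V(1)])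
    let ?e1 = "(xpow i (int l) ?V, zero_sec ?V, zero_sec ?V)" and ?e2 = "(zero_sec ?V, xpow i (int m) ?V, zero_sec ?V)" and ?e3 = "(zero_sec ?V, zero_sec ?V, xpow i ?k ?V)"
    have "\<alpha> ?V (wedge_over PP (T_sheaf l m) ?V ?e1 ?e2 ?e3) = dform ?V ?e1 ?e2 ?e3"
      using \<alpha>[unfolded canonical_det_def, THEN conjunct2, rule_format, of ?V, OF _ x x x] V(1)
      unfolding PP_simps zero_sec_def[symmetric] dform_diagonal[OF V(1) x x x] by simp
    moreover have "\<alpha> ?V (wedge_over PP (T_sheaf l m) ?V ?e1 ?e2 ?e3) = sec_mult homog ?V (sec_of homog ?V (Const c0)) (dform ?V ?e1 ?e2 ?e3)"
      by (rule c[OF V(1)]) (simp_all add: T_sheaf_def TT_simps x z)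
    ultimately have "sec_of homog ?V 1 = sec_mult homog ?V (sec_of homog ?V (Const c0)) (sec_of homog ?V 1)"
      unfolding dform_chart_basis[OF V, of "int l" "int m" ?k, simplified] by simp
    then have "sec_of homog ?V 1 Q = sec_mult homog ?V (sec_of homog ?V (Const c0)) (sec_of homog ?V 1) Q" by (rule fun_cong)
    then show "fraction (dn Q) (Const c0) 1 = fraction (dn Q) 1 1"
      using i mult_set.fraction_mult[OF mult_set_denoms[OF Q]] mult_set.one_mem[OF mult_set_denoms[OF Q]] by simp
  qed
  then have "(Const c0 :: ('v, 'a) mpoly) = Const 1" by simp
  then show ?thesis unfolding Const_eq_iff .
qed

section \<open>Transport along isomorphisms of modules\<close>

lemma module_transport:
  assumes M: "Module.module A M" and h: "linear_iso A M N h" and z: "h \<zero>\<^bsub>M\<^esub> = \<zero>\<^bsub>N\<^esub>"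
  shows "Module.module A N"
proof -
  interpret M: Module.module A M by (rule M)
  have bij: "bij_betw h (carrier M) (carrier N)"
    and add: "\<And>x y. x \<in> carrier M \<Longrightarrow> y \<in> carrier M \<Longrightarrow> h x \<oplus>\<^bsub>N\<^esub> h y = h (x \<oplus>\<^bsub>M\<^esub> y)"
    and smult: "\<And>c x. c \<in> carrier A \<Longrightarrow> x \<in> carrier M \<Longrightarrow> c \<odot>\<^bsub>N\<^esub> h x = h (c \<odot>\<^bsub>M\<^esub> x)"
    using h unfolding linear_iso_def by auto
  have cl: "h x \<in> carrier N" if "x \<in> carrier M" for x using bij that by (auto simp: bij_betw_def)
  have ex: "\<exists>x\<in>carrier M. y = h x" if "y \<in> carrier N" for y using bij that unfolding bij_betw_def by blast
  show ?thesis
  proof (rule moduleI[OF M.R.is_cring])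
    show "abelian_group N"
    proof (rule abelian_groupI)
      show "\<zero>\<^bsub>N\<^esub> \<in> carrier N" using cl[of "\<zero>\<^bsub>M\<^esub>"] z by simp
      fix x assume "x \<in> carrier N"
      then obtain x' where x: "x' \<in> carrier M" "x = h x'" using ex by blast
      show "\<zero>\<^bsub>N\<^esub> \<oplus>\<^bsub>N\<^esub> x = x" unfolding x(2) z[symmetric] using x(1) by (simp add: add)
      have "h (\<ominus>\<^bsub>M\<^esub> x') \<oplus>\<^bsub>N\<^esub> x = \<zero>\<^bsub>N\<^esub>" unfolding x(2) using x(1) by (simp add: add M.M.l_neg z)
      then show "\<exists>y\<in>carrier N. y \<oplus>\<^bsub>N\<^esub> x = \<zero>\<^bsub>N\<^esub>" using cl[of "\<ominus>\<^bsub>M\<^esub> x'"] x(1) by blast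
      fix y assume "y \<in> carrier N"
      then obtain y' where y: "y' \<in> carrier M" "y = h y'" using ex by blast
      show "x \<oplus>\<^bsub>N\<^esub> y \<in> carrier N" unfolding x(2) y(2) using x(1) y(1) by (simp add: add cl)
      show "x \<oplus>\<^bsub>N\<^esub> y = y \<oplus>\<^bsub>N\<^esub> x" unfolding x(2) y(2) using x(1) y(1) by (simp add: add M.M.a_comm)
      fix w assume "w \<in> carrier N"
      then obtain w' where w: "w' \<in> carrier M" "w = h w'" using ex by blast
      show "x \<oplus>\<^bsub>N\<^esub> y \<oplus>\<^bsub>N\<^esub> w = x \<oplus>\<^bsub>N\<^esub> (y \<oplus>\<^bsub>N\<^esub> w)"
        unfolding x(2) y(2) w(2) using x(1) y(1) w(1) by (simp add: add M.M.a_assoc)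
    qed
  next
    fix a x assume a: "a \<in> carrier A" and "x \<in> carrier N"
    then obtain x' where x: "x' \<in> carrier M" "x = h x'" using ex by blast
    show "a \<odot>\<^bsub>N\<^esub> x \<in> carrier N" unfolding x(2) using a x(1) by (simp add: smult cl)
    fix b assume b: "b \<in> carrier A"
    show "(a \<oplus>\<^bsub>A\<^esub> b) \<odot>\<^bsub>N\<^esub> x = a \<odot>\<^bsub>N\<^esub> x \<oplus>\<^bsub>N\<^esub> b \<odot>\<^bsub>N\<^esub> x"
      unfolding x(2) using a b x(1) by (simp add: smult add M.smult_l_distr)
    show "(a \<otimes>\<^bsub>A\<^esub> b) \<odot>\<^bsub>N\<^esub> x = a \<odot>\<^bsub>N\<^esub> (b \<odot>\<^bsub>N\<^esub> x)"
      unfolding x(2) using a b x(1) by (simp add: smult M.smult_assoc1)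
  next
    fix a x y assume a: "a \<in> carrier A" and "x \<in> carrier N" "y \<in> carrier N"
    then obtain x' y' where x: "x' \<in> carrier M" "x = h x'" and y: "y' \<in> carrier M" "y = h y'" using ex by meson
    show "a \<odot>\<^bsub>N\<^esub> (x \<oplus>\<^bsub>N\<^esub> y) = a \<odot>\<^bsub>N\<^esub> x \<oplus>\<^bsub>N\<^esub> a \<odot>\<^bsub>N\<^esub> y"
      unfolding x(2) y(2) using a x(1) y(1) by (simp add: smult add M.smult_r_distr)
  next
    fix x assume "x \<in> carrier N"
    then obtain x' where x: "x' \<in> carrier M" "x = h x'" using ex by blast
    show "\<one>\<^bsub>A\<^esub> \<odot>\<^bsub>N\<^esub> x = x" unfolding x(2) using x(1) by (simp add: smult)
  qed
qed

lemma alt_form_scale: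
  assumes "cring A" "alt_form A M \<omega>" "d \<in> carrier A"
  shows "alt_form A M (\<lambda>u v w. d \<otimes>\<^bsub>A\<^esub> \<omega> u v w)"
proof -
  interpret A: cring A by fact
  show ?thesis
    using assms(3) unfolding alt_form_def
    by (intro ballI conjI) (simp_all add: alt_formD[OF assms(2)] A.r_distr A.m_lcomm)
qed

locale presheaf_iso = M: presheaf_of_modules Y M
  for Y :: "('x, 'r) ringed_space" and M :: "('x, 'r, 'm) sheaf_module" +
  fixes N :: "('x, 'r, 'n) sheaf_module" and \<Phi> :: "'x set \<Rightarrow> 'm \<Rightarrow> 'n"
  assumes iso: "\<And>U. openin (space Y) U \<Longrightarrow> linear_iso (str Y U) (sections M U) (sections N U) (\<Phi> U)"
    and \<Phi>_zero: "\<And>U. openin (space Y) U \<Longrightarrow> \<Phi> U \<zero>\<^bsub>sections M U\<^esub> = \<zero>\<^bsub>sections N U\<^esub>"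
    and \<Phi>_res: "\<And>U V x. openin (space Y) U \<Longrightarrow> V \<in> opens Y U \<Longrightarrow> x \<in> carrier (sections M U) \<Longrightarrow>
      res N V (\<Phi> U x) = \<Phi> V (res M V x)"
begin

lemma \<Phi>_bij: "openin (space Y) U \<Longrightarrow> bij_betw (\<Phi> U) (carrier (sections M U)) (carrier (sections N U))"
  by (rule iso[unfolded linear_iso_def, THEN conjunct1])

lemma \<Phi>_closed: "openin (space Y) U \<Longrightarrow> x \<in> carrier (sections M U) \<Longrightarrow> \<Phi> U x \<in> carrier (sections N U)"
  by (rule bij_betw_apply[OF \<Phi>_bij])

lemma \<Phi>_surj:
  assumes "openin (space Y) U" "y \<in> carrier (sections N U)"
  obtains x where "x \<in> carrier (sections M U)" "y = \<Phi> U x"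
  using assms(2) bij_betw_imp_surj_on[OF \<Phi>_bij[OF assms(1)]] that by (metis imageE)

lemma \<Phi>_add: "openin (space Y) U \<Longrightarrow> x \<in> carrier (sections M U) \<Longrightarrow> y \<in> carrier (sections M U) \<Longrightarrow>
    \<Phi> U (x \<oplus>\<^bsub>sections M U\<^esub> y) = \<Phi> U x \<oplus>\<^bsub>sections N U\<^esub> \<Phi> U y"
  by (rule iso[unfolded linear_iso_def, THEN conjunct2, THEN conjunct1, rule_format])

lemma \<Phi>_smult: "openin (space Y) U \<Longrightarrow> c \<in> carrier (str Y U) \<Longrightarrow> x \<in> carrier (sections M U) \<Longrightarrow>
    \<Phi> U (c \<odot>\<^bsub>sections M U\<^esub> x) = c \<odot>\<^bsub>sections N U\<^esub> \<Phi> U x"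
  by (rule iso[unfolded linear_iso_def, THEN conjunct2, THEN conjunct2, rule_format])

lemma presheaf_N: "presheaf_of_modules Y N"
proof (rule presheaf_of_modules.intro)
  fix U assume U: "openin (space Y) U"
  interpret MU: ext3_module "str Y U" "sections M U" by (rule M.ext3_module_sections[OF U])
  show "ext3_module (str Y U) (sections N U)"
    by (rule ext3_module.intro[OF module_transport[OF MU.module iso[OF U] \<Phi>_zero[OF U]]])
  fix V assume V: "V \<in> opens Y U"
  then have oV: "openin (space Y) V" by simp
  show "str_res Y V \<in> hom (add_monoid (str Y U)) (add_monoid (str Y V))" by (rule M.str_res_hom[OF U V])
  note r = semilinearD[OF M.res_semilinear[OF U V]]
  show "semilinear (str Y U) (sections N U) (sections N V) (str_res Y V) (res N V) (str Y V)"
    unfolding semilinear_def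
  proof (intro ballI conjI)
    fix u assume "u \<in> carrier (sections N U)"
    then obtain u' where u: "u' \<in> carrier (sections M U)" "u = \<Phi> U u'" by (rule \<Phi>_surj[OF U])
    show "res N V u \<in> carrier (sections N V)"
      unfolding u(2) \<Phi>_res[OF U V u(1)] by (rule \<Phi>_closed[OF oV r(1)[OF u(1)]])
    show "str_res Y V c \<in> carrier (str Y V)" if "c \<in> carrier (str Y U)" for c by (rule r(3)[OF u(1) that])
    show "res N V (c \<odot>\<^bsub>sections N U\<^esub> u) = str_res Y V c \<odot>\<^bsub>sections N V\<^esub> res N V u"
      if c: "c \<in> carrier (str Y U)" for c
      unfolding u(2) using u(1) c
      by (simp add: \<Phi>_smult[OF U, symmetric] \<Phi>_res[OF U V] r \<Phi>_smult[OF oV])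
    fix v assume "v \<in> carrier (sections N U)"
    then obtain v' where v: "v' \<in> carrier (sections M U)" "v = \<Phi> U v'" by (rule \<Phi>_surj[OF U])
    show "res N V (u \<oplus>\<^bsub>sections N U\<^esub> v) = res N V u \<oplus>\<^bsub>sections N V\<^esub> res N V v"
      unfolding u(2) v(2) using u(1) v(1)
      by (simp add: \<Phi>_add[OF U, symmetric] \<Phi>_res[OF U V] r \<Phi>_add[OF oV])
  qed
qed

text \<open>Orientations are carried along an isomorphism of presheaves by applying its inverse to the
  arguments of the form.\<close>

lemma exists_det_iso_transport:
  assumes alt: "\<And>U. openin (space Y) U \<Longrightarrow> alt_form (str Y U) (sections M U) (\<omega> U)"
    and nat: "\<And>U V u v w. openin (space Y) U \<Longrightarrow> V \<in> opens Y U \<Longrightarrow> u \<in> carrier (sections M U) \<Longrightarrow>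
       v \<in> carrier (sections M U) \<Longrightarrow> w \<in> carrier (sections M U) \<Longrightarrow>
       str_res Y V (\<omega> U u v w) = \<omega> V (res M V u) (res M V v) (res M V w)"
    and basis: "\<And>U P. openin (space Y) U \<Longrightarrow> P \<in> U \<Longrightarrow> \<exists>V\<in>opens Y U. P \<in> V \<and>
       (\<exists>e1 e2 e3 d. ext3_generated (str Y V) (sections M V) e1 e2 e3 \<and> d \<in> carrier (str Y V) \<and>
          d \<otimes>\<^bsub>str Y V\<^esub> \<omega> V e1 e2 e3 = \<one>\<^bsub>str Y V\<^esub>)"
  shows "\<exists>\<alpha>. det_iso Y N \<alpha> \<and> (\<forall>U. openin (space Y) U \<longrightarrow> (\<forall>u\<in>carrier (sections M U).
     \<forall>v\<in>carrier (sections M U). \<forall>w\<in>carrier (sections M U). \<alpha> U (wedge_over Y N U (\<Phi> U u) (\<Phi> U v) (\<Phi> U w)) = \<omega> U u v w))"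
proof -
  define \<Psi> where "\<Psi> U = inv_into (carrier (sections M U)) (\<Phi> U)" for U
  have \<Psi>: "\<Psi> U (\<Phi> U x) = x" if "openin (space Y) U" "x \<in> carrier (sections M U)" for U x
    unfolding \<Psi>_def by (rule inv_into_f_f[OF bij_betw_imp_inj_on[OF \<Phi>_bij[OF that(1)]] that(2)])
  define \<omega>' where "\<omega>' U u v w = \<omega> U (\<Psi> U u) (\<Psi> U v) (\<Psi> U w)" for U u v w
  have \<omega>': "\<omega>' U (\<Phi> U u) (\<Phi> U v) (\<Phi> U w) = \<omega> U u v w" if "openin (space Y) U" "u \<in> carrier (sections M U)"
    "v \<in> carrier (sections M U)" "w \<in> carrier (sections M U)" for U u v w
    using that by (simp add: \<omega>'_def \<Psi>)
  have "\<exists>\<alpha>. det_iso Y N \<alpha> \<and> (\<forall>U. openin (space Y) U \<longrightarrow> (\<forall>u\<in>carrier (sections N U).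
     \<forall>v\<in>carrier (sections N U). \<forall>w\<in>carrier (sections N U). \<alpha> U (wedge_over Y N U u v w) = \<omega>' U u v w))"
  proof (rule presheaf_of_modules.exists_det_iso[OF presheaf_N])
    fix U assume U: "openin (space Y) U"
    interpret MU: ext3_module "str Y U" "sections M U" by (rule M.ext3_module_sections[OF U])
    note a = alt_formD[OF alt[OF U]]
    show "alt_form (str Y U) (sections N U) (\<omega>' U)"
      unfolding alt_form_def
    proof (intro ballI)
      fix u v w assume "u \<in> carrier (sections N U)" "v \<in> carrier (sections N U)" "w \<in> carrier (sections N U)"
      then obtain u' v' w' where u: "u' \<in> carrier (sections M U)" "u = \<Phi> U u'" and v: "v' \<in> carrier (sections M U)" "v = \<Phi> U v'"
        and w: "w' \<in> carrier (sections M U)" "w = \<Phi> U w'" by (meson \<Phi>_surj[OF U])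
      have add: "\<omega>' U (u \<oplus>\<^bsub>sections N U\<^esub> x) v w = \<omega>' U u v w \<oplus>\<^bsub>str Y U\<^esub> \<omega>' U x v w \<and>
          \<omega>' U u (v \<oplus>\<^bsub>sections N U\<^esub> x) w = \<omega>' U u v w \<oplus>\<^bsub>str Y U\<^esub> \<omega>' U u x w \<and>
          \<omega>' U u v (w \<oplus>\<^bsub>sections N U\<^esub> x) = \<omega>' U u v w \<oplus>\<^bsub>str Y U\<^esub> \<omega>' U u v x" if "x \<in> carrier (sections N U)" for x
      proof -
        obtain x' where x: "x' \<in> carrier (sections M U)" "x = \<Phi> U x'" using \<Phi>_surj[OF U \<open>x \<in> carrier (sections N U)\<close>] .
        show ?thesis unfolding u(2) v(2) w(2) x(2) using u(1) v(1) w(1) x(1)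
          by (simp add: \<Phi>_add[OF U, symmetric] \<omega>'[OF U] a(5-7))
      qed
      show "\<omega>' U u v w \<in> carrier (str Y U) \<and>
       \<omega>' U u u w = \<zero>\<^bsub>str Y U\<^esub> \<and> \<omega>' U u w w = \<zero>\<^bsub>str Y U\<^esub> \<and> \<omega>' U u w u = \<zero>\<^bsub>str Y U\<^esub> \<and>
       (\<forall>x\<in>carrier (sections N U). \<omega>' U (u \<oplus>\<^bsub>sections N U\<^esub> x) v w = \<omega>' U u v w \<oplus>\<^bsub>str Y U\<^esub> \<omega>' U x v w \<and>
          \<omega>' U u (v \<oplus>\<^bsub>sections N U\<^esub> x) w = \<omega>' U u v w \<oplus>\<^bsub>str Y U\<^esub> \<omega>' U u x w \<and>
          \<omega>' U u v (w \<oplus>\<^bsub>sections N U\<^esub> x) = \<omega>' U u v w \<oplus>\<^bsub>str Y U\<^esub> \<omega>' U u v x) \<and>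
       (\<forall>c\<in>carrier (str Y U). \<omega>' U (c \<odot>\<^bsub>sections N U\<^esub> u) v w = c \<otimes>\<^bsub>str Y U\<^esub> \<omega>' U u v w \<and>
          \<omega>' U u (c \<odot>\<^bsub>sections N U\<^esub> v) w = c \<otimes>\<^bsub>str Y U\<^esub> \<omega>' U u v w \<and> \<omega>' U u v (c \<odot>\<^bsub>sections N U\<^esub> w) = c \<otimes>\<^bsub>str Y U\<^esub> \<omega>' U u v w)"
        using add unfolding u(2) v(2) w(2) using u(1) v(1) w(1)
        by (simp add: \<Phi>_smult[OF U, symmetric] \<omega>'[OF U] a)
    qed
    show "str_res Y V (\<omega>' U u v w) = \<omega>' V (res N V u) (res N V v) (res N V w)"
      if V: "V \<in> opens Y U" and uvw: "u \<in> carrier (sections N U)" "v \<in> carrier (sections N U)" "w \<in> carrier (sections N U)" for V u v w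
    proof -
      have oV: "openin (space Y) V" using V by simp
      obtain u' v' w' where u: "u' \<in> carrier (sections M U)" "u = \<Phi> U u'" and v: "v' \<in> carrier (sections M U)" "v = \<Phi> U v'"
        and w: "w' \<in> carrier (sections M U)" "w = \<Phi> U w'" using uvw by (meson \<Phi>_surj[OF U])
      note r = semilinearD(1)[OF M.res_semilinear[OF U V]]
      show ?thesis unfolding u(2) v(2) w(2) using u(1) v(1) w(1)
        by (simp add: \<omega>'[OF U] \<omega>'[OF oV] \<Phi>_res[OF U V] r nat[OF U V])
    qed
    fix P assume P: "P \<in> U"
    obtain V e1 e2 e3 d where V: "V \<in> opens Y U" "P \<in> V" and gen: "ext3_generated (str Y V) (sections M V) e1 e2 e3"
      and d: "d \<in> carrier (str Y V)" "d \<otimes>\<^bsub>str Y V\<^esub> \<omega> V e1 e2 e3 = \<one>\<^bsub>str Y V\<^esub>"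
      using basis[OF U P] by blast
    have oV: "openin (space Y) V" using V(1) by simp
    interpret G: ext3_generated "str Y V" "sections M V" e1 e2 e3 by (rule gen)
    have "ext3_generated (str Y V) (sections N V) (\<Phi> V e1) (\<Phi> V e2) (\<Phi> V e3)"
    proof (intro ext3_generated.intro ext3_generated_axioms.intro presheaf_of_modules.ext3_module_sections[OF presheaf_N oV])
      show "\<Phi> V e1 \<in> carrier (sections N V)" "\<Phi> V e2 \<in> carrier (sections N V)" "\<Phi> V e3 \<in> carrier (sections N V)"
        using \<Phi>_closed[OF oV] G.e by blast+
      fix u assume "u \<in> carrier (sections N V)"
      then obtain u' where u: "u' \<in> carrier (sections M V)" "u = \<Phi> V u'" by (rule \<Phi>_surj[OF oV])
      obtain a b c where abc: "a \<in> carrier (str Y V)" "b \<in> carrier (str Y V)" "c \<in> carrier (str Y V)"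
        "u' = a \<odot>\<^bsub>sections M V\<^esub> e1 \<oplus>\<^bsub>sections M V\<^esub> (b \<odot>\<^bsub>sections M V\<^esub> e2 \<oplus>\<^bsub>sections M V\<^esub> c \<odot>\<^bsub>sections M V\<^esub> e3)"
        using G.span[OF u(1)] by blast
      have "u = a \<odot>\<^bsub>sections N V\<^esub> \<Phi> V e1 \<oplus>\<^bsub>sections N V\<^esub> (b \<odot>\<^bsub>sections N V\<^esub> \<Phi> V e2 \<oplus>\<^bsub>sections N V\<^esub> c \<odot>\<^bsub>sections N V\<^esub> \<Phi> V e3)"
        unfolding u(2) abc(4) using abc(1-3) G.e by (simp add: \<Phi>_add[OF oV] \<Phi>_smult[OF oV])
      then show "\<exists>a\<in>carrier (str Y V). \<exists>b\<in>carrier (str Y V). \<exists>c\<in>carrier (str Y V).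
        u = a \<odot>\<^bsub>sections N V\<^esub> \<Phi> V e1 \<oplus>\<^bsub>sections N V\<^esub> (b \<odot>\<^bsub>sections N V\<^esub> \<Phi> V e2 \<oplus>\<^bsub>sections N V\<^esub> c \<odot>\<^bsub>sections N V\<^esub> \<Phi> V e3)"
        using abc(1-3) by blast
    qed
    moreover have "d \<otimes>\<^bsub>str Y V\<^esub> \<omega>' V (\<Phi> V e1) (\<Phi> V e2) (\<Phi> V e3) = \<one>\<^bsub>str Y V\<^esub>"
      unfolding \<omega>'[OF oV G.e] by (rule d(2))
    ultimately show "\<exists>V\<in>opens Y U. P \<in> V \<and> (\<exists>e1 e2 e3 d. ext3_generated (str Y V) (sections N V) e1 e2 e3 \<and> d \<in> carrier (str Y V) \<and>
          d \<otimes>\<^bsub>str Y V\<^esub> \<omega>' V e1 e2 e3 = \<one>\<^bsub>str Y V\<^esub>)"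
      using V d(1) by blast
  qed
  then obtain \<alpha> where \<alpha>: "det_iso Y N \<alpha>" "\<forall>U. openin (space Y) U \<longrightarrow> (\<forall>u\<in>carrier (sections N U).
     \<forall>v\<in>carrier (sections N U). \<forall>w\<in>carrier (sections N U). \<alpha> U (wedge_over Y N U u v w) = \<omega>' U u v w)" by blast
  have "\<alpha> U (wedge_over Y N U (\<Phi> U u) (\<Phi> U v) (\<Phi> U w)) = \<omega> U u v w"
    if "openin (space Y) U" "u \<in> carrier (sections M U)" "v \<in> carrier (sections M U)" "w \<in> carrier (sections M U)" for U u v w
    using \<alpha>(2)[rule_format, OF that(1) \<Phi>_closed[OF that(1,2)] \<Phi>_closed[OF that(1,3)] \<Phi>_closed[OF that(1,4)]]
    unfolding \<omega>'[OF that] .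
  then show ?thesis using \<alpha>(1) by blast
qed

end

section \<open>The dual of a sum of three twisting sheaves\<close>

definition pair3 :: "('v::finite, 'a::comm_ring_1) mpoly set set \<Rightarrow>
    ('v, 'a) mpoly sect \<times> ('v, 'a) mpoly sect \<times> ('v, 'a) mpoly sect \<Rightarrow>
    ('v, 'a) mpoly sect \<times> ('v, 'a) mpoly sect \<times> ('v, 'a) mpoly sect \<Rightarrow> ('v, 'a) mpoly sect" where
  "pair3 V = (\<lambda>(x1, x2, x3) (w1, w2, w3).
     sec_add homog V (sec_add homog V (sec_mult homog V x1 w1) (sec_mult homog V x2 w2)) (sec_mult homog V x3 w3))"

text \<open>The form that pairs with \<open>x\<close>, on all smaller open sets at once.  The pairing is computed
  pointwise, so \<open>x\<close> can be kept as a section over \<open>U\<close>.\<close>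

definition dual_of :: "int \<Rightarrow> int \<Rightarrow> int \<Rightarrow> ('v::finite, 'a::comm_ring_1) mpoly set set \<Rightarrow>
    ('v, 'a) mpoly sect \<times> ('v, 'a) mpoly sect \<times> ('v, 'a) mpoly sect \<Rightarrow>
    ('v, 'a) mpoly set set \<Rightarrow> ('v, 'a) mpoly sect \<times> ('v, 'a) mpoly sect \<times> ('v, 'a) mpoly sect \<Rightarrow> ('v, 'a) mpoly sect" where
  "dual_of k1 k2 k3 U x = (\<lambda>V\<in>opens PP U. \<lambda>w\<in>carrier (sections (TT k1 k2 k3) V). pair3 V x w)"

lemma pair3_value: "P \<in> V \<Longrightarrow> pair3 V (x1, x2, x3) (w1, w2, w3) P =
    x1 P \<otimes>\<^bsub>LL P\<^esub> w1 P \<oplus>\<^bsub>LL P\<^esub> x2 P \<otimes>\<^bsub>LL P\<^esub> w2 P \<oplus>\<^bsub>LL P\<^esub> x3 P \<otimes>\<^bsub>LL P\<^esub> w3 P"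
  by (simp add: pair3_def)

lemma pair3_ext [simp]: "pair3 V x w \<in> extensional V"
  by (simp add: pair3_def split: prod.split)

lemma sec_mult_restrict_left: "sec_mult homog V (restrict \<sigma> V) \<tau> = sec_mult homog V \<sigma> \<tau>"
  by (simp add: sec_mult_def fun_eq_iff restrict_def)

lemma pair3_restrict_left: "pair3 V (res (TT l1 l2 l3) V x) w = pair3 V x w"
  by (cases x, cases w) (simp add: pair3_def TT_simps sec_mult_restrict_left)

lemma pair3_restrict:
  assumes "W \<subseteq> V"
  shows "restrict (pair3 V x w) W = pair3 W x (res (TT k1 k2 k3) W w)"
  using assms by (cases x, cases w) (auto simp: pair3_def TT_simps fun_eq_iff restrict_def subset_iff sec_add_def sec_mult_def)

lemma pair3_closed:
  assumes V: "opn V" and x: "x \<in> carrier (sections (TT (- k1) (- k2) (- k3)) V)" and w: "w \<in> carrier (sections (TT k1 k2 k3) V)"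
  shows "pair3 V x w \<in> tw 0 V"
proof -
  obtain x1 x2 x3 where x: "x = (x1, x2, x3)" "x1 \<in> tw (- k1) V" "x2 \<in> tw (- k2) V" "x3 \<in> tw (- k3) V" by (rule TT_cases[OF x])
  obtain w1 w2 w3 where w: "w = (w1, w2, w3)" "w1 \<in> tw k1 V" "w2 \<in> tw k2 V" "w3 \<in> tw k3 V" by (rule TT_cases[OF w])
  show ?thesis unfolding x(1) w(1) pair3_def prod.case
    by (intro sec_add_closed[OF V] sec_mult_closed[OF V x(2) w(2)] sec_mult_closed[OF V x(3) w(3)]
        sec_mult_closed[OF V x(4) w(4)]) simp_all
qed

lemma (in cring) pair3_linear:
  assumes "x1 \<in> carrier R" "x2 \<in> carrier R" "x3 \<in> carrier R" "y1 \<in> carrier R" "y2 \<in> carrier R" "y3 \<in> carrier R"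
    "w1 \<in> carrier R" "w2 \<in> carrier R" "w3 \<in> carrier R" "c \<in> carrier R"
  shows "(x1 \<oplus> y1) \<otimes> w1 \<oplus> (x2 \<oplus> y2) \<otimes> w2 \<oplus> (x3 \<oplus> y3) \<otimes> w3
      = (x1 \<otimes> w1 \<oplus> x2 \<otimes> w2 \<oplus> x3 \<otimes> w3) \<oplus> (y1 \<otimes> w1 \<oplus> y2 \<otimes> w2 \<oplus> y3 \<otimes> w3)"
    "w1 \<otimes> (x1 \<oplus> y1) \<oplus> w2 \<otimes> (x2 \<oplus> y2) \<oplus> w3 \<otimes> (x3 \<oplus> y3)
      = (w1 \<otimes> x1 \<oplus> w2 \<otimes> x2 \<oplus> w3 \<otimes> x3) \<oplus> (w1 \<otimes> y1 \<oplus> w2 \<otimes> y2 \<oplus> w3 \<otimes> y3)"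
    "(c \<otimes> x1) \<otimes> w1 \<oplus> (c \<otimes> x2) \<otimes> w2 \<oplus> (c \<otimes> x3) \<otimes> w3 = c \<otimes> (x1 \<otimes> w1 \<oplus> x2 \<otimes> w2 \<oplus> x3 \<otimes> w3)"
    "w1 \<otimes> (c \<otimes> x1) \<oplus> w2 \<otimes> (c \<otimes> x2) \<oplus> w3 \<otimes> (c \<otimes> x3) = c \<otimes> (w1 \<otimes> x1 \<oplus> w2 \<otimes> x2 \<oplus> w3 \<otimes> x3)"
  using assms by algebra+

lemma pair3_laws:
  assumes V: "opn V" and xT: "x \<in> carrier (sections (TT l1 l2 l3) V)" and yT: "y \<in> carrier (sections (TT l1 l2 l3) V)"
    and wT: "w \<in> carrier (sections (TT k1 k2 k3) V)" and c: "c \<in> tw 0 V"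
  shows "pair3 V (x \<oplus>\<^bsub>sections (TT l1 l2 l3) V\<^esub> y) w = sec_add homog V (pair3 V x w) (pair3 V y w)"
    "pair3 V w (x \<oplus>\<^bsub>sections (TT l1 l2 l3) V\<^esub> y) = sec_add homog V (pair3 V w x) (pair3 V w y)"
    "pair3 V (c \<odot>\<^bsub>sections (TT l1 l2 l3) V\<^esub> x) w = sec_mult homog V c (pair3 V x w)"
    "pair3 V w (c \<odot>\<^bsub>sections (TT l1 l2 l3) V\<^esub> x) = sec_mult homog V c (pair3 V w x)"
proof -
  obtain x1 x2 x3 where x: "x = (x1, x2, x3)" "x1 \<in> tw l1 V" "x2 \<in> tw l2 V" "x3 \<in> tw l3 V" by (rule TT_cases[OF xT])
  obtain y1 y2 y3 where y: "y = (y1, y2, y3)" "y1 \<in> tw l1 V" "y2 \<in> tw l2 V" "y3 \<in> tw l3 V" by (rule TT_cases[OF yT])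
  obtain w1 w2 w3 where w: "w = (w1, w2, w3)" "w1 \<in> tw k1 V" "w2 \<in> tw k2 V" "w3 \<in> tw k3 V" by (rule TT_cases[OF wT])
  note v = x(2-4)[THEN tw_value[OF V]] y(2-4)[THEN tw_value[OF V]] w(2-4)[THEN tw_value[OF V]] tw_value[OF V c]
  note lin = cring.pair3_linear[OF LL_cring_U[OF V] v]
  show "pair3 V (x \<oplus>\<^bsub>sections (TT l1 l2 l3) V\<^esub> y) w = sec_add homog V (pair3 V x w) (pair3 V y w)"
    unfolding x(1) y(1) w(1) TT_simps by (rule tw_eqI[of _ V]) (simp_all add: pair3_value lin(1))
  show "pair3 V w (x \<oplus>\<^bsub>sections (TT l1 l2 l3) V\<^esub> y) = sec_add homog V (pair3 V w x) (pair3 V w y)"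
    unfolding x(1) y(1) w(1) TT_simps by (rule tw_eqI[of _ V]) (simp_all add: pair3_value lin(2))
  show "pair3 V (c \<odot>\<^bsub>sections (TT l1 l2 l3) V\<^esub> x) w = sec_mult homog V c (pair3 V x w)"
    unfolding x(1) w(1) TT_simps by (rule tw_eqI[of _ V]) (simp_all add: pair3_value lin(3))
  show "pair3 V w (c \<odot>\<^bsub>sections (TT l1 l2 l3) V\<^esub> x) = sec_mult homog V c (pair3 V w x)"
    unfolding x(1) w(1) TT_simps by (rule tw_eqI[of _ V]) (simp_all add: pair3_value lin(4))
qed

lemma dual_carrier:
  "\<phi> \<in> carrier (sections (dual_sheaf PP M) U) \<longleftrightarrow>
     \<phi> \<in> extensional (opens PP U) \<and>
     (\<forall>V\<in>opens PP U. \<phi> V \<in> extensional (carrier (sections M V)) \<and> (\<forall>u\<in>carrier (sections M V). \<phi> V u \<in> tw 0 V \<and>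
        (\<forall>v\<in>carrier (sections M V). \<phi> V (u \<oplus>\<^bsub>sections M V\<^esub> v) = sec_add homog V (\<phi> V u) (\<phi> V v)) \<and>
        (\<forall>c\<in>tw 0 V. \<phi> V (c \<odot>\<^bsub>sections M V\<^esub> u) = sec_mult homog V c (\<phi> V u)) \<and>
        (\<forall>W\<in>opens PP V. restrict (\<phi> V u) W = \<phi> W (res M W u))))"
  unfolding dual_sheaf_def linear_forms_def
  by (simp add: PP_simps(2-7) PiE_iff Pi_iff) meson

lemma dual_simps:
  "\<zero>\<^bsub>sections (dual_sheaf PP M) U\<^esub> = (\<lambda>V\<in>opens PP U. \<lambda>t\<in>carrier (sections M V). sec_of homog V 0)"
  "\<phi> \<oplus>\<^bsub>sections (dual_sheaf PP M) U\<^esub> \<psi> = (\<lambda>V\<in>opens PP U. \<lambda>t\<in>carrier (sections M V). sec_add homog V (\<phi> V t) (\<psi> V t))"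
  "c \<odot>\<^bsub>sections (dual_sheaf PP M) U\<^esub> \<phi> = (\<lambda>V\<in>opens PP U. \<lambda>t\<in>carrier (sections M V). sec_mult homog V (restrict c V) (\<phi> V t))"
  "res (dual_sheaf PP M) V \<phi> = (\<lambda>W\<in>opens PP V. \<phi> W)"
  by (simp_all add: dual_sheaf_def PP_simps(2-7))

lemma TT_res_closed:
  assumes "opn U" "opn V" "V \<subseteq> U" "u \<in> carrier (sections (TT k1 k2 k3) U)"
  shows "res (TT k1 k2 k3) V u \<in> carrier (sections (TT k1 k2 k3) V)"
  using assms(4) by (rule TT_cases) (simp add: TT_simps tw_restrict[OF assms(1-3)])

lemma TT_closed:
  assumes "opn V" "u \<in> carrier (sections (TT k1 k2 k3) V)"
  shows "c \<in> tw 0 V \<Longrightarrow> c \<odot>\<^bsub>sections (TT k1 k2 k3) V\<^esub> u \<in> carrier (sections (TT k1 k2 k3) V)"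
    "v \<in> carrier (sections (TT k1 k2 k3) V) \<Longrightarrow> u \<oplus>\<^bsub>sections (TT k1 k2 k3) V\<^esub> v \<in> carrier (sections (TT k1 k2 k3) V)"
proof -
  interpret Module.module "str PP V" "sections (TT k1 k2 k3) V" by (rule module_TT[OF assms(1)])
  show "c \<odot>\<^bsub>sections (TT k1 k2 k3) V\<^esub> u \<in> carrier (sections (TT k1 k2 k3) V)" if "c \<in> tw 0 V"
    using smult_closed[OF _ assms(2)] that unfolding PP_simps .
  show "u \<oplus>\<^bsub>sections (TT k1 k2 k3) V\<^esub> v \<in> carrier (sections (TT k1 k2 k3) V)"
    if "v \<in> carrier (sections (TT k1 k2 k3) V)" by (rule M.a_closed[OF assms(2) that])
qed

lemma dualD:
  assumes "\<phi> \<in> carrier (sections (dual_sheaf PP M) U)" "V \<in> opens PP U" "u \<in> carrier (sections M V)"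
  shows "\<phi> V u \<in> tw 0 V"
    "v \<in> carrier (sections M V) \<Longrightarrow> \<phi> V (u \<oplus>\<^bsub>sections M V\<^esub> v) = sec_add homog V (\<phi> V u) (\<phi> V v)"
    "c \<in> tw 0 V \<Longrightarrow> \<phi> V (c \<odot>\<^bsub>sections M V\<^esub> u) = sec_mult homog V c (\<phi> V u)"
    "W \<in> opens PP V \<Longrightarrow> restrict (\<phi> V u) W = \<phi> W (res M W u)"
  using bspec[OF assms(1)[unfolded dual_carrier, THEN conjunct2] assms(2), THEN conjunct2, rule_format, OF assms(3)]
  by blast+

lemma dual_of_closed:
  assumes U: "opn U" and x: "x \<in> carrier (sections (TT (- k1) (- k2) (- k3)) U)"
  shows "dual_of k1 k2 k3 U x \<in> carrier (sections (dual_sheaf PP (TT k1 k2 k3)) U)"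
  unfolding dual_carrier
proof (intro conjI ballI)
  show "dual_of k1 k2 k3 U x \<in> extensional (opens PP U)" by (simp add: dual_of_def)
  fix V assume V': "V \<in> opens PP U"
  then have V: "opn V" "V \<subseteq> U" unfolding opens_PP by blast+
  have eq: "dual_of k1 k2 k3 U x V w = pair3 V x w" if "w \<in> carrier (sections (TT k1 k2 k3) V)" for w
    using V' that by (simp add: dual_of_def)
  let ?x = "res (TT (- k1) (- k2) (- k3)) V x"
  have xV: "?x \<in> carrier (sections (TT (- k1) (- k2) (- k3)) V)" by (rule TT_res_closed[OF U V x])
  have px: "pair3 V x w = pair3 V ?x w" for w by (rule pair3_restrict_left[symmetric])
  show "dual_of k1 k2 k3 U x V \<in> extensional (carrier (sections (TT k1 k2 k3) V))" using V' by (simp add: dual_of_def)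
  fix u assume u: "u \<in> carrier (sections (TT k1 k2 k3) V)"
  show "dual_of k1 k2 k3 U x V u \<in> tw 0 V" unfolding eq[OF u] px by (rule pair3_closed[OF V(1) xV u])
  show "dual_of k1 k2 k3 U x V (u \<oplus>\<^bsub>sections (TT k1 k2 k3) V\<^esub> v)
      = sec_add homog V (dual_of k1 k2 k3 U x V u) (dual_of k1 k2 k3 U x V v)"
    if v: "v \<in> carrier (sections (TT k1 k2 k3) V)" for v
    unfolding eq[OF u] eq[OF v] eq[OF TT_closed(2)[OF V(1) u v]] px by (rule pair3_laws(2)[OF V(1) u v xV sec_zero_closed[OF V(1)]])
  show "dual_of k1 k2 k3 U x V (c \<odot>\<^bsub>sections (TT k1 k2 k3) V\<^esub> u) = sec_mult homog V c (dual_of k1 k2 k3 U x V u)"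
    if c: "c \<in> tw 0 V" for c
    unfolding eq[OF u] eq[OF TT_closed(1)[OF V(1) u c]] px by (rule pair3_laws(4)[OF V(1) u u xV c])
  fix W assume W': "W \<in> opens PP V"
  then have W: "opn W" "W \<subseteq> V" unfolding opens_PP by blast+
  have "W \<in> opens PP U" unfolding opens_PP using W V by blast
  then have "dual_of k1 k2 k3 U x W (res (TT k1 k2 k3) W u) = pair3 W x (res (TT k1 k2 k3) W u)"
    using TT_res_closed[OF V(1) W u] by (simp add: dual_of_def)
  then show "restrict (dual_of k1 k2 k3 U x V u) W = dual_of k1 k2 k3 U x W (res (TT k1 k2 k3) W u)"
    unfolding eq[OF u] using pair3_restrict[OF W(2)] by simp
qed

text \<open>On a chart the coordinates of a form are its values on the basis divided by the corresponding
  powers of the variable.  They do not depend on the chart, because the form is linear and compatible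
  with restriction, so they glue.\<close>

lemma dual_of_surj:
  fixes \<phi> :: "('v::finite, 'a::comm_ring_1) mpoly set set \<Rightarrow> _"
  assumes U: "opn U" and \<phi>: "\<phi> \<in> carrier (sections (dual_sheaf PP (TT k1 k2 k3)) U)"
  shows "\<exists>x\<in>carrier (sections (TT (- k1) (- k2) (- k3)) U). \<phi> = dual_of k1 k2 k3 U x"
proof -
  let ?T = "\<lambda>V. sections (TT k1 k2 k3) V"
  note d = dualD[OF \<phi>]
  define e1 where "e1 i V = (xpow i k1 V, zero_sec V, zero_sec V)" for i and V :: "('v, 'a) mpoly set set"
  define e2 where "e2 i V = (zero_sec V, xpow i k2 V, zero_sec V)" for i and V :: "('v, 'a) mpoly set set"
  define e3 where "e3 i V = (zero_sec V, zero_sec V, xpow i k3 V)" for i and V :: "('v, 'a) mpoly set set"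
  note e_defs = e1_def e2_def e3_def
  define C where "C i = U \<inter> D (Xvar i)" for i
  have C: "opn (C i)" "C i \<subseteq> D (Xvar i)" "C i \<subseteq> U" "C i \<in> opens PP U" for i
    unfolding C_def opens_PP using openin_Int[OF U op_D[OF homog_Xvar]] by auto
  have eT: "e1 i V \<in> carrier (?T V)" "e2 i V \<in> carrier (?T V)" "e3 i V \<in> carrier (?T V)"
    if "opn V" "V \<subseteq> D (Xvar i)" for i V
    unfolding e_defs by (simp_all add: TT_simps xpow_tw[OF that] zero_sec_closed[OF that(1)])
  define ch where "ch P = (SOME i. P \<in> C i)" for P
  have ch: "P \<in> C (ch P)" if P: "P \<in> U" for P
  proof -
    obtain i where "P \<in> C i" unfolding C_def using chart_neighbourhood[OF U P] by blast
    then show ?thesis unfolding ch_def by (rule someI)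
  qed
  define p where "p e k = (\<lambda>P\<in>U. \<phi> (C (ch P)) (e (ch P) (C (ch P))) P \<otimes>\<^bsub>LL P\<^esub> xpow (ch P) (- k) (C (ch P)) P)"
    for e :: "'v \<Rightarrow> ('v, 'a) mpoly set set \<Rightarrow> _" and k :: int
  have \<phi>v: "\<phi> V w P \<in> carrier (LL P)" if "opn V" "V \<subseteq> U" "w \<in> carrier (?T V)" "P \<in> V" for V w P
    using tw_value[OF that(1) d(1)[OF _ that(3)] that(4)] that(1,2) unfolding opens_PP by blast
  have pv: "p e k P \<in> carrier (LL P)" if P: "P \<in> U" and e: "\<forall>i. e i (C i) \<in> carrier (?T (C i))" for e k P
  proof -
    interpret L: cring "LL P" by (rule LL_cring_U[OF U P])
    show ?thesis unfolding p_def using P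
      by (simp add: \<phi>v[OF C(1,3) spec[OF e] ch[OF P]] tw_value[OF C(1) xpow_tw[OF C(1,2)] ch[OF P]])
  qed
  have eC: "e1 i (C i) \<in> carrier (?T (C i))" "e2 i (C i) \<in> carrier (?T (C i))" "e3 i (C i) \<in> carrier (?T (C i))" for i
    by (rule eT[OF C(1,2)])+
  have key: "\<phi> V (w1, w2, w3) P = p e1 k1 P \<otimes>\<^bsub>LL P\<^esub> w1 P \<oplus>\<^bsub>LL P\<^esub> p e2 k2 P \<otimes>\<^bsub>LL P\<^esub> w2 P \<oplus>\<^bsub>LL P\<^esub> p e3 k3 P \<otimes>\<^bsub>LL P\<^esub> w3 P"
    if V: "opn V" "V \<subseteq> U" and w: "w1 \<in> tw k1 V" "w2 \<in> tw k2 V" "w3 \<in> tw k3 V" and P: "P \<in> V" for V w1 w2 w3 P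
  proof -
    have PU: "P \<in> U" using P V by blast
    interpret L: cring "LL P" by (rule LL_cring_U[OF U PU])
    define i where "i = ch P"
    have Pi: "P \<in> C i" unfolding i_def by (rule ch[OF PU])
    let ?V = "V \<inter> C i"
    have W: "opn ?V" "?V \<subseteq> D (Xvar i)" "?V \<subseteq> U" "P \<in> ?V" using openin_Int[OF V(1) C(1)] C(2)[of i] V P Pi by auto
    have oV: "V \<in> opens PP U" and oW: "?V \<in> opens PP U" and oWV: "?V \<in> opens PP V" and oWC: "?V \<in> opens PP (C i)"
      unfolding opens_PP using V W by auto
    have wT: "(w1, w2, w3) \<in> carrier (?T V)" using w by (simp add: TT_simps)
    let ?r = "\<lambda>w. restrict w ?V"
    have r: "?r w1 \<in> tw k1 ?V" "?r w2 \<in> tw k2 ?V" "?r w3 \<in> tw k3 ?V"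
      using w by (simp_all add: tw_restrict[OF V(1) W(1) Int_lower1])
    let ?a = "sec_mult homog ?V (?r w1) (xpow i (- k1) ?V)"
    let ?b = "sec_mult homog ?V (?r w2) (xpow i (- k2) ?V)"
    let ?c = "sec_mult homog ?V (?r w3) (xpow i (- k3) ?V)"
    have cl: "?a \<in> tw 0 ?V" "?b \<in> tw 0 ?V" "?c \<in> tw 0 ?V"
      by (rule sec_mult_closed[OF W(1) r(1) xpow_tw[OF W(1,2)]], simp)
        (rule sec_mult_closed[OF W(1) r(2) xpow_tw[OF W(1,2)]], simp, rule sec_mult_closed[OF W(1) r(3) xpow_tw[OF W(1,2)]], simp)
    have dec: "(?r w1, ?r w2, ?r w3) = ?a \<odot>\<^bsub>?T ?V\<^esub> e1 i ?V \<oplus>\<^bsub>?T ?V\<^esub> (?b \<odot>\<^bsub>?T ?V\<^esub> e2 i ?V \<oplus>\<^bsub>?T ?V\<^esub> ?c \<odot>\<^bsub>?T ?V\<^esub> e3 i ?V)"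
      unfolding e_defs TT_simps zero_sec_def
      by (simp add: xpow_cancel[OF W(1,2)] r sec_units_right[OF W(1) cl(1)] sec_units_right[OF W(1) cl(2)] sec_units_right[OF W(1) cl(3)]
          sec_units[OF W(1) r(2)] sec_units[OF W(1) r(3)] sec_units_right[OF W(1) r(1)] sec_units_right[OF W(1) r(2)]
          sec_units[OF W(1) sec_zero_closed[OF W(1), of 0]])
    note m = TT_closed[OF W(1)]
    note eW = eT[OF W(1,2)]
    have f: "\<phi> ?V (e i ?V) P = \<phi> (C i) (e i (C i)) P"
      if "e i (C i) \<in> carrier (?T (C i))" "res (TT k1 k2 k3) ?V (e i (C i)) = e i ?V" for e
      using d(4)[OF C(4) that(1) oWC] that(2) W(4)
      by (metis restrict_apply')
    have f': "\<phi> ?V (e1 i ?V) P = \<phi> (C i) (e1 i (C i)) P" "\<phi> ?V (e2 i ?V) P = \<phi> (C i) (e2 i (C i)) P" "\<phi> ?V (e3 i ?V) P = \<phi> (C i) (e3 i (C i)) P"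
      by (intro f eC; simp add: e_defs TT_simps xpow_restrict[OF Int_lower2] zero_sec_restrict[OF Int_lower2])+
    have x: "xpow i k ?V P = xpow i k (C i) P" for k using W(4) by (simp add: xpow_def)
    have "\<phi> V (w1, w2, w3) P = restrict (\<phi> V (w1, w2, w3)) ?V P" using W(4) by simp
    also have "restrict (\<phi> V (w1, w2, w3)) ?V = \<phi> ?V (?r w1, ?r w2, ?r w3)"
      using d(4)[OF oV wT oWV] by (simp add: TT_simps)
    also have "\<dots> = sec_add homog ?V (sec_mult homog ?V ?a (\<phi> ?V (e1 i ?V)))
        (sec_add homog ?V (sec_mult homog ?V ?b (\<phi> ?V (e2 i ?V))) (sec_mult homog ?V ?c (\<phi> ?V (e3 i ?V))))"
      unfolding dec using cl eW by (simp only: d(2)[OF oW] d(3)[OF oW] m)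
    also have "\<dots> P = (w1 P \<otimes>\<^bsub>LL P\<^esub> xpow i (- k1) (C i) P) \<otimes>\<^bsub>LL P\<^esub> \<phi> (C i) (e1 i (C i)) P \<oplus>\<^bsub>LL P\<^esub>
        ((w2 P \<otimes>\<^bsub>LL P\<^esub> xpow i (- k2) (C i) P) \<otimes>\<^bsub>LL P\<^esub> \<phi> (C i) (e2 i (C i)) P \<oplus>\<^bsub>LL P\<^esub>
         (w3 P \<otimes>\<^bsub>LL P\<^esub> xpow i (- k3) (C i) P) \<otimes>\<^bsub>LL P\<^esub> \<phi> (C i) (e3 i (C i)) P)"
      using W(4) by (simp add: f' x)
    also have "\<dots> = p e1 k1 P \<otimes>\<^bsub>LL P\<^esub> w1 P \<oplus>\<^bsub>LL P\<^esub> p e2 k2 P \<otimes>\<^bsub>LL P\<^esub> w2 P \<oplus>\<^bsub>LL P\<^esub> p e3 k3 P \<otimes>\<^bsub>LL P\<^esub> w3 P"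
      using PU w[THEN tw_value[OF V(1) _ P]] \<phi>v[OF C(1,3) eC(1) Pi] \<phi>v[OF C(1,3) eC(2) Pi] \<phi>v[OF C(1,3) eC(3) Pi]
        tw_value[OF C(1) xpow_tw[OF C(1,2)] Pi]
      unfolding p_def i_def[symmetric] restrict_apply'[OF PU] by (simp add: L.m_ac L.a_ac)
    finally show ?thesis .
  qed
  have p_tw: "p e1 k1 \<in> tw (- k1) U" "p e2 k2 \<in> tw (- k2) U" "p e3 k3 \<in> tw (- k3) U"
  proof -
    have glue: "p e k \<in> tw (- k) U"
      if e: "\<forall>i. e i (C i) \<in> carrier (?T (C i))"
        and val: "\<And>i Q. Q \<in> C i \<Longrightarrow> \<phi> (C i) (e i (C i)) Q = p e k Q \<otimes>\<^bsub>LL Q\<^esub> xpow i k (C i) Q" for e k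
    proof (rule tw_glue[OF U])
      show "p e k \<in> extensional U" by (simp add: p_def)
      fix P assume P: "P \<in> U"
      define i where "i = ch P"
      have "restrict (p e k) (C i) = sec_mult homog (C i) (\<phi> (C i) (e i (C i))) (xpow i (- k) (C i))"
      proof (rule tw_eqI[of _ "C i"])
        fix Q assume Q: "Q \<in> C i"
        have QU: "Q \<in> U" using Q C(3) by blast
        interpret L: cring "LL Q" by (rule LL_cring_U[OF U QU])
        have pQ: "p e k Q \<in> carrier (LL Q)" by (rule pv[OF QU], rule e)
        show "restrict (p e k) (C i) Q = sec_mult homog (C i) (\<phi> (C i) (e i (C i))) (xpow i (- k) (C i)) Q"
          using Q pQ tw_value[OF C(1) xpow_tw[OF C(1,2)] Q] xpow_mult_inverse[OF C(2) Q]
          by (simp add: val L.m_assoc)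
      qed simp_all
      also have "\<dots> \<in> tw (- k) (C i)"
        by (rule sec_mult_closed[OF C(1) d(1)[OF C(4) spec[OF e]] xpow_tw[OF C(1,2)]]) simp
      finally show "\<exists>V. opn V \<and> P \<in> V \<and> V \<subseteq> U \<and> restrict (p e k) V \<in> tw (- k) V"
        using C(1,3) ch[OF P] unfolding i_def by blast
    qed
    have val: "\<phi> (C i) (e1 i (C i)) Q = p e1 k1 Q \<otimes>\<^bsub>LL Q\<^esub> xpow i k1 (C i) Q \<and>
        \<phi> (C i) (e2 i (C i)) Q = p e2 k2 Q \<otimes>\<^bsub>LL Q\<^esub> xpow i k2 (C i) Q \<and>
        \<phi> (C i) (e3 i (C i)) Q = p e3 k3 Q \<otimes>\<^bsub>LL Q\<^esub> xpow i k3 (C i) Q" if Q: "Q \<in> C i" for i Q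
    proof -
      have QU: "Q \<in> U" using Q C(3) by blast
      interpret L: cring "LL Q" by (rule LL_cring_U[OF U QU])
      note x = xpow_tw[OF C(1,2)] and z = zero_sec_closed[OF C(1)]
      have pvs: "p e1 k1 Q \<in> carrier (LL Q)" "p e2 k2 Q \<in> carrier (LL Q)" "p e3 k3 Q \<in> carrier (LL Q)"
        by (rule pv[OF QU], rule allI, rule eC)+
      show ?thesis
        unfolding key[OF C(1,3) x z z Q, folded e_defs] key[OF C(1,3) z x z Q, folded e_defs] key[OF C(1,3) z z x Q, folded e_defs]
        using pvs tw_value[OF C(1) x Q] Q by (simp add: zero_sec_value)
    qed
    show "p e1 k1 \<in> tw (- k1) U" using val by (intro glue allI eC) blast
    show "p e2 k2 \<in> tw (- k2) U" using val by (intro glue allI eC) blast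
    show "p e3 k3 \<in> tw (- k3) U" using val by (intro glue allI eC) blast
  qed
  let ?x = "(p e1 k1, p e2 k2, p e3 k3)"
  have "\<phi> = dual_of k1 k2 k3 U ?x"
  proof (rule extensionalityI)
    show "\<phi> \<in> extensional (opens PP U)" using \<phi> unfolding dual_carrier by blast
    show "dual_of k1 k2 k3 U ?x \<in> extensional (opens PP U)" by (simp add: dual_of_def)
    fix V assume V': "V \<in> opens PP U"
    then have V: "opn V" "V \<subseteq> U" unfolding opens_PP by blast+
    show "\<phi> V = dual_of k1 k2 k3 U ?x V"
    proof (rule extensionalityI)
      show "\<phi> V \<in> extensional (carrier (?T V))" using \<phi> V' unfolding dual_carrier by blast
      show "dual_of k1 k2 k3 U ?x V \<in> extensional (carrier (?T V))" using V' by (simp add: dual_of_def)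
      fix w assume wT: "w \<in> carrier (?T V)"
      obtain w1 w2 w3 where w: "w = (w1, w2, w3)" "w1 \<in> tw k1 V" "w2 \<in> tw k2 V" "w3 \<in> tw k3 V" by (rule TT_cases[OF wT])
      have "\<phi> V w = pair3 V ?x w"
      proof (rule tw_eqI[of _ V])
        show "\<phi> V w \<in> extensional V" by (rule tw_extensional[OF d(1)[OF V' wT]])
        show "\<phi> V w P = pair3 V ?x w P" if "P \<in> V" for P
          unfolding w(1) pair3_value[OF that] by (rule key[OF V w(2-4) that])
      qed simp
      then show "\<phi> V w = dual_of k1 k2 k3 U ?x V w" using V' wT by (simp add: dual_of_def)
    qed
  qed
  moreover have "?x \<in> carrier (sections (TT (- k1) (- k2) (- k3)) U)" using p_tw by (simp add: TT_simps)
  ultimately show ?thesis by blast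
qed

lemma presheaf_res_TT:
  assumes "opn U" "opn V" "V \<subseteq> U"
  shows "semilinear (str PP U) (sections (TT k1 k2 k3) U) (sections (TT k1 k2 k3) V) (str_res PP V) (res (TT k1 k2 k3) V) (str PP V)"
  by (rule presheaf_of_modules.res_semilinear[OF presheaf_TT]) (use assms in \<open>simp_all add: PP_simps\<close>)

text \<open>Pairing with a basis vector and dividing by the power of the variable recovers a coordinate.\<close>

lemma pair3_chart_basis:
  assumes V: "opn V" "V \<subseteq> D (Xvar i)" and P: "P \<in> V"
    and x: "x1 P \<in> carrier (LL P)" "x2 P \<in> carrier (LL P)" "x3 P \<in> carrier (LL P)"
  shows "pair3 V (x1, x2, x3) (xpow i k V, zero_sec V, zero_sec V) P \<otimes>\<^bsub>LL P\<^esub> xpow i (- k) V P = x1 P"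
    "pair3 V (x1, x2, x3) (zero_sec V, xpow i k V, zero_sec V) P \<otimes>\<^bsub>LL P\<^esub> xpow i (- k) V P = x2 P"
    "pair3 V (x1, x2, x3) (zero_sec V, zero_sec V, xpow i k V) P \<otimes>\<^bsub>LL P\<^esub> xpow i (- k) V P = x3 P"
    "pair3 V (xpow i k V, zero_sec V, zero_sec V) (x1, x2, x3) P \<otimes>\<^bsub>LL P\<^esub> xpow i (- k) V P = x1 P"
    "pair3 V (zero_sec V, xpow i k V, zero_sec V) (x1, x2, x3) P \<otimes>\<^bsub>LL P\<^esub> xpow i (- k) V P = x2 P"
    "pair3 V (zero_sec V, zero_sec V, xpow i k V) (x1, x2, x3) P \<otimes>\<^bsub>LL P\<^esub> xpow i (- k) V P = x3 P"
proof -
  interpret L: cring "LL P" by (rule LL_cring_U[OF V(1) P])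
  have xp: "xpow i k V P \<in> carrier (LL P)" "xpow i (- k) V P \<in> carrier (LL P)"
    using tw_value[OF V(1) xpow_tw[OF V] P] by blast+
  have c1: "(y \<otimes>\<^bsub>LL P\<^esub> xpow i k V P) \<otimes>\<^bsub>LL P\<^esub> xpow i (- k) V P = y" if "y \<in> carrier (LL P)" for y
    using that xp xpow_mult_inverse(1)[OF V(2) P] by (simp add: L.m_assoc)
  have c2: "(xpow i k V P \<otimes>\<^bsub>LL P\<^esub> y) \<otimes>\<^bsub>LL P\<^esub> xpow i (- k) V P = y" if "y \<in> carrier (LL P)" for y
    using c1[OF that] L.m_comm[OF that xp(1)] by simp
  show "pair3 V (x1, x2, x3) (xpow i k V, zero_sec V, zero_sec V) P \<otimes>\<^bsub>LL P\<^esub> xpow i (- k) V P = x1 P"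
    "pair3 V (x1, x2, x3) (zero_sec V, xpow i k V, zero_sec V) P \<otimes>\<^bsub>LL P\<^esub> xpow i (- k) V P = x2 P"
    "pair3 V (x1, x2, x3) (zero_sec V, zero_sec V, xpow i k V) P \<otimes>\<^bsub>LL P\<^esub> xpow i (- k) V P = x3 P"
    "pair3 V (xpow i k V, zero_sec V, zero_sec V) (x1, x2, x3) P \<otimes>\<^bsub>LL P\<^esub> xpow i (- k) V P = x1 P"
    "pair3 V (zero_sec V, xpow i k V, zero_sec V) (x1, x2, x3) P \<otimes>\<^bsub>LL P\<^esub> xpow i (- k) V P = x2 P"
    "pair3 V (zero_sec V, zero_sec V, xpow i k V) (x1, x2, x3) P \<otimes>\<^bsub>LL P\<^esub> xpow i (- k) V P = x3 P"
    using P x xp by (simp_all add: pair3_value zero_sec_value c1 c2)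
qed

lemma dual_of_inj:
  assumes U: "opn U" and xT: "x \<in> carrier (sections (TT (- k1) (- k2) (- k3)) U)"
    and yT: "y \<in> carrier (sections (TT (- k1) (- k2) (- k3)) U)"
    and eq: "dual_of k1 k2 k3 U x = dual_of k1 k2 k3 U y"
  shows "x = y"
proof -
  obtain x1 x2 x3 where x: "x = (x1, x2, x3)" "x1 \<in> tw (- k1) U" "x2 \<in> tw (- k2) U" "x3 \<in> tw (- k3) U" by (rule TT_cases[OF xT])
  obtain y1 y2 y3 where y: "y = (y1, y2, y3)" "y1 \<in> tw (- k1) U" "y2 \<in> tw (- k2) U" "y3 \<in> tw (- k3) U" by (rule TT_cases[OF yT])
  have "x1 P = y1 P \<and> x2 P = y2 P \<and> x3 P = y3 P" if P: "P \<in> U" for P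
  proof -
    obtain i where i: "opn (U \<inter> D (Xvar i))" "P \<in> U \<inter> D (Xvar i)" by (rule chart_neighbourhood[OF U P])
    let ?V = "U \<inter> D (Xvar i)"
    have Vo: "?V \<in> opens PP U" unfolding opens_PP using i(1) by simp
    have pe: "pair3 ?V (x1, x2, x3) w = pair3 ?V (y1, y2, y3) w" if "w \<in> carrier (sections (TT k1 k2 k3) ?V)" for w
    proof -
      have "dual_of k1 k2 k3 U x ?V w = dual_of k1 k2 k3 U y ?V w" by (simp only: eq)
      then show ?thesis using Vo that unfolding dual_of_def x(1) y(1) by simp
    qed
    have e: "(xpow i k1 ?V, zero_sec ?V, zero_sec ?V) \<in> carrier (sections (TT k1 k2 k3) ?V)"
      "(zero_sec ?V, xpow i k2 ?V, zero_sec ?V) \<in> carrier (sections (TT k1 k2 k3) ?V)"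
      "(zero_sec ?V, zero_sec ?V, xpow i k3 ?V) \<in> carrier (sections (TT k1 k2 k3) ?V)"
      by (simp_all add: TT_simps xpow_tw[OF i(1) Int_lower2] zero_sec_closed[OF i(1)])
    note xv = x(2-4)[THEN tw_value[OF U _ P]] and yv = y(2-4)[THEN tw_value[OF U _ P]]
    note bx = pair3_chart_basis[OF i(1) Int_lower2 i(2), of x1 x2 x3, OF xv]
      and by_ = pair3_chart_basis[OF i(1) Int_lower2 i(2), of y1 y2 y3, OF yv]
    show ?thesis
      using bx(1)[of k1] by_(1)[of k1] bx(2)[of k2] by_(2)[of k2] bx(3)[of k3] by_(3)[of k3]
      unfolding pe[OF e(1)] pe[OF e(2)] pe[OF e(3)] by simp
  qed
  then have "x1 = y1" "x2 = y2" "x3 = y3"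
    by - (rule tw_eqI[OF tw_extensional[OF x(2)] tw_extensional[OF y(2)]], simp,
      rule tw_eqI[OF tw_extensional[OF x(3)] tw_extensional[OF y(3)]], simp,
      rule tw_eqI[OF tw_extensional[OF x(4)] tw_extensional[OF y(4)]], simp)
  then show ?thesis unfolding x(1) y(1) by simp
qed

lemma presheaf_iso_dual:
  "presheaf_iso (PP :: (('v::finite, 'a::comm_ring_1) mpoly set, _) ringed_space)
     (TT (- k1) (- k2) (- k3)) (dual_sheaf PP (TT k1 k2 k3)) (dual_of k1 k2 k3)"
proof (intro presheaf_iso.intro presheaf_TT presheaf_iso_axioms.intro)
  fix U :: "('v, 'a) mpoly set set"
  assume "openin (space PP) U"
  then have U: "opn U" by (simp add: PP_simps)
  let ?T' = "sections (TT (- k1) (- k2) (- k3)) U"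
  show "linear_iso (str PP U) ?T' (sections (dual_sheaf PP (TT k1 k2 k3)) U) (dual_of k1 k2 k3 U)"
    unfolding linear_iso_def
  proof (intro conjI ballI)
    show "bij_betw (dual_of k1 k2 k3 U) (carrier ?T') (carrier (sections (dual_sheaf PP (TT k1 k2 k3)) U))"
    proof (rule bij_betw_imageI)
      show "inj_on (dual_of k1 k2 k3 U) (carrier ?T')" by (rule inj_onI, rule dual_of_inj[OF U])
      show "dual_of k1 k2 k3 U ` carrier ?T' = carrier (sections (dual_sheaf PP (TT k1 k2 k3)) U)"
      proof
        show "dual_of k1 k2 k3 U ` carrier ?T' \<subseteq> carrier (sections (dual_sheaf PP (TT k1 k2 k3)) U)"
          by (rule image_subsetI, rule dual_of_closed[OF U])
        show "carrier (sections (dual_sheaf PP (TT k1 k2 k3)) U) \<subseteq> dual_of k1 k2 k3 U ` carrier ?T'"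
        proof
          fix \<phi> assume "\<phi> \<in> carrier (sections (dual_sheaf PP (TT k1 k2 k3)) U)"
          from dual_of_surj[OF U this] show "\<phi> \<in> dual_of k1 k2 k3 U ` carrier ?T'" by (elim bexE) (rule image_eqI)
        qed
      qed
    qed
    fix x assume x: "x \<in> carrier ?T'"
    have res: "pair3 V (res (TT (- k1) (- k2) (- k3)) V z) w = pair3 V z w" for V z w by (rule pair3_restrict_left)
    show "dual_of k1 k2 k3 U (x \<oplus>\<^bsub>?T'\<^esub> y) = dual_of k1 k2 k3 U x \<oplus>\<^bsub>sections (dual_sheaf PP (TT k1 k2 k3)) U\<^esub> dual_of k1 k2 k3 U y"
      if y: "y \<in> carrier ?T'" for y
      unfolding dual_simps dual_of_def
    proof (intro restrict_ext)
      fix V w assume V': "V \<in> opens PP U" and w: "w \<in> carrier (sections (TT k1 k2 k3) V)"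
      then have V: "opn V" "V \<subseteq> U" unfolding opens_PP by blast+
      note r = semilinearD[OF presheaf_res_TT[OF U V]]
      have "pair3 V (x \<oplus>\<^bsub>?T'\<^esub> y) w = sec_add homog V (pair3 V x w) (pair3 V y w)"
        unfolding res[symmetric, of V "x \<oplus>\<^bsub>?T'\<^esub> y"] r(2)[OF x y] pair3_laws(1)[OF V(1) r(1)[OF x] r(1)[OF y] w sec_zero_closed[OF V(1)]] res ..
      then show "pair3 V (x \<oplus>\<^bsub>?T'\<^esub> y) w = sec_add homog V ((\<lambda>V\<in>opens PP U. \<lambda>w\<in>carrier (sections (TT k1 k2 k3) V). pair3 V x w) V w)
         ((\<lambda>V\<in>opens PP U. \<lambda>w\<in>carrier (sections (TT k1 k2 k3) V). pair3 V y w) V w)"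
        unfolding restrict_apply'[OF V'] restrict_apply'[OF w] .
    qed
    show "dual_of k1 k2 k3 U (c \<odot>\<^bsub>?T'\<^esub> x) = c \<odot>\<^bsub>sections (dual_sheaf PP (TT k1 k2 k3)) U\<^esub> dual_of k1 k2 k3 U x"
      if c: "c \<in> carrier (str PP U)" for c
      unfolding dual_simps dual_of_def
    proof (intro restrict_ext)
      fix V w assume V': "V \<in> opens PP U" and w: "w \<in> carrier (sections (TT k1 k2 k3) V)"
      then have V: "opn V" "V \<subseteq> U" unfolding opens_PP by blast+
      note r = semilinearD[OF presheaf_res_TT[OF U V]]
      have cV: "restrict c V \<in> tw 0 V" using r(3)[OF x c] unfolding PP_simps .
      have "pair3 V (c \<odot>\<^bsub>?T'\<^esub> x) w = sec_mult homog V (restrict c V) (pair3 V x w)"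
        unfolding res[symmetric, of V "c \<odot>\<^bsub>?T'\<^esub> x"] r(4)[OF x c] PP_simps pair3_laws(3)[OF V(1) r(1)[OF x] r(1)[OF x] w cV] res ..
      then show "pair3 V (c \<odot>\<^bsub>?T'\<^esub> x) w = sec_mult homog V (restrict c V) ((\<lambda>V\<in>opens PP U. \<lambda>w\<in>carrier (sections (TT k1 k2 k3) V). pair3 V x w) V w)"
        unfolding restrict_apply'[OF V'] restrict_apply'[OF w] .
    qed
  qed
  show "dual_of k1 k2 k3 U \<zero>\<^bsub>?T'\<^esub> = \<zero>\<^bsub>sections (dual_sheaf PP (TT k1 k2 k3)) U\<^esub>"
    unfolding dual_simps dual_of_def
  proof (intro restrict_ext)
    fix V w assume V': "V \<in> opens PP U" and wT: "w \<in> carrier (sections (TT k1 k2 k3) V)"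
    then have V: "opn V" "V \<subseteq> U" unfolding opens_PP by blast+
    obtain w1 w2 w3 where w: "w = (w1, w2, w3)" "w1 \<in> tw k1 V" "w2 \<in> tw k2 V" "w3 \<in> tw k3 V" by (rule TT_cases[OF wT])
    show "pair3 V \<zero>\<^bsub>?T'\<^esub> w = sec_of homog V 0"
      unfolding w(1) TT_simps
    proof (rule tw_eqI[of _ V])
      fix P assume P: "P \<in> V"
      interpret L: cring "LL P" by (rule LL_cring_U[OF V(1) P])
      show "pair3 V (sec_of homog U 0, sec_of homog U 0, sec_of homog U 0) (w1, w2, w3) P = sec_of homog V 0 P"
        using P V(2) w(2-4)[THEN tw_value[OF V(1) _ P]] by (simp add: pair3_value LL_zero[symmetric] subset_iff)
    qed simp_all
  qed
  fix V x assume V': "V \<in> opens PP U"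
  then have "W \<in> opens PP U" if "W \<in> opens PP V" for W using that unfolding opens_PP by blast
  then show "res (dual_sheaf PP (TT k1 k2 k3)) V (dual_of k1 k2 k3 U x) = dual_of k1 k2 k3 V (res (TT (- k1) (- k2) (- k3)) V x)"
    unfolding dual_simps dual_of_def
  proof (intro restrict_ext)
    fix W assume W: "W \<in> opens PP V" and sub: "\<And>W. W \<in> opens PP V \<Longrightarrow> W \<in> opens PP U"
    have WV: "W \<subseteq> V" using W by simp
    have "pair3 W (res (TT (- k1) (- k2) (- k3)) V x) w = pair3 W x w" for w
      using WV by (cases x, cases w) (auto simp: pair3_def TT_simps fun_eq_iff restrict_def sec_add_def sec_mult_def subset_iff)
    then show "(\<lambda>V\<in>opens PP U. \<lambda>w\<in>carrier (sections (TT k1 k2 k3) V). pair3 V x w) W =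
        (\<lambda>w\<in>carrier (sections (TT k1 k2 k3) W). pair3 W (res (TT (- k1) (- k2) (- k3)) V x) w)"
      unfolding restrict_apply'[OF sub[OF W]] by simp
  qed
qed

section \<open>The dual orientation\<close>

context cring
begin

lemma D3_mult_rows:
  assumes a: "a1 \<in> carrier R" "a2 \<in> carrier R" "a3 \<in> carrier R" "b1 \<in> carrier R" "b2 \<in> carrier R" "b3 \<in> carrier R"
    "c1 \<in> carrier R" "c2 \<in> carrier R" "c3 \<in> carrier R"
    and x: "x1 \<in> carrier R" "x2 \<in> carrier R" "x3 \<in> carrier R" "y1 \<in> carrier R" "y2 \<in> carrier R" "y3 \<in> carrier R"
    "z1 \<in> carrier R" "z2 \<in> carrier R" "z3 \<in> carrier R"
  shows "D3 R (a1 \<otimes> x1 \<oplus> a2 \<otimes> y1 \<oplus> a3 \<otimes> z1) (a1 \<otimes> x2 \<oplus> a2 \<otimes> y2 \<oplus> a3 \<otimes> z2) (a1 \<otimes> x3 \<oplus> a2 \<otimes> y3 \<oplus> a3 \<otimes> z3)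
      (b1 \<otimes> x1 \<oplus> b2 \<otimes> y1 \<oplus> b3 \<otimes> z1) (b1 \<otimes> x2 \<oplus> b2 \<otimes> y2 \<oplus> b3 \<otimes> z2) (b1 \<otimes> x3 \<oplus> b2 \<otimes> y3 \<oplus> b3 \<otimes> z3)
      (c1 \<otimes> x1 \<oplus> c2 \<otimes> y1 \<oplus> c3 \<otimes> z1) (c1 \<otimes> x2 \<oplus> c2 \<otimes> y2 \<oplus> c3 \<otimes> z2) (c1 \<otimes> x3 \<oplus> c2 \<otimes> y3 \<oplus> c3 \<otimes> z3)
    = D3 R a1 a2 a3 b1 b2 b3 c1 c2 c3 \<otimes> D3 R x1 x2 x3 y1 y2 y3 z1 z2 z3"
proof -
  let ?d = "D3 R x1 x2 x3 y1 y2 y3 z1 z2 z3"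
  have d: "?d \<in> carrier R" using x by (rule D3_closed)
  have row1: "D3 R (a1 \<otimes> x1 \<oplus> a2 \<otimes> y1 \<oplus> a3 \<otimes> z1) (a1 \<otimes> x2 \<oplus> a2 \<otimes> y2 \<oplus> a3 \<otimes> z2) (a1 \<otimes> x3 \<oplus> a2 \<otimes> y3 \<oplus> a3 \<otimes> z3) p1 p2 p3 q1 q2 q3
      = a1 \<otimes> D3 R x1 x2 x3 p1 p2 p3 q1 q2 q3 \<oplus> a2 \<otimes> D3 R y1 y2 y3 p1 p2 p3 q1 q2 q3 \<oplus> a3 \<otimes> D3 R z1 z2 z3 p1 p2 p3 q1 q2 q3"
    if "p1 \<in> carrier R" "p2 \<in> carrier R" "p3 \<in> carrier R" "q1 \<in> carrier R" "q2 \<in> carrier R" "q3 \<in> carrier R" for p1 p2 p3 q1 q2 q3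
    using that a x by (simp add: D3_row1_linear)
  have row2: "D3 R p1 p2 p3 (b1 \<otimes> x1 \<oplus> b2 \<otimes> y1 \<oplus> b3 \<otimes> z1) (b1 \<otimes> x2 \<oplus> b2 \<otimes> y2 \<oplus> b3 \<otimes> z2) (b1 \<otimes> x3 \<oplus> b2 \<otimes> y3 \<oplus> b3 \<otimes> z3) q1 q2 q3
      = b1 \<otimes> D3 R p1 p2 p3 x1 x2 x3 q1 q2 q3 \<oplus> b2 \<otimes> D3 R p1 p2 p3 y1 y2 y3 q1 q2 q3 \<oplus> b3 \<otimes> D3 R p1 p2 p3 z1 z2 z3 q1 q2 q3"
    if "p1 \<in> carrier R" "p2 \<in> carrier R" "p3 \<in> carrier R" "q1 \<in> carrier R" "q2 \<in> carrier R" "q3 \<in> carrier R" for p1 p2 p3 q1 q2 q3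
    using that a x by (simp add: D3_row2_linear)
  have row3: "D3 R p1 p2 p3 q1 q2 q3 (c1 \<otimes> x1 \<oplus> c2 \<otimes> y1 \<oplus> c3 \<otimes> z1) (c1 \<otimes> x2 \<oplus> c2 \<otimes> y2 \<oplus> c3 \<otimes> z2) (c1 \<otimes> x3 \<oplus> c2 \<otimes> y3 \<oplus> c3 \<otimes> z3)
      = c1 \<otimes> D3 R p1 p2 p3 q1 q2 q3 x1 x2 x3 \<oplus> c2 \<otimes> D3 R p1 p2 p3 q1 q2 q3 y1 y2 y3 \<oplus> c3 \<otimes> D3 R p1 p2 p3 q1 q2 q3 z1 z2 z3"
    if "p1 \<in> carrier R" "p2 \<in> carrier R" "p3 \<in> carrier R" "q1 \<in> carrier R" "q2 \<in> carrier R" "q3 \<in> carrier R" for p1 p2 p3 q1 q2 q3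
    using that a x by (simp add: D3_row3_linear)
  have p132: "D3 R x1 x2 x3 z1 z2 z3 y1 y2 y3 = \<ominus> ?d" using x by (intro D3_swap(2))
  have p213: "D3 R y1 y2 y3 x1 x2 x3 z1 z2 z3 = \<ominus> ?d" using x by (intro D3_swap(1))
  have p312: "D3 R z1 z2 z3 x1 x2 x3 y1 y2 y3 = ?d"
    using D3_swap(1)[of z1 z2 z3 x1 x2 x3 y1 y2 y3] x d p132 by simp
  have p231: "D3 R y1 y2 y3 z1 z2 z3 x1 x2 x3 = ?d"
    using D3_swap(2)[of y1 y2 y3 z1 z2 z3 x1 x2 x3] x d p213 by simp
  have p321: "D3 R z1 z2 z3 y1 y2 y3 x1 x2 x3 = \<ominus> ?d"
    using D3_swap(1)[of z1 z2 z3 y1 y2 y3 x1 x2 x3] x d p231 by simp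
  have fin: "c1 \<otimes> (b2 \<otimes> (a3 \<otimes> \<ominus> d) \<oplus> b3 \<otimes> (a2 \<otimes> d)) \<oplus> c2 \<otimes> (b1 \<otimes> (a3 \<otimes> d) \<oplus> b3 \<otimes> (a1 \<otimes> \<ominus> d)) \<oplus>
       c3 \<otimes> (b1 \<otimes> (a2 \<otimes> \<ominus> d) \<oplus> b2 \<otimes> (a1 \<otimes> d)) = D3 R a1 a2 a3 b1 b2 b3 c1 c2 c3 \<otimes> d"
    if "d \<in> carrier R" for d
    unfolding D3_def using a that by algebra
  show ?thesis
    using a x d
    by (simp add: row1 row2 row3 D3_alt p132 p213 p312 p231 p321 D3_closed) (rule fin[OF d])
qed

end

lemma det3_D3: "det3 A m = D3 A (m 0 0) (m 0 1) (m 0 2) (m 1 0) (m 1 1) (m 1 2) (m 2 0) (m 2 1) (m 2 2)"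
  by (simp add: det3_def D3_def)

lemma D3_str_value:
  assumes U: "opn U" and P: "P \<in> U"
    and m: "a1 \<in> tw 0 U" "a2 \<in> tw 0 U" "a3 \<in> tw 0 U" "b1 \<in> tw 0 U" "b2 \<in> tw 0 U" "b3 \<in> tw 0 U"
      "c1 \<in> tw 0 U" "c2 \<in> tw 0 U" "c3 \<in> tw 0 U"
  shows "D3 (str PP U) a1 a2 a3 b1 b2 b3 c1 c2 c3 P = D3 (LL P) (a1 P) (a2 P) (a3 P) (b1 P) (b2 P) (b3 P) (c1 P) (c2 P) (c3 P)"
    "D3 (str PP U) a1 a2 a3 b1 b2 b3 c1 c2 c3 \<in> tw 0 U"
proof -
  interpret S: cring "str PP U" by (rule cring_PP[OF U])
  have uminus: "\<ominus>\<^bsub>str PP U\<^esub> a = sec_uminus U a" if "a \<in> carrier (str PP U)" for a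
    by (rule S.minus_equality) (use that in \<open>simp_all add: PP_simps sec_uminus_left[OF U] sec_uminus_closed[OF U]\<close>)
  have minus: "(a \<ominus>\<^bsub>str PP U\<^esub> b) P = a P \<ominus>\<^bsub>LL P\<^esub> b P" if "b \<in> carrier (str PP U)" for a b
    using that P sec_uminus_value[OF U _ P, of b] unfolding S.minus_eq uminus[OF that] PP_simps by (simp add: a_minus_def)
  have pt: "(a \<otimes>\<^bsub>str PP U\<^esub> b) P = a P \<otimes>\<^bsub>LL P\<^esub> b P" "(a \<oplus>\<^bsub>str PP U\<^esub> b) P = a P \<oplus>\<^bsub>LL P\<^esub> b P" for a b
    using P by (simp_all add: PP_simps)
  note m' = m[folded PP_simps(2)]
  show "D3 (str PP U) a1 a2 a3 b1 b2 b3 c1 c2 c3 P = D3 (LL P) (a1 P) (a2 P) (a3 P) (b1 P) (b2 P) (b3 P) (c1 P) (c2 P) (c3 P)"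
    unfolding D3_def using m' by (simp add: pt minus)
  show "D3 (str PP U) a1 a2 a3 b1 b2 b3 c1 c2 c3 \<in> tw 0 U"
    unfolding PP_simps(2)[symmetric] using m' by (rule S.D3_closed)
qed

lemma sec_Const_closed: "opn U \<Longrightarrow> sec_of homog U (Const c) \<in> tw 0 U"
  using sec_of_closed[OF _ homog_Const] by fastforce

text \<open>The matrix of pairings is the product of the two matrices of coordinates, one of them
  transposed, and the constants cancel.\<close>

lemma dform_pairing:
  assumes U: "opn U" and k: "k1 + k2 + k3 = 0" and c: "c0 * d0 = 1"
    and u: "u1 \<in> carrier (sections (TT k1 k2 k3) U)" "u2 \<in> carrier (sections (TT k1 k2 k3) U)" "u3 \<in> carrier (sections (TT k1 k2 k3) U)"
    and x: "x1 \<in> carrier (sections (TT (- k1) (- k2) (- k3)) U)" "x2 \<in> carrier (sections (TT (- k1) (- k2) (- k3)) U)"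
      "x3 \<in> carrier (sections (TT (- k1) (- k2) (- k3)) U)"
  shows "sec_mult homog U (sec_mult homog U (sec_of homog U (Const c0)) (dform U u1 u2 u3))
      (sec_mult homog U (sec_of homog U (Const d0)) (dform U x1 x2 x3))
    = D3 (str PP U) (pair3 U x1 u1) (pair3 U x2 u1) (pair3 U x3 u1) (pair3 U x1 u2) (pair3 U x2 u2) (pair3 U x3 u2)
       (pair3 U x1 u3) (pair3 U x2 u3) (pair3 U x3 u3)"
proof (rule tw_eqI[of _ U])
  have pc: "pair3 U y v \<in> tw 0 U" if "y \<in> carrier (sections (TT (- k1) (- k2) (- k3)) U)" "v \<in> carrier (sections (TT k1 k2 k3) U)" for y v
    by (rule pair3_closed[OF U that])
  note D = D3_str_value[OF U _ pc[OF x(1) u(1)] pc[OF x(2) u(1)] pc[OF x(3) u(1)] pc[OF x(1) u(2)] pc[OF x(2) u(2)] pc[OF x(3) u(2)]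
      pc[OF x(1) u(3)] pc[OF x(2) u(3)] pc[OF x(3) u(3)]]
  let ?r = "D3 (str PP U) (pair3 U x1 u1) (pair3 U x2 u1) (pair3 U x3 u1) (pair3 U x1 u2) (pair3 U x2 u2) (pair3 U x3 u2)
       (pair3 U x1 u3) (pair3 U x2 u3) (pair3 U x3 u3)"
  have "?r \<in> tw 0 U" unfolding PP_simps(2)[symmetric]
    by (rule cring.D3_closed[OF cring_PP[OF U]]) (simp_all add: PP_simps pc u x)
  then show "?r \<in> extensional U" by (rule tw_extensional)
  fix P assume P: "P \<in> U"
  interpret L: cring "LL P" by (rule LL_cring_U[OF U P])
  interpret mult_set "dn P" by (rule mult_set_denoms[OF op_subset_Proj[OF U P]])
  obtain a1 a2 a3 where a: "u1 = (a1, a2, a3)" "a1 \<in> tw k1 U" "a2 \<in> tw k2 U" "a3 \<in> tw k3 U" by (rule TT_cases[OF u(1)])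
  obtain b1 b2 b3 where b: "u2 = (b1, b2, b3)" "b1 \<in> tw k1 U" "b2 \<in> tw k2 U" "b3 \<in> tw k3 U" by (rule TT_cases[OF u(2)])
  obtain g1 g2 g3 where g: "u3 = (g1, g2, g3)" "g1 \<in> tw k1 U" "g2 \<in> tw k2 U" "g3 \<in> tw k3 U" by (rule TT_cases[OF u(3)])
  obtain p1 p2 p3 where p: "x1 = (p1, p2, p3)" "p1 \<in> tw (- k1) U" "p2 \<in> tw (- k2) U" "p3 \<in> tw (- k3) U" by (rule TT_cases[OF x(1)])
  obtain q1 q2 q3 where q: "x2 = (q1, q2, q3)" "q1 \<in> tw (- k1) U" "q2 \<in> tw (- k2) U" "q3 \<in> tw (- k3) U" by (rule TT_cases[OF x(2)])
  obtain r1 r2 r3 where r: "x3 = (r1, r2, r3)" "r1 \<in> tw (- k1) U" "r2 \<in> tw (- k2) U" "r3 \<in> tw (- k3) U" by (rule TT_cases[OF x(3)])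
  note vu = a(2-4)[THEN tw_value[OF U _ P]] b(2-4)[THEN tw_value[OF U _ P]] g(2-4)[THEN tw_value[OF U _ P]]
  note vx = p(2-4)[THEN tw_value[OF U _ P]] q(2-4)[THEN tw_value[OF U _ P]] r(2-4)[THEN tw_value[OF U _ P]]
  note vx' = vx(1,4,7,2,5,8,3,6,9)
  let ?u = "D3 (LL P) (a1 P) (a2 P) (a3 P) (b1 P) (b2 P) (b3 P) (g1 P) (g2 P) (g3 P)"
  let ?x = "D3 (LL P) (p1 P) (p2 P) (p3 P) (q1 P) (q2 P) (q3 P) (r1 P) (r2 P) (r3 P)"
  have ux: "?u \<in> carrier (LL P)" "?x \<in> carrier (LL P)" by (rule L.D3_closed[OF vu], rule L.D3_closed[OF vx])
  have cd: "fraction (dn P) (Const c0) 1 \<otimes>\<^bsub>LL P\<^esub> fraction (dn P) (Const d0) 1 = \<one>\<^bsub>LL P\<^esub>"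
    unfolding LL_one by (simp add: fraction_mult Const_simps(4)[symmetric] c del: Const_simps(4))
  have cc: "fraction (dn P) (Const c0) 1 \<in> carrier (LL P)" "fraction (dn P) (Const d0) 1 \<in> carrier (LL P)" by simp_all
  have "(fraction (dn P) (Const c0) 1 \<otimes>\<^bsub>LL P\<^esub> ?u) \<otimes>\<^bsub>LL P\<^esub> (fraction (dn P) (Const d0) 1 \<otimes>\<^bsub>LL P\<^esub> ?x)
     = (fraction (dn P) (Const c0) 1 \<otimes>\<^bsub>LL P\<^esub> fraction (dn P) (Const d0) 1) \<otimes>\<^bsub>LL P\<^esub> (?u \<otimes>\<^bsub>LL P\<^esub> ?x)"
    using ux cc by (simp add: L.m_ac)
  also have "\<dots> = ?u \<otimes>\<^bsub>LL P\<^esub> ?x" unfolding cd using ux by simp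
  finally have main: "(fraction (dn P) (Const c0) 1 \<otimes>\<^bsub>LL P\<^esub> ?u) \<otimes>\<^bsub>LL P\<^esub> (fraction (dn P) (Const d0) 1 \<otimes>\<^bsub>LL P\<^esub> ?x)
     = ?u \<otimes>\<^bsub>LL P\<^esub> ?x" .
  have tr: "?x = D3 (LL P) (p1 P) (q1 P) (r1 P) (p2 P) (q2 P) (r2 P) (p3 P) (q3 P) (r3 P)"
    by (rule L.D3_transpose[OF vx])
  note main2 = trans[OF main arg_cong[OF tr, of "\<lambda>z. ?u \<otimes>\<^bsub>LL P\<^esub> z"]]
  have pv: "pair3 U (s1, s2, s3) (v1, v2, v3) P = v1 P \<otimes>\<^bsub>LL P\<^esub> s1 P \<oplus>\<^bsub>LL P\<^esub> v2 P \<otimes>\<^bsub>LL P\<^esub> s2 P \<oplus>\<^bsub>LL P\<^esub> v3 P \<otimes>\<^bsub>LL P\<^esub> s3 P"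
    if "s1 P \<in> carrier (LL P)" "s2 P \<in> carrier (LL P)" "s3 P \<in> carrier (LL P)" "v1 P \<in> carrier (LL P)" "v2 P \<in> carrier (LL P)" "v3 P \<in> carrier (LL P)"
    for s1 s2 s3 v1 v2 v3
    using that P by (simp add: pair3_value L.m_comm)
  show "sec_mult homog U (sec_mult homog U (sec_of homog U (Const c0)) (dform U u1 u2 u3))
      (sec_mult homog U (sec_of homog U (Const d0)) (dform U x1 x2 x3)) P = ?r P"
    unfolding D(1)[OF P] unfolding a(1) b(1) g(1) p(1) q(1) r(1)
    using vu vx P by (simp only: pv L.D3_mult_rows sec_simps dform_value main2)
qed simp

lemma exists_dual_det:
  fixes \<alpha> :: "(('v::finite, 'a::comm_ring_1) mpoly set, _, _) det_form"
  assumes k: "k1 + k2 + k3 = 0" and c: "c0 * d0 = 1"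
    and \<alpha>: "\<And>U u v w. opn U \<Longrightarrow> u \<in> carrier (sections (TT k1 k2 k3) U) \<Longrightarrow> v \<in> carrier (sections (TT k1 k2 k3) U) \<Longrightarrow>
       w \<in> carrier (sections (TT k1 k2 k3) U) \<Longrightarrow>
       \<alpha> U (wedge_over PP (TT k1 k2 k3) U u v w) = sec_mult homog U (sec_of homog U (Const c0)) (dform U u v w)"
  shows "\<exists>\<beta>. det_iso PP (dual_sheaf PP (TT k1 k2 k3)) \<beta> \<and>
     (\<forall>U. openin (space PP) U \<longrightarrow>
       (\<forall>u1\<in>carrier (sections (TT k1 k2 k3) U). \<forall>u2\<in>carrier (sections (TT k1 k2 k3) U). \<forall>u3\<in>carrier (sections (TT k1 k2 k3) U).
        \<forall>x1\<in>carrier (sections (dual_sheaf PP (TT k1 k2 k3)) U). \<forall>x2\<in>carrier (sections (dual_sheaf PP (TT k1 k2 k3)) U).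
        \<forall>x3\<in>carrier (sections (dual_sheaf PP (TT k1 k2 k3)) U).
          \<alpha> U (wedge_over PP (TT k1 k2 k3) U u1 u2 u3) \<otimes>\<^bsub>str PP U\<^esub> \<beta> U (wedge_over PP (dual_sheaf PP (TT k1 k2 k3)) U x1 x2 x3)
            = det3 (str PP U) (\<lambda>i j. ([x1, x2, x3] ! j) U ([u1, u2, u3] ! i))))"
proof -
  let ?T = "\<lambda>U. sections (TT k1 k2 k3) U"
  let ?T' = "\<lambda>U. sections (TT (- k1) (- k2) (- k3)) U"
  interpret I: presheaf_iso "PP :: (('v, 'a) mpoly set, _) ringed_space" "TT (- k1) (- k2) (- k3)"
    "dual_sheaf PP (TT k1 k2 k3)" "dual_of k1 k2 k3" by (rule presheaf_iso_dual)
  have k': "- k1 + - k2 + - k3 = 0" using k by simp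
  have "\<exists>\<beta>. det_iso PP (dual_sheaf PP (TT k1 k2 k3)) \<beta> \<and> (\<forall>U :: ('v, 'a) mpoly set set. openin (space PP) U \<longrightarrow> (\<forall>u\<in>carrier (?T' U).
     \<forall>v\<in>carrier (?T' U). \<forall>w\<in>carrier (?T' U). \<beta> U (wedge_over PP (dual_sheaf PP (TT k1 k2 k3)) U (dual_of k1 k2 k3 U u)
       (dual_of k1 k2 k3 U v) (dual_of k1 k2 k3 U w)) = sec_of homog U (Const d0) \<otimes>\<^bsub>str PP U\<^esub> dform U u v w))"
  proof (rule I.exists_det_iso_transport[where \<omega> = "\<lambda>U u v w. sec_of homog U (Const d0) \<otimes>\<^bsub>str PP U\<^esub> dform U u v w"])
    fix U :: "('v, 'a) mpoly set set"
    assume "openin (space PP) U"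
    then have U: "opn U" by (simp add: PP_simps)
    show "alt_form (str PP U) (?T' U) (\<lambda>u v w. sec_of homog U (Const d0) \<otimes>\<^bsub>str PP U\<^esub> dform U u v w)"
      by (rule alt_form_scale[OF cring_PP[OF U] alt_form_dform[OF U k']]) (simp add: PP_simps sec_Const_closed[OF U])
    show "str_res PP V (sec_of homog U (Const d0) \<otimes>\<^bsub>str PP U\<^esub> dform U u v w) = sec_of homog V (Const d0) \<otimes>\<^bsub>str PP V\<^esub>
        dform V (res (TT (- k1) (- k2) (- k3)) V u) (res (TT (- k1) (- k2) (- k3)) V v) (res (TT (- k1) (- k2) (- k3)) V w)"
      if "V \<in> opens PP U" for V u v w
    proof -
      have V: "V \<subseteq> U" using that by simp
      show ?thesis unfolding PP_simps sec_restrict[OF V] dform_restrict[OF V, where ?k1.0 = "- k1" and ?k2.0 = "- k2" and ?k3.0 = "- k3"] ..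
    qed
    fix P assume "P \<in> U"
    then obtain i where i: "opn (U \<inter> D (Xvar i))" "P \<in> U \<inter> D (Xvar i)" by (rule chart_neighbourhood[OF U])
    let ?V = "U \<inter> D (Xvar i)"
    interpret S: cring "str PP ?V" by (rule cring_PP[OF i(1)])
    have cc: "sec_of homog ?V (Const e) \<in> carrier (str PP ?V)" for e unfolding PP_simps by (rule sec_Const_closed[OF i(1)])
    have "sec_of homog ?V (Const c0) \<otimes>\<^bsub>str PP ?V\<^esub> (sec_of homog ?V (Const d0) \<otimes>\<^bsub>str PP ?V\<^esub>
        dform ?V (xpow i (- k1) ?V, zero_sec ?V, zero_sec ?V) (zero_sec ?V, xpow i (- k2) ?V, zero_sec ?V) (zero_sec ?V, zero_sec ?V, xpow i (- k3) ?V))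
        = sec_of homog ?V (Const c0) \<otimes>\<^bsub>str PP ?V\<^esub> sec_of homog ?V (Const d0)"
      unfolding dform_chart_basis[OF i(1) Int_lower2 k'] PP_simps(5)[symmetric] using cc by simp
    also have "\<dots> = \<one>\<^bsub>str PP ?V\<^esub>"
      unfolding PP_simps
    proof (rule tw_eqI[of _ ?V])
      fix Q assume Q: "Q \<in> ?V"
      interpret mult_set "dn Q" by (rule mult_set_denoms[OF op_subset_Proj[OF i(1) Q]])
      show "sec_mult homog ?V (sec_of homog ?V (Const c0)) (sec_of homog ?V (Const d0)) Q = sec_of homog ?V 1 Q"
        using Q by (simp add: fraction_mult Const_simps(4)[symmetric] c del: Const_simps(4))
    qed simp_all
    finally show "\<exists>V\<in>opens PP U. P \<in> V \<and> (\<exists>e1 e2 e3 d. ext3_generated (str PP V) (?T' V) e1 e2 e3 \<and>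
       d \<in> carrier (str PP V) \<and> d \<otimes>\<^bsub>str PP V\<^esub> (sec_of homog V (Const d0) \<otimes>\<^bsub>str PP V\<^esub> dform V e1 e2 e3) = \<one>\<^bsub>str PP V\<^esub>)"
      using i(1) i(2) TT_chart_basis[OF i(1) Int_lower2, of "- k1" "- k2" "- k3"] cc
      by (intro bexI[of _ ?V] conjI exI) (assumption | simp add: opens_PP PP_simps(1))+
  qed
  then obtain \<beta> where \<beta>: "det_iso PP (dual_sheaf PP (TT k1 k2 k3)) \<beta>"
    "\<forall>U :: ('v, 'a) mpoly set set. openin (space PP) U \<longrightarrow> (\<forall>u\<in>carrier (?T' U).
     \<forall>v\<in>carrier (?T' U). \<forall>w\<in>carrier (?T' U). \<beta> U (wedge_over PP (dual_sheaf PP (TT k1 k2 k3)) U (dual_of k1 k2 k3 U u)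
       (dual_of k1 k2 k3 U v) (dual_of k1 k2 k3 U w)) = sec_of homog U (Const d0) \<otimes>\<^bsub>str PP U\<^esub> dform U u v w)" by blast
  show ?thesis
  proof (intro exI[of _ \<beta>] conjI \<beta>(1) allI impI ballI)
    fix U :: "('v, 'a) mpoly set set" and u1 u2 u3 y1 y2 y3
    assume oU: "openin (space PP) U" and u: "u1 \<in> carrier (?T U)" "u2 \<in> carrier (?T U)" "u3 \<in> carrier (?T U)"
      and y: "y1 \<in> carrier (sections (dual_sheaf PP (TT k1 k2 k3)) U)" "y2 \<in> carrier (sections (dual_sheaf PP (TT k1 k2 k3)) U)"
        "y3 \<in> carrier (sections (dual_sheaf PP (TT k1 k2 k3)) U)"
    have U: "opn U" using oU by (simp add: PP_simps)
    obtain x1 where x1: "x1 \<in> carrier (?T' U)" "y1 = dual_of k1 k2 k3 U x1" by (rule I.\<Phi>_surj[OF oU y(1)])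
    obtain x2 where x2: "x2 \<in> carrier (?T' U)" "y2 = dual_of k1 k2 k3 U x2" by (rule I.\<Phi>_surj[OF oU y(2)])
    obtain x3 where x3: "x3 \<in> carrier (?T' U)" "y3 = dual_of k1 k2 k3 U x3" by (rule I.\<Phi>_surj[OF oU y(3)])
    have UU: "U \<in> opens PP U" using oU by simp
    have dv: "dual_of k1 k2 k3 U x U u = pair3 U x u" if "u \<in> carrier (?T U)" for x u
      unfolding dual_of_def restrict_apply'[OF UU] restrict_apply'[OF that] ..
    show "\<alpha> U (wedge_over PP (TT k1 k2 k3) U u1 u2 u3) \<otimes>\<^bsub>str PP U\<^esub> \<beta> U (wedge_over PP (dual_sheaf PP (TT k1 k2 k3)) U y1 y2 y3)
            = det3 (str PP U) (\<lambda>i j. ([y1, y2, y3] ! j) U ([u1, u2, u3] ! i))"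
      unfolding \<alpha>[OF U u] x1(2) x2(2) x3(2) \<beta>(2)[rule_format, OF oU x1(1) x2(1) x3(1)] det3_D3 PP_simps(3)
        dform_pairing[OF U k c u x1(1) x2(1) x3(1)]
      by (simp add: dv u numeral_2_eq_2)
  qed
qed

text \<open>The dual orientation is defined by choice; all that is used of it are the following two
  properties.\<close>

lemma dual_det_properties:
  fixes \<alpha> :: "(('v::finite, 'a::comm_ring_1) mpoly set, _, _) det_form"
  assumes k: "k1 + k2 + k3 = 0" and c: "c0 * d0 = 1"
    and \<alpha>: "\<And>U u v w. opn U \<Longrightarrow> u \<in> carrier (sections (TT k1 k2 k3) U) \<Longrightarrow> v \<in> carrier (sections (TT k1 k2 k3) U) \<Longrightarrow>
       w \<in> carrier (sections (TT k1 k2 k3) U) \<Longrightarrow>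
       \<alpha> U (wedge_over PP (TT k1 k2 k3) U u v w) = sec_mult homog U (sec_of homog U (Const c0)) (dform U u v w)"
  shows "det_iso PP (dual_sheaf PP (TT k1 k2 k3)) (dual_det PP (TT k1 k2 k3) \<alpha>)"
    "opn U \<Longrightarrow> u1 \<in> carrier (sections (TT k1 k2 k3) U) \<Longrightarrow> u2 \<in> carrier (sections (TT k1 k2 k3) U) \<Longrightarrow> u3 \<in> carrier (sections (TT k1 k2 k3) U) \<Longrightarrow>
       x1 \<in> carrier (sections (dual_sheaf PP (TT k1 k2 k3)) U) \<Longrightarrow> x2 \<in> carrier (sections (dual_sheaf PP (TT k1 k2 k3)) U) \<Longrightarrow>
       x3 \<in> carrier (sections (dual_sheaf PP (TT k1 k2 k3)) U) \<Longrightarrow>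
       \<alpha> U (wedge_over PP (TT k1 k2 k3) U u1 u2 u3) \<otimes>\<^bsub>str PP U\<^esub> dual_det PP (TT k1 k2 k3) \<alpha> U (wedge_over PP (dual_sheaf PP (TT k1 k2 k3)) U x1 x2 x3)
            = det3 (str PP U) (\<lambda>i j. ([x1, x2, x3] ! j) U ([u1, u2, u3] ! i))"
proof -
  have ex: "\<exists>\<beta>. det_iso PP (dual_sheaf PP (TT k1 k2 k3)) \<beta> \<and>
     (\<forall>U. openin (space PP) U \<longrightarrow>
       (\<forall>u1\<in>carrier (sections (TT k1 k2 k3) U). \<forall>u2\<in>carrier (sections (TT k1 k2 k3) U). \<forall>u3\<in>carrier (sections (TT k1 k2 k3) U).
        \<forall>x1\<in>carrier (sections (dual_sheaf PP (TT k1 k2 k3)) U). \<forall>x2\<in>carrier (sections (dual_sheaf PP (TT k1 k2 k3)) U).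
        \<forall>x3\<in>carrier (sections (dual_sheaf PP (TT k1 k2 k3)) U).
          \<alpha> U (wedge_over PP (TT k1 k2 k3) U u1 u2 u3) \<otimes>\<^bsub>str PP U\<^esub> \<beta> U (wedge_over PP (dual_sheaf PP (TT k1 k2 k3)) U x1 x2 x3)
            = det3 (str PP U) (\<lambda>i j. ([x1, x2, x3] ! j) U ([u1, u2, u3] ! i))))"
    by (rule exists_dual_det[OF k c], rule \<alpha>, assumption+)
  note ex = someI_ex[OF ex, folded dual_det_def]
  show "det_iso PP (dual_sheaf PP (TT k1 k2 k3)) (dual_det PP (TT k1 k2 k3) \<alpha>)" by (rule ex[THEN conjunct1])
  show "\<alpha> U (wedge_over PP (TT k1 k2 k3) U u1 u2 u3) \<otimes>\<^bsub>str PP U\<^esub> dual_det PP (TT k1 k2 k3) \<alpha> U (wedge_over PP (dual_sheaf PP (TT k1 k2 k3)) U x1 x2 x3)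
            = det3 (str PP U) (\<lambda>i j. ([x1, x2, x3] ! j) U ([u1, u2, u3] ! i))"
    if U: "opn U" and a: "u1 \<in> carrier (sections (TT k1 k2 k3) U)" "u2 \<in> carrier (sections (TT k1 k2 k3) U)" "u3 \<in> carrier (sections (TT k1 k2 k3) U)"
       "x1 \<in> carrier (sections (dual_sheaf PP (TT k1 k2 k3)) U)" "x2 \<in> carrier (sections (dual_sheaf PP (TT k1 k2 k3)) U)"
       "x3 \<in> carrier (sections (dual_sheaf PP (TT k1 k2 k3)) U)"
    using U by (intro ex[THEN conjunct2, rule_format, OF _ a]) (simp add: PP_simps)
qed

section \<open>The two vector products\<close>

lemma sec_of_arith:
  assumes U: "opn U"
  shows "sec_add homog U (sec_of homog U f) (sec_of homog U g) = sec_of homog U (f + g)"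
    "sec_mult homog U (sec_of homog U f) (sec_of homog U g) = sec_of homog U (f * g)"
proof -
  have "sec_add homog U (sec_of homog U f) (sec_of homog U g) P = sec_of homog U (f + g) P \<and>
     sec_mult homog U (sec_of homog U f) (sec_of homog U g) P = sec_of homog U (f * g) P" if P: "P \<in> U" for P
  proof -
    interpret mult_set "dn P" by (rule mult_set_denoms[OF op_subset_Proj[OF U P]])
    show ?thesis using P by (simp add: fraction_add fraction_mult)
  qed
  then show "sec_add homog U (sec_of homog U f) (sec_of homog U g) = sec_of homog U (f + g)"
    "sec_mult homog U (sec_of homog U f) (sec_of homog U g) = sec_of homog U (f * g)"
    by (auto intro!: tw_eqI[of _ U])
qed

lemma res_dual_of: "V \<subseteq> U \<Longrightarrow> res (dual_sheaf PP M) V (dual_of k1 k2 k3 U x) = dual_of k1 k2 k3 V x"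
  by (auto simp: dual_simps dual_of_def opens_PP fun_eq_iff restrict_def)

lemma dual_of_restrict: "dual_of k1 k2 k3 V (res (TT l1 l2 l3) V x) = dual_of k1 k2 k3 V x"
proof -
  have "sec_mult homog W (restrict \<sigma> V) \<tau> = sec_mult homog W \<sigma> \<tau>" if "W \<subseteq> V" for W \<sigma> \<tau>
    unfolding sec_mult_def by (rule restrict_ext) (use that in auto)
  then have "pair3 W (res (TT l1 l2 l3) V x) w = pair3 W x w" if "W \<subseteq> V" for W w
    using that by (cases x, cases w) (simp add: pair3_def TT_simps)
  then show ?thesis unfolding dual_of_def by (intro restrict_ext) (simp add: opens_PP)
qed

lemma dual_of_apply:
  "V \<in> opens PP U \<Longrightarrow> w \<in> carrier (sections (TT k1 k2 k3) V) \<Longrightarrow> dual_of k1 k2 k3 U x V w = pair3 V x w"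
  by (simp add: dual_of_def)

context
  fixes \<alpha> :: "(('v::finite, 'a::comm_ring_1) mpoly set, ('v, 'a) mpoly sect,
      ('v, 'a) mpoly sect \<times> ('v, 'a) mpoly sect \<times> ('v, 'a) mpoly sect) det_form"
    and k1 k2 k3 :: int and c0 d0 :: 'a
  assumes k: "k1 + k2 + k3 = 0" and c: "c0 * d0 = 1"
    and \<alpha>: "\<And>U u v w. opn U \<Longrightarrow> u \<in> carrier (sections (TT k1 k2 k3) U) \<Longrightarrow> v \<in> carrier (sections (TT k1 k2 k3) U) \<Longrightarrow>
       w \<in> carrier (sections (TT k1 k2 k3) U) \<Longrightarrow>
       \<alpha> U (wedge_over PP (TT k1 k2 k3) U u v w) = sec_mult homog U (sec_of homog U (Const c0)) (dform U u v w)"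
begin

lemma det_iso_dual_det: "det_iso PP (dual_sheaf PP (TT k1 k2 k3)) (dual_det PP (TT k1 k2 k3) \<alpha>)"
  by (rule dual_det_properties(1)[OF k c], rule \<alpha>, assumption+)

lemma dual_det_value:
  assumes "opn U" "u1 \<in> carrier (sections (TT k1 k2 k3) U)" "u2 \<in> carrier (sections (TT k1 k2 k3) U)"
    "u3 \<in> carrier (sections (TT k1 k2 k3) U)" "x1 \<in> carrier (sections (dual_sheaf PP (TT k1 k2 k3)) U)"
    "x2 \<in> carrier (sections (dual_sheaf PP (TT k1 k2 k3)) U)" "x3 \<in> carrier (sections (dual_sheaf PP (TT k1 k2 k3)) U)"
  shows "\<alpha> U (wedge_over PP (TT k1 k2 k3) U u1 u2 u3) \<otimes>\<^bsub>str PP U\<^esub> dual_det PP (TT k1 k2 k3) \<alpha> U (wedge_over PP (dual_sheaf PP (TT k1 k2 k3)) U x1 x2 x3)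
            = det3 (str PP U) (\<lambda>i j. ([x1, x2, x3] ! j) U ([u1, u2, u3] ! i))"
  by (rule dual_det_properties(2)[OF k c]) (rule \<alpha>, assumption+, rule assms(1), rule assms(2), rule assms(3), rule assms(4), rule assms(5), rule assms(6), rule assms(7))

lemma dual_det_closed:
  assumes "opn U" "x1 \<in> carrier (sections (dual_sheaf PP (TT k1 k2 k3)) U)"
    "x2 \<in> carrier (sections (dual_sheaf PP (TT k1 k2 k3)) U)" "x3 \<in> carrier (sections (dual_sheaf PP (TT k1 k2 k3)) U)"
  shows "dual_det PP (TT k1 k2 k3) \<alpha> U (wedge_over PP (dual_sheaf PP (TT k1 k2 k3)) U x1 x2 x3) \<in> carrier (str PP U)"
proof -
  interpret I: presheaf_iso "PP :: (('v, 'a) mpoly set, _) ringed_space" "TT (- k1) (- k2) (- k3)"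
    "dual_sheaf PP (TT k1 k2 k3)" "dual_of k1 k2 k3" by (rule presheaf_iso_dual)
  have oU: "openin (space PP) U" using assms(1) by (simp add: PP_simps)
  have "wedge_over PP (dual_sheaf PP (TT k1 k2 k3)) U x1 x2 x3 \<in> carrier (ext3 (str PP U) (sections (dual_sheaf PP (TT k1 k2 k3)) U))"
    unfolding wedge_over_def
    by (rule ext3_module.wedge_ext3[OF presheaf_of_modules.ext3_module_sections[OF I.presheaf_N oU] assms(2-4)])
  from hom_in_carrier[OF det_isoD(1)[OF det_iso_dual_det oU] this] show ?thesis by simp
qed

text \<open>In the pairing identity for a chart basis, two columns of the matrix are concentrated in the
  last row, so its determinant is zero, while the orientation of the chart basis is the unit \<open>c0\<close>.\<close>

lemma dual_det_third_summand_on_chart: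
  assumes V: "opn V" "V \<subseteq> D (Xvar i)" and h: "h1 \<in> tw (- k3) V" "h2 \<in> tw (- k3) V"
    and z: "z \<in> carrier (sections (dual_sheaf PP (TT k1 k2 k3)) V)"
  shows "dual_det PP (TT k1 k2 k3) \<alpha> V (wedge_over PP (dual_sheaf PP (TT k1 k2 k3)) V
      (dual_of k1 k2 k3 V (zero_sec V, zero_sec V, h1)) (dual_of k1 k2 k3 V (zero_sec V, zero_sec V, h2)) z) = sec_of homog V 0"
    (is "?b = _")
proof -
  let ?T = "sections (TT k1 k2 k3) V"
  let ?e1 = "(xpow i k1 V, zero_sec V, zero_sec V)" and ?e2 = "(zero_sec V, xpow i k2 V, zero_sec V)" and ?e3 = "(zero_sec V, zero_sec V, xpow i k3 V)"
  let ?x1 = "dual_of k1 k2 k3 V (zero_sec V, zero_sec V, h1)" and ?x2 = "dual_of k1 k2 k3 V (zero_sec V, zero_sec V, h2)"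
  interpret S: cring "str PP V" by (rule cring_PP[OF V(1)])
  have VV: "V \<in> opens PP V" using V(1) unfolding opens_PP by simp
  have e: "?e1 \<in> carrier ?T" "?e2 \<in> carrier ?T" "?e3 \<in> carrier ?T"
    by (simp_all add: TT_simps xpow_tw[OF V] zero_sec_closed[OF V(1)])
  have x: "?x1 \<in> carrier (sections (dual_sheaf PP (TT k1 k2 k3)) V)" "?x2 \<in> carrier (sections (dual_sheaf PP (TT k1 k2 k3)) V)"
    by (rule dual_of_closed[OF V(1)], simp add: TT_simps h zero_sec_closed[OF V(1)])+
  have b: "?b \<in> carrier (str PP V)" by (rule dual_det_closed[OF V(1) x z])
  have v: "?x1 V w \<in> carrier (str PP V)" "?x2 V w \<in> carrier (str PP V)" "z V w \<in> carrier (str PP V)"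
    if w: "w \<in> carrier ?T" for w
    unfolding PP_simps by (rule dualD(1)[OF _ VV w], fact)+
  have van: "pair3 V (zero_sec V, zero_sec V, h) ?e1 = zero_sec V" "pair3 V (zero_sec V, zero_sec V, h) ?e2 = zero_sec V" if h: "h \<in> tw (- k3) V" for h
  proof -
    have "pair3 V (zero_sec V, zero_sec V, h) ?e1 P = zero_sec V P \<and> pair3 V (zero_sec V, zero_sec V, h) ?e2 P = zero_sec V P" if P: "P \<in> V" for P
    proof -
      interpret L: cring "LL P" by (rule LL_cring_U[OF V(1) P])
      show ?thesis
        using P tw_value[OF V(1) h P] tw_value[OF V(1) xpow_tw[OF V] P] by (simp add: pair3_value zero_sec_value)
    qed
    then show "pair3 V (zero_sec V, zero_sec V, h) ?e1 = zero_sec V" "pair3 V (zero_sec V, zero_sec V, h) ?e2 = zero_sec V"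
      by - (rule tw_eqI[of _ V]; simp add: zero_sec_def)+
  qed
  have z12: "?x1 V ?e1 = \<zero>\<^bsub>str PP V\<^esub>" "?x1 V ?e2 = \<zero>\<^bsub>str PP V\<^esub>" "?x2 V ?e1 = \<zero>\<^bsub>str PP V\<^esub>" "?x2 V ?e2 = \<zero>\<^bsub>str PP V\<^esub>"
    unfolding dual_of_apply[OF VV e(1)] dual_of_apply[OF VV e(2)] van[OF h(1)] van[OF h(2)] by (simp_all add: PP_simps zero_sec_def)
  let ?C = "\<alpha> V (wedge_over PP (TT k1 k2 k3) V ?e1 ?e2 ?e3)"
  have "?C \<otimes>\<^bsub>str PP V\<^esub> ?b = det3 (str PP V) (\<lambda>i j. ([?x1, ?x2, z] ! j) V ([?e1, ?e2, ?e3] ! i))"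
    by (rule dual_det_value[OF V(1) e x z])
  also have "\<dots> = D3 (str PP V) (?x1 V ?e1) (?x2 V ?e1) (z V ?e1) (?x1 V ?e2) (?x2 V ?e2) (z V ?e2) (?x1 V ?e3) (?x2 V ?e3) (z V ?e3)"
    by (simp add: det3_D3 numeral_2_eq_2)
  also have "\<dots> = \<zero>\<^bsub>str PP V\<^esub>"
    unfolding z12 D3_def using v[OF e(1)] v[OF e(2)] v[OF e(3)] by (simp add: S.minus_eq)
  finally have Cb: "?C \<otimes>\<^bsub>str PP V\<^esub> ?b = \<zero>\<^bsub>str PP V\<^esub>" .
  have C: "?C = sec_of homog V (Const c0)"
    unfolding \<alpha>[OF V(1) e] dform_chart_basis[OF V k] sec_of_arith(2)[OF V(1)] by simp
  have Cc: "sec_of homog V (Const c0) \<in> carrier (str PP V)" "sec_of homog V (Const d0) \<in> carrier (str PP V)"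
    unfolding PP_simps by (rule sec_Const_closed[OF V(1)])+
  have DC: "sec_of homog V (Const d0) \<otimes>\<^bsub>str PP V\<^esub> sec_of homog V (Const c0) = \<one>\<^bsub>str PP V\<^esub>"
    unfolding PP_simps sec_of_arith(2)[OF V(1)] Const_simps(4)[symmetric] mult.commute[of d0] c Const_simps ..
  have "?b = (sec_of homog V (Const d0) \<otimes>\<^bsub>str PP V\<^esub> sec_of homog V (Const c0)) \<otimes>\<^bsub>str PP V\<^esub> ?b"
    unfolding DC using b by simp
  also have "\<dots> = sec_of homog V (Const d0) \<otimes>\<^bsub>str PP V\<^esub> (?C \<otimes>\<^bsub>str PP V\<^esub> ?b)"
    unfolding C by (rule S.m_assoc[OF Cc(2,1) b])
  finally show ?thesis using S.r_null[OF Cc(2)] unfolding Cb PP_simps(6) by (rule trans)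
qed

lemma dual_det_third_summand:
  assumes U: "opn U" and h: "h1 \<in> tw (- k3) U" "h2 \<in> tw (- k3) U"
    and z: "z \<in> carrier (sections (dual_sheaf PP (TT k1 k2 k3)) U)"
  shows "dual_det PP (TT k1 k2 k3) \<alpha> U (wedge_over PP (dual_sheaf PP (TT k1 k2 k3)) U
      (dual_of k1 k2 k3 U (zero_sec U, zero_sec U, h1)) (dual_of k1 k2 k3 U (zero_sec U, zero_sec U, h2)) z) = sec_of homog U 0"
    (is "?b = _")
proof (rule tw_eqI[OF tw_extensional sec_ext(3)])
  interpret I: presheaf_iso "PP :: (('v, 'a) mpoly set, _) ringed_space" "TT (- k1) (- k2) (- k3)"
    "dual_sheaf PP (TT k1 k2 k3)" "dual_of k1 k2 k3" by (rule presheaf_iso_dual)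
  let ?D = "dual_sheaf PP (TT k1 k2 k3)"
  let ?x = "\<lambda>U h. dual_of k1 k2 k3 U (zero_sec U, zero_sec U, h)"
  have oU: "openin (space PP) U" using U by (simp add: PP_simps)
  have x: "?x U h \<in> carrier (sections ?D U)" if "h \<in> tw (- k3) U" for h
    by (rule dual_of_closed[OF U]) (simp add: TT_simps that zero_sec_closed[OF U])
  show "?b \<in> tw 0 U" using dual_det_closed[OF U x[OF h(1)] x[OF h(2)] z] unfolding PP_simps .
  fix P assume P: "P \<in> U"
  obtain i where i: "opn (U \<inter> D (Xvar i))" "P \<in> U \<inter> D (Xvar i)" by (rule chart_neighbourhood[OF U P])
  let ?V = "U \<inter> D (Xvar i)"
  have Vo: "?V \<in> opens PP U" unfolding opens_PP using i(1) by simp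
  have hV: "restrict h1 ?V \<in> tw (- k3) ?V" "restrict h2 ?V \<in> tw (- k3) ?V"
    by (rule tw_restrict[OF U i(1) Int_lower1 h(1)], rule tw_restrict[OF U i(1) Int_lower1 h(2)])
  have r: "res ?D ?V (?x U h) = ?x ?V (restrict h ?V)" for h
    unfolding res_dual_of[OF Int_lower1]
    by (subst dual_of_restrict[of _ _ _ _ "- k1" "- k2" "- k3", symmetric]) (simp add: TT_simps zero_sec_restrict)
  have zV: "res ?D ?V z \<in> carrier (sections ?D ?V)"
    by (rule semilinearD(1)[OF presheaf_of_modules.res_semilinear[OF I.presheaf_N oU Vo] z])
  have "?b P = restrict ?b ?V P" using i(2) by simp
  also have "restrict ?b ?V = sec_of homog ?V 0"
    using presheaf_of_modules.det_iso_restrict[OF I.presheaf_N det_iso_dual_det oU Vo x[OF h(1)] x[OF h(2)] z]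
    unfolding r dual_det_third_summand_on_chart[OF i(1) Int_lower2 hV zV] PP_simps .
  finally show "?b P = sec_of homog U 0 P" using i(2) by simp
qed

text \<open>This is the uniqueness behind the definite description of the vector product of two forms.\<close>

lemma section_zero_if_forms_vanish:
  assumes U: "opn U" and w: "w \<in> carrier (sections (TT k1 k2 k3) U)"
    and van: "\<And>V z. V \<in> opens PP U \<Longrightarrow> z \<in> carrier (sections (dual_sheaf PP (TT k1 k2 k3)) V) \<Longrightarrow>
        z V (res (TT k1 k2 k3) V w) = sec_of homog V 0"
  shows "w = (zero_sec U, zero_sec U, zero_sec U)"
proof -
  obtain w1 w2 w3 where w': "w = (w1, w2, w3)" "w1 \<in> tw k1 U" "w2 \<in> tw k2 U" "w3 \<in> tw k3 U" by (rule TT_cases[OF w])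
  have "w1 P = zero_sec U P \<and> w2 P = zero_sec U P \<and> w3 P = zero_sec U P" if P: "P \<in> U" for P
  proof -
    obtain i where i: "opn (U \<inter> D (Xvar i))" "P \<in> U \<inter> D (Xvar i)" by (rule chart_neighbourhood[OF U P])
    let ?V = "U \<inter> D (Xvar i)"
    interpret L: cring "LL P" by (rule LL_cring_U[OF U P])
    have Vo: "?V \<in> opens PP U" "?V \<in> opens PP ?V" unfolding opens_PP using i(1) by simp_all
    let ?w = "(restrict w1 ?V, restrict w2 ?V, restrict w3 ?V)"
    have wV: "?w \<in> carrier (sections (TT k1 k2 k3) ?V)"
      using TT_res_closed[OF U i(1) Int_lower1 w] by (simp add: w'(1) TT_simps)
    have p: "pair3 ?V x ?w P = \<zero>\<^bsub>LL P\<^esub>" if x: "x \<in> carrier (sections (TT (- k1) (- k2) (- k3)) ?V)" for x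
    proof -
      have "pair3 ?V x ?w = dual_of k1 k2 k3 ?V x ?V (res (TT k1 k2 k3) ?V w)"
        using dual_of_apply[OF Vo(2) wV, of x] by (simp add: w'(1) TT_simps)
      also have "\<dots> = sec_of homog ?V 0" by (rule van[OF Vo(1) dual_of_closed[OF i(1) x]])
      finally show ?thesis using i(2) by (simp add: LL_zero)
    qed
    have v: "restrict w1 ?V P \<in> carrier (LL P)" "restrict w2 ?V P \<in> carrier (LL P)" "restrict w3 ?V P \<in> carrier (LL P)"
      using w'(2-4)[THEN tw_value[OF U _ P]] i(2) by simp_all
    note b = pair3_chart_basis(4-6)[where V = ?V and i = i and P = P and ?x1.0 = "restrict w1 ?V" and ?x2.0 = "restrict w2 ?V"
        and ?x3.0 = "restrict w3 ?V", OF i(1) Int_lower2 i(2) v]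
    have e: "(xpow i (- k1) ?V, zero_sec ?V, zero_sec ?V) \<in> carrier (sections (TT (- k1) (- k2) (- k3)) ?V)"
      "(zero_sec ?V, xpow i (- k2) ?V, zero_sec ?V) \<in> carrier (sections (TT (- k1) (- k2) (- k3)) ?V)"
      "(zero_sec ?V, zero_sec ?V, xpow i (- k3) ?V) \<in> carrier (sections (TT (- k1) (- k2) (- k3)) ?V)"
      by (simp_all add: TT_simps xpow_tw[OF i(1) Int_lower2] zero_sec_closed[OF i(1)])
    have xc: "xpow i j ?V P \<in> carrier (LL P)" for j by (rule tw_value[OF i(1) xpow_tw[OF i(1) Int_lower2] i(2)])
    have "\<zero>\<^bsub>LL P\<^esub> = restrict w1 ?V P" using b(1)[of "- k1"] unfolding p[OF e(1)] L.l_null[OF xc] .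
    moreover have "\<zero>\<^bsub>LL P\<^esub> = restrict w2 ?V P" using b(2)[of "- k2"] unfolding p[OF e(2)] L.l_null[OF xc] .
    moreover have "\<zero>\<^bsub>LL P\<^esub> = restrict w3 ?V P" using b(3)[of "- k3"] unfolding p[OF e(3)] L.l_null[OF xc] .
    ultimately show ?thesis using i(2) by (simp add: zero_sec_value[OF P])
  qed
  then have "w1 = zero_sec U" "w2 = zero_sec U" "w3 = zero_sec U"
    by - (rule tw_eqI[OF tw_extensional[OF w'(2)]], simp add: zero_sec_def, simp,
      rule tw_eqI[OF tw_extensional[OF w'(3)]], simp add: zero_sec_def, simp,
      rule tw_eqI[OF tw_extensional[OF w'(4)]], simp add: zero_sec_def, simp)
  then show ?thesis unfolding w'(1) by simp
qed

lemma sheaf_dual_cross_third_summand: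
  assumes U: "opn U" and h: "h1 \<in> tw (- k3) U" "h2 \<in> tw (- k3) U"
  shows "sheaf_dual_cross PP (TT k1 k2 k3) \<alpha> U (dual_of k1 k2 k3 U (zero_sec U, zero_sec U, h1)) (dual_of k1 k2 k3 U (zero_sec U, zero_sec U, h2))
     = (zero_sec U, zero_sec U, zero_sec U)"
  unfolding sheaf_dual_cross_def
proof (rule the_equality)
  let ?T = "sections (TT k1 k2 k3)"
  have rhs: "dual_det PP (TT k1 k2 k3) \<alpha> V (wedge_over PP (dual_sheaf PP (TT k1 k2 k3)) V
          (res (dual_sheaf PP (TT k1 k2 k3)) V (dual_of k1 k2 k3 U (zero_sec U, zero_sec U, h1)))
          (res (dual_sheaf PP (TT k1 k2 k3)) V (dual_of k1 k2 k3 U (zero_sec U, zero_sec U, h2))) z) = sec_of homog V 0"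
    if V: "V \<in> opens PP U" and z: "z \<in> carrier (sections (dual_sheaf PP (TT k1 k2 k3)) V)" for V z
  proof -
    have V': "opn V" "V \<subseteq> U" using V unfolding opens_PP by simp_all
    have r: "res (dual_sheaf PP (TT k1 k2 k3)) V (dual_of k1 k2 k3 U (zero_sec U, zero_sec U, h)) = dual_of k1 k2 k3 V (zero_sec V, zero_sec V, restrict h V)" for h
      unfolding res_dual_of[OF V'(2)]
      by (subst dual_of_restrict[of _ _ _ _ "- k1" "- k2" "- k3", symmetric]) (simp add: TT_simps zero_sec_restrict V')
    show ?thesis unfolding r
      by (rule dual_det_third_summand[OF V'(1) tw_restrict[OF U V' h(1)] tw_restrict[OF U V' h(2)] z])
  qed
  have zT: "(zero_sec V, zero_sec V, zero_sec V) \<in> carrier (?T V)" if "opn V" for V by (simp add: TT_simps zero_sec_closed[OF that])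
  have zero: "z V (res (TT k1 k2 k3) V (zero_sec U, zero_sec U, zero_sec U)) = sec_of homog V 0"
    if V: "V \<in> opens PP U" and z: "z \<in> carrier (sections (dual_sheaf PP (TT k1 k2 k3)) V)" for V z
  proof -
    have V': "opn V" "V \<subseteq> U" using V unfolding opens_PP by simp_all
    have VV: "V \<in> opens PP V" unfolding opens_PP using V' by simp
    have e: "res (TT k1 k2 k3) V (zero_sec U, zero_sec U, zero_sec U) = sec_of homog V 0 \<odot>\<^bsub>?T V\<^esub> (zero_sec V, zero_sec V, zero_sec V)"
      by (simp add: TT_simps zero_sec_restrict[OF V'(2)] sec_units(3)[OF V'(1) zero_sec_closed[OF V'(1)]]) (simp add: zero_sec_def)
    show ?thesis unfolding e dualD(3)[OF z VV zT[OF V'(1)] sec_zero_closed[OF V'(1)]]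
      by (rule sec_units(3)[OF V'(1) dualD(1)[OF z VV zT[OF V'(1)]]])
  qed
  show "(zero_sec U, zero_sec U, zero_sec U) \<in> carrier (?T U) \<and> (\<forall>V\<in>opens PP U. \<forall>z\<in>carrier (sections (dual_sheaf PP (TT k1 k2 k3)) V).
        z V (res (TT k1 k2 k3) V (zero_sec U, zero_sec U, zero_sec U)) = dual_det PP (TT k1 k2 k3) \<alpha> V (wedge_over PP (dual_sheaf PP (TT k1 k2 k3)) V
          (res (dual_sheaf PP (TT k1 k2 k3)) V (dual_of k1 k2 k3 U (zero_sec U, zero_sec U, h1)))
          (res (dual_sheaf PP (TT k1 k2 k3)) V (dual_of k1 k2 k3 U (zero_sec U, zero_sec U, h2))) z))"
    by (intro conjI ballI zT[OF U]) (simp only: zero rhs)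
  fix w
  assume w: "w \<in> carrier (?T U) \<and> (\<forall>V\<in>opens PP U. \<forall>z\<in>carrier (sections (dual_sheaf PP (TT k1 k2 k3)) V).
        z V (res (TT k1 k2 k3) V w) = dual_det PP (TT k1 k2 k3) \<alpha> V (wedge_over PP (dual_sheaf PP (TT k1 k2 k3)) V
          (res (dual_sheaf PP (TT k1 k2 k3)) V (dual_of k1 k2 k3 U (zero_sec U, zero_sec U, h1)))
          (res (dual_sheaf PP (TT k1 k2 k3)) V (dual_of k1 k2 k3 U (zero_sec U, zero_sec U, h2))) z))"
  show "w = (zero_sec U, zero_sec U, zero_sec U)"
  proof (rule section_zero_if_forms_vanish[OF U])
    show "w \<in> carrier (?T U)" using w by (rule conjunct1)
    fix V z assume "V \<in> opens PP U" "z \<in> carrier (sections (dual_sheaf PP (TT k1 k2 k3)) V)"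
    then show "z V (res (TT k1 k2 k3) V w) = sec_of homog V 0"
      using w[THEN conjunct2, rule_format] rhs by simp
  qed
qed

text \<open>A determinant with rows \<open>(f1, g1, 0)\<close>, \<open>(f2, g2, 0)\<close> and \<open>w\<close> only involves the last entry of \<open>w\<close>.\<close>

lemma sheaf_cross_first_summands:
  assumes U: "opn U" and f: "f1 \<in> homog l" "f2 \<in> homog l" and g: "g1 \<in> homog m" "g2 \<in> homog m"
    and kk: "k1 = int l" "k2 = int m"
  shows "sheaf_cross PP (TT k1 k2 k3) \<alpha> U (sec_of homog U f1, sec_of homog U g1, zero_sec U) (sec_of homog U f2, sec_of homog U g2, zero_sec U)
     = dual_of k1 k2 k3 U (zero_sec U, zero_sec U, sec_of homog U (Const c0 * (f1 * g2 - g1 * f2)))"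
  unfolding sheaf_cross_def dual_of_def
proof (rule restrict_ext, rule restrict_ext)
  fix V w assume V: "V \<in> opens PP U" and w: "w \<in> carrier (sections (TT k1 k2 k3) V)"
  have V': "opn V" "V \<subseteq> U" using V unfolding opens_PP by simp_all
  obtain w1 w2 w3 where w': "w = (w1, w2, w3)" "w1 \<in> tw k1 V" "w2 \<in> tw k2 V" "w3 \<in> tw k3 V" by (rule TT_cases[OF w])
  have r: "res (TT k1 k2 k3) V (sec_of homog U f, sec_of homog U g, zero_sec U) = (sec_of homog V f, sec_of homog V g, zero_sec V)" for f g
    by (simp add: TT_simps zero_sec_restrict[OF V'(2)] sec_restrict(3)[OF V'(2)])
  have T: "(sec_of homog V f, sec_of homog V g, zero_sec V) \<in> carrier (sections (TT k1 k2 k3) V)" if "f \<in> homog l" "g \<in> homog m" for f g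
    by (simp add: TT_simps kk sec_of_closed[OF V'(1) that(1)] sec_of_closed[OF V'(1) that(2)] zero_sec_closed[OF V'(1)])
  have "sec_mult homog V (sec_of homog V (Const c0)) (dform V (sec_of homog V f1, sec_of homog V g1, zero_sec V) (sec_of homog V f2, sec_of homog V g2, zero_sec V) w) P
      = pair3 V (zero_sec U, zero_sec U, sec_of homog U (Const c0 * (f1 * g2 - g1 * f2))) w P" if P: "P \<in> V" for P
  proof -
    interpret L: cring "LL P" by (rule LL_cring_U[OF V'(1) P])
    interpret mult_set "dn P" by (rule mult_set_denoms[OF op_subset_Proj[OF V'(1) P]])
    note wv = w'(2-4)[THEN tw_value[OF V'(1) _ P]]
    have PU: "P \<in> U" using P V'(2) by blast
    let ?F = "\<lambda>f. fraction (dn P) f 1"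
    have d: "?F f1 \<otimes>\<^bsub>LL P\<^esub> ?F g2 \<ominus>\<^bsub>LL P\<^esub> ?F g1 \<otimes>\<^bsub>LL P\<^esub> ?F f2 = ?F (f1 * g2 - g1 * f2)"
      by (simp add: L.minus_eq fraction_mult fraction_uminus fraction_add)
    have F: "?F f \<in> carrier (LL P)" for f by simp
    have D: "D3 (LL P) a b \<zero>\<^bsub>LL P\<^esub> a' b' \<zero>\<^bsub>LL P\<^esub> p q s = (a \<otimes>\<^bsub>LL P\<^esub> b' \<ominus>\<^bsub>LL P\<^esub> b \<otimes>\<^bsub>LL P\<^esub> a') \<otimes>\<^bsub>LL P\<^esub> s"
      if "a \<in> carrier (LL P)" "b \<in> carrier (LL P)" "a' \<in> carrier (LL P)" "b' \<in> carrier (LL P)" "p \<in> carrier (LL P)" "q \<in> carrier (LL P)" "s \<in> carrier (LL P)"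
      for a b a' b' p q s
      unfolding D3_def using that by algebra
    have "sec_mult homog V (sec_of homog V (Const c0)) (dform V (sec_of homog V f1, sec_of homog V g1, zero_sec V) (sec_of homog V f2, sec_of homog V g2, zero_sec V) w) P
        = ?F (Const c0) \<otimes>\<^bsub>LL P\<^esub> (?F (f1 * g2 - g1 * f2) \<otimes>\<^bsub>LL P\<^esub> w3 P)"
      using P by (simp add: w'(1) dform_value zero_sec_value D[OF F F F F wv] d)
    also have "\<dots> = (?F (Const c0) \<otimes>\<^bsub>LL P\<^esub> ?F (f1 * g2 - g1 * f2)) \<otimes>\<^bsub>LL P\<^esub> w3 P" by (rule L.m_assoc[OF F F wv(3), symmetric])
    also have "?F (Const c0) \<otimes>\<^bsub>LL P\<^esub> ?F (f1 * g2 - g1 * f2) = ?F (Const c0 * (f1 * g2 - g1 * f2))" by (simp add: fraction_mult)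
    also have "\<dots> \<otimes>\<^bsub>LL P\<^esub> w3 P = pair3 V (zero_sec U, zero_sec U, sec_of homog U (Const c0 * (f1 * g2 - g1 * f2))) w P"
      using P wv F by (simp add: w'(1) pair3_value zero_sec_value[OF PU] sec_simps(3)[OF PU])
    finally show ?thesis .
  qed
  then show "\<alpha> V (wedge_over PP (TT k1 k2 k3) V (res (TT k1 k2 k3) V (sec_of homog U f1, sec_of homog U g1, zero_sec U))
      (res (TT k1 k2 k3) V (sec_of homog U f2, sec_of homog U g2, zero_sec U)) w)
     = pair3 V (zero_sec U, zero_sec U, sec_of homog U (Const c0 * (f1 * g2 - g1 * f2))) w"
    unfolding r \<alpha>[OF V'(1) T[OF f(1) g(1)] T[OF f(2) g(2)] w] by (intro tw_eqI[of _ V]) simp_all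
qed

end

section \<open>The algebra of global sections\<close>

definition lower_left :: "nat \<Rightarrow> nat \<Rightarrow> ('v::finite, 'a::comm_ring_1) mpoly \<Rightarrow>
    ('v, 'a) mpoly set set \<Rightarrow> ('v, 'a) mpoly sect \<times> ('v, 'a) mpoly sect \<times> ('v, 'a) mpoly sect \<Rightarrow> ('v, 'a) mpoly sect" where
  "lower_left l m h = dual_of (int l) (int m) (- int l - int m) (Proj homog) (zero_sec (Proj homog), zero_sec (Proj homog), sec_of homog (Proj homog) h)"

lemma C_matrix_eq:
  fixes h :: "('v::finite, 'a::comm_ring_1) mpoly"
  shows "C_matrix l m (a, f, g, h) =
    (sec_of homog (Proj homog) (Const a), (sec_of homog (Proj homog) f, sec_of homog (Proj homog) g, zero_sec (Proj homog)), lower_left l m h)"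
proof -
  let ?X = "Proj homog :: ('v, 'a) mpoly set set"
  have "sec_mult homog V (sec_of homog V h) (snd (snd w)) = pair3 V (zero_sec ?X, zero_sec ?X, sec_of homog ?X h) w"
    if V: "opn V" and w: "w \<in> carrier (sections (TT (int l) (int m) (- int l - int m)) V)" for V w
  proof -
    obtain w1 w2 w3 where w': "w = (w1, w2, w3)" "w1 \<in> tw (int l) V" "w2 \<in> tw (int m) V" "w3 \<in> tw (- int l - int m) V"
      by (rule TT_cases[OF w])
    show ?thesis
    proof (rule tw_eqI[of _ V])
      fix P assume P: "P \<in> V"
      interpret L: cring "LL P" by (rule LL_cring_U[OF V P])
      interpret mult_set "dn P" by (rule mult_set_denoms[OF op_subset_Proj[OF V P]])
      show "sec_mult homog V (sec_of homog V h) (snd (snd w)) P = pair3 V (zero_sec ?X, zero_sec ?X, sec_of homog ?X h) w P"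
        using P w'(2-4)[THEN tw_value[OF V _ P]] op_subset_Proj[OF V P]
        by (simp add: w'(1) pair3_value zero_sec_value)
    qed simp_all
  qed
  then show ?thesis
    unfolding C_matrix_def lower_left_def dual_of_def T_sheaf_def PP_simps(1) topspace_Proj zero_sec_def[symmetric] prod.case
    by (intro arg_cong2[of _ _ _ _ Pair] refl restrict_ext) (simp add: opens_PP del: restrict_apply)
qed

lemma C_alg_simps:
  "carrier (C_alg l m \<alpha>) = tw 0 (Proj homog) \<times> carrier (sections (T_sheaf l m) (Proj homog)) \<times> carrier (sections (dual_sheaf PP (T_sheaf l m)) (Proj homog))"
  "(a, u, x) \<otimes>\<^bsub>C_alg l m \<alpha>\<^esub> (b, v, y) =
     (sec_add homog (Proj homog) (sec_add homog (Proj homog) (sec_mult homog (Proj homog) a b) (y (Proj homog) u)) (x (Proj homog) v),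
      (a \<odot>\<^bsub>sections (T_sheaf l m) (Proj homog)\<^esub> v \<oplus>\<^bsub>sections (T_sheaf l m) (Proj homog)\<^esub> b \<odot>\<^bsub>sections (T_sheaf l m) (Proj homog)\<^esub> u)
        \<ominus>\<^bsub>sections (T_sheaf l m) (Proj homog)\<^esub> sheaf_dual_cross PP (T_sheaf l m) \<alpha> (Proj homog) x y,
      (b \<odot>\<^bsub>sections (dual_sheaf PP (T_sheaf l m)) (Proj homog)\<^esub> x \<oplus>\<^bsub>sections (dual_sheaf PP (T_sheaf l m)) (Proj homog)\<^esub>
         a \<odot>\<^bsub>sections (dual_sheaf PP (T_sheaf l m)) (Proj homog)\<^esub> y)
        \<oplus>\<^bsub>sections (dual_sheaf PP (T_sheaf l m)) (Proj homog)\<^esub> sheaf_cross PP (T_sheaf l m) \<alpha> (Proj homog) u v)"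
  "\<one>\<^bsub>C_alg l m \<alpha>\<^esub> = (sec_of homog (Proj homog) 1, \<zero>\<^bsub>sections (T_sheaf l m) (Proj homog)\<^esub>, \<zero>\<^bsub>sections (dual_sheaf PP (T_sheaf l m)) (Proj homog)\<^esub>)"
  "\<zero>\<^bsub>C_alg l m \<alpha>\<^esub> = (sec_of homog (Proj homog) 0, \<zero>\<^bsub>sections (T_sheaf l m) (Proj homog)\<^esub>, \<zero>\<^bsub>sections (dual_sheaf PP (T_sheaf l m)) (Proj homog)\<^esub>)"
  "(a, u, x) \<oplus>\<^bsub>C_alg l m \<alpha>\<^esub> (b, v, y) = (sec_add homog (Proj homog) a b, u \<oplus>\<^bsub>sections (T_sheaf l m) (Proj homog)\<^esub> v,
      x \<oplus>\<^bsub>sections (dual_sheaf PP (T_sheaf l m)) (Proj homog)\<^esub> y)"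
  "r \<odot>\<^bsub>C_alg l m \<alpha>\<^esub> (a, u, x) = (sec_mult homog (Proj homog) (sec_of homog (Proj homog) (Const r)) a,
      sec_of homog (Proj homog) (Const r) \<odot>\<^bsub>sections (T_sheaf l m) (Proj homog)\<^esub> u,
      sec_of homog (Proj homog) (Const r) \<odot>\<^bsub>sections (dual_sheaf PP (T_sheaf l m)) (Proj homog)\<^esub> x)"
  by (simp_all add: C_alg_def restrict_scalars_def sheaf_Col_def colour_algebra_def PP_simps)

text \<open>The multiplication of the algebra of global sections for \<open>c\<close> times the canonical orientation.\<close>

definition mat_mult :: "'a::comm_ring_1 \<Rightarrow> 'a \<times> ('v::finite, 'a) mpoly \<times> ('v, 'a) mpoly \<times> ('v, 'a) mpoly \<Rightarrow>
    'a \<times> ('v, 'a) mpoly \<times> ('v, 'a) mpoly \<times> ('v, 'a) mpoly \<Rightarrow> 'a \<times> ('v, 'a) mpoly \<times> ('v, 'a) mpoly \<times> ('v, 'a) mpoly" where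
  "mat_mult c = (\<lambda>(a, f, g, h) (b, f', g', h').
     (a * b, Const a * f' + Const b * f, Const a * g' + Const b * g, Const b * h + Const a * h' + Const c * (f * g' - g * f')))"

definition mat_alg :: "nat \<Rightarrow> nat \<Rightarrow> 'a \<Rightarrow>
    ('a::comm_ring_1, 'a \<times> ('v::finite, 'a) mpoly \<times> ('v, 'a) mpoly \<times> ('v, 'a) mpoly) module" where
  "mat_alg l m c = (matrix_space l m)\<lparr>monoid.mult := mat_mult c, one := (1, 0, 0, 0)\<rparr>"

definition algebra_iso :: "('r, 'b) module \<Rightarrow> ('r, 'c) module \<Rightarrow> ('b \<Rightarrow> 'c) \<Rightarrow> 'r ring \<Rightarrow> bool" where
  "algebra_iso A B h R \<longleftrightarrow> linear_iso R A B h \<and> h \<zero>\<^bsub>A\<^esub> = \<zero>\<^bsub>B\<^esub> \<and> h \<one>\<^bsub>A\<^esub> = \<one>\<^bsub>B\<^esub> \<and>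
     (\<forall>x\<in>carrier A. \<forall>y\<in>carrier A. h (x \<otimes>\<^bsub>A\<^esub> y) = h x \<otimes>\<^bsub>B\<^esub> h y)"

context
  fixes \<alpha> :: "('v::finite, 'a::comm_ring_1) T_form" and l m :: nat and c0 d0 :: 'a
  assumes l: "l > 0" and m: "m > 0" and c: "c0 * d0 = 1"
    and \<alpha>: "\<And>U u v w. opn U \<Longrightarrow> u \<in> carrier (sections (T_sheaf l m) U) \<Longrightarrow> v \<in> carrier (sections (T_sheaf l m) U) \<Longrightarrow>
       w \<in> carrier (sections (T_sheaf l m) U) \<Longrightarrow>
       \<alpha> U (wedge_over PP (T_sheaf l m) U u v w) = sec_mult homog U (sec_of homog U (Const c0)) (dform U u v w)"
begin

abbreviation "PX \<equiv> Proj homog :: ('v, 'a) mpoly set set"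
abbreviation "TX \<equiv> sections (T_sheaf l m) PX"
abbreviation "DX \<equiv> sections (dual_sheaf PP (T_sheaf l m)) PX"
abbreviation "third h \<equiv> (zero_sec PX, zero_sec PX, sec_of homog PX h)"

lemma third_closed: "h \<in> homog (l + m) \<Longrightarrow> third h \<in> carrier (sections (TT (- int l) (- int m) (- (- int l - int m))) PX)"
  using sec_of_closed[OF op_Proj, of h "l + m"] by (simp add: TT_simps zero_sec_closed[OF op_Proj] add.commute)

lemma lower_left_closed: "h \<in> homog (l + m) \<Longrightarrow> lower_left l m h \<in> carrier DX"
  unfolding lower_left_def T_sheaf_def by (rule dual_of_closed[OF op_Proj third_closed])

lemma lower_left_linear:
  assumes "h \<in> homog (l + m)" "h' \<in> homog (l + m)"
  shows "lower_left l m h \<oplus>\<^bsub>DX\<^esub> lower_left l m h' = lower_left l m (h + h')"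
    "sec_of homog PX (Const r) \<odot>\<^bsub>DX\<^esub> lower_left l m h = lower_left l m (Const r * h)"
proof -
  interpret I: presheaf_iso "PP :: (('v, 'a) mpoly set, _) ringed_space" "TT (- int l) (- int m) (- (- int l - int m))"
    "dual_sheaf PP (TT (int l) (int m) (- int l - int m))" "dual_of (int l) (int m) (- int l - int m)" by (rule presheaf_iso_dual)
  have oX: "openin (space PP) PX" by (simp add: PP_simps)
  have z: "zero_sec PX \<in> tw 0 PX" by (rule zero_sec_closed[OF op_Proj])
  have t: "third h \<oplus>\<^bsub>sections (TT (- int l) (- int m) (- (- int l - int m))) PX\<^esub> third h' = third (h + h')"
    by (simp add: TT_simps sec_of_arith[OF op_Proj] zero_sec_def)
  have s: "sec_of homog PX (Const r) \<odot>\<^bsub>sections (TT (- int l) (- int m) (- (- int l - int m))) PX\<^esub> third h = third (Const r * h)"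
    by (simp add: TT_simps sec_of_arith[OF op_Proj] zero_sec_def)
  have rc: "sec_of homog PX (Const r) \<in> carrier (str PP PX)" unfolding PP_simps by (rule sec_Const_closed[OF op_Proj])
  show "lower_left l m h \<oplus>\<^bsub>DX\<^esub> lower_left l m h' = lower_left l m (h + h')"
    unfolding lower_left_def T_sheaf_def t[symmetric] by (rule I.\<Phi>_add[OF oX third_closed third_closed, symmetric]; fact)
  show "sec_of homog PX (Const r) \<odot>\<^bsub>DX\<^esub> lower_left l m h = lower_left l m (Const r * h)"
    unfolding lower_left_def T_sheaf_def s[symmetric] by (rule I.\<Phi>_smult[OF oX rc third_closed, symmetric]; fact)
qed

lemma lower_left_zero: "lower_left l m 0 = \<zero>\<^bsub>DX\<^esub>"
proof -
  interpret I: presheaf_iso "PP :: (('v, 'a) mpoly set, _) ringed_space" "TT (- int l) (- int m) (- (- int l - int m))"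
    "dual_sheaf PP (TT (int l) (int m) (- int l - int m))" "dual_of (int l) (int m) (- int l - int m)" by (rule presheaf_iso_dual)
  have oX: "openin (space PP) PX" by (simp add: PP_simps)
  have "third 0 = \<zero>\<^bsub>sections (TT (- int l) (- int m) (- (- int l - int m))) PX\<^esub>" by (simp add: TT_simps zero_sec_def)
  then show "lower_left l m 0 = \<zero>\<^bsub>DX\<^esub>" unfolding lower_left_def T_sheaf_def using I.\<Phi>_zero[OF oX] by simp
qed

lemma lower_left_pairing:
  assumes "h \<in> homog (l + m)" "f \<in> homog l" "g \<in> homog m"
  shows "lower_left l m h PX (sec_of homog PX f, sec_of homog PX g, zero_sec PX) = sec_of homog PX 0"
proof -
  have XX: "PX \<in> opens PP PX" unfolding opens_PP by simp
  have T: "(sec_of homog PX f, sec_of homog PX g, zero_sec PX) \<in> carrier (sections (TT (int l) (int m) (- int l - int m)) PX)"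
    by (simp add: TT_simps sec_of_closed[OF op_Proj assms(2)] sec_of_closed[OF op_Proj assms(3)] zero_sec_closed[OF op_Proj])
  show ?thesis
    unfolding lower_left_def dual_of_apply[OF XX T]
    by (simp add: pair3_def zero_sec_def sec_of_arith[OF op_Proj])
qed

lemma C_matrix_closed: "f \<in> homog l \<Longrightarrow> g \<in> homog m \<Longrightarrow> h \<in> homog (l + m) \<Longrightarrow> C_matrix l m (a, f, g, h) \<in> carrier (C_alg l m \<alpha>)"
  by (simp add: C_matrix_eq C_alg_simps lower_left_closed sec_Const_closed)
    (simp add: T_sheaf_def TT_simps zero_sec_closed sec_of_closed)

lemma C_matrix_linear:
  assumes "f \<in> homog l" "g \<in> homog m" "h \<in> homog (l + m)" "f' \<in> homog l" "g' \<in> homog m" "h' \<in> homog (l + m)"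
  shows "C_matrix l m (a, f, g, h) \<oplus>\<^bsub>C_alg l m \<alpha>\<^esub> C_matrix l m (b, f', g', h') = C_matrix l m (a + b, f + f', g + g', h + h')"
    "r \<odot>\<^bsub>C_alg l m \<alpha>\<^esub> C_matrix l m (a, f, g, h) = C_matrix l m (r * a, Const r * f, Const r * g, Const r * h)"
  unfolding C_matrix_eq C_alg_simps lower_left_linear[OF assms(3,6)]
  by (simp_all add: T_sheaf_def TT_simps sec_of_arith zero_sec_def)

lemma C_matrix_units:
  "C_matrix l m (0, 0, 0, 0) = \<zero>\<^bsub>C_alg l m \<alpha>\<^esub>" "C_matrix l m (1, 0, 0, 0) = \<one>\<^bsub>C_alg l m \<alpha>\<^esub>"
  unfolding C_matrix_eq C_alg_simps lower_left_zero
  by (simp_all add: T_sheaf_def TT_simps zero_sec_def)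

lemma C_matrix_mult:
  assumes x: "f \<in> homog l" "g \<in> homog m" "h \<in> homog (l + m)" and y: "f' \<in> homog l" "g' \<in> homog m" "h' \<in> homog (l + m)"
  shows "C_matrix l m (a, f, g, h) \<otimes>\<^bsub>C_alg l m \<alpha>\<^esub> C_matrix l m (b, f', g', h') = C_matrix l m (mat_mult c0 (a, f, g, h) (b, f', g', h'))"
proof -
  let ?k = "- int l - int m"
  have k: "int l + int m + ?k = 0" by simp
  have \<alpha>': "\<alpha> U (wedge_over PP (TT (int l) (int m) ?k) U u v w) = sec_mult homog U (sec_of homog U (Const c0)) (dform U u v w)"
    if "opn U" "u \<in> carrier (sections (TT (int l) (int m) ?k) U)" "v \<in> carrier (sections (TT (int l) (int m) ?k) U)"
      "w \<in> carrier (sections (TT (int l) (int m) ?k) U)" for U u v w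
    by (rule \<alpha>[unfolded T_sheaf_def, OF that])
  interpret T: Module.module "str PP PX" TX unfolding T_sheaf_def by (rule module_TT[OF op_Proj])
  have hc: "sec_of homog PX h \<in> tw (- ?k) PX" "sec_of homog PX h' \<in> tw (- ?k) PX"
    using sec_of_closed[OF op_Proj x(3)] sec_of_closed[OF op_Proj y(3)] by (simp_all add: add.commute)
  have dc: "sheaf_dual_cross PP (T_sheaf l m) \<alpha> PX (lower_left l m h) (lower_left l m h') = \<zero>\<^bsub>TX\<^esub>"
    unfolding lower_left_def T_sheaf_def
    by (subst sheaf_dual_cross_third_summand[OF k c _ op_Proj hc]) (rule \<alpha>', assumption+, simp add: TT_simps zero_sec_def)
  have cr: "sheaf_cross PP (T_sheaf l m) \<alpha> PX (sec_of homog PX f, sec_of homog PX g, zero_sec PX) (sec_of homog PX f', sec_of homog PX g', zero_sec PX)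
      = lower_left l m (Const c0 * (f * g' - g * f'))"
    unfolding lower_left_def T_sheaf_def
    by (rule sheaf_cross_first_summands[OF k c _ op_Proj x(1) y(1) x(2) y(2) refl refl]) (rule \<alpha>', assumption+)
  have C: "Const r * p \<in> homog d" if "p \<in> homog d" for r d and p :: "('v, 'a) mpoly" using that by (rule homog_Const_mult)
  have hm: "f * g' - g * f' \<in> homog (l + m)"
    using homog_diff[OF homog_mult[OF x(1) y(2)] homog_mult[OF y(1) x(2)]] by (simp add: mult.commute)
  have third: "(sec_of homog PX (Const b) \<odot>\<^bsub>DX\<^esub> lower_left l m h \<oplus>\<^bsub>DX\<^esub> sec_of homog PX (Const a) \<odot>\<^bsub>DX\<^esub> lower_left l m h')
      \<oplus>\<^bsub>DX\<^esub> lower_left l m (Const c0 * (f * g' - g * f')) = lower_left l m (Const b * h + Const a * h' + Const c0 * (f * g' - g * f'))"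
    unfolding lower_left_linear(2)[OF x(3) x(3)] lower_left_linear(2)[OF y(3) y(3)] lower_left_linear(1)[OF C[OF x(3)] C[OF y(3)]]
    by (rule lower_left_linear(1)[OF homog_add[OF C[OF x(3)] C[OF y(3)]] C[OF hm]])
  have uT: "(sec_of homog PX (Const a * f' + Const b * f), sec_of homog PX (Const a * g' + Const b * g), zero_sec PX) \<in> carrier TX"
    using C x y by (simp add: T_sheaf_def TT_simps zero_sec_closed sec_of_closed homog_add)
  have sum: "sec_of homog PX (Const a) \<odot>\<^bsub>TX\<^esub> (sec_of homog PX f', sec_of homog PX g', zero_sec PX) \<oplus>\<^bsub>TX\<^esub>
       sec_of homog PX (Const b) \<odot>\<^bsub>TX\<^esub> (sec_of homog PX f, sec_of homog PX g, zero_sec PX)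
     = (sec_of homog PX (Const a * f' + Const b * f), sec_of homog PX (Const a * g' + Const b * g), zero_sec PX)"
    by (simp add: T_sheaf_def TT_simps sec_of_arith zero_sec_def)
  have "\<ominus>\<^bsub>TX\<^esub> \<zero>\<^bsub>TX\<^esub> = \<zero>\<^bsub>TX\<^esub>" by (rule T.M.minus_equality[OF T.M.r_zero]; rule T.M.zero_closed)
  then have upper: "(sec_of homog PX (Const a) \<odot>\<^bsub>TX\<^esub> (sec_of homog PX f', sec_of homog PX g', zero_sec PX) \<oplus>\<^bsub>TX\<^esub>
       sec_of homog PX (Const b) \<odot>\<^bsub>TX\<^esub> (sec_of homog PX f, sec_of homog PX g, zero_sec PX)) \<ominus>\<^bsub>TX\<^esub> \<zero>\<^bsub>TX\<^esub>
     = (sec_of homog PX (Const a * f' + Const b * f), sec_of homog PX (Const a * g' + Const b * g), zero_sec PX)"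
    using T.M.r_zero[OF uT] unfolding sum T.M.minus_eq by (rule ssubst)
  show ?thesis
    unfolding C_matrix_eq C_alg_simps mat_mult_def prod.case cr dc third upper lower_left_pairing[OF x(3) y(1,2)]
      lower_left_pairing[OF y(3) x(1,2)]
    by (simp add: sec_of_arith)
qed

text \<open>Sections of negative degree are zero: this concerns degree \<open>- l - m\<close> for the upper right entry,
  and the degrees \<open>- l\<close> and \<open>- m\<close> for the lower left one.\<close>

lemma C_matrix_bij:
  assumes two: "(i0 :: 'v) \<noteq> j0"
  shows "bij_betw (C_matrix l m) (UNIV \<times> homog l \<times> homog m \<times> homog (l + m)) (carrier (C_alg l m \<alpha>))"
proof (rule bij_betw_imageI)
  interpret I: presheaf_iso "PP :: (('v, 'a) mpoly set, _) ringed_space" "TT (- int l) (- int m) (- (- int l - int m))"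
    "dual_sheaf PP (TT (int l) (int m) (- int l - int m))" "dual_of (int l) (int m) (- int l - int m)" by (rule presheaf_iso_dual)
  have oX: "openin (space PP) PX" by (simp add: PP_simps)
  show "inj_on (C_matrix l m) (UNIV \<times> homog l \<times> homog m \<times> homog (l + m) :: ('a \<times> ('v, 'a) mpoly \<times> ('v, 'a) mpoly \<times> ('v, 'a) mpoly) set)"
  proof (rule inj_onI)
    fix x y :: "'a \<times> ('v, 'a) mpoly \<times> ('v, 'a) mpoly \<times> ('v, 'a) mpoly"
    assume xy: "x \<in> UNIV \<times> homog l \<times> homog m \<times> homog (l + m)" "y \<in> UNIV \<times> homog l \<times> homog m \<times> homog (l + m)"
      and eq: "C_matrix l m x = C_matrix l m y"
    obtain a f g h b f' g' h' where x: "x = (a, f, g, h)" and y: "y = (b, f', g', h')" by (cases x, cases y) blast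
    have h: "h \<in> homog (l + m)" "h' \<in> homog (l + m)" using xy by (simp_all add: x y)
    have e: "a = b" "f = f'" "g = g'" "lower_left l m h = lower_left l m h'"
      using eq unfolding x y C_matrix_eq by (simp_all add: sec_of_inject)
    have "third h = third h'"
      by (rule inj_onD[OF bij_betw_imp_inj_on[OF I.\<Phi>_bij[OF oX]] e(4)[unfolded lower_left_def] third_closed[OF h(1)] third_closed[OF h(2)]])
    then show "x = y" using e by (simp add: x y sec_of_inject)
  qed
  show "C_matrix l m ` (UNIV \<times> homog l \<times> homog m \<times> homog (l + m)) = carrier (C_alg l m \<alpha>)"
  proof
    show "C_matrix l m ` (UNIV \<times> homog l \<times> homog m \<times> homog (l + m)) \<subseteq> carrier (C_alg l m \<alpha>)"
      using C_matrix_closed by auto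
    show "carrier (C_alg l m \<alpha>) \<subseteq> C_matrix l m ` (UNIV \<times> homog l \<times> homog m \<times> homog (l + m))"
    proof
      fix \<xi> assume \<xi>: "\<xi> \<in> carrier (C_alg l m \<alpha>)"
      obtain s u \<phi> where su: "\<xi> = (s, u, \<phi>)" by (cases \<xi>)
      have s: "s \<in> tw (int 0) PX" and u: "u \<in> carrier (sections (TT (int l) (int m) (- int l - int m)) PX)"
        and \<phi>: "\<phi> \<in> carrier (sections (dual_sheaf PP (TT (int l) (int m) (- int l - int m))) PX)"
        using \<xi> unfolding su C_alg_simps T_sheaf_def by simp_all
      obtain p where p: "p \<in> homog 0" "s = sec_of homog PX p" using global_sections_nonneg[OF s two] by blast
      obtain a where a: "p = Const a" using homog_zero_Const[OF p(1)] by blast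
      obtain u1 u2 u3 where u': "u = (u1, u2, u3)" "u1 \<in> tw (int l) PX" "u2 \<in> tw (int m) PX" "u3 \<in> tw (- int l - int m) PX"
        by (rule TT_cases[OF u])
      obtain f where f: "f \<in> homog l" "u1 = sec_of homog PX f" using global_sections_nonneg[OF u'(2) two] by blast
      obtain g where g: "g \<in> homog m" "u2 = sec_of homog PX g" using global_sections_nonneg[OF u'(3) two] by blast
      have u3: "u3 = sec_of homog PX 0" by (rule global_sections_neg[OF u'(4) _ two]) (use l in simp)
      obtain x where x: "x \<in> carrier (sections (TT (- int l) (- int m) (- (- int l - int m))) PX)"
        "\<phi> = dual_of (int l) (int m) (- int l - int m) PX x" by (rule I.\<Phi>_surj[OF oX \<phi>])
      obtain x1 x2 x3 where x': "x = (x1, x2, x3)" "x1 \<in> tw (- int l) PX" "x2 \<in> tw (- int m) PX" "x3 \<in> tw (- (- int l - int m)) PX"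
        by (rule TT_cases[OF x(1)])
      have x12: "x1 = sec_of homog PX 0" "x2 = sec_of homog PX 0"
        by (rule global_sections_neg[OF x'(2) _ two], use l in simp, rule global_sections_neg[OF x'(3) _ two], use m in simp)
      have "x3 \<in> tw (int (l + m)) PX" using x'(4) by (simp add: add.commute)
      then obtain h where h: "h \<in> homog (l + m)" "x3 = sec_of homog PX h" using global_sections_nonneg[OF _ two] by blast
      have "\<xi> = C_matrix l m (a, f, g, h)"
        unfolding C_matrix_eq su p(2) a u'(1) f(2) g(2) u3 lower_left_def x(2) x'(1) x12 h(2) zero_sec_def ..
      then show "\<xi> \<in> C_matrix l m ` (UNIV \<times> homog l \<times> homog m \<times> homog (l + m))" using f(1) g(1) h(1) by blast
    qed
  qed
qed

lemma C_matrix_iso: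
  assumes two: "(i0 :: 'v) \<noteq> j0"
  shows "algebra_iso (mat_alg l m c0) (C_alg l m \<alpha>) (C_matrix l m) ring_of_type_algebra"
proof -
  have m: "carrier (mat_alg l m c0 :: ('a, 'a \<times> ('v, 'a) mpoly \<times> ('v, 'a) mpoly \<times> ('v, 'a) mpoly) module) = UNIV \<times> homog l \<times> homog m \<times> homog (l + m)"
    "(a, f, g, h) \<oplus>\<^bsub>mat_alg l m c0\<^esub> (b, f', g', h') = (a + b, f + f', g + g', h + h')"
    "x \<otimes>\<^bsub>mat_alg l m c0\<^esub> y = mat_mult c0 x y"
    "r \<odot>\<^bsub>mat_alg l m c0\<^esub> (a, f, g, h) = (r * a, Const r * f, Const r * g, Const r * h)"
    "\<zero>\<^bsub>mat_alg l m c0\<^esub> = (0, 0, 0, 0)" "\<one>\<^bsub>mat_alg l m c0\<^esub> = (1, 0, 0, 0)" for a b r :: 'a and f g h f' g' h' x y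
    by (simp_all add: mat_alg_def matrix_space_def)
  show ?thesis
    unfolding algebra_iso_def linear_iso_def m(1,3,5,6)
  proof (intro conjI ballI C_matrix_bij[OF two] C_matrix_units)
    fix x y :: "'a \<times> ('v, 'a) mpoly \<times> ('v, 'a) mpoly \<times> ('v, 'a) mpoly"
    assume x: "x \<in> UNIV \<times> homog l \<times> homog m \<times> homog (l + m)" and y: "y \<in> UNIV \<times> homog l \<times> homog m \<times> homog (l + m)"
    obtain a f g h where x': "x = (a, f, g, h)" "f \<in> homog l" "g \<in> homog m" "h \<in> homog (l + m)" using x by (cases x) blast
    obtain b f' g' h' where y': "y = (b, f', g', h')" "f' \<in> homog l" "g' \<in> homog m" "h' \<in> homog (l + m)" using y by (cases y) blast
    show "C_matrix l m (x \<oplus>\<^bsub>mat_alg l m c0\<^esub> y) = C_matrix l m x \<oplus>\<^bsub>C_alg l m \<alpha>\<^esub> C_matrix l m y"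
      unfolding x'(1) y'(1) m(2) C_matrix_linear(1)[OF x'(2-4) y'(2-4)] ..
    show "C_matrix l m (mat_mult c0 x y) = C_matrix l m x \<otimes>\<^bsub>C_alg l m \<alpha>\<^esub> C_matrix l m y"
      unfolding x'(1) y'(1) C_matrix_mult[OF x'(2-4) y'(2-4)] ..
  next
    fix r and x :: "'a \<times> ('v, 'a) mpoly \<times> ('v, 'a) mpoly \<times> ('v, 'a) mpoly"
    assume x: "x \<in> UNIV \<times> homog l \<times> homog m \<times> homog (l + m)"
    obtain a f g h where x': "x = (a, f, g, h)" "f \<in> homog l" "g \<in> homog m" "h \<in> homog (l + m)" using x by (cases x) blast
    show "C_matrix l m (r \<odot>\<^bsub>mat_alg l m c0\<^esub> x) = r \<odot>\<^bsub>C_alg l m \<alpha>\<^esub> C_matrix l m x"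
      unfolding x'(1) m(4) C_matrix_linear(2)[OF x'(2-4) x'(2-4)] ..
  qed
qed

end

section \<open>Transport along algebra isomorphisms\<close>

definition associative_alg :: "('r, 'c) module \<Rightarrow> bool" where
  "associative_alg A \<longleftrightarrow> (\<forall>x\<in>carrier A. \<forall>y\<in>carrier A. \<forall>z\<in>carrier A. (x \<otimes>\<^bsub>A\<^esub> y) \<otimes>\<^bsub>A\<^esub> z = x \<otimes>\<^bsub>A\<^esub> (y \<otimes>\<^bsub>A\<^esub> z))"

lemma unital_algebraD:
  assumes "unital_algebra R A"
  shows "Module.module R A" "x \<in> carrier A \<Longrightarrow> y \<in> carrier A \<Longrightarrow> x \<otimes>\<^bsub>A\<^esub> y \<in> carrier A"
  using assms unfolding unital_algebra_def by blast+

lemma associative_noncommutative_Jordan: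
  assumes A: "unital_algebra R A" and as: "associative_alg A"
  shows "noncommutative_Jordan A"
proof -
  interpret Module.module R A by (rule unital_algebraD(1)[OF A])
  note cl = unital_algebraD(2)[OF A]
  have "associator A x y z = \<zero>\<^bsub>A\<^esub>" if "x \<in> carrier A" "y \<in> carrier A" "z \<in> carrier A" for x y z
    using as that unfolding associator_def associative_alg_def by (simp add: cl M.r_neg a_minus_def)
  then show ?thesis unfolding noncommutative_Jordan_def by (simp add: cl)
qed

context
  fixes A :: "('r, 'b) module" and B :: "('r, 'c) module" and h :: "'b \<Rightarrow> 'c" and R :: "'r ring"
  assumes iso: "algebra_iso A B h R" and A: "unital_algebra R A"
begin

lemma algebra_iso_facts:
  "linear_iso R A B h" "bij_betw h (carrier A) (carrier B)" "h \<zero>\<^bsub>A\<^esub> = \<zero>\<^bsub>B\<^esub>" "h \<one>\<^bsub>A\<^esub> = \<one>\<^bsub>B\<^esub>"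
  "x \<in> carrier A \<Longrightarrow> y \<in> carrier A \<Longrightarrow> h x \<oplus>\<^bsub>B\<^esub> h y = h (x \<oplus>\<^bsub>A\<^esub> y)"
  "x \<in> carrier A \<Longrightarrow> y \<in> carrier A \<Longrightarrow> h x \<otimes>\<^bsub>B\<^esub> h y = h (x \<otimes>\<^bsub>A\<^esub> y)"
  "c \<in> carrier R \<Longrightarrow> x \<in> carrier A \<Longrightarrow> c \<odot>\<^bsub>B\<^esub> h x = h (c \<odot>\<^bsub>A\<^esub> x)"
  using iso unfolding algebra_iso_def linear_iso_def by simp_all

lemma algebra_iso_carrier: "carrier B = h ` carrier A"
  using bij_betw_imp_surj_on[OF algebra_iso_facts(2)] by (rule sym)

lemma module_iso_target: "Module.module R B"
  by (rule module_transport[OF unital_algebraD(1)[OF A] algebra_iso_facts(1,3)])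

lemma unital_algebra_iso: "unital_algebra R B"
proof -
  interpret Module.module R A by (rule unital_algebraD(1)[OF A])
  note cl = unital_algebraD(2)[OF A]
  have one: "\<one>\<^bsub>A\<^esub> \<in> carrier A" and
    laws: "\<And>x y z. x \<in> carrier A \<Longrightarrow> y \<in> carrier A \<Longrightarrow> z \<in> carrier A \<Longrightarrow>
        (x \<oplus>\<^bsub>A\<^esub> y) \<otimes>\<^bsub>A\<^esub> z = (x \<otimes>\<^bsub>A\<^esub> z) \<oplus>\<^bsub>A\<^esub> (y \<otimes>\<^bsub>A\<^esub> z) \<and> z \<otimes>\<^bsub>A\<^esub> (x \<oplus>\<^bsub>A\<^esub> y) = (z \<otimes>\<^bsub>A\<^esub> x) \<oplus>\<^bsub>A\<^esub> (z \<otimes>\<^bsub>A\<^esub> y)"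
      "\<And>c x y. c \<in> carrier R \<Longrightarrow> x \<in> carrier A \<Longrightarrow> y \<in> carrier A \<Longrightarrow>
        (c \<odot>\<^bsub>A\<^esub> x) \<otimes>\<^bsub>A\<^esub> y = c \<odot>\<^bsub>A\<^esub> (x \<otimes>\<^bsub>A\<^esub> y) \<and> x \<otimes>\<^bsub>A\<^esub> (c \<odot>\<^bsub>A\<^esub> y) = c \<odot>\<^bsub>A\<^esub> (x \<otimes>\<^bsub>A\<^esub> y)"
      "\<And>x. x \<in> carrier A \<Longrightarrow> \<one>\<^bsub>A\<^esub> \<otimes>\<^bsub>A\<^esub> x = x \<and> x \<otimes>\<^bsub>A\<^esub> \<one>\<^bsub>A\<^esub> = x"
    using A unfolding unital_algebra_def by simp_all
  show ?thesis
    unfolding unital_algebra_def algebra_iso_carrier algebra_iso_facts(4)[symmetric]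
    by (intro conjI module_iso_target imageI one) (auto simp: algebra_iso_facts(5-7) cl one laws)
qed

lemma associative_alg_iso: "associative_alg A \<Longrightarrow> associative_alg B"
  unfolding associative_alg_def algebra_iso_carrier by (simp add: algebra_iso_facts(6) unital_algebraD(2)[OF A])

end

section \<open>Free modules\<close>

lemma additive_finsum:
  assumes M: "abelian_group M" and N: "abelian_group N" and h: "h \<in> carrier M \<rightarrow> carrier N"
    and add: "\<And>x y. x \<in> carrier M \<Longrightarrow> y \<in> carrier M \<Longrightarrow> h (x \<oplus>\<^bsub>M\<^esub> y) = h x \<oplus>\<^bsub>N\<^esub> h y"
    and fin: "finite I" and f: "f \<in> I \<rightarrow> carrier M"
  shows "h (\<Oplus>\<^bsub>M\<^esub>i\<in>I. f i) = (\<Oplus>\<^bsub>N\<^esub>i\<in>I. h (f i))"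
proof -
  interpret M: abelian_group M by fact
  interpret N: abelian_group N by fact
  have hc: "h x \<in> carrier N" if "x \<in> carrier M" for x using h that by blast
  have "h \<zero>\<^bsub>M\<^esub> \<oplus>\<^bsub>N\<^esub> h \<zero>\<^bsub>M\<^esub> = h \<zero>\<^bsub>M\<^esub>" using add[of "\<zero>\<^bsub>M\<^esub>" "\<zero>\<^bsub>M\<^esub>"] by simp
  then have zero: "h \<zero>\<^bsub>M\<^esub> = \<zero>\<^bsub>N\<^esub>" using hc[OF M.zero_closed] N.add.r_cancel_one by simp
  show ?thesis using fin f
  proof (induction I)
    case (insert i I)
    then have fI: "f \<in> I \<rightarrow> carrier M" "f i \<in> carrier M" by auto
    have "(\<lambda>i. h (f i)) \<in> I \<rightarrow> carrier N" using fI(1) hc by blast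
    then show ?case
      using insert(3)[OF fI(1)] fI hc insert(1,2)
      by (simp add: M.finsum_insert N.finsum_insert add M.finsum_closed)
  qed (simp add: zero)
qed

lemma free_of_rank_iso:
  assumes free: "free_of_rank R M N" and h: "linear_iso R M M' h" and z: "h \<zero>\<^bsub>M\<^esub> = \<zero>\<^bsub>M'\<^esub>"
  shows "free_of_rank R M' N"
proof -
  obtain b where M: "Module.module R M" and b: "b \<in> {..<N} \<rightarrow> carrier M"
    and ex: "\<forall>x\<in>carrier M. \<exists>!c. c \<in> {..<N} \<rightarrow>\<^sub>E carrier R \<and> x = (\<Oplus>\<^bsub>M\<^esub>i\<in>{..<N}. c i \<odot>\<^bsub>M\<^esub> b i)"
    using free unfolding free_of_rank_def by blast
  have M': "Module.module R M'" by (rule module_transport[OF M h z])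
  interpret M: Module.module R M by (rule M)
  interpret M': Module.module R M' by (rule M')
  have bij: "bij_betw h (carrier M) (carrier M')"
    and add: "\<And>x y. x \<in> carrier M \<Longrightarrow> y \<in> carrier M \<Longrightarrow> h (x \<oplus>\<^bsub>M\<^esub> y) = h x \<oplus>\<^bsub>M'\<^esub> h y"
    and smult: "\<And>c x. c \<in> carrier R \<Longrightarrow> x \<in> carrier M \<Longrightarrow> h (c \<odot>\<^bsub>M\<^esub> x) = c \<odot>\<^bsub>M'\<^esub> h x"
    using h unfolding linear_iso_def by simp_all
  have hc: "h \<in> carrier M \<rightarrow> carrier M'" using bij by (rule bij_betw_imp_funcset)
  have summand: "(\<lambda>i. c i \<odot>\<^bsub>M\<^esub> b i) \<in> {..<N} \<rightarrow> carrier M" if "c \<in> {..<N} \<rightarrow>\<^sub>E carrier R" for c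
    using that b by (auto simp: PiE_iff Pi_iff)
  have sum: "(\<Oplus>\<^bsub>M'\<^esub>i\<in>{..<N}. c i \<odot>\<^bsub>M'\<^esub> h (b i)) = h (\<Oplus>\<^bsub>M\<^esub>i\<in>{..<N}. c i \<odot>\<^bsub>M\<^esub> b i)"
    if c: "c \<in> {..<N} \<rightarrow>\<^sub>E carrier R" for c
  proof -
    have "h (\<Oplus>\<^bsub>M\<^esub>i\<in>{..<N}. c i \<odot>\<^bsub>M\<^esub> b i) = (\<Oplus>\<^bsub>M'\<^esub>i\<in>{..<N}. h (c i \<odot>\<^bsub>M\<^esub> b i))"
      by (rule additive_finsum[OF M.abelian_group_axioms M'.abelian_group_axioms hc add _ summand[OF c]]) simp_all
    also have "\<dots> = (\<Oplus>\<^bsub>M'\<^esub>i\<in>{..<N}. c i \<odot>\<^bsub>M'\<^esub> h (b i))"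
    proof (rule M'.finsum_cong')
      show "(\<lambda>i. c i \<odot>\<^bsub>M'\<^esub> h (b i)) \<in> {..<N} \<rightarrow> carrier M'" using c b hc by (auto simp: PiE_iff Pi_iff)
      show "h (c i \<odot>\<^bsub>M\<^esub> b i) = c i \<odot>\<^bsub>M'\<^esub> h (b i)" if "i \<in> {..<N}" for i
        using that c b by (intro smult) (auto simp: PiE_iff Pi_iff)
    qed simp
    finally show ?thesis by (rule sym)
  qed
  have sumc: "(\<Oplus>\<^bsub>M\<^esub>i\<in>{..<N}. c i \<odot>\<^bsub>M\<^esub> b i) \<in> carrier M" if "c \<in> {..<N} \<rightarrow>\<^sub>E carrier R" for c
    by (rule M.finsum_closed[OF summand[OF that]])
  have "\<exists>!c. c \<in> {..<N} \<rightarrow>\<^sub>E carrier R \<and> y = (\<Oplus>\<^bsub>M'\<^esub>i\<in>{..<N}. c i \<odot>\<^bsub>M'\<^esub> h (b i))" if y: "y \<in> carrier M'" for y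
  proof -
    obtain x where x: "x \<in> carrier M" "y = h x" using y bij unfolding bij_betw_def by blast
    have "c \<in> {..<N} \<rightarrow>\<^sub>E carrier R \<and> y = (\<Oplus>\<^bsub>M'\<^esub>i\<in>{..<N}. c i \<odot>\<^bsub>M'\<^esub> h (b i))
        \<longleftrightarrow> c \<in> {..<N} \<rightarrow>\<^sub>E carrier R \<and> x = (\<Oplus>\<^bsub>M\<^esub>i\<in>{..<N}. c i \<odot>\<^bsub>M\<^esub> b i)" for c
      by (cases "c \<in> {..<N} \<rightarrow>\<^sub>E carrier R")
        (simp_all add: sum x(2) inj_on_eq_iff[OF bij_betw_imp_inj_on[OF bij] x(1) sumc])
    then show ?thesis using bspec[OF ex x(1)] by simp
  qed
  moreover have "(\<lambda>i. h (b i)) \<in> {..<N} \<rightarrow> carrier M'" using b hc by blast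
  ultimately show ?thesis unfolding free_of_rank_def by (intro conjI M' bexI[of _ "\<lambda>i. h (b i)"] ballI)
qed

text \<open>The element \<open>x\<close> and the combination of the \<open>b i\<close> with coefficients \<open>\<kappa> i x\<close> have the same
  coordinates, and coordinates separate elements.\<close>

lemma free_of_rank_dual_basis:
  assumes M: "Module.module R M" and I: "finite I" "card I = N"
    and b: "\<And>i. i \<in> I \<Longrightarrow> b i \<in> carrier M"
    and \<kappa>: "\<And>i x. i \<in> I \<Longrightarrow> x \<in> carrier M \<Longrightarrow> \<kappa> i x \<in> carrier R"
    and \<kappa>_add: "\<And>i x y. i \<in> I \<Longrightarrow> x \<in> carrier M \<Longrightarrow> y \<in> carrier M \<Longrightarrow> \<kappa> i (x \<oplus>\<^bsub>M\<^esub> y) = \<kappa> i x \<oplus>\<^bsub>R\<^esub> \<kappa> i y"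
    and \<kappa>_smult: "\<And>i c x. i \<in> I \<Longrightarrow> c \<in> carrier R \<Longrightarrow> x \<in> carrier M \<Longrightarrow> \<kappa> i (c \<odot>\<^bsub>M\<^esub> x) = c \<otimes>\<^bsub>R\<^esub> \<kappa> i x"
    and \<kappa>_b: "\<And>i j. i \<in> I \<Longrightarrow> j \<in> I \<Longrightarrow> \<kappa> i (b j) = (if i = j then \<one>\<^bsub>R\<^esub> else \<zero>\<^bsub>R\<^esub>)"
    and sep: "\<And>x y. x \<in> carrier M \<Longrightarrow> y \<in> carrier M \<Longrightarrow> (\<And>i. i \<in> I \<Longrightarrow> \<kappa> i x = \<kappa> i y) \<Longrightarrow> x = y"
  shows "free_of_rank R M N"
proof -
  interpret Module.module R M by (rule M)
  obtain e where e: "bij_betw e {..<N} I" using ex_bij_betw_nat_finite[OF I(1)] I(2) by (auto simp: atLeast0LessThan)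
  have eI: "e i \<in> I" if "i < N" for i using bij_betw_apply[OF e] that by simp
  have einj: "e i = e j \<longleftrightarrow> i = j" if "i < N" "j < N" for i j
    using inj_on_eq_iff[OF bij_betw_imp_inj_on[OF e]] that by simp
  let ?s = "\<lambda>c. \<Oplus>\<^bsub>M\<^esub>i\<in>{..<N}. c i \<odot>\<^bsub>M\<^esub> b (e i)"
  have summand: "(\<lambda>i. c i \<odot>\<^bsub>M\<^esub> b (e i)) \<in> {..<N} \<rightarrow> carrier M" if "c \<in> {..<N} \<rightarrow> carrier R" for c
    using that b eI by auto
  have sc: "?s c \<in> carrier M" if "c \<in> {..<N} \<rightarrow> carrier R" for c by (rule M.finsum_closed[OF summand[OF that]])
  have coord: "\<kappa> (e j) (?s c) = c j" if c: "c \<in> {..<N} \<rightarrow> carrier R" and j: "j < N" for c j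
  proof -
    have "\<kappa> (e j) (?s c) = (\<Oplus>\<^bsub>R\<^esub>i\<in>{..<N}. \<kappa> (e j) (c i \<odot>\<^bsub>M\<^esub> b (e i)))"
      by (rule additive_finsum[OF M.abelian_group_axioms R.abelian_group_axioms _ \<kappa>_add[OF eI[OF j]] _ summand[OF c]])
        (use \<kappa>[OF eI[OF j]] in auto)
    also have "\<dots> = (\<Oplus>\<^bsub>R\<^esub>i\<in>{..<N}. if j = i then c i else \<zero>\<^bsub>R\<^esub>)"
    proof (rule R.finsum_cong')
      have ci: "c i \<in> carrier R" if "i < N" for i using c that by (auto simp: Pi_iff)
      show "(\<lambda>i. if j = i then c i else \<zero>\<^bsub>R\<^esub>) \<in> {..<N} \<rightarrow> carrier R" using ci by simp
      show "\<kappa> (e j) (c i \<odot>\<^bsub>M\<^esub> b (e i)) = (if j = i then c i else \<zero>\<^bsub>R\<^esub>)" if "i \<in> {..<N}" for i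
      proof -
        have i: "i < N" using that by simp
        show ?thesis
          unfolding \<kappa>_smult[OF eI[OF j] ci[OF i] b[OF eI[OF i]]] \<kappa>_b[OF eI[OF j] eI[OF i]] einj[OF j i]
          using ci[OF i] by simp
      qed
    qed simp
    also have "\<dots> = c j" by (rule R.add.finprod_singleton) (use c j in simp_all)
    finally show ?thesis .
  qed
  have "\<exists>!c. c \<in> {..<N} \<rightarrow>\<^sub>E carrier R \<and> x = ?s c" if x: "x \<in> carrier M" for x
  proof (intro ex1I[of _ "\<lambda>i\<in>{..<N}. \<kappa> (e i) x"] conjI)
    let ?c = "\<lambda>i\<in>{..<N}. \<kappa> (e i) x"
    show cE: "?c \<in> {..<N} \<rightarrow>\<^sub>E carrier R" using \<kappa>[OF eI x] by auto
    then have c: "?c \<in> {..<N} \<rightarrow> carrier R" unfolding PiE_def by (rule IntD1)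
    show "x = ?s ?c"
    proof (rule sep[OF x sc[OF c]])
      fix i assume "i \<in> I"
      then obtain j where j: "j < N" "i = e j" using e unfolding bij_betw_def by blast
      show "\<kappa> i x = \<kappa> i (?s ?c)" unfolding j(2) coord[OF c j(1)] using j(1) by simp
    qed
    fix c' assume c': "c' \<in> {..<N} \<rightarrow>\<^sub>E carrier R \<and> x = ?s c'"
    then have "c' \<in> {..<N} \<rightarrow> carrier R" unfolding PiE_def by (elim conjE IntE)
    then have "\<kappa> (e j) x = c' j" if "j < N" for j using coord[OF _ that] c' by metis
    then show "c' = ?c" using c' by (intro extensionalityI[of _ "{..<N}"]) (auto simp: PiE_iff)
  qed
  moreover have "(\<lambda>i. b (e i)) \<in> {..<N} \<rightarrow> carrier M" using b eI by simp
  ultimately show ?thesis unfolding free_of_rank_def by (intro conjI M bexI[of _ "\<lambda>i. b (e i)"] ballI)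
qed

section \<open>The algebra of matrices\<close>

lemma mat_alg_simps:
  "carrier (mat_alg l m c) = UNIV \<times> homog l \<times> homog m \<times> homog (l + m)"
  "(a, f, g, h) \<oplus>\<^bsub>mat_alg l m c\<^esub> (b, f', g', h') = (a + b, f + f', g + g', h + h')"
  "x \<otimes>\<^bsub>mat_alg l m c\<^esub> y = mat_mult c x y"
  "r \<odot>\<^bsub>mat_alg l m c\<^esub> (a, f, g, h) = (r * a, Const r * f, Const r * g, Const r * h)"
  "\<zero>\<^bsub>mat_alg l m c\<^esub> = (0, 0, 0, 0)" "\<one>\<^bsub>mat_alg l m c\<^esub> = (1, 0, 0, 0)"
  by (simp_all add: mat_alg_def matrix_space_def)

lemma ring_of_type_simps [simp]:
  "carrier ring_of_type_algebra = UNIV" "x \<oplus>\<^bsub>ring_of_type_algebra\<^esub> y = x + y" "x \<otimes>\<^bsub>ring_of_type_algebra\<^esub> y = x * y"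
  "\<one>\<^bsub>ring_of_type_algebra\<^esub> = 1" "\<zero>\<^bsub>ring_of_type_algebra\<^esub> = 0"
  by (simp_all add: ring_of_type_algebra_def)

lemma mat_cases:
  assumes "x \<in> UNIV \<times> homog l \<times> homog m \<times> homog (l + m)"
  obtains a f g h where "x = (a, f, g, h)" "f \<in> homog l" "g \<in> homog m" "h \<in> homog (l + m)"
  using assms by auto

lemma module_mat_alg:
  "Module.module ring_of_type_algebra (mat_alg l m c :: ('a::comm_ring_1, 'a \<times> ('v::finite, 'a) mpoly \<times> ('v, 'a) mpoly \<times> ('v, 'a) mpoly) module)"
  (is "Module.module _ ?A")
proof (rule moduleI[OF cring_from_type_algebra])
  show "abelian_group ?A"
  proof (rule abelian_groupI)
    show "\<exists>y\<in>carrier ?A. y \<oplus>\<^bsub>?A\<^esub> x = \<zero>\<^bsub>?A\<^esub>" if xA: "x \<in> carrier ?A" for x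
    proof -
      obtain a f g h where x: "x = (a, f, g, h)" "f \<in> homog l" "g \<in> homog m" "h \<in> homog (l + m)"
        using xA unfolding mat_alg_simps by (rule mat_cases)
      show ?thesis
        by (rule bexI[of _ "(- a, - f, - g, - h)"]) (use x in \<open>simp_all add: mat_alg_simps homog_uminus\<close>)
    qed
  qed (auto simp: mat_alg_simps homog_add algebra_simps)
qed (auto simp: mat_alg_simps homog_Const_mult homog_Const_mult[unfolded mult.commute[of "Const _"]] algebra_simps)

lemma mat_mult_closed:
  assumes "f \<in> homog l" "g \<in> homog m" "h \<in> homog (l + m)" "f' \<in> homog l" "g' \<in> homog m" "h' \<in> homog (l + m)"
  shows "mat_mult c (a, f, g, h) (b, f', g', h') \<in> UNIV \<times> homog l \<times> homog m \<times> homog (l + m)"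
proof -
  have "g * f' \<in> homog (l + m)" using homog_mult[OF assms(4,2)] by (simp add: mult.commute)
  then have "f * g' - g * f' \<in> homog (l + m)" using homog_mult[OF assms(1,5)] by (intro homog_diff)
  then show ?thesis using assms by (simp add: mat_mult_def homog_add homog_Const_mult)
qed

lemma unital_algebra_mat_alg:
  "unital_algebra ring_of_type_algebra (mat_alg l m c :: ('a::comm_ring_1, 'a \<times> ('v::finite, 'a) mpoly \<times> ('v, 'a) mpoly \<times> ('v, 'a) mpoly) module)"
  unfolding unital_algebra_def mat_alg_simps(1,3,6) ring_of_type_simps
proof (intro conjI module_mat_alg ballI)
  fix x y :: "'a \<times> ('v, 'a) mpoly \<times> ('v, 'a) mpoly \<times> ('v, 'a) mpoly"
  assume "x \<in> UNIV \<times> homog l \<times> homog m \<times> homog (l + m)" "y \<in> UNIV \<times> homog l \<times> homog m \<times> homog (l + m)"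
  then show "mat_mult c x y \<in> UNIV \<times> homog l \<times> homog m \<times> homog (l + m)"
    by (elim mat_cases) (simp only: mat_mult_closed)
qed (auto simp: mat_alg_simps mat_mult_def algebra_simps)

text \<open>The product of two off-diagonal matrices lies in the lower left corner, which annihilates
  all off-diagonal matrices.\<close>

lemma associative_mat_alg:
  "associative_alg (mat_alg l m c :: ('a::comm_ring_1, 'a \<times> ('v::finite, 'a) mpoly \<times> ('v, 'a) mpoly \<times> ('v, 'a) mpoly) module)"
  unfolding associative_alg_def mat_alg_simps(1,3)
  by (auto simp: mat_mult_def algebra_simps)

section \<open>Monomial bases\<close>

lemma lookup_Const_mult: "Poly_Mapping.lookup (Const c * p) \<mu> = c * Poly_Mapping.lookup p \<mu>"
  unfolding Const_def mult_map_scale_conv_mult[symmetric] by (simp add: Poly_Mapping.map.rep_eq when_def)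

text \<open>A monomial of degree \<open>d\<close> is a list of \<open>n + 1\<close> exponents with sum \<open>d\<close>.\<close>

lemma card_monomials:
  assumes "card (UNIV :: 'v::finite set) = n + 1"
  shows "finite {\<mu> :: 'v \<Rightarrow>\<^sub>0 nat. mdeg \<mu> = d}" "card {\<mu> :: 'v \<Rightarrow>\<^sub>0 nat. mdeg \<mu> = d} = (d + n) choose n"
proof -
  obtain xs where xs: "set xs = (UNIV :: 'v set)" "distinct xs" using finite_distinct_list[OF finite] by blast
  have len: "length xs = n + 1" using distinct_card[OF xs(2)] xs(1) assms by simp
  let ?L = "{k :: nat list. length k = n + 1 \<and> sum_list k = d}"
  have sum: "mdeg \<mu> = sum_list (map (Poly_Mapping.lookup \<mu>) xs)" for \<mu> :: "'v \<Rightarrow>\<^sub>0 nat"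
    by (simp add: mdeg_def sum_list_distinct_conv_sum_set[OF xs(2)] xs(1))
  have bij: "bij_betw (\<lambda>\<mu> :: 'v \<Rightarrow>\<^sub>0 nat. map (Poly_Mapping.lookup \<mu>) xs) {\<mu>. mdeg \<mu> = d} ?L"
  proof (rule bij_betw_imageI)
    show "inj_on (\<lambda>\<mu> :: 'v \<Rightarrow>\<^sub>0 nat. map (Poly_Mapping.lookup \<mu>) xs) {\<mu>. mdeg \<mu> = d}"
      by (rule inj_onI) (use xs(1) in \<open>auto intro!: poly_mapping_eqI simp: map_eq_conv\<close>)
    show "(\<lambda>\<mu> :: 'v \<Rightarrow>\<^sub>0 nat. map (Poly_Mapping.lookup \<mu>) xs) ` {\<mu>. mdeg \<mu> = d} = ?L"
    proof
      show "(\<lambda>\<mu> :: 'v \<Rightarrow>\<^sub>0 nat. map (Poly_Mapping.lookup \<mu>) xs) ` {\<mu>. mdeg \<mu> = d} \<subseteq> ?L"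
        by (auto simp: sum len)
      show "?L \<subseteq> (\<lambda>\<mu> :: 'v \<Rightarrow>\<^sub>0 nat. map (Poly_Mapping.lookup \<mu>) xs) ` {\<mu>. mdeg \<mu> = d}"
      proof
        fix k assume k: "k \<in> ?L"
        let ?f = "\<lambda>v. the (map_of (zip xs k) v)"
        have "Poly_Mapping.lookup (Abs_poly_mapping ?f) = ?f" by (rule lookup_Abs_poly_mapping) simp
        then have map: "map (Poly_Mapping.lookup (Abs_poly_mapping ?f)) xs = k"
          using k len xs(2) by (intro nth_equalityI) (simp_all add: map_of_zip_nth)
        moreover have "mdeg (Abs_poly_mapping ?f) = d" unfolding sum map using k by simp
        ultimately show "k \<in> (\<lambda>\<mu> :: 'v \<Rightarrow>\<^sub>0 nat. map (Poly_Mapping.lookup \<mu>) xs) ` {\<mu>. mdeg \<mu> = d}"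
          by (intro image_eqI[of _ _ "Abs_poly_mapping ?f"]) simp_all
      qed
    qed
  qed
  have cardL: "card ?L = (d + n) choose n"
    unfolding card_length_sum_list using binomial_symmetric[of n "d + n"] by simp
  show "card {\<mu> :: 'v \<Rightarrow>\<^sub>0 nat. mdeg \<mu> = d} = (d + n) choose n" using bij_betw_same_card[OF bij] cardL by simp
  moreover have "(d + n) choose n > 0" by simp
  ultimately show "finite {\<mu> :: 'v \<Rightarrow>\<^sub>0 nat. mdeg \<mu> = d}" by (metis card.infinite less_irrefl)
qed

lemma free_mat_alg:
  assumes n: "card (UNIV :: 'v::finite set) = n + 1"
  shows "free_of_rank ring_of_type_algebra
      (mat_alg l m c :: ('a::comm_ring_1, 'a \<times> ('v, 'a) mpoly \<times> ('v, 'a) mpoly \<times> ('v, 'a) mpoly) module)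
      (1 + ((l + n) choose n) + ((m + n) choose n) + (((l + m) + n) choose n))"
proof -
  let ?M = "\<lambda>d. {\<mu> :: 'v \<Rightarrow>\<^sub>0 nat. mdeg \<mu> = d}"
  let ?I = "{()} <+> (?M l <+> (?M m <+> ?M (l + m)))"
  let ?s = "\<lambda>\<mu>. Poly_Mapping.single \<mu> 1 :: ('v, 'a) mpoly"
  let ?b = "case_sum (\<lambda>_. (1, 0, 0, 0)) (case_sum (\<lambda>\<mu>. (0, ?s \<mu>, 0, 0)) (case_sum (\<lambda>\<mu>. (0, 0, ?s \<mu>, 0)) (\<lambda>\<mu>. (0, 0, 0, ?s \<mu>))))"
  let ?\<kappa> = "\<lambda>i (a :: 'a, f, g, h). case_sum (\<lambda>_. a) (case_sum (Poly_Mapping.lookup f) (case_sum (Poly_Mapping.lookup g) (Poly_Mapping.lookup h))) i"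
  have s: "?s \<mu> \<in> homog d" if "mdeg \<mu> = d" for \<mu> d using that by (auto simp: homog_iff lookup_single when_def)
  have eqI: "p = q" if "p \<in> homog d" "q \<in> homog d" "\<And>\<mu>. mdeg \<mu> = d \<Longrightarrow> Poly_Mapping.lookup p \<mu> = Poly_Mapping.lookup q \<mu>"
    for p q :: "('v, 'a) mpoly" and d
    by (rule poly_mapping_eqI) (use that in \<open>metis homog_iff\<close>)
  show ?thesis
  proof (rule free_of_rank_dual_basis[where I = ?I and b = ?b and \<kappa> = ?\<kappa>])
    show "finite ?I" "card ?I = 1 + ((l + n) choose n) + ((m + n) choose n) + (((l + m) + n) choose n)"
      by (simp_all add: card_monomials[OF n] card_Plus)
    show "?b i \<in> carrier (mat_alg l m c)" if "i \<in> ?I" for i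
      using that by (auto simp: mat_alg_simps intro: s)
    show "?\<kappa> i (?b j) = (if i = j then \<one>\<^bsub>ring_of_type_algebra\<^esub> else \<zero>\<^bsub>ring_of_type_algebra\<^esub>)" if "i \<in> ?I" "j \<in> ?I" for i j
      using that by (auto simp: lookup_single when_def split: sum.splits)
    show "?\<kappa> i (x \<oplus>\<^bsub>mat_alg l m c\<^esub> y) = ?\<kappa> i x \<oplus>\<^bsub>ring_of_type_algebra\<^esub> ?\<kappa> i y" for i x y
      by (cases x, cases y) (simp add: mat_alg_simps lookup_add split: sum.splits)
    show "?\<kappa> i (r \<odot>\<^bsub>mat_alg l m c\<^esub> x) = r \<otimes>\<^bsub>ring_of_type_algebra\<^esub> ?\<kappa> i x" for i r x
      by (cases x) (simp add: mat_alg_simps lookup_Const_mult split: sum.splits)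
    show "x = y" if x: "x \<in> carrier (mat_alg l m c)" and y: "y \<in> carrier (mat_alg l m c)" and eq: "\<And>i. i \<in> ?I \<Longrightarrow> ?\<kappa> i x = ?\<kappa> i y"
      for x y
    proof -
      obtain a f g h where x': "x = (a, f, g, h)" "f \<in> homog l" "g \<in> homog m" "h \<in> homog (l + m)"
        using x unfolding mat_alg_simps by (rule mat_cases)
      obtain b f' g' h' where y': "y = (b, f', g', h')" "f' \<in> homog l" "g' \<in> homog m" "h' \<in> homog (l + m)"
        using y unfolding mat_alg_simps by (rule mat_cases)
      have "a = b" using eq[OF InlI[OF singletonI]] by (simp add: x'(1) y'(1))
      moreover have "f = f'" by (rule eqI[OF x'(2) y'(2)]) (use eq[OF InrI[OF InlI[OF CollectI]]] in \<open>simp add: x'(1) y'(1)\<close>)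
      moreover have "g = g'" by (rule eqI[OF x'(3) y'(3)]) (use eq[OF InrI[OF InrI[OF InlI[OF CollectI]]]] in \<open>simp add: x'(1) y'(1)\<close>)
      moreover have "h = h'" by (rule eqI[OF x'(4) y'(4)]) (use eq[OF InrI[OF InrI[OF InrI[OF CollectI]]]] in \<open>simp add: x'(1) y'(1)\<close>)
      ultimately show ?thesis by (simp add: x'(1) y'(1))
    qed
  qed (simp_all add: module_mat_alg)
qed

section \<open>The embedding into the split colour algebra\<close>

lemma abelian_group_triples: "abelian_group (triples :: ('s::comm_ring_1, 's \<times> 's \<times> 's) module)"
proof (rule abelian_groupI)
  show "\<exists>y\<in>carrier triples. y \<oplus>\<^bsub>triples\<^esub> x = \<zero>\<^bsub>triples\<^esub>" for x :: "'s \<times> 's \<times> 's"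
    by (cases x, rule bexI[of _ "(- fst x, - fst (snd x), - snd (snd x))"]) (simp_all add: triples_def)
qed (auto simp: triples_def algebra_simps)

lemma triples_minus: "(u :: 's::comm_ring_1 \<times> 's \<times> 's) \<ominus>\<^bsub>triples\<^esub> (0, 0, 0) = u"
proof -
  interpret abelian_group "triples :: ('s, 's \<times> 's \<times> 's) module" by (rule abelian_group_triples)
  have z: "\<zero>\<^bsub>triples\<^esub> = (0 :: 's, 0 :: 's, 0 :: 's)" and c: "u \<in> carrier triples" by (simp_all add: triples_def)
  have "\<ominus>\<^bsub>triples\<^esub> \<zero>\<^bsub>triples\<^esub> = (\<zero>\<^bsub>triples\<^esub> :: 's \<times> 's \<times> 's)" by (rule minus_equality[OF r_zero]; rule zero_closed)
  then show ?thesis unfolding z[symmetric] minus_eq using r_zero[OF c] by (rule ssubst)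
qed

lemma Col_over_simps:
  "carrier Col_over = UNIV"
  "(a, (u1, u2, u3), (x1, x2, x3)) \<oplus>\<^bsub>Col_over\<^esub> (b, (v1, v2, v3), (y1, y2, y3)) =
     (a + b, (u1 + v1, u2 + v2, u3 + v3), (x1 + y1, x2 + y2, x3 + y3))"
  "r \<odot>\<^bsub>Col_over\<^esub> (a, (u1, u2, u3), (x1, x2, x3)) =
     (Const r * a, (Const r * u1, Const r * u2, Const r * u3), (Const r * x1, Const r * x2, Const r * x3))"
  "\<zero>\<^bsub>Col_over\<^esub> = (0, (0, 0, 0), (0, 0, 0))" "\<one>\<^bsub>Col_over\<^esub> = (1, (0, 0, 0), (0, 0, 0))"
  "(a, (u1, u2, 0), (0, 0, x)) \<otimes>\<^bsub>Col_over\<^esub> (b, (v1, v2, 0), (0, 0, y)) =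
     (a * b, (a * v1 + b * u1, a * v2 + b * u2, 0), (0, 0, b * x + a * y + (u1 * v2 - u2 * v1)))"
  by (simp_all add: Col_over_def restrict_scalars_def Col_def colour_algebra_def triples_minus)
    (simp_all add: triples_def)

lemma module_Col_over:
  "Module.module ring_of_type_algebra (Col_over :: ('a::comm_ring_1, ('v::finite, 'a) mpoly \<times> (('v, 'a) mpoly \<times> ('v, 'a) mpoly \<times> ('v, 'a) mpoly) \<times> _) module)"
  (is "Module.module _ ?A")
proof (rule moduleI[OF cring_from_type_algebra])
  show "abelian_group ?A"
  proof (rule abelian_groupI)
    show "\<exists>y\<in>carrier ?A. y \<oplus>\<^bsub>?A\<^esub> x = \<zero>\<^bsub>?A\<^esub>" for x
    proof -
      obtain a u1 u2 u3 x1 x2 x3 where x: "x = (a, (u1, u2, u3), (x1, x2, x3))" by (cases x) auto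
      show ?thesis
        by (rule bexI[of _ "(- a, (- u1, - u2, - u3), (- x1, - x2, - x3))"]) (simp_all add: x Col_over_simps)
    qed
  qed (auto simp: Col_over_simps algebra_simps)
qed (auto simp: Col_over_simps algebra_simps)

text \<open>The factor \<open>d\<close> is the inverse of the constant of the orientation.\<close>

definition col_embed :: "'a::comm_ring_1 \<Rightarrow> 'a \<times> ('v::finite, 'a) mpoly \<times> ('v, 'a) mpoly \<times> ('v, 'a) mpoly \<Rightarrow>
    ('v, 'a) mpoly \<times> (('v, 'a) mpoly \<times> ('v, 'a) mpoly \<times> ('v, 'a) mpoly) \<times> (('v, 'a) mpoly \<times> ('v, 'a) mpoly \<times> ('v, 'a) mpoly)" where
  "col_embed d = (\<lambda>(a, f, g, h). (Const a, (f, g, 0), (0, 0, Const d * h)))"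

lemma col_embed_iso:
  fixes c d :: "'a::comm_ring_1"
  assumes cd: "c * d = 1"
  shows "algebra_iso (mat_alg l m c :: ('a, 'a \<times> ('v::finite, 'a) mpoly \<times> ('v, 'a) mpoly \<times> ('v, 'a) mpoly) module)
    (Col_over\<lparr>carrier := col_embed d ` carrier (mat_alg l m c)\<rparr>) (col_embed d) ring_of_type_algebra"
proof -
  have cd': "Const d * (Const c * p) = p" for p :: "('v, 'a) mpoly"
  proof -
    have "Const d * (Const c * p) = Const (c * d) * p" by (simp add: algebra_simps)
    then show ?thesis unfolding cd by simp
  qed
  have cd'': "h = h'" if "Const d * h = Const d * h'" for h h' :: "('v, 'a) mpoly"
  proof -
    have "Const c * (Const d * h) = Const c * (Const d * h')" unfolding that ..
    then show ?thesis using cd'[of h] cd'[of h'] by (simp add: mult.left_commute)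
  qed
  let ?A = "mat_alg l m c :: ('a, 'a \<times> ('v, 'a) mpoly \<times> ('v, 'a) mpoly \<times> ('v, 'a) mpoly) module"
  have inj: "inj_on (col_embed d) (carrier ?A)"
    by (rule inj_onI) (auto simp: col_embed_def dest: cd'')
  have mult: "col_embed d (mat_mult c (a, f, g, h) (b, f', g', h')) = col_embed d (a, f, g, h) \<otimes>\<^bsub>Col_over\<^esub> col_embed d (b, f', g', h')"
    for a b and f g h f' g' h' :: "('v, 'a) mpoly"
    unfolding col_embed_def mat_mult_def prod.case Col_over_simps distrib_left cd'
    by (simp add: mult.left_commute)
  show ?thesis
    unfolding algebra_iso_def linear_iso_def mat_alg_simps(3,5,6)
  proof (intro conjI ballI bij_betw_imageI inj)
    fix x y assume x: "x \<in> carrier ?A" and y: "y \<in> carrier ?A"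
    show "col_embed d (x \<oplus>\<^bsub>?A\<^esub> y) = col_embed d x \<oplus>\<^bsub>Col_over\<lparr>carrier := col_embed d ` carrier ?A\<rparr>\<^esub> col_embed d y"
      by (cases x, cases y) (simp add: col_embed_def mat_alg_simps Col_over_simps distrib_left)
    show "col_embed d (mat_mult c x y) = col_embed d x \<otimes>\<^bsub>Col_over\<lparr>carrier := col_embed d ` carrier ?A\<rparr>\<^esub> col_embed d y"
      by (cases x, cases y) (simp add: mult)
  next
    fix r x assume "x \<in> carrier ?A"
    show "col_embed d (r \<odot>\<^bsub>?A\<^esub> x) = r \<odot>\<^bsub>Col_over\<lparr>carrier := col_embed d ` carrier ?A\<rparr>\<^esub> col_embed d x"
      by (cases x) (simp add: col_embed_def mat_alg_simps Col_over_simps mult.left_commute)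
  qed (simp_all add: col_embed_def Col_over_simps)
qed

text \<open>The image is isomorphic to \<open>B\<close> as an algebra.  In particular it is a module, which implies
  that it is a submodule.\<close>

lemma Jordan_embedding_of_iso:
  fixes C :: "('a::comm_ring_1, 'c) module" and B :: "('a, 'b) module"
    and e :: "'b \<Rightarrow> ('v::finite, 'a) mpoly \<times> (('v, 'a) mpoly \<times> ('v, 'a) mpoly \<times> ('v, 'a) mpoly) \<times> _"
  assumes B: "unital_algebra ring_of_type_algebra B" "associative_alg B"
    and h: "algebra_iso B C h ring_of_type_algebra"
    and e: "algebra_iso B (Col_over\<lparr>carrier := e ` carrier B\<rparr>) e ring_of_type_algebra"
  shows "Jordan_embedding C (\<lambda>\<xi>. e (inv_into (carrier B) h \<xi>))"
proof -
  let ?\<iota> = "\<lambda>\<xi>. e (inv_into (carrier B) h \<xi>)"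
  let ?S = "Col_over\<lparr>carrier := e ` carrier B\<rparr>"
  interpret B: Module.module ring_of_type_algebra B by (rule unital_algebraD(1)[OF B(1)])
  note hf = algebra_iso_facts[OF h B(1)] and ef = algebra_iso_facts[OF e B(1), simplified]
  have C: "carrier C = h ` carrier B" by (rule algebra_iso_carrier[OF h B(1)])
  have inv: "inv_into (carrier B) h (h x) = x" if "x \<in> carrier B" for x
    by (rule inv_into_f_f[OF bij_betw_imp_inj_on[OF hf(2)] that])
  have one: "\<one>\<^bsub>B\<^esub> \<in> carrier B" using B(1) unfolding unital_algebra_def by simp
  note cl = unital_algebraD(2)[OF B(1)]
  have im: "?\<iota> ` carrier C = e ` carrier B" unfolding C image_image by (rule image_cong[OF refl]) (simp add: inv)
  have inj: "inj_on ?\<iota> (carrier C)"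
    unfolding C by (rule inj_onI) (auto simp: inv dest: inj_onD[OF bij_betw_imp_inj_on[OF ef(2)]])
  have hom: "algebra_hom ring_of_type_algebra C Col_over ?\<iota>"
    unfolding algebra_hom_def C hf(4)[symmetric]
    by (auto simp: hf(5-7) inv cl one ef(4-7) Col_over_simps(1))
  have S: "unital_algebra ring_of_type_algebra ?S" "associative_alg ?S"
    by (rule unital_algebra_iso[OF e B(1)], rule associative_alg_iso[OF e B])
  have "submodule (e ` carrier B) ring_of_type_algebra Col_over"
    by (rule Module.module.module_incl_imp_submodule[OF module_Col_over _ unital_algebraD(1)[OF S(1)]]) (simp add: Col_over_simps(1))
  moreover have "\<one>\<^bsub>Col_over\<^esub> \<in> e ` carrier B" using ef(4) one by (metis imageI)
  moreover have "x \<otimes>\<^bsub>Col_over\<^esub> y \<in> e ` carrier B" if "x \<in> e ` carrier B" "y \<in> e ` carrier B" for x y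
    using unital_algebraD(2)[OF S(1)] that by simp
  ultimately have sub: "subalgebra ring_of_type_algebra Col_over (e ` carrier B)" unfolding subalgebra_def by blast
  show ?thesis
    unfolding Jordan_embedding_def im
    by (intro conjI hom inj sub associative_noncommutative_Jordan[OF S])
qed

lemma linear_iso_matrix_space:
  "linear_iso R (mat_alg l m c) C h \<Longrightarrow> linear_iso R (matrix_space l m) C h"
  by (simp add: linear_iso_def mat_alg_def)

theorem mainTheorem9:
  fixes l m n :: nat
  assumes "(2::'a::comm_ring_1) dvd 1"
    and "n \<ge> 1" and "card (UNIV :: 'v::finite set) = n + 1"
    and "l > 0" and "m > 0"
  shows
    "(\<forall>\<alpha> :: ('v, 'a) T_form. det_iso PP (T_sheaf l m) \<alpha> \<longrightarrow>
        unital_algebra ring_of_type_algebra (C_alg l m \<alpha>) \<and>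
        linear_iso ring_of_type_algebra (matrix_space l m) (C_alg l m \<alpha>) (C_matrix l m) \<and>
        free_of_rank ring_of_type_algebra (C_alg l m \<alpha>)
          (1 + ((l + n) choose n) + ((m + n) choose n) + (((l + m) + n) choose n)) \<and>
        noncommutative_Jordan (C_alg l m \<alpha>) \<and>
        (\<exists>\<iota> :: ('v, 'a) C_elem \<Rightarrow> ('v, 'a) mpoly \<times> _. Jordan_embedding (C_alg l m \<alpha>) \<iota>))
     \<and> (\<exists>\<alpha> :: ('v, 'a) T_form. canonical_det l m \<alpha>)
     \<and> (\<forall>\<alpha> :: ('v, 'a) T_form. canonical_det l m \<alpha> \<longrightarrow>
        (\<forall>a b. \<forall>f_l\<in>homog l. \<forall>g_l\<in>homog l. \<forall>f_m\<in>homog m. \<forall>g_m\<in>homog m.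
         \<forall>f_lm\<in>homog (l + m). \<forall>g_lm\<in>homog (l + m).
           C_matrix l m (a, f_l, f_m, f_lm) \<otimes>\<^bsub>C_alg l m \<alpha>\<^esub> C_matrix l m (b, g_l, g_m, g_lm)
             = C_matrix l m
                 (a * b,
                  Const a * g_l + Const b * f_l,
                  Const a * g_m + Const b * f_m,
                  Const b * f_lm + Const a * g_lm + f_l * g_m - f_m * g_l)) \<and>
        (\<exists>\<iota> :: ('v, 'a) C_elem \<Rightarrow> ('v, 'a) mpoly \<times> _. Jordan_embedding (C_alg l m \<alpha>) \<iota> \<and>
           (\<forall>a. \<forall>f_l\<in>homog l. \<forall>f_m\<in>homog m. \<forall>f_lm\<in>homog (l + m).
              \<iota> (C_matrix l m (a, f_l, f_m, f_lm)) = (Const a, (f_l, f_m, 0), (0, 0, f_lm)))))"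
proof (intro conjI allI impI ballI)
  let ?A = "\<lambda>c. mat_alg l m c :: ('a, 'a \<times> ('v, 'a) mpoly \<times> ('v, 'a) mpoly \<times> ('v, 'a) mpoly) module"
  let ?N = "1 + ((l + n) choose n) + ((m + n) choose n) + (((l + m) + n) choose n)"
  have "\<not> card (UNIV :: 'v set) \<le> Suc 0" using assms(2,3) by simp
  then obtain i0 j0 :: 'v where two: "i0 \<noteq> j0" by (auto simp: card_le_Suc0_iff_eq)
  have sum0: "int l + int m + (- int l - int m) = 0" by simp
  have iso: "\<exists>c0 d0. c0 * d0 = 1 \<and> algebra_iso (?A c0) (C_alg l m \<alpha>) (C_matrix l m) ring_of_type_algebra \<and>
      (canonical_det l m \<alpha> \<longrightarrow> c0 = 1)"
    if det: "det_iso PP (T_sheaf l m) \<alpha>" for \<alpha> :: "('v, 'a) T_form"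
  proof -
    obtain c0 d0 :: 'a where c: "c0 * d0 = 1"
      and \<alpha>: "\<And>U u v w. opn U \<Longrightarrow> u \<in> carrier (sections (T_sheaf l m) U) \<Longrightarrow> v \<in> carrier (sections (T_sheaf l m) U) \<Longrightarrow>
       w \<in> carrier (sections (T_sheaf l m) U) \<Longrightarrow>
       \<alpha> U (wedge_over PP (T_sheaf l m) U u v w) = sec_mult homog U (sec_of homog U (Const c0)) (dform U u v w)"
      using det_iso_is_multiple_of_canonical[OF det[unfolded T_sheaf_def] sum0 two, folded T_sheaf_def] by blast
    have "algebra_iso (?A c0) (C_alg l m \<alpha>) (C_matrix l m) ring_of_type_algebra"
      by (rule C_matrix_iso[OF assms(4,5) c _ two]) (rule \<alpha>, assumption+)
    moreover have "c0 = 1" if "canonical_det l m \<alpha>"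
      by (rule canonical_det_constant[OF that]) (rule \<alpha>, assumption+)
    ultimately show ?thesis using c by blast
  qed
  note U = unital_algebra_mat_alg and As = associative_mat_alg
  fix \<alpha> :: "('v, 'a) T_form"
  {
    assume det: "det_iso PP (T_sheaf l m) \<alpha>"
    obtain c0 d0 where c: "c0 * d0 = 1" and h: "algebra_iso (?A c0) (C_alg l m \<alpha>) (C_matrix l m) ring_of_type_algebra"
      using iso[OF det] by blast
    note hf = algebra_iso_facts[OF h U]
    show u: "unital_algebra ring_of_type_algebra (C_alg l m \<alpha>)" by (rule unital_algebra_iso[OF h U])
    show "linear_iso ring_of_type_algebra (matrix_space l m) (C_alg l m \<alpha>) (C_matrix l m)"
      by (rule linear_iso_matrix_space[OF hf(1)])
    show "free_of_rank ring_of_type_algebra (C_alg l m \<alpha>) ?N"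
      by (rule free_of_rank_iso[OF free_mat_alg[OF assms(3)] hf(1,3)])
    show "noncommutative_Jordan (C_alg l m \<alpha>)"
      by (rule associative_noncommutative_Jordan[OF u associative_alg_iso[OF h U As]])
    show "\<exists>\<iota> :: ('v, 'a) C_elem \<Rightarrow> ('v, 'a) mpoly \<times> _. Jordan_embedding (C_alg l m \<alpha>) \<iota>"
      by (rule exI, rule Jordan_embedding_of_iso[OF U As h col_embed_iso[OF c]])
  }
  show "\<exists>\<alpha> :: ('v, 'a) T_form. canonical_det l m \<alpha>" by (rule exists_canonical_det_T_sheaf)
  assume can: "canonical_det l m \<alpha>"
  obtain c0 :: 'a where "algebra_iso (?A c0) (C_alg l m \<alpha>) (C_matrix l m) ring_of_type_algebra" "c0 = 1"
    using iso[OF can[unfolded canonical_det_def, THEN conjunct1]] can by blast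
  then have h: "algebra_iso (?A 1) (C_alg l m \<alpha>) (C_matrix l m) ring_of_type_algebra" by simp
  note hf = algebra_iso_facts[OF h U, unfolded mat_alg_simps(1,3)]
  {
    fix a b :: 'a and f_l g_l f_m g_m f_lm g_lm :: "('v, 'a) mpoly"
    assume "f_l \<in> homog l" "g_l \<in> homog l" "f_m \<in> homog m" "g_m \<in> homog m" "f_lm \<in> homog (l + m)" "g_lm \<in> homog (l + m)"
    then have "(a, f_l, f_m, f_lm) \<in> UNIV \<times> homog l \<times> homog m \<times> homog (l + m)" "(b, g_l, g_m, g_lm) \<in> UNIV \<times> homog l \<times> homog m \<times> homog (l + m)"
      by simp_all
    then have "C_matrix l m (a, f_l, f_m, f_lm) \<otimes>\<^bsub>C_alg l m \<alpha>\<^esub> C_matrix l m (b, g_l, g_m, g_lm)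
        = C_matrix l m (mat_mult 1 (a, f_l, f_m, f_lm) (b, g_l, g_m, g_lm))" by (rule hf(6))
    then show "C_matrix l m (a, f_l, f_m, f_lm) \<otimes>\<^bsub>C_alg l m \<alpha>\<^esub> C_matrix l m (b, g_l, g_m, g_lm)
             = C_matrix l m (a * b, Const a * g_l + Const b * f_l, Const a * g_m + Const b * f_m,
                  Const b * f_lm + Const a * g_lm + f_l * g_m - f_m * g_l)"
      by (simp add: mat_mult_def add_diff_eq)
  }
  let ?\<iota> = "\<lambda>\<xi>. col_embed 1 (inv_into (carrier (?A 1)) (C_matrix l m) \<xi>)"
  have "?\<iota> (C_matrix l m x) = col_embed 1 x" if "x \<in> UNIV \<times> homog l \<times> homog m \<times> homog (l + m)" for x
    unfolding mat_alg_simps(1) inv_into_f_f[OF bij_betw_imp_inj_on[OF hf(2)] that] ..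
  then show "\<exists>\<iota> :: ('v, 'a) C_elem \<Rightarrow> ('v, 'a) mpoly \<times> _. Jordan_embedding (C_alg l m \<alpha>) \<iota> \<and>
           (\<forall>a. \<forall>f_l\<in>homog l. \<forall>f_m\<in>homog m. \<forall>f_lm\<in>homog (l + m).
              \<iota> (C_matrix l m (a, f_l, f_m, f_lm)) = (Const a, (f_l, f_m, 0), (0, 0, f_lm)))"
    using Jordan_embedding_of_iso[OF U As h col_embed_iso[of 1 1]]
    by (intro exI[of _ ?\<iota>]) (simp add: col_embed_def)
qed

end
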